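(* Let $\Omega\subset\mathbb{C}^d$ be open and let $\Phi:\Omega\to\mathbb{C}$ be a holomorphic function. Let $s>n/2$. (a) If $u=(u_1,\dots,u_d)\in\mathcal{H}^s_{\mathrm{ul}}(\mathbb{R}^n)^d$ satisfies the condition $\overline{u(\mathbb{R}^n)}\subset\Omega$, then $$\Phi\circ u\equiv\Phi(u)\in\mathcal{H}^{s'}_{\mathrm{ul}}(\mathbb{R}^n)\quad\text{for all } s'<s.$$ (b) Suppose that $s'\in(n/2,s)$. If $u,u_\varepsilon\in\mathcal{H}^s_{\mathrm{ul}}(\mathbb{R}^n)^d$, $0<\varepsilon\le1$, $\overline{u(\mathbb{R}^n)}\subset\Omega$ and $u_\varepsilon\to u$ in $\mathcal{H}^{s'}_{\mathrm{ul}}(\mathbb{R}^n)^d$ as $\varepsilon\to0$, then there is $\varepsilon_0\in(0,1]$ such that $\overline{u_\varepsilon(\mathbb{R}^n)}\subset\Omega$ for every $0<\varepsilon\le\varepsilon_0$, and $\Phi(u_\varepsilon)\to\Phi(u)$ in $\mathcal{H}^{s'}_{\mathrm{ul}}(\mathbb{R}^n)$ as $\varepsilon\to0$.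
   Context: For $s\in\mathbb{R}$, $\mathcal{H}^s(\mathbb{R}^n)=\{u\in\mathcal{S}'(\mathbb{R}^n):(1-\Delta)^{s/2}u\in L^2(\mathbb{R}^n)\}$ with norm $\|u\|_{\mathcal{H}^s}=\|(1-\Delta)^{s/2}u\|_{L^2}$. For $y\in\mathbb{R}^n$, $\tau_y\chi=\chi(\cdot-y)$. The uniformly local (Kato-)Sobolev space $\mathcal{H}^s_{\mathrm{ul}}(\mathbb{R}^n)$ is the set of distributions $u\in\mathcal{D}'(\mathbb{R}^n)$ for which there is $\chi\in\mathcal{C}_0^\infty(\mathbb{R}^n)\smallsetminus\{0\}$ such that $\|u\|_{s,\mathrm{ul},\chi}:=\sup_{y\in\mathbb{R}^n}\|u\,\tau_y\chi\|_{\mathcal{H}^s}<\infty$. The space does not depend on the choice of $\chi$, and different $\chi$ give equivalent norms; $\mathcal{H}^s_{\mathrm{ul}}(\mathbb{R}^n)$ carries the resulting norm topology. For $s>n/2$ the elements of $\mathcal{H}^s_{\mathrm{ul}}(\mathbb{R}^n)$ are (represented by) bounded continuous functions, so that $u(\mathbb{R}^n)\subset\mathbb{C}^d$ makes sense; closures are taken in $\mathbb{C}^d$. *)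

theory Defs
  imports "HOL-Analysis.Analysis"
begin

(* Distributions are complex-valued functionals on functions.  Only the values on test
   functions (for D') or on Schwartz functions (for S') matter; every notion below reads
   off only these values. *)
type_synonym 'n functional = "(real^'n \<Rightarrow> complex) \<Rightarrow> complex"

definition partial_deriv :: "'n::finite \<Rightarrow> (real^'n \<Rightarrow> complex) \<Rightarrow> real^'n \<Rightarrow> complex" where
  "partial_deriv i f x = frechet_derivative f (at x) (axis i 1)"

(* A multi-index of order k is encoded as a list of k coordinate directions. *)
definition partials :: "'n::finite list \<Rightarrow> (real^'n \<Rightarrow> complex) \<Rightarrow> real^'n \<Rightarrow> complex" where
  "partials js f = foldr partial_deriv js f"

definition smooth :: "(real^'n::finite \<Rightarrow> complex) \<Rightarrow> bool" where
  "smooth f \<longleftrightarrow> (\<forall>js x. partials js f differentiable (at x))"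

definition test_function :: "(real^'n::finite \<Rightarrow> complex) \<Rightarrow> bool" where
  "test_function \<phi> \<longleftrightarrow> smooth \<phi> \<and> compact (closure {x. \<phi> x \<noteq> 0})"

definition schwartz :: "(real^'n::finite \<Rightarrow> complex) \<Rightarrow> bool" where
  "schwartz \<phi> \<longleftrightarrow> smooth \<phi> \<and>
     (\<forall>k js. bounded (range (\<lambda>x. (1 + norm x) ^ k *\<^sub>R partials js \<phi> x)))"

definition linear_on_functions ::
    "((real^'n::finite \<Rightarrow> complex) \<Rightarrow> bool) \<Rightarrow> 'n functional \<Rightarrow> bool" where
  "linear_on_functions P u \<longleftrightarrow>
     (\<forall>\<phi> \<psi> a b. P \<phi> \<longrightarrow> P \<psi> \<longrightarrow> u (\<lambda>x. a * \<phi> x + b * \<psi> x) = a * u \<phi> + b * u \<psi>)"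

definition distribution :: "'n::finite functional \<Rightarrow> bool" where
  "distribution u \<longleftrightarrow> linear_on_functions test_function u \<and>
     (\<forall>K. compact K \<longrightarrow> (\<exists>C N. \<forall>\<phi>. test_function \<phi> \<longrightarrow> {x. \<phi> x \<noteq> 0} \<subseteq> K \<longrightarrow>
        norm (u \<phi>) \<le> C * (\<Sum>js | length js \<le> N. SUP x. norm (partials js \<phi> x))))"

definition tempered_distribution :: "'n::finite functional \<Rightarrow> bool" where
  "tempered_distribution u \<longleftrightarrow> linear_on_functions schwartz u \<and>
     (\<exists>C N. \<forall>\<phi>. schwartz \<phi> \<longrightarrow>
        norm (u \<phi>) \<le> C * (\<Sum>js | length js \<le> N. SUP x. (1 + norm x) ^ N * norm (partials js \<phi> x)))"

definition regular_dist :: "(real^'n::finite \<Rightarrow> complex) \<Rightarrow> 'n functional" where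
  "regular_dist f \<phi> = (LINT x|lborel. f x * \<phi> x)"

(* If m is a test function and u is in D', this is a functional on all of S (indeed on all
   smooth functions): the canonical extension of the compactly supported distribution m u. *)
definition dist_mult :: "(real^'n::finite \<Rightarrow> complex) \<Rightarrow> 'n functional \<Rightarrow> 'n functional" where
  "dist_mult m u \<phi> = u (\<lambda>x. m x * \<phi> x)"

definition dist_diff :: "'n::finite functional \<Rightarrow> 'n functional \<Rightarrow> 'n functional" where
  "dist_diff u v \<phi> = u \<phi> - v \<phi>"

definition fourier :: "(real^'n::finite \<Rightarrow> complex) \<Rightarrow> real^'n \<Rightarrow> complex" where
  "fourier \<phi> \<xi> = (LINT x|lborel. cis (- (x \<bullet> \<xi>)) * \<phi> x)"

definition inv_fourier :: "(real^'n::finite \<Rightarrow> complex) \<Rightarrow> real^'n \<Rightarrow> complex" where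
  "inv_fourier \<phi> x = (LINT \<xi>|lborel. cis (x \<bullet> \<xi>) * \<phi> \<xi>) / of_real ((2 * pi) ^ CARD('n))"

definition dist_fourier :: "'n::finite functional \<Rightarrow> 'n functional" where
  "dist_fourier u \<phi> = u (fourier \<phi>)"

definition dist_inv_fourier :: "'n::finite functional \<Rightarrow> 'n functional" where
  "dist_inv_fourier u \<phi> = u (inv_fourier \<phi>)"

(* The operator (1 - Laplacian)^(s/2) on S', as a Fourier multiplier. *)
definition bessel_op :: "real \<Rightarrow> 'n::finite functional \<Rightarrow> 'n functional" where
  "bessel_op s u = dist_inv_fourier
     (dist_mult (\<lambda>\<xi>. of_real ((1 + (norm \<xi>)\<^sup>2) powr (s / 2))) (dist_fourier u))"

definition square_integrable :: "(real^'n::finite \<Rightarrow> complex) \<Rightarrow> bool" where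
  "square_integrable g \<longleftrightarrow> g \<in> borel_measurable lborel \<and> integrable lborel (\<lambda>x. (norm (g x))\<^sup>2)"

definition L2_function_norm :: "(real^'n::finite \<Rightarrow> complex) \<Rightarrow> real" where
  "L2_function_norm g = sqrt (LINT x|lborel. (norm (g x))\<^sup>2)"

definition sobolev :: "real \<Rightarrow> 'n::finite functional set" where
  "sobolev s = {u. tempered_distribution u \<and>
     (\<exists>g. square_integrable g \<and> (\<forall>\<phi>. schwartz \<phi> \<longrightarrow> bessel_op s u \<phi> = regular_dist g \<phi>))}"

(* The L2 density g of (1 - Laplacian)^(s/2) u is unique up to null sets, so the infimum is
   over a single value; functionals outside the Sobolev space get norm infinity. *)
definition sobolev_norm :: "real \<Rightarrow> 'n::finite functional \<Rightarrow> ennreal" where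
  "sobolev_norm s u = (if u \<in> sobolev s
     then (INF g \<in> {g. square_integrable g \<and>
             (\<forall>\<phi>. schwartz \<phi> \<longrightarrow> bessel_op s u \<phi> = regular_dist g \<phi>)}.
             ennreal (L2_function_norm g))
     else \<infinity>)"

definition ul_norm :: "real \<Rightarrow> (real^'n::finite \<Rightarrow> complex) \<Rightarrow> 'n functional \<Rightarrow> ennreal" where
  "ul_norm s \<eta> u = (SUP y. sobolev_norm s (dist_mult (\<lambda>x. \<eta> (x - y)) u))"

definition sobolev_ul :: "real \<Rightarrow> 'n::finite functional set" where
  "sobolev_ul s = {u. distribution u \<and>
     (\<exists>\<eta>. test_function \<eta> \<and> \<eta> \<noteq> (\<lambda>_. 0) \<and> ul_norm s \<eta> u < \<infinity>)}"

(* Convergence in the norm topology.  The norms for different cutoffs are equivalent, so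
   "for some cutoff" and "for every cutoff" agree. *)
definition ul_tendsto ::
    "real \<Rightarrow> ('e \<Rightarrow> 'n::finite functional) \<Rightarrow> 'n functional \<Rightarrow> 'e filter \<Rightarrow> bool" where
  "ul_tendsto s v w F \<longleftrightarrow> w \<in> sobolev_ul s \<and> eventually (\<lambda>e. v e \<in> sobolev_ul s) F \<and>
     (\<exists>\<eta>. test_function \<eta> \<and> \<eta> \<noteq> (\<lambda>_. 0) \<and>
        ((\<lambda>e. ul_norm s \<eta> (dist_diff (v e) w)) \<longlongrightarrow> 0) F)"

(* The bounded continuous function representing u; it exists (uniquely) for u in the
   uniformly local Sobolev space of order s > n/2. *)
definition cont_rep :: "'n::finite functional \<Rightarrow> real^'n \<Rightarrow> complex" where
  "cont_rep u = (THE f. continuous_on UNIV f \<and> bounded (range f) \<and>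
     (\<forall>\<phi>. test_function \<phi> \<longrightarrow> u \<phi> = regular_dist f \<phi>))"

definition cont_rep_vec :: "('n::finite functional)^'d::finite \<Rightarrow> real^'n \<Rightarrow> complex^'d" where
  "cont_rep_vec u x = (\<chi> i. cont_rep (u $ i) x)"

(* Complex differentiability at every point: a real Frechet derivative that is
   complex-linear. *)
definition holomorphic_on_several :: "(complex^'d::finite \<Rightarrow> complex) \<Rightarrow> (complex^'d) set \<Rightarrow> bool" where
  "holomorphic_on_several \<Phi> \<Omega> \<longleftrightarrow>
     (\<forall>z\<in>\<Omega>. \<exists>D. (\<Phi> has_derivative D) (at z) \<and> (\<forall>c v. D (c *s v) = c * D v))"

end

theory Submission
  imports Defs "HOL-Complex_Analysis.Cauchy_Integral_Formula" "HOL-Probability.Characteristic_Functions"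
begin

text \<open>Why the theorem holds.  Locally a function \<open>u\<close> in the uniformly local space of order \<open>s > n/2\<close> is a constant
  plus a small perturbation, not only in the supremum norm but, at the price of passing from \<open>s\<close> to a smaller
  order \<open>t > n/2\<close>, in the Sobolev norm of order \<open>t\<close>, and uniformly in the centre of localisation.  Near a
  constant, composition with a holomorphic function is given by an absolutely convergent expansion in a
  Banach algebra.

  The norm is handled on the Fourier side: \<open>hs s f M\<close> says that \<open>f\<close> is continuous with bounded support and that
  \<open>(1 + |\<xi>|^2)^(s/2)\<close> times its transform has norm at most \<open>M\<close> in \<open>L\<^sup>2\<close>.  The predicate only bounds the norm,
  and its balls are closed under bounded pointwise limits (\<open>hs_limit\<close>, from Fatou's lemma); so a series, or
  a mean over a circle, belongs to such a ball as soon as its partial sums do.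

  The analytic core consists of two estimates.  In \<open>hs_mult_dilated\<close> the norm is submultiplicative up to a
  constant, and the constant stays the same when one factor is dilated, \<open>x \<mapsto> g (r x)\<close> with \<open>r \<le> 1\<close>.  In
  \<open>hs_zoom_small\<close> this becomes the statement that \<open>g (r z) - g 0\<close>, cut off at unit distance, tends to zero
  in order \<open>t\<close> as \<open>r\<close> tends to zero, uniformly for \<open>g\<close> in a ball of order \<open>s > t\<close>: at high frequencies the
  spare order \<open>s - t\<close> wins over the uniform bound of order \<open>s\<close>, and at low frequencies the equicontinuity of
  that ball is enough.

  For perturbations \<open>h\<close> of a constant \<open>z0\<close> that are small in norm, \<open>hs_compose\<close> replaces the arguments of \<open>\<Phi>\<close> one
  after another by Cauchy's formula: \<open>\<Phi> (z0 + h)\<close> becomes a mean of values of \<open>\<Phi>\<close> with one argument frozen on a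
  circle, weighted with \<open>c / (c - h)\<close>, which is a geometric series.  The bound depends on \<open>\<Phi>\<close> only through its
  maximum on a compact polydisc neighbourhood of the range.  Applying the same bound along complex lines,
  and Cauchy's formula once more, makes the composition Lipschitz (\<open>hs_compose_Lipschitz\<close>), which yields the convergence in the
  second half of the theorem.

  It remains to pass between distributions and functions.  The space in the theorem is defined through densities
  of \<open>(1 - \<Delta>)^(s/2) (\<eta> u)\<close>; by \<open>sobolev_norm_less_imp_hs\<close> and \<open>hs_imp_sobolev_norm_le\<close>, which rest on the Fourier
  transform of square integrable functions, a bound for this density is a bound in the sense of \<open>hs\<close>.  The local
  representatives of \<open>\<eta> u\<close> for the translates of \<open>\<eta>\<close> are glued to a bounded continuous function, and any
  cutoff of sufficiently small support is dominated by \<open>\<eta>\<close> (\<open>ul_norm_controls_small_cutoffs\<close>).  That suffices, because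
  the norm of the composition may be tested with one cutoff, chosen as small as the estimates demand.\<close>

section \<open>Smooth functions\<close>

lemma partial_deriv_eqI:
  "(f has_derivative D) (at x) \<Longrightarrow> partial_deriv i f x = D (axis i 1)"
  unfolding partial_deriv_def by (metis frechet_derivative_at)

lemma partials_Nil [simp]: "partials [] f = f"
  by (simp add: partials_def)

lemma partials_Cons [simp]: "partials (j # js) f = partial_deriv j (partials js f)"
  by (simp add: partials_def)

lemma partials_append: "partials (js @ ks) f = partials js (partials ks f)"
  by (simp add: partials_def)

lemma partials_in:
  assumes "f \<in> S" "\<And>f i. f \<in> S \<Longrightarrow> partial_deriv i f \<in> S"
  shows "partials js f \<in> S"
  by (induction js) (use assms in auto)

text \<open>Smoothness is coinductive, which replaces induction over multi-indices: it suffices to exhibit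
  a class of differentiable functions that is closed under partial derivatives.\<close>

lemma smooth_coinduct:
  assumes "f \<in> S" "\<And>f x. f \<in> S \<Longrightarrow> f differentiable (at x)"
    and "\<And>f i. f \<in> S \<Longrightarrow> partial_deriv i f \<in> S"
  shows "smooth f"
  unfolding smooth_def using partials_in[OF assms(1,3)] assms(2) by blast

lemma smooth_differentiable: "smooth f \<Longrightarrow> f differentiable (at x)"
  unfolding smooth_def by (metis partials_Nil)

lemma smooth_partials: "smooth f \<Longrightarrow> smooth (partials js f)"
  unfolding smooth_def partials_append[symmetric] by blast

lemma smooth_partial_deriv: "smooth f \<Longrightarrow> smooth (partial_deriv i f)"
  using smooth_partials[of f "[i]"] by simp

lemma smooth_continuous_on: "smooth f \<Longrightarrow> continuous_on A f"
  by (meson continuous_at_imp_continuous_on differentiable_imp_continuous_within smooth_differentiable)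

lemma smooth_measurable: "smooth f \<Longrightarrow> f \<in> borel_measurable borel"
  by (intro borel_measurable_continuous_onI smooth_continuous_on)

lemma partial_deriv_add:
  assumes "f differentiable (at x)" "g differentiable (at x)"
  shows "partial_deriv i (\<lambda>x. f x + g x) x = partial_deriv i f x + partial_deriv i g x"
proof -
  have "(f has_derivative frechet_derivative f (at x)) (at x)" "(g has_derivative frechet_derivative g (at x)) (at x)"
    using assms frechet_derivative_works by blast+
  from has_derivative_add[OF this] show ?thesis
    by (subst partial_deriv_eqI, assumption) (simp add: partial_deriv_def)
qed

lemma partial_deriv_const: "partial_deriv i (\<lambda>x. c) = (\<lambda>x. 0)"
  by (rule ext) (subst partial_deriv_eqI[OF has_derivative_const], simp)

lemma partial_deriv_mult:
  assumes "f differentiable (at x)" "g differentiable (at x)"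
  shows "partial_deriv i (\<lambda>x. f x * g x) x = f x * partial_deriv i g x + partial_deriv i f x * g x"
proof -
  have "(f has_derivative frechet_derivative f (at x)) (at x)" "(g has_derivative frechet_derivative g (at x)) (at x)"
    using assms frechet_derivative_works by blast+
  from has_derivative_mult[OF this] show ?thesis
    by (subst partial_deriv_eqI, assumption) (simp add: partial_deriv_def)
qed

lemma partial_deriv_cmult:
  assumes "f differentiable (at x)"
  shows "partial_deriv i (\<lambda>x. a * f x) x = a * partial_deriv i f x"
  by (subst partial_deriv_mult) (use assms in \<open>auto simp: partial_deriv_const\<close>)

lemma has_derivative_zero_on_open:
  assumes "open U" "x \<in> U" "\<And>y. y \<in> U \<Longrightarrow> f y = (0::complex)"
  shows "(f has_derivative (\<lambda>_. 0)) (at x)"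
  using has_derivative_transform_within_open[of "\<lambda>_. 0" "\<lambda>_. 0" x UNIV U f] assms by auto

lemma partial_deriv_zero_on_open:
  assumes "open U" "x \<in> U" "\<And>y. y \<in> U \<Longrightarrow> f y = (0::complex)"
  shows "partial_deriv i f x = 0"
  using partial_deriv_eqI[OF has_derivative_zero_on_open[OF assms]] by simp

lemma partials_zero_on_open:
  assumes "open U" "\<And>y. y \<in> U \<Longrightarrow> f y = (0::complex)" "x \<in> U"
  shows "partials js f x = 0"
  using assms(3)
proof (induction js arbitrary: x)
  case (Cons a js)
  then show ?case using partial_deriv_zero_on_open[OF assms(1)] by auto
qed (use assms in auto)

inductive_set prod_span :: "(real^'n::finite \<Rightarrow> complex) set \<Rightarrow> (real^'n \<Rightarrow> complex) set \<Rightarrow> (real^'n \<Rightarrow> complex) set"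
  for A B where
  prod: "a \<in> A \<Longrightarrow> b \<in> B \<Longrightarrow> (\<lambda>x. a x * b x) \<in> prod_span A B"
| add: "f \<in> prod_span A B \<Longrightarrow> g \<in> prod_span A B \<Longrightarrow> (\<lambda>x. f x + g x) \<in> prod_span A B"

text \<open>Leibniz' rule without its coefficients: the derivatives of a product are sums of
  products of derivatives, so that any bound which survives sums passes to the product.\<close>

lemma prod_span_closed:
  assumes A: "\<And>a i x. a \<in> A \<Longrightarrow> a differentiable (at x) \<and> partial_deriv i a \<in> A"
    and B: "\<And>b i x. b \<in> B \<Longrightarrow> b differentiable (at x) \<and> partial_deriv i b \<in> B"
    and "f \<in> prod_span A B"
  shows "f differentiable (at x) \<and> partial_deriv i f \<in> prod_span A B"
  using assms(3)
proof (induction arbitrary: x)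
  case (prod a b)
  have "partial_deriv i (\<lambda>x. a x * b x) = (\<lambda>x. a x * partial_deriv i b x + partial_deriv i a x * b x)"
    using A B prod by (intro ext partial_deriv_mult) auto
  with A B prod show ?case
    by (auto intro!: prod_span.intros)
next
  case (add f g)
  have "partial_deriv i (\<lambda>x. f x + g x) = (\<lambda>x. partial_deriv i f x + partial_deriv i g x)"
    using add by (intro ext partial_deriv_add) auto
  with add show ?case
    by (auto intro!: prod_span.intros)
qed

lemma partials_closed:
  assumes "smooth f" "a \<in> range (\<lambda>js. partials js f)"
  shows "a differentiable (at x) \<and> partial_deriv i a \<in> range (\<lambda>js. partials js f)"
proof -
  obtain js where "a = partials js f" using assms by blast
  then have "partial_deriv i a = partials (i # js) f" by simp
  then show ?thesis using assms \<open>a = _\<close> by (auto simp: smooth_def simp del: partials_Cons)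
qed

lemma partials_self: "f \<in> range (\<lambda>js. partials js f)"
  by (rule range_eqI[of _ _ "[]"]) simp

lemma partials_mult:
  assumes "smooth f" "smooth g"
  shows "partials js (\<lambda>x. f x * g x) \<in> prod_span (range (\<lambda>ks. partials ks f)) (range (\<lambda>ks. partials ks g))"
  by (rule partials_in, rule prod_span.prod[OF partials_self partials_self])
    (use prod_span_closed[OF partials_closed[OF assms(1)] partials_closed[OF assms(2)]] in blast)

lemma smooth_mult:
  assumes "smooth f" "smooth g"
  shows "smooth (\<lambda>x. f x * g x)"
  by (rule smooth_coinduct[OF prod_span.prod[OF partials_self partials_self]])
    (use prod_span_closed[OF partials_closed[OF assms(1)] partials_closed[OF assms(2)]] in blast)+

lemma smooth_add:
  assumes "smooth f" "smooth g"
  shows "smooth (\<lambda>x. f x + g x)"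
proof (rule smooth_coinduct[where S = "{\<lambda>x. f x + g x | f g. smooth f \<and> smooth g}"])
  fix h :: "real^'n \<Rightarrow> complex" and i assume "h \<in> {\<lambda>x. f x + g x | f g. smooth f \<and> smooth g}"
  then obtain f g where *: "h = (\<lambda>x. f x + g x)" "smooth f" "smooth g" by blast
  then have "partial_deriv i h = (\<lambda>x. partial_deriv i f x + partial_deriv i g x)"
    by (auto intro!: partial_deriv_add smooth_differentiable)
  then show "partial_deriv i h \<in> {\<lambda>x. f x + g x | f g. smooth f \<and> smooth g}"
    using * smooth_partial_deriv by blast
qed (use assms smooth_differentiable in \<open>auto intro!: differentiable_add\<close>)

lemma smooth_const: "smooth (\<lambda>x. c)"
proof (rule smooth_coinduct[where S = "range (\<lambda>c x. c)"])
  fix h :: "real^'n \<Rightarrow> complex" and i assume "h \<in> range (\<lambda>c x. c)"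
  then obtain c where "h = (\<lambda>x. c)" by blast
  then have "partial_deriv i h = (\<lambda>x. 0)"
    by (simp add: partial_deriv_const)
  then show "partial_deriv i h \<in> range (\<lambda>c x. c)" by simp
qed auto

lemma smooth_diff:
  assumes "smooth f" "smooth g"
  shows "smooth (\<lambda>x. f x - g x)"
  using smooth_add[OF assms(1) smooth_mult[OF smooth_const[of "-1"] assms(2)]] by simp

lemma smooth_sum:
  assumes "\<And>i. i \<in> I \<Longrightarrow> smooth (f i)"
  shows "smooth (\<lambda>x. \<Sum>i\<in>I. f i x)"
  using assms by (induction I rule: infinite_finite_induct) (auto intro: smooth_const smooth_add)

lemma partial_deriv_affine:
  assumes "f differentiable (at (c *\<^sub>R x + b))"
  shows "partial_deriv i (\<lambda>x. f (c *\<^sub>R x + b)) x = of_real c * partial_deriv i f (c *\<^sub>R x + b)"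
    and "(\<lambda>x. f (c *\<^sub>R x + b)) differentiable (at x)"
proof -
  let ?D = "frechet_derivative f (at (c *\<^sub>R x + b))"
  have D: "(f has_derivative ?D) (at (c *\<^sub>R x + b))"
    using assms frechet_derivative_works by blast
  have a: "((\<lambda>x. c *\<^sub>R x + b) has_derivative (\<lambda>h. c *\<^sub>R h)) (at x)"
    by (auto intro!: derivative_eq_intros)
  from has_derivative_compose[OF a D]
  have *: "((\<lambda>x. f (c *\<^sub>R x + b)) has_derivative (\<lambda>h. ?D (c *\<^sub>R h))) (at x)" .
  have "?D (c *\<^sub>R axis i 1) = of_real c * ?D (axis i 1)"
    using linear_scale[OF has_derivative_linear[OF D], of c "axis i 1"] by (simp add: scaleR_conv_of_real)
  then show "partial_deriv i (\<lambda>x. f (c *\<^sub>R x + b)) x = of_real c * partial_deriv i f (c *\<^sub>R x + b)"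
    using partial_deriv_eqI[OF *] by (simp add: partial_deriv_def)
  show "(\<lambda>x. f (c *\<^sub>R x + b)) differentiable (at x)"
    using * differentiableI by blast
qed

lemma partials_affine:
  assumes "smooth f"
  shows "partials js (\<lambda>x. f (c *\<^sub>R x + b)) = (\<lambda>x. of_real c ^ length js * partials js f (c *\<^sub>R x + b))"
proof (induction js)
  case (Cons j js)
  have d: "partials js f differentiable (at x)" for x using assms by (simp add: smooth_def)
  have "partial_deriv j (\<lambda>x. of_real c ^ length js * partials js f (c *\<^sub>R x + b)) x
     = of_real c ^ length js * partial_deriv j (\<lambda>x. partials js f (c *\<^sub>R x + b)) x" for x
    by (intro partial_deriv_cmult partial_deriv_affine(2) d)
  then show ?case using partial_deriv_affine(1)[OF d] by (simp add: fun_eq_iff Cons)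
qed simp

lemma smooth_affine:
  assumes "smooth f"
  shows "smooth (\<lambda>x. f (c *\<^sub>R x + b))"
  unfolding smooth_def partials_affine[OF assms]
  by (intro allI differentiable_mult differentiable_const partial_deriv_affine(2)
      smooth_differentiable[OF smooth_partials[OF assms]])

lemma smooth_translate: "smooth f \<Longrightarrow> smooth (\<lambda>x. f (x - y))"
  using smooth_affine[of f 1 "-y"] by simp

lemma smooth_cnj:
  assumes "smooth f"
  shows "smooth (\<lambda>x. cnj (f x))"
proof (rule smooth_coinduct[where S = "{\<lambda>x. cnj (f x) | f. smooth f}"])
  fix h :: "real^'n \<Rightarrow> complex" and i x assume "h \<in> {\<lambda>x. cnj (f x) | f. smooth f}"
  then obtain f where *: "h = (\<lambda>x. cnj (f x))" "smooth f" by blast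
  have D: "(h has_derivative (\<lambda>v. cnj (frechet_derivative f (at x) v))) (at x)" for x
    unfolding * using *(2) frechet_derivative_works smooth_differentiable
    by (intro has_derivative_cnj) blast
  then show "h differentiable (at x)" using differentiableI by blast
  have "partial_deriv i h = (\<lambda>x. cnj (partial_deriv i f x))"
    using partial_deriv_eqI[OF D] by (auto simp: partial_deriv_def)
  then show "partial_deriv i h \<in> {\<lambda>x. cnj (f x) | f. smooth f}"
    using * smooth_partial_deriv by blast
qed (use assms in auto)

text \<open>Quotients are extended by zero off the closed set \<^term>\<open>K\<close> that carries the numerator, which
  Isabelle's convention for division does by itself.  The class of all \<open>p / m^k\<close> with such \<open>p\<close> is
  closed under differentiation.\<close>

lemma smooth_divide:
  fixes p m :: "real^'n::finite \<Rightarrow> complex"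
  assumes "smooth p" "smooth m" "closed K" and p0: "\<And>x. x \<notin> K \<Longrightarrow> p x = 0"
    and m0: "\<And>x. x \<in> K \<Longrightarrow> m x \<noteq> 0"
  shows "smooth (\<lambda>x. p x / m x)"
proof (rule smooth_coinduct[where S = "{\<lambda>x. p x / m x ^ k | p k. smooth p \<and> (\<forall>x. x \<notin> K \<longrightarrow> p x = 0)}"])
  show "(\<lambda>x. p x / m x) \<in> {\<lambda>x. p x / m x ^ k | p k. smooth p \<and> (\<forall>x. x \<notin> K \<longrightarrow> p x = 0)}"
    using assms by (auto intro!: exI[of _ p] exI[of _ "1::nat"])
  fix h :: "real^'n \<Rightarrow> complex" and i x assume "h \<in> {\<lambda>x. p x / m x ^ k | p k. smooth p \<and> (\<forall>x. x \<notin> K \<longrightarrow> p x = 0)}"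
  then obtain p k where h: "h = (\<lambda>x. p x / m x ^ k)" and p: "smooth p" "\<And>x. x \<notin> K \<Longrightarrow> p x = 0"
    by auto
  have m: "smooth m" by fact
  define q where "q x = partial_deriv i p x * m x - of_nat k * (p x * partial_deriv i m x)" for x
  have "smooth q" unfolding q_def
    by (intro smooth_diff smooth_mult smooth_partial_deriv p m smooth_const)
  moreover have pK: "partial_deriv i p x = 0" if "x \<notin> K" for x
    using partial_deriv_zero_on_open[of "-K" x p] that p assms(3) by auto
  moreover have D: "h differentiable (at x) \<and> partial_deriv i h x = q x / m x ^ Suc k" for x
  proof (cases "x \<in> K")
    case False
    then have "(h has_derivative (\<lambda>_. 0)) (at x)"
      using p assms(3) h by (intro has_derivative_zero_on_open[of "-K"]) auto
    then show ?thesis using partial_deriv_eqI[of h "\<lambda>_. 0" x i] False p pK by (auto simp: q_def differentiable_def)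
  next
    case True
    let ?P = "frechet_derivative p (at x)" and ?M = "frechet_derivative m (at x)"
    have P: "(p has_derivative ?P) (at x)" and M: "(m has_derivative ?M) (at x)"
      using p m frechet_derivative_works smooth_differentiable by blast+
    have mx: "m x \<noteq> 0" using m0 True by auto
    have "(h has_derivative (\<lambda>v. (?P v * m x - of_nat k * (p x * ?M v)) / m x ^ Suc k)) (at x)"
    proof -
      have "((\<lambda>x. m x ^ k) has_derivative (\<lambda>v. of_nat k * ?M v * m x ^ (k - 1))) (at x)"
        by (rule has_derivative_power[OF M])
      from has_derivative_divide'[OF P this] mx
      have "(h has_derivative (\<lambda>v. (?P v * m x ^ k - p x * (of_nat k * ?M v * m x ^ (k - 1))) / (m x ^ k * m x ^ k))) (at x)"
        unfolding h by simp
      moreover have "(?P v * m x ^ k - p x * (of_nat k * ?M v * m x ^ (k - 1))) / (m x ^ k * m x ^ k)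
          = (?P v * m x - of_nat k * (p x * ?M v)) / m x ^ Suc k" for v
        using mx by (cases k) (simp_all add: field_simps)
      ultimately show ?thesis by simp
    qed
    then show ?thesis using partial_deriv_eqI by (auto simp: q_def differentiable_def partial_deriv_def)
  qed
  ultimately have "partial_deriv i h = (\<lambda>x. q x / m x ^ Suc k)" "smooth q" "\<forall>x. x \<notin> K \<longrightarrow> q x = 0"
    using p by (auto simp: q_def)
  then show "partial_deriv i h \<in> {\<lambda>x. p x / m x ^ k | p k. smooth p \<and> (\<forall>x. x \<notin> K \<longrightarrow> p x = 0)}"
    by blast
  show "h differentiable (at x)" using D by blast
qed

section \<open>Radial functions, weights and bumps\<close>

text \<open>The module that \<open>h (c + e |x|^2)\<close>, \<open>h \<in> H\<close>, generate over the polynomials in the coordinates.  It is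
  closed under differentiation as soon as derivatives of members of \<open>H\<close> are combinations of members;
  the powers of \<open>1 + |x|^2\<close> and the functions \<open>flat k\<close> below are the two instances.\<close>

inductive_set radial_span :: "(real \<Rightarrow> real) set \<Rightarrow> real \<Rightarrow> real \<Rightarrow> (real^'n::finite \<Rightarrow> complex) set"
  for H c e where
  radial: "h \<in> H \<Longrightarrow> (\<lambda>x. of_real (h (c + e * (norm x)\<^sup>2))) \<in> radial_span H c e"
| add: "f \<in> radial_span H c e \<Longrightarrow> g \<in> radial_span H c e \<Longrightarrow> (\<lambda>x. f x + g x) \<in> radial_span H c e"
| scale: "f \<in> radial_span H c e \<Longrightarrow> (\<lambda>x. a * f x) \<in> radial_span H c e"
| coord: "f \<in> radial_span H c e \<Longrightarrow> (\<lambda>x. of_real (x $ i) * f x) \<in> radial_span H c e"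

lemma has_derivative_coord: "((\<lambda>x. of_real (x $ i) :: complex) has_derivative (\<lambda>v. of_real (v $ i))) (at x)"
  by (intro bounded_linear.has_derivative[OF bounded_linear_of_real] bounded_linear_imp_has_derivative bounded_linear_vec_nth)

lemma smooth_coord: "smooth (\<lambda>x::real^'n::finite. of_real (x $ j))"
proof -
  have p: "partial_deriv i (\<lambda>x. of_real (x $ j)) = (\<lambda>x::real^'n. if i = j then 1 else 0)" for i
    by (auto simp: fun_eq_iff partial_deriv_eqI[OF has_derivative_coord] axis_def)
  have "partials js (\<lambda>x. of_real (x $ j)) differentiable (at x)" for js and x :: "real^'n"
  proof (cases js rule: rev_cases)
    case Nil
    then show ?thesis using has_derivative_coord differentiableI by (auto simp: differentiable_def)
  next
    case (snoc ks i)
    then show ?thesis 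
      by (cases "i = j") (simp_all add: partials_append p smooth_const[unfolded smooth_def, rule_format])
  qed
  then show ?thesis by (simp add: smooth_def)
qed

lemma radial_span_closed:
  fixes f :: "real^'n::finite \<Rightarrow> complex"
  assumes H: "\<And>h. h \<in> H \<Longrightarrow> \<exists>h1\<in>H. \<exists>h2\<in>H. \<exists>a b. \<forall>x::real^'n.
        (h has_real_derivative a * h1 (c + e * (norm x)\<^sup>2) + b * h2 (c + e * (norm x)\<^sup>2)) (at (c + e * (norm x)\<^sup>2))"
    and "f \<in> radial_span H c e"
  shows "f differentiable (at x) \<and> partial_deriv i f \<in> radial_span H c e"
  using assms(2)
proof (induction arbitrary: x)
  case (radial h)
  then obtain h1 h2 a b where h: "h1 \<in> H" "h2 \<in> H" and
    h': "\<And>x::real^'n. (h has_real_derivative a * h1 (c + e * (norm x)\<^sup>2) + b * h2 (c + e * (norm x)\<^sup>2)) (at (c + e * (norm x)\<^sup>2))"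
    using H by meson
  let ?q = "\<lambda>x::real^'n. c + e * (norm x)\<^sup>2"
  have q: "(?q has_derivative (\<lambda>v. e * (2 * (x \<bullet> v)))) (at x)" for x
    unfolding power2_norm_eq_inner by (auto intro!: derivative_eq_intros simp: inner_commute)
  have D: "((\<lambda>x. of_real (h (?q x))) has_derivative
     (\<lambda>v. of_real ((e * (2 * (x \<bullet> v))) * (a * h1 (?q x) + b * h2 (?q x))) :: complex)) (at x)" for x
    by (intro bounded_linear.has_derivative[OF bounded_linear_of_real]
        has_derivative_compose[OF q has_field_derivative_imp_has_derivative[OF h', of x], THEN has_derivative_eq_rhs])
      (auto simp: mult.commute)
  have "partial_deriv i (\<lambda>x. of_real (h (?q x))) = (\<lambda>x. (of_real (2*e*a) * (of_real (x $ i) * of_real (h1 (?q x))))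
     + (of_real (2*e*b) * (of_real (x $ i) * of_real (h2 (?q x)))) :: complex)"
    by (auto simp: fun_eq_iff partial_deriv_eqI[OF D] inner_axis algebra_simps)
  moreover have "\<dots> \<in> radial_span H c e"
    by (intro radial_span.intros h)
  ultimately show ?case using D differentiableI by auto
next
  case (add f g)
  have "partial_deriv i (\<lambda>x. f x + g x) = (\<lambda>x. partial_deriv i f x + partial_deriv i g x)"
    using add by (intro ext partial_deriv_add) auto
  with add show ?case
    by (auto intro!: radial_span.intros)
next
  case (scale f a)
  have "partial_deriv i (\<lambda>x. a * f x) = (\<lambda>x. a * partial_deriv i f x)"
    using scale by (intro ext partial_deriv_cmult) auto
  with scale show ?case
    by (auto intro!: radial_span.intros)
next
  case (coord f j)
  have d: "(\<lambda>x. of_real (x $ j) :: complex) differentiable (at x)" for x :: "real^'n"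
    using smooth_coord smooth_differentiable by blast
  have p: "partial_deriv i (\<lambda>x. of_real (x $ j)) x = of_real (if i = j then 1 else 0)" for x :: "real^'n"
    by (auto simp: fun_eq_iff partial_deriv_eqI[OF has_derivative_coord] axis_def)
  have "partial_deriv i (\<lambda>x. of_real (x $ j) * f x) = (\<lambda>x. of_real (x $ j) * partial_deriv i f x + of_real (if i = j then 1 else 0) * f x)"
    using coord d by (intro ext) (subst partial_deriv_mult, auto simp: p)
  with coord d show ?case
    by (auto intro!: radial_span.intros derivative_intros)
qed

text \<open>The symbol of \<open>(1 - \<Delta>)^(s/2)\<close>.\<close>

definition wt :: "real \<Rightarrow> real^'n::finite \<Rightarrow> real" where
  "wt s x = (1 + (norm x)\<^sup>2) powr (s / 2)"

definition poly_bounded :: "(real^'n::finite \<Rightarrow> complex) \<Rightarrow> bool" where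
  "poly_bounded f \<longleftrightarrow> (\<exists>C k. \<forall>x. norm (f x) \<le> C * (1 + norm x) ^ k)"

definition temperate :: "(real^'n::finite \<Rightarrow> complex) \<Rightarrow> bool" where
  "temperate m \<longleftrightarrow> smooth m \<and> (\<forall>js. poly_bounded (partials js m))"

lemma one_plus_norm_ge_1: "1 \<le> 1 + norm x" by simp

lemma poly_boundedI: "(\<And>x. norm (f x) \<le> C * (1 + norm x) ^ k) \<Longrightarrow> poly_bounded f"
  unfolding poly_bounded_def by blast

lemma poly_bounded_nonneg:
  assumes "poly_bounded f"
  obtains C k where "C \<ge> 0" "\<And>x. norm (f x) \<le> C * (1 + norm x) ^ k"
proof -
  obtain C k where *: "\<And>x. norm (f x) \<le> C * (1 + norm x) ^ k"
    using assms unfolding poly_bounded_def by blast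
  have "norm (f x) \<le> \<bar>C\<bar> * (1 + norm x) ^ k" for x
    by (rule order_trans[OF *]) (auto intro!: mult_right_mono)
  then show ?thesis using that[of "\<bar>C\<bar>" k] by simp
qed

lemma poly_bounded_add:
  assumes "poly_bounded f" "poly_bounded g"
  shows "poly_bounded (\<lambda>x. f x + g x)"
proof -
  obtain C k D l where *: "C \<ge> 0" "\<And>x. norm (f x) \<le> C * (1 + norm x) ^ k" "D \<ge> 0" "\<And>x. norm (g x) \<le> D * (1 + norm x) ^ l"
    using assms poly_bounded_nonneg by metis
  show ?thesis
  proof (rule poly_boundedI[of _ "C + D" "k + l"])
    fix x
    have "norm (f x) \<le> C * (1 + norm x) ^ (k + l)"
      by (rule order_trans[OF *(2)]) (intro mult_left_mono power_increasing; use * in auto)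
    moreover have "norm (g x) \<le> D * (1 + norm x) ^ (k + l)"
      by (rule order_trans[OF *(4)]) (intro mult_left_mono power_increasing; use * in auto)
    ultimately show "norm (f x + g x) \<le> (C + D) * (1 + norm x) ^ (k + l)"
      by (intro order_trans[OF norm_triangle_ineq]) (simp add: algebra_simps)
  qed
qed

lemma poly_bounded_mult:
  assumes "poly_bounded f" "poly_bounded g"
  shows "poly_bounded (\<lambda>x. f x * g x)"
proof -
  obtain C k D l where *: "C \<ge> 0" "\<And>x. norm (f x) \<le> C * (1 + norm x) ^ k" "D \<ge> 0" "\<And>x. norm (g x) \<le> D * (1 + norm x) ^ l"
    using assms poly_bounded_nonneg by metis
  show ?thesis
  proof (rule poly_boundedI[of _ "C * D" "k + l"])
    fix x
    show "norm (f x * g x) \<le> (C * D) * (1 + norm x) ^ (k + l)"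
      using mult_mono[OF *(2)[of x] *(4)[of x]] * by (auto simp: norm_mult power_add algebra_simps)
  qed
qed

lemma poly_bounded_const: "poly_bounded (\<lambda>x. c)"
  by (rule poly_boundedI[of _ "norm c" 0]) auto

lemma poly_bounded_coord: "poly_bounded (\<lambda>x. of_real (x $ i))"
  by (rule poly_boundedI[of _ 1 1]) (auto intro: order_trans[OF component_le_norm_cart])

lemma wt_pos [simp]: "wt s x > 0"
  by (smt (verit) wt_def powr_gt_zero zero_le_power2)

lemma wt_nonneg [simp]: "wt s x \<ge> 0" and wt_nz [simp]: "wt s x \<noteq> 0"
  using wt_pos[of s x] by linarith+

lemma wt_mult: "wt s x * wt t x = wt (s + t) x"
  by (simp add: wt_def powr_add add_divide_distrib)

lemma wt_0 [simp]: "wt 0 x = 1"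
proof -
  have "1 + (norm x)\<^sup>2 \<noteq> 0" by (smt (verit) zero_le_power2)
  then show ?thesis by (simp add: wt_def)
qed

lemma wt_inverse: "wt s x * wt (- s) x = 1"
  by (simp add: wt_mult)

lemma wt_mono: "s \<le> t \<Longrightarrow> wt s x \<le> wt t x"
  unfolding wt_def by (intro powr_mono) auto

lemma wt_continuous: "continuous_on A (wt s)"
  unfolding wt_def by (intro continuous_intros) (auto, smt (verit) zero_le_power2)

lemma wt_measurable [measurable]: "wt s \<in> borel_measurable borel"
  by (intro borel_measurable_continuous_onI wt_continuous)

lemma wt_square: "(wt s x)\<^sup>2 = wt (2 * s) x"
  by (simp add: power2_eq_square wt_mult)

lemma poly_bounded_powr: "poly_bounded (\<lambda>x. of_real ((1 + 1 * (norm x)\<^sup>2) powr t))"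
proof -
  obtain k :: nat where k: "t \<le> real k" using real_arch_simple by blast
  show ?thesis
  proof (rule poly_boundedI[of _ 1 "2 * k"])
    fix x :: "real^'n"
    have 1: "1 + (norm x)\<^sup>2 \<ge> 1" by simp
    have "(1 + (norm x)\<^sup>2) powr t \<le> (1 + (norm x)\<^sup>2) powr real k"
      by (intro powr_mono k) auto
    also have "\<dots> = (1 + (norm x)\<^sup>2) ^ k"
      using 1 by (subst powr_realpow) linarith+
    also have "\<dots> \<le> ((1 + norm x)\<^sup>2) ^ k"
      by (intro power_mono) (auto simp: power2_eq_square algebra_simps)
    finally show "cmod (of_real ((1 + 1 * (norm x)\<^sup>2) powr t)) \<le> 1 * (1 + norm x) ^ (2 * k)"
      by (simp add: power_mult)
  qed
qed

lemma temperate_powr: "temperate (\<lambda>x. of_real ((1 + 1 * (norm x)\<^sup>2) powr t))"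
proof -
  define H :: "(real \<Rightarrow> real) set" where "H = range (\<lambda>t y. y powr t)"
  have H: "\<exists>h1\<in>H. \<exists>h2\<in>H. \<exists>a b. \<forall>x::real^'n.
        (h has_real_derivative a * h1 (1 + 1 * (norm x)\<^sup>2) + b * h2 (1 + 1 * (norm x)\<^sup>2)) (at (1 + 1 * (norm x)\<^sup>2))"
    if "h \<in> H" for h
  proof -
    obtain t where t: "h = (\<lambda>y. y powr t)" using \<open>h \<in> H\<close> H_def by auto
    have "(h has_real_derivative t * (y powr (t - 1)) + 0 * (y powr t)) (at y)" if "y > 0" for y
      unfolding t using that by (auto intro!: derivative_eq_intros)
    moreover have "1 + 1 * (norm x)\<^sup>2 > 0" for x :: "real^'n" by (smt (verit) zero_le_power2)
    ultimately have "\<forall>x::real^'n. (h has_real_derivative t * (1 + 1 * (norm x)\<^sup>2) powr (t - 1) + 0 * (1 + 1 * (norm x)\<^sup>2) powr t)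
        (at (1 + 1 * (norm x)\<^sup>2))" by blast
    then show ?thesis unfolding H_def
      by (intro bexI[of _ "\<lambda>y. y powr (t - 1)"] bexI[of _ "\<lambda>y. y powr t"] exI[of _ t] exI[of _ 0]) auto
  qed
  let ?S = "radial_span H 1 1 :: (real^'n \<Rightarrow> complex) set"
  have base: "(\<lambda>x. of_real ((1 + 1 * (norm x)\<^sup>2) powr t)) \<in> ?S"
    by (rule radial_span.radial[where h = "\<lambda>y. y powr t"]) (auto simp: H_def)
  note cl = radial_span_closed[OF H]
  have "poly_bounded f" if "f \<in> ?S" for f
    using that by induction (auto simp: H_def intro: poly_bounded_powr[simplified] poly_bounded_add poly_bounded_mult poly_bounded_const poly_bounded_coord)
  moreover have "partials js (\<lambda>x. of_real ((1 + 1 * (norm x)\<^sup>2) powr t)) \<in> ?S" for js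
    by (rule partials_in[OF base]) (use cl in blast)
  moreover have "smooth (\<lambda>x::real^'n. of_real ((1 + 1 * (norm x)\<^sup>2) powr t))"
    by (rule smooth_coinduct[OF base]) (use cl in blast)+
  ultimately show ?thesis unfolding temperate_def by blast
qed

lemma temperate_wt: "temperate (\<lambda>x. of_real (wt s x))"
  using temperate_powr[of "s / 2"] by (simp add: wt_def)

text \<open>The functions \<open>exp (-1/t) / t^k\<close> for \<open>t > 0\<close>, extended by zero, are closed under
  differentiation; this is what makes the bump functions smooth.\<close>

definition flat :: "nat \<Rightarrow> real \<Rightarrow> real" where
  "flat k t = (if t > 0 then exp (- 1 / t) / t ^ k else 0)"

text \<open>One term of the exponential series bounds \<open>exp (1/t)\<close> from below.  That the bound is quadratic in \<open>t\<close>
  makes the derivative at 0 vanish.\<close>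

lemma flat_bound: "\<bar>flat k t\<bar> \<le> fact (k + 2) * t\<^sup>2"
proof (cases "t > 0")
  case True
  define c :: real where "c = fact (k + 2)"
  have c: "c > 0" by (simp add: c_def)
  have "(\<Sum>n\<in>{k + 2}. inverse (fact n) * (1 / t) ^ n) \<le> (\<Sum>n. inverse (fact n) * (1 / t) ^ n)"
    by (intro sum_le_suminf summable_exp) (use True in auto)
  then have "inverse c * (1 / t) ^ (k + 2) \<le> exp (1 / t)"
    unfolding exp_def c_def by (simp only: sum.insert sum.empty finite.emptyI empty_iff not_False_eq_True add_0_right scaleR_conv_of_real of_real_inverse of_real_fact of_real_eq_id id_apply)
  then have "exp (- (1 / t)) \<le> c * t ^ (k + 2)"
    using True c by (simp add: exp_minus field_simps del: power_Suc power_add)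
  then have "exp (- 1 / t) / t ^ k \<le> c * t\<^sup>2"
    using True by (simp add: field_simps power_add power2_eq_square)
  then show ?thesis using True by (simp add: flat_def c_def)
qed (simp add: flat_def)

lemma flat_deriv: "(flat k has_real_derivative 1 * flat (k + 2) t + (- real k) * flat (k + 1) t) (at t)"
proof (cases "t = 0")
  case True
  have "((\<lambda>h. flat k h / h) \<longlongrightarrow> 0) (at 0)"
  proof (rule Lim_null_comparison[where g = "\<lambda>h. fact (k + 2) * \<bar>h\<bar>"])
    have "\<bar>flat k h / h\<bar> \<le> fact (k + 2) * \<bar>h\<bar>" if "h \<noteq> 0" for h
    proof -
      have "\<bar>flat k h / h\<bar> \<le> fact (k + 2) * h\<^sup>2 / \<bar>h\<bar>"
        unfolding abs_divide by (intro divide_right_mono flat_bound) auto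
      also have "\<dots> = fact (k + 2) * \<bar>h\<bar>"
        using that by (metis abs_divide abs_of_nonneg nonzero_mult_div_cancel_left power2_eq_square times_divide_eq_right zero_le_power2 abs_ge_zero power2_abs abs_zero abs_eq_0)
      finally show ?thesis .
    qed
    then show "\<forall>\<^sub>F h in at 0. norm (flat k h / h) \<le> fact (k + 2) * \<bar>h\<bar>"
      by (auto simp: eventually_at_filter)
    have "((\<lambda>h::real. fact (k + 2) * \<bar>h\<bar>) \<longlongrightarrow> fact (k + 2) * \<bar>0\<bar>) (at 0)"
      by (intro tendsto_intros)
    then show "((\<lambda>h::real. fact (k + 2) * \<bar>h\<bar>) \<longlongrightarrow> 0) (at 0)" by simp
  qed
  then show ?thesis using True by (simp add: DERIV_def flat_def[of _ 0])
next
  case False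
  show ?thesis
  proof (cases "t > 0")
    case True
    have "((\<lambda>t. exp (- 1 / t) / t ^ k) has_real_derivative 1 * flat (k + 2) t + (- real k) * flat (k + 1) t) (at t)"
    proof -
      have "((\<lambda>t. exp (- 1 / t) / t ^ k) has_real_derivative
          ((exp (- 1 / t) * (1 / t\<^sup>2)) * t ^ k - exp (- 1 / t) * (real k * t ^ (k - 1))) / (t ^ k * t ^ k)) (at t)"
        using True by (auto intro!: derivative_eq_intros simp: power2_eq_square)
      also have "((exp (- 1 / t) * (1 / t\<^sup>2)) * t ^ k - exp (- 1 / t) * (real k * t ^ (k - 1))) / (t ^ k * t ^ k)
          = 1 * flat (k + 2) t + (- real k) * flat (k + 1) t"
      proof -
        have "((e * (1 / t\<^sup>2)) * t ^ k - e * (real k * t ^ (k - 1))) / (t ^ k * t ^ k)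
            = e / t ^ (k + 2) - real k * (e / t ^ (k + 1))" for e
          using True by (cases k) (simp_all add: field_simps power2_eq_square)
        then show ?thesis using True by (simp add: flat_def)
      qed
      finally show ?thesis .
    qed
    then show ?thesis
      by (rule DERIV_cong_ev[THEN iffD1, rotated -1])
        (use True eventually_at_right_less eventually_nhds_in_open[of "{0<..}" t] in \<open>auto simp: flat_def elim!: eventually_mono\<close>)
  next
    case f: False
    then have "t < 0" using False by simp
    have "((\<lambda>t. 0) has_real_derivative 1 * flat (k + 2) t + (- real k) * flat (k + 1) t) (at t)"
      using \<open>t < 0\<close> by (auto simp: flat_def)
    then show ?thesis
      by (rule DERIV_cong_ev[THEN iffD1, rotated -1])
        (use \<open>t < 0\<close> eventually_nhds_in_open[of "{..<0}" t] in \<open>auto simp: flat_def elim!: eventually_mono\<close>)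
  qed
qed

lemma smooth_flat_radial: "smooth (\<lambda>x. of_real (flat k (c + e * (norm x)\<^sup>2)))"
proof -
  define H where "H = range flat"
  have H: "\<exists>h1\<in>H. \<exists>h2\<in>H. \<exists>a b. \<forall>x::real^'n.
        (h has_real_derivative a * h1 (c + e * (norm x)\<^sup>2) + b * h2 (c + e * (norm x)\<^sup>2)) (at (c + e * (norm x)\<^sup>2))"
    if "h \<in> H" for h
  proof -
    obtain k where k: "h = flat k" using \<open>h \<in> H\<close> H_def by auto
    show ?thesis unfolding H_def k
      by (rule bexI[of _ "flat (k + 2)"], rule bexI[of _ "flat (k + 1)"], rule exI[of _ 1], rule exI[of _ "- real k"])
        (use flat_deriv in auto)
  qed
  show ?thesis
    by (rule smooth_coinduct[where S = "radial_span H c e"])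
      (use radial_span_closed[OF H] in \<open>auto simp: H_def intro!: radial_span.radial\<close>)
qed

text \<open>The numerator is positive for \<open>|x|^2 < 2\<close> only and the second summand of the denominator for
  \<open>|x|^2 > 1\<close> only, so that the denominator has no zeros.\<close>

definition plateau :: "real^'n::finite \<Rightarrow> complex" where
  "plateau x = of_real (flat 0 (2 + (-1) * (norm x)\<^sup>2)) /
     (of_real (flat 0 (2 + (-1) * (norm x)\<^sup>2)) + of_real (flat 0 (-1 + 1 * (norm x)\<^sup>2)))"

lemma flat_nonneg: "flat k t \<ge> 0" and flat_pos: "t > 0 \<Longrightarrow> flat k t > 0" and flat_zero: "t \<le> 0 \<Longrightarrow> flat k t = 0"
  by (auto simp: flat_def)

lemma plateau_real: "plateau x = of_real (Re (plateau x))"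
  and plateau_range: "0 \<le> Re (plateau x)" "Re (plateau x) \<le> 1"
proof -
  let ?a = "flat 0 (2 + (-1) * (norm x)\<^sup>2)" and ?b = "flat 0 (-1 + 1 * (norm x)\<^sup>2)"
  have *: "plateau x = of_real (?a / (?a + ?b))" by (simp add: plateau_def)
  then show "plateau x = of_real (Re (plateau x))" by simp
  have "?a \<ge> 0" "?b \<ge> 0" by (auto simp: flat_nonneg)
  then show "0 \<le> Re (plateau x)" "Re (plateau x) \<le> 1"
    unfolding * by (auto simp: divide_simps)
qed

lemma plateau_1: "norm x \<le> 1 \<Longrightarrow> plateau x = 1"
proof -
  assume "norm x \<le> 1"
  then have "(norm x)\<^sup>2 \<le> 1" by (simp add: power_le_one)
  then have "flat 0 (-1 + 1 * (norm x)\<^sup>2) = 0" "flat 0 (2 + (-1) * (norm x)\<^sup>2) > 0"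
    using flat_zero flat_pos by (auto intro!: flat_pos)
  then show ?thesis by (simp add: plateau_def)
qed

lemma plateau_0: "norm x \<ge> 2 \<Longrightarrow> plateau x = 0"
proof -
  assume "norm x \<ge> 2"
  then have "(norm x)\<^sup>2 \<ge> 2\<^sup>2" by (intro power_mono) auto
  then show ?thesis by (simp add: plateau_def flat_zero)
qed

lemma smooth_plateau: "smooth plateau"
  unfolding plateau_def[abs_def]
proof (rule smooth_divide[where K = UNIV])
  fix x :: "real^'n"
  have "flat 0 (2 + (-1) * (norm x)\<^sup>2) > 0 \<or> flat 0 (-1 + 1 * (norm x)\<^sup>2) > 0"
    by (cases "(norm x)\<^sup>2 < 2") (auto intro: flat_pos)
  then have "flat 0 (2 + (-1) * (norm x)\<^sup>2) + flat 0 (-1 + 1 * (norm x)\<^sup>2) \<noteq> 0"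
    using flat_nonneg[of 0 "2 + (-1) * (norm x)\<^sup>2"] flat_nonneg[of 0 "-1 + 1 * (norm x)\<^sup>2"] by linarith
  then show "complex_of_real (flat 0 (2 + (-1) * (norm x)\<^sup>2)) + of_real (flat 0 (-1 + 1 * (norm x)\<^sup>2)) \<noteq> 0"
    by (simp only: of_real_add[symmetric] of_real_eq_0_iff not_False_eq_True)
qed (rule smooth_flat_radial smooth_add closed_UNIV | simp only: UNIV_I not_True_eq_False)+

section \<open>Test functions and Schwartz functions\<close>

lemma test_function_iff: "test_function f \<longleftrightarrow> smooth f \<and> (\<exists>R. \<forall>x. norm x > R \<longrightarrow> f x = 0)"
proof
  assume f: "test_function f"
  then have "bounded {x. f x \<noteq> 0}"
    by (simp add: test_function_def)
  then obtain R where "\<And>x. f x \<noteq> 0 \<Longrightarrow> norm x \<le> R" unfolding bounded_iff by auto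
  then show "smooth f \<and> (\<exists>R. \<forall>x. norm x > R \<longrightarrow> f x = 0)"
    using f unfolding test_function_def by (metis not_le)
next
  assume *: "smooth f \<and> (\<exists>R. \<forall>x. norm x > R \<longrightarrow> f x = 0)"
  then obtain R where R: "\<And>x. norm x > R \<Longrightarrow> f x = 0" by blast
  have "bounded {x. f x \<noteq> 0}"
    unfolding bounded_iff by (rule exI[of _ R]) (use R in \<open>force simp: not_less\<close>)
  then show "test_function f" using * by (simp add: test_function_def)
qed

lemma test_function_smooth: "test_function f \<Longrightarrow> smooth f"
  by (simp add: test_function_def)

lemma test_function_mult_smooth: "test_function f \<Longrightarrow> smooth g \<Longrightarrow> test_function (\<lambda>x. f x * g x)"
  by (fastforce simp: test_function_iff intro: smooth_mult)

lemma test_function_affine: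
  assumes "test_function f" "c \<noteq> 0"
  shows "test_function (\<lambda>x. f (c *\<^sub>R x + b))"
proof -
  obtain R where R: "\<And>x. norm x > R \<Longrightarrow> f x = 0" using assms test_function_iff by blast
  have "f (c *\<^sub>R x + b) = 0" if "norm x > (R + norm b) / \<bar>c\<bar>" for x
  proof (rule R)
    have "\<bar>c\<bar> * norm x > R + norm b" using that assms(2) by (simp add: field_simps)
    then show "norm (c *\<^sub>R x + b) > R" using norm_triangle_ineq2[of "c *\<^sub>R x" "-b"] by simp
  qed
  then show ?thesis using assms smooth_affine test_function_iff by blast
qed

lemma test_function_translate: "test_function f \<Longrightarrow> test_function (\<lambda>x. f (x - y))"
  using test_function_affine[of f 1 "-y"] by simp

lemma test_function_plateau: "test_function plateau"
  unfolding test_function_iff using smooth_plateau plateau_0 by (metis less_eq_real_def)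

lemma test_function_bounded:
  assumes "test_function f"
  shows "bounded (range f)"
proof -
  have "bounded (f ` closure {x. f x \<noteq> 0})"
    using assms unfolding test_function_def
    by (intro compact_imp_bounded compact_continuous_image smooth_continuous_on) auto
  then have "bounded (insert 0 (f ` closure {x. f x \<noteq> 0}))" by simp
  moreover have "range f \<subseteq> insert 0 (f ` closure {x. f x \<noteq> 0})"
    using closure_subset[of "{x. f x \<noteq> 0}"] by auto
  ultimately show ?thesis by (rule bounded_subset)
qed

lemma test_function_partials:
  assumes "test_function f"
  shows "test_function (partials js f)"
proof -
  obtain R where R: "\<And>x. norm x > R \<Longrightarrow> f x = 0" using assms test_function_iff by blast
  have "partials js f x = 0" if "norm x > R" for x
    by (rule partials_zero_on_open[of "{x. norm x > R}"])
      (use R that in \<open>auto intro!: open_Collect_less continuous_intros\<close>)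
  then show ?thesis using assms smooth_partials by (auto simp: test_function_iff)
qed

lemma test_function_schwartz:
  assumes "test_function f"
  shows "schwartz f"
  unfolding schwartz_def
proof (intro conjI allI)
  show "smooth f" using assms by (simp add: test_function_def)
  fix k js
  have t: "test_function (partials js f)" by (rule test_function_partials[OF assms])
  obtain R where R: "\<And>x. norm x > R \<Longrightarrow> partials js f x = 0" using t test_function_iff by blast
  obtain B where B: "\<And>x. norm (partials js f x) \<le> B"
    using test_function_bounded[OF t] unfolding bounded_iff by auto
  have "norm ((1 + norm x) ^ k *\<^sub>R partials js f x) \<le> (1 + \<bar>R\<bar>) ^ k * \<bar>B\<bar>" for x
  proof (cases "norm x > R")
    case False
    then show ?thesis using B[of x] by (auto intro!: mult_mono power_mono)
  qed (use R in auto)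
  then show "bounded (range (\<lambda>x. (1 + norm x) ^ k *\<^sub>R partials js f x))"
    unfolding bounded_iff by blast
qed

lemma schwartz_smooth: "schwartz f \<Longrightarrow> smooth f"
  by (simp add: schwartz_def)

lemma schwartz_bound:
  assumes "schwartz f"
  obtains C where "C \<ge> 0" "\<And>x. (1 + norm x) ^ k * norm (partials js f x) \<le> C"
proof -
  have "bounded (range (\<lambda>x. (1 + norm x) ^ k *\<^sub>R partials js f x))"
    using assms by (simp add: schwartz_def)
  then obtain C where C: "\<And>x. norm ((1 + norm x) ^ k *\<^sub>R partials js f x) \<le> C"
    unfolding bounded_iff by blast
  have "0 \<le> C" using order_trans[OF norm_ge_zero C] .
  then show ?thesis using that[of C] C by auto
qed

lemma schwartzI:
  assumes "smooth f" "\<And>k js. \<exists>C. \<forall>x. (1 + norm x) ^ k * norm (partials js f x) \<le> C"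
  shows "schwartz f"
  unfolding schwartz_def bounded_iff using assms by fastforce

lemma schwartz_partials: "schwartz f \<Longrightarrow> schwartz (partials js f)"
  unfolding schwartz_def partials_append[symmetric] using smooth_partials by blast

lemma schwartz_mult:
  assumes m: "temperate m" and f: "schwartz f"
  shows "schwartz (\<lambda>x. m x * f x)"
proof (rule schwartzI)
  show "smooth (\<lambda>x. m x * f x)" using assms smooth_mult by (auto simp: temperate_def schwartz_def)
  fix k js
  have "g \<in> prod_span (range (\<lambda>ks. partials ks m)) (range (\<lambda>ks. partials ks f)) \<Longrightarrow>
     \<forall>k. \<exists>C. \<forall>x. (1 + norm x) ^ k * norm (g x) \<le> C" for g
  proof (induction rule: prod_span.induct)
    case (prod a b)
    then obtain ks js where ab: "a = partials ks m" "b = partials js f" by blast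
    obtain D l where D: "D \<ge> 0" "\<And>x. norm (a x) \<le> D * (1 + norm x) ^ l"
      using m ab poly_bounded_nonneg unfolding temperate_def by metis
    show ?case
    proof
      fix k
      obtain C where C: "C \<ge> 0" "\<And>x. (1 + norm x) ^ (k + l) * norm (b x) \<le> C"
        using schwartz_bound[OF f] ab by metis
      have "(1 + norm x) ^ k * norm (a x * b x) \<le> D * C" for x
      proof -
        have "(1 + norm x) ^ k * norm (a x * b x) \<le> (1 + norm x) ^ k * ((D * (1 + norm x) ^ l) * norm (b x))"
          unfolding norm_mult by (intro mult_left_mono mult_right_mono D) auto
        also have "\<dots> = D * ((1 + norm x) ^ (k + l) * norm (b x))" by (simp add: power_add algebra_simps)
        also have "\<dots> \<le> D * C" by (intro mult_left_mono C D)
        finally show ?thesis .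
      qed
      then show "\<exists>C. \<forall>x. (1 + norm x) ^ k * norm (a x * b x) \<le> C" by blast
    qed
  next
    case (add f g)
    show ?case
    proof
      fix k
      obtain C D where "\<And>x. (1 + norm x) ^ k * norm (f x) \<le> C" "\<And>x. (1 + norm x) ^ k * norm (g x) \<le> D"
        using add.IH by metis
      then have "(1 + norm x) ^ k * norm (f x + g x) \<le> C + D" for x
        by (smt (verit) distrib_left mult_left_mono norm_triangle_ineq one_plus_norm_ge_1 zero_le_power)
      then show "\<exists>C. \<forall>x. (1 + norm x) ^ k * norm (f x + g x) \<le> C" by blast
    qed
  qed
  then show "\<exists>C. \<forall>x. (1 + norm x) ^ k * norm (partials js (\<lambda>x. m x * f x) x) \<le> C"
    using partials_mult m f unfolding temperate_def schwartz_def by blast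
qed

lemma temperate_coord: "temperate (\<lambda>x::real^'n::finite. of_real (x $ j))"
proof -
  have p: "partial_deriv i (\<lambda>x. of_real (x $ j)) = (\<lambda>x::real^'n. if i = j then 1 else 0)" for i
    by (auto simp: fun_eq_iff partial_deriv_eqI[OF has_derivative_coord] axis_def)
  have z: "partials js (\<lambda>x::real^'n. c) \<in> range (\<lambda>c x. c)" for js c
    by (rule partials_in) (auto simp: partial_deriv_const fun_eq_iff intro!: exI[of _ 0])
  have "poly_bounded (partials js (\<lambda>x::real^'n. of_real (x $ j)))" for js
  proof (cases js rule: rev_cases)
    case Nil
    then show ?thesis using poly_bounded_coord by auto
  next
    case (snoc ks i)
    then show ?thesis using z[of ks "if i = j then 1 else 0"] by (auto simp: partials_append p poly_bounded_const)
  qed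
  then show ?thesis using smooth_coord by (auto simp: temperate_def)
qed

lemma temperate_const: "temperate (\<lambda>x::real^'n::finite. c)"
proof -
  have z: "partials js (\<lambda>x::real^'n. c) \<in> range (\<lambda>c x. c)" for js
    by (rule partials_in) (auto simp: partial_deriv_const fun_eq_iff intro!: exI[of _ 0])
  have "poly_bounded (partials js (\<lambda>x::real^'n. c))" for js
    using z[of js] by (auto simp: poly_bounded_const)
  then show ?thesis using smooth_const by (auto simp: temperate_def)
qed

lemma schwartz_uminus_arg:
  assumes "schwartz f"
  shows "schwartz (\<lambda>x. f (- x))"
proof -
  have s: "smooth f" using assms schwartz_smooth by auto
  have e: "(\<lambda>x. f (- x)) = (\<lambda>x. f ((-1) *\<^sub>R x + 0))" by simp
  show ?thesis
  proof (rule schwartzI)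
    show "smooth (\<lambda>x. f (- x))" unfolding e by (rule smooth_affine[OF s])
    fix k js
    obtain C where "\<And>x. (1 + norm x) ^ k * norm (partials js f x) \<le> C"
      using schwartz_bound[OF assms] by metis
    from this[of "- x" for x] have "(1 + norm x) ^ k * norm (partials js (\<lambda>x. f (- x)) x) \<le> C" for x
      unfolding e partials_affine[OF s] by (simp add: norm_mult norm_power)
    then show "\<exists>C. \<forall>x. (1 + norm x) ^ k * norm (partials js (\<lambda>x. f (- x)) x) \<le> C" by blast
  qed
qed

section \<open>Integration on Euclidean space\<close>

lemma nn_integral_lborel_affine:
  fixes t :: "'a::euclidean_space"
  assumes [measurable]: "f \<in> borel_measurable borel" and c: "c \<noteq> 0"
  shows "(\<integral>\<^sup>+x. f x \<partial>lborel) = ennreal (\<bar>c\<bar> ^ DIM('a)) * (\<integral>\<^sup>+x. f (t + c *\<^sub>R x) \<partial>lborel)"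
proof -
  have "(\<integral>\<^sup>+x. f x \<partial>lborel) = (\<integral>\<^sup>+x. f x \<partial>density (distr lborel borel (\<lambda>x. t + c *\<^sub>R x)) (\<lambda>_. ennreal (\<bar>c\<bar> ^ DIM('a))))"
    by (rule arg_cong[OF lborel_affine[OF c], of "\<lambda>M. integral\<^sup>N M f"])
  also have "\<dots> = ennreal (\<bar>c\<bar> ^ DIM('a)) * (\<integral>\<^sup>+x. f (t + c *\<^sub>R x) \<partial>lborel)"
    by (simp add: nn_integral_density nn_integral_distr nn_integral_cmult)
  finally show ?thesis .
qed

lemma integral_lborel_affine:
  fixes t :: "'a::euclidean_space" and f :: "'a \<Rightarrow> complex"
  assumes [measurable]: "f \<in> borel_measurable borel" and c: "c \<noteq> 0"
  shows "(LINT x|lborel. f x) = of_real (\<bar>c\<bar> ^ DIM('a)) * (LINT x|lborel. f (t + c *\<^sub>R x))"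
proof -
  have "(LINT x|lborel. f x) = (LINT x|density (distr lborel borel (\<lambda>x. t + c *\<^sub>R x)) (\<lambda>_. ennreal (\<bar>c\<bar> ^ DIM('a))). f x)"
    by (rule arg_cong[OF lborel_affine[OF c], of "\<lambda>M. integral\<^sup>L M f"])
  also have "\<dots> = of_real (\<bar>c\<bar> ^ DIM('a)) * (LINT x|lborel. f (t + c *\<^sub>R x))"
    by (subst integral_density) (auto simp: integral_distr scaleR_conv_of_real)
  finally show ?thesis .
qed

lemma integrable_lborel_affine:
  fixes t :: "'a::euclidean_space" and f :: "'a \<Rightarrow> complex"
  assumes f: "integrable lborel f" and c: "c \<noteq> 0"
  shows "integrable lborel (\<lambda>x. f (t + c *\<^sub>R x))"
proof -
  have [measurable]: "f \<in> borel_measurable borel" using f by auto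
  have "(\<integral>\<^sup>+x. ennreal (norm (f x)) \<partial>lborel) < \<infinity>" using f by (simp add: integrable_iff_bounded)
  then have "(\<integral>\<^sup>+x. ennreal (norm (f (t + c *\<^sub>R x))) \<partial>lborel) < \<infinity>"
    using c by (subst (asm) nn_integral_lborel_affine[OF _ c, of _ t]) (auto simp: ennreal_mult_less_top)
  then show ?thesis by (simp add: integrable_iff_bounded)
qed

text \<open>Summing over the dyadic balls \<open>|x| < 2^k\<close> turns the integral of the weight into a geometric
  series with ratio \<open>2^(s+n)\<close>.\<close>

lemma integrable_wt:
  assumes s: "s < - real CARD('n)"
  shows "integrable lborel (wt s :: real^'n::finite \<Rightarrow> real)"
proof -
  let ?n = "CARD('n)"
  define a where "a k = 2 powr (- s) * (2 ^ k) powr s" for k :: nat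
  have a0: "a k \<ge> 0" for k by (simp add: a_def)
  define V where "V = unit_ball_vol (real DIM(real^'n))"
  have V: "V \<ge> 0" by (simp add: V_def)
  define q where "q = 2 powr (s + ?n)"
  have q: "q \<ge> 0" "q < 1" using s by (auto simp: q_def powr_less_one)
  have pw: "ennreal (wt s x) \<le> (\<Sum>k. ennreal (a k) * indicator (ball 0 (2 ^ k)) x)" for x :: "real^'n"
  proof -
    obtain j where "norm x < real j" using reals_Archimedean2 by blast
    also have "real j < 2 ^ j" by (metis of_nat_less_two_power)
    finally have ex: "norm x < 2 ^ j" .
    define k where "k = (LEAST k. norm x < 2 ^ k)"
    have k: "norm x < 2 ^ k" unfolding k_def by (rule LeastI[of "\<lambda>k. norm x < 2 ^ k", OF ex])
    have "wt s x \<le> a k"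
    proof (cases k)
      case 0
      have "wt s x \<le> wt 0 x" using s by (intro wt_mono) auto
      also have "\<dots> \<le> a 0" using s by (auto simp: a_def intro!: ge_one_powr_ge_zero)
      finally show ?thesis using 0 by simp
    next
      case (Suc i)
      then have "\<not> norm x < 2 ^ i" unfolding k_def by (metis lessI not_less_Least)
      then have i: "norm x \<ge> 2 ^ i" by simp
      have "0 < (2::real) ^ i" by simp
      then have x: "norm x > 0" using i by linarith
      have "wt s x \<le> ((norm x)\<^sup>2) powr (s / 2)"
        unfolding wt_def by (rule powr_mono2') (use s x in auto)
      also have "\<dots> = norm x powr s"
        using x by (simp add: powr_powr flip: powr_numeral)
      also have "\<dots> \<le> (2 ^ i) powr s" by (rule powr_mono2') (use s i in auto)
      also have "\<dots> = a k" using Suc by (simp add: a_def powr_mult powr_minus field_simps)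
      finally show ?thesis .
    qed
    then have "ennreal (wt s x) \<le> (\<Sum>k\<in>{k}. ennreal (a k) * indicator (ball 0 (2 ^ k)) x)"
      using k by (simp add: ennreal_leI)
    also have "\<dots> \<le> (\<Sum>k. ennreal (a k) * indicator (ball 0 (2 ^ k)) x)"
      by (intro sum_le_suminf summableI) auto
    finally show ?thesis .
  qed
  have "(\<integral>\<^sup>+x. ennreal (wt s x) \<partial>(lborel :: (real^'n) measure))
      \<le> (\<integral>\<^sup>+x. (\<Sum>k. ennreal (a k) * indicator (ball 0 (2 ^ k)) x) \<partial>(lborel :: (real^'n) measure))"
    by (intro nn_integral_mono pw)
  also have "\<dots> = (\<Sum>k. ennreal (a k) * emeasure lborel (ball (0::real^'n) (2 ^ k)))"
  proof (subst nn_integral_suminf)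
    show "(\<lambda>x::real^'n. ennreal (a i) * indicator (ball 0 (2 ^ i)) x) \<in> borel_measurable lborel" for i
      by (intro borel_measurable_times_ennreal borel_measurable_indicator) auto
  qed (simp add: nn_integral_cmult_indicator)
  also have "\<dots> = (\<Sum>k. ennreal (2 powr (- s) * V * q ^ k))"
  proof (intro suminf_cong)
    fix k
    have "ennreal (a k) * emeasure lborel (ball (0::real^'n) (2 ^ k)) = ennreal (a k * (V * (2 ^ k) ^ ?n))"
      using a0 V by (simp add: emeasure_ball V_def ennreal_mult)
    also have "a k * (V * (2 ^ k) ^ ?n) = 2 powr (- s) * V * q ^ k"
      by (simp add: a_def q_def powr_power powr_add algebra_simps powr_powr flip: powr_realpow)
    finally show "ennreal (a k) * emeasure lborel (ball (0::real^'n) (2 ^ k)) = ennreal (2 powr (- s) * V * q ^ k)" .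
  qed
  also have "\<dots> < \<infinity>"
    unfolding less_top[symmetric] infinity_ennreal_def
    by (intro ennreal_suminf_neq_top summable_mult summable_geometric) (use q V in auto)
  finally show ?thesis by (simp add: integrable_iff_bounded)
qed

lemma wt_le_power: "wt (real m) x \<le> (1 + norm x) ^ m"
proof -
  have "wt (real m) x \<le> ((1 + norm x)\<^sup>2) powr (real m / 2)"
    unfolding wt_def by (intro powr_mono2) (auto simp: power2_eq_square algebra_simps)
  also have "\<dots> = (1 + norm x) powr real m"
    by (simp add: powr_powr add_pos_nonneg flip: powr_numeral)
  also have "\<dots> = (1 + norm x) ^ m" by (simp add: powr_realpow add_pos_nonneg)
  finally show ?thesis .
qed

lemma integrable_decay:
  fixes f :: "real^'n::finite \<Rightarrow> complex"
  assumes [measurable]: "f \<in> borel_measurable borel"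
    and C: "\<And>x. (1 + norm x) ^ (CARD('n) + 1) * norm (f x) \<le> C"
  shows "integrable lborel f"
proof (rule Bochner_Integration.integrable_bound[where f = "\<lambda>x. C * wt (- real (CARD('n) + 1)) x"])
  have "integrable lborel (wt (- real (CARD('n) + 1)) :: real^'n \<Rightarrow> real)"
    by (intro integrable_wt) auto
  then show "integrable lborel (\<lambda>x::real^'n. C * wt (- real (CARD('n) + 1)) x)"
    by (rule integrable_mult_right)
  show "AE x in lborel. norm (f x) \<le> norm (C * wt (- real (CARD('n) + 1)) x)"
  proof (rule AE_I2)
    fix x :: "real^'n"
    let ?w = "wt (real (CARD('n) + 1)) x" and ?v = "wt (- real (CARD('n) + 1)) x"
    have "?w * norm (f x) \<le> C"
      using mult_right_mono[OF wt_le_power[of "CARD('n) + 1" x] norm_ge_zero[of "f x"]] C[of x] by linarith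
    then have "?v * (?w * norm (f x)) \<le> ?v * C" by (intro mult_left_mono) auto
    also have "?v * (?w * norm (f x)) = (?w * ?v) * norm (f x)" by (simp only: mult_ac)
    also have "\<dots> = norm (f x)" by (simp only: wt_inverse mult_1)
    finally have "norm (f x) \<le> C * ?v" by (simp only: mult.commute)
    also have "\<dots> \<le> norm (C * ?v)" by (simp only: real_norm_def abs_ge_self)
    finally show "norm (f x) \<le> norm (C * ?v)" .
  qed
qed simp

lemma measurable_cis [measurable (raw)]: "g \<in> borel_measurable M \<Longrightarrow> (\<lambda>x. cis (g x)) \<in> borel_measurable M"
  by (rule measurable_compose[of g M borel cis]) (auto intro!: borel_measurable_continuous_onI continuous_intros)

text \<open>Functions all of whose moments are finite; these include the Schwartz functions and the
  integrable functions of bounded support.\<close>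

definition rapid :: "(real^'n::finite \<Rightarrow> complex) \<Rightarrow> bool" where
  "rapid f \<longleftrightarrow> f \<in> borel_measurable borel \<and> (\<forall>k. integrable lborel (\<lambda>x. (1 + norm x) ^ k *\<^sub>R f x))"

lemma rapid_measurable [measurable_dest]: "rapid f \<Longrightarrow> f \<in> borel_measurable borel"
  by (simp add: rapid_def)

lemma rapid_integrable: "rapid f \<Longrightarrow> integrable lborel f"
  unfolding rapid_def by (metis (no_types, lifting) Bochner_Integration.integrable_cong power_0 scaleR_one)

lemma rapid_mult_linear:
  assumes f: "rapid f" and [measurable]: "m \<in> borel_measurable borel" and m: "\<And>x. norm (m x) \<le> K * (1 + norm x)"
  shows "rapid (\<lambda>x. m x * f x)"
  unfolding rapid_def
proof (intro conjI allI)
  have [measurable]: "f \<in> borel_measurable borel" using f by (simp add: rapid_def)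
  show "(\<lambda>x. m x * f x) \<in> borel_measurable borel" by measurable
  fix k
  show "integrable lborel (\<lambda>x. (1 + norm x) ^ k *\<^sub>R (m x * f x))"
  proof (rule Bochner_Integration.integrable_bound[where f = "\<lambda>x. K *\<^sub>R ((1 + norm x) ^ (k + 1) *\<^sub>R f x)"])
    have "integrable lborel (\<lambda>x. (1 + norm x) ^ (k + 1) *\<^sub>R f x)" using f unfolding rapid_def by blast
    then show "integrable lborel (\<lambda>x. K *\<^sub>R ((1 + norm x) ^ (k + 1) *\<^sub>R f x))" by (rule integrable_scaleR_right)
    have "norm ((1 + norm x) ^ k *\<^sub>R (m x * f x)) \<le> norm (K *\<^sub>R ((1 + norm x) ^ (k + 1) *\<^sub>R f x))" for x
    proof -
      have "(1 + norm x) ^ k * (norm (m x) * norm (f x)) \<le> (1 + norm x) ^ k * ((\<bar>K\<bar> * (1 + norm x)) * norm (f x))"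
        by (intro mult_left_mono mult_right_mono order_trans[OF m[of x]]) auto
      also have "\<dots> = \<bar>K\<bar> * ((1 + norm x) ^ (k + 1) * norm (f x))" by (simp only: power_Suc Suc_eq_plus1[symmetric] mult_ac)
      finally show ?thesis
      proof -
        have "\<bar>(1 + norm x) ^ i\<bar> = (1 + norm x) ^ i" for i by simp
        then show "(1 + norm x) ^ k * (norm (m x) * norm (f x)) \<le> \<bar>K\<bar> * ((1 + norm x) ^ (k + 1) * norm (f x)) \<Longrightarrow> ?thesis"
          by (simp only: norm_scaleR norm_mult)
      qed
    qed
    then show "AE x in lborel. norm ((1 + norm x) ^ k *\<^sub>R (m x * f x)) \<le> norm (K *\<^sub>R ((1 + norm x) ^ (k + 1) *\<^sub>R f x))" by simp
  qed measurable
qed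

lemma schwartz_measurable [measurable_dest]: "schwartz f \<Longrightarrow> f \<in> borel_measurable borel"
  by (simp add: schwartz_smooth smooth_measurable)

lemma schwartz_rapid:
  fixes f :: "real^'n::finite \<Rightarrow> complex"
  assumes f: "schwartz f"
  shows "rapid f"
  unfolding rapid_def
proof (intro conjI allI)
  show [measurable]: "f \<in> borel_measurable borel" using schwartz_measurable[OF f] .
  fix k
  obtain C where C: "\<And>x. (1 + norm x) ^ (CARD('n) + 1 + k) * norm (partials [] f x) \<le> C"
    using schwartz_bound[OF f] by blast
  show "integrable lborel (\<lambda>x. (1 + norm x) ^ k *\<^sub>R f x)"
    by (rule integrable_decay[where C = C]) (use C in \<open>auto simp: power_add algebra_simps\<close>)
qed

lemma schwartz_integrable: "schwartz f \<Longrightarrow> integrable lborel f"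
  by (simp add: rapid_integrable schwartz_rapid)

lemma schwartz_bounded:
  assumes "schwartz f"
  obtains B where "B \<ge> 0" "\<And>x. norm (f x) \<le> B"
  using schwartz_bound[OF assms, of 0 "[]"] by auto

section \<open>The Fourier transform\<close>

lemma fourier_integrand:
  "integrable lborel f \<Longrightarrow> integrable lborel (\<lambda>x. cis (- (x \<bullet> \<xi>)) * f x)"
  by (rule Bochner_Integration.integrable_bound[of _ f]) (auto simp: norm_mult)

lemma fourier_bound: "integrable lborel f \<Longrightarrow> norm (fourier f \<xi>) \<le> (LINT x|lborel. norm (f x))"
  unfolding fourier_def by (rule order_trans[OF integral_norm_bound]) (simp add: norm_mult)

lemma fourier_continuous:
  assumes f: "integrable lborel f"
  shows "continuous_on A (fourier f)"
proof (rule continuous_at_imp_continuous_on, rule ballI)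
  fix \<xi>
  have [measurable]: "f \<in> borel_measurable borel" using f by auto
  show "isCont (fourier f) \<xi>"
    unfolding continuous_at_sequentially
  proof (intro allI impI)
    fix X assume X: "X \<longlonglongrightarrow> \<xi>"
    have "(\<lambda>m. (LINT x|lborel. cis (- (x \<bullet> X m)) * f x)) \<longlonglongrightarrow> (LINT x|lborel. cis (- (x \<bullet> \<xi>)) * f x)"
    proof (rule integral_dominated_convergence[where w = "\<lambda>x. norm (f x)"])
      show "AE x in lborel. (\<lambda>m. cis (- (x \<bullet> X m)) * f x) \<longlonglongrightarrow> cis (- (x \<bullet> \<xi>)) * f x"
        by (intro AE_I2 tendsto_intros isCont_tendsto_compose[of _ cis] continuous_intros X)
    qed (use f in \<open>auto simp: norm_mult\<close>)
    then show "(fourier f \<circ> X) \<longlonglongrightarrow> fourier f \<xi>" by (simp add: fourier_def comp_def)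
  qed
qed

lemma fourier_measurable: "integrable lborel f \<Longrightarrow> fourier f \<in> borel_measurable borel"
  by (intro borel_measurable_continuous_onI fourier_continuous)

lemma cis_remainder: "cmod (cis t - 1 - \<i> * of_real t) \<le> t\<^sup>2"
proof -
  have "cmod (iexp t - (\<Sum>k\<le>1. (\<i> * t) ^ k / fact k)) \<le> \<bar>t\<bar> ^ (Suc 1) / fact (Suc 1)"
    by (rule iexp_approx1)
  also have "\<dots> \<le> t\<^sup>2" by (simp add: power2_eq_square flip: abs_mult)
  finally show ?thesis by (simp add: cis_conv_exp algebra_simps)
qed

text \<open>The remainder of \<open>cis\<close> is at most quadratic, so the error is \<open>|h|^2\<close> times the second moment of \<open>f\<close>.\<close>

lemma fourier_has_derivative:
  assumes f: "rapid f"
  shows "(fourier f has_derivative (\<lambda>v. fourier (\<lambda>x. (- \<i> * of_real (x \<bullet> v)) * f x) \<xi>)) (at \<xi>)"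
proof -
  have fm [measurable]: "f \<in> borel_measurable borel" using f by auto
  have r1: "rapid (\<lambda>x. (- \<i> * of_real (x \<bullet> v)) * f x)" for v
  proof (rule rapid_mult_linear[OF f, where K = "norm v"])
    fix x
    have "\<bar>x \<bullet> v\<bar> \<le> norm v * norm x" using Cauchy_Schwarz_ineq2[of x v] by (simp add: mult.commute)
    also have "\<dots> \<le> norm v * (1 + norm x)" by (intro mult_left_mono) auto
    finally show "norm (- \<i> * of_real (x \<bullet> v)) \<le> norm v * (1 + norm x)" by (simp add: norm_mult)
  qed simp
  have r2: "rapid (\<lambda>x. of_real (norm x) * (of_real (norm x) * f x))"
    by (intro rapid_mult_linear[where K = 1] f) auto
  have r0: "rapid (\<lambda>x. of_real (norm x) * f x)"
    by (intro rapid_mult_linear[where K = 1] f) auto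
  note int = fourier_integrand[OF rapid_integrable]
  define D where "D v = fourier (\<lambda>x. (- \<i> * of_real (x \<bullet> v)) * f x) \<xi>" for v
  define K where "K = (LINT x|lborel. norm (of_real (norm x) * (of_real (norm x) * f x)))"
  have K: "K \<ge> 0" by (simp add: K_def)
  have "bounded_linear D"
  proof (rule bounded_linear_intro)
    show "D (v + w) = D v + D w" for v w
      unfolding D_def fourier_def
      by (subst Bochner_Integration.integral_add[symmetric]) (use int[OF r1] in \<open>auto simp: algebra_simps\<close>)
    show "D (c *\<^sub>R v) = c *\<^sub>R D v" for c v
    proof -
      have "D (c *\<^sub>R v) = (LINT x|lborel. of_real c * (cis (- (x \<bullet> \<xi>)) * ((- \<i> * of_real (x \<bullet> v)) * f x)))"
        unfolding D_def fourier_def by (intro Bochner_Integration.integral_cong) (auto simp: mult_ac)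
      then show ?thesis by (simp only: integral_mult_right_zero D_def fourier_def scaleR_conv_of_real)
    qed
    show "norm (D v) \<le> norm v * (LINT x|lborel. norm (of_real (norm x) * f x))" for v
    proof -
      have "norm (D v) \<le> (LINT x|lborel. norm ((- \<i> * of_real (x \<bullet> v)) * f x))"
        unfolding D_def by (rule fourier_bound[OF rapid_integrable[OF r1]])
      also have "\<dots> \<le> (LINT x|lborel. norm v * norm (of_real (norm x) * f x))"
      proof (rule integral_mono)
        show "norm ((- \<i> * of_real (x \<bullet> v)) * f x) \<le> norm v * norm (of_real (norm x) * f x)" for x
          using mult_right_mono[OF Cauchy_Schwarz_ineq2[of x v] norm_ge_zero[of "f x"]]
          by (simp add: norm_mult mult_ac)
      qed (use rapid_integrable[OF r1] rapid_integrable[OF r0] in auto)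
      finally show ?thesis by simp
    qed
  qed
  moreover have "((\<lambda>h. norm (fourier f (\<xi> + h) - fourier f \<xi> - D h) / norm h) \<longlongrightarrow> 0) (at 0)"
  proof (rule Lim_null_comparison[where g = "\<lambda>h. norm h * K"])
    have "norm (fourier f (\<xi> + h) - fourier f \<xi> - D h) \<le> (norm h)\<^sup>2 * K" for h
    proof -
      define R where "R x = cis (- (x \<bullet> (\<xi> + h))) * f x - cis (- (x \<bullet> \<xi>)) * f x - cis (- (x \<bullet> \<xi>)) * ((- \<i> * of_real (x \<bullet> h)) * f x)" for x
      have e: "fourier f (\<xi> + h) - fourier f \<xi> - D h = (LINT x|lborel. R x)"
        unfolding fourier_def D_def R_def
        by (simp only: Bochner_Integration.integral_diff[OF Bochner_Integration.integrable_diff[OF int[OF f] int[OF f]] int[OF r1]]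
            Bochner_Integration.integral_diff[OF int[OF f] int[OF f]])
      have R: "norm (R x) \<le> (norm h)\<^sup>2 * norm (of_real (norm x) * (of_real (norm x) * f x))" for x
      proof -
        have "cis (- (x \<bullet> (\<xi> + h))) = cis (- (x \<bullet> \<xi>)) * cis (- (x \<bullet> h))"
          by (simp add: cis_mult inner_add_right)
        then have "R x = cis (- (x \<bullet> \<xi>)) * (cis (- (x \<bullet> h)) - 1 - \<i> * of_real (- (x \<bullet> h))) * f x"
          by (simp add: R_def algebra_simps)
        then have "norm (R x) = norm (cis (- (x \<bullet> h)) - 1 - \<i> * of_real (- (x \<bullet> h))) * norm (f x)"
          by (simp only: norm_mult norm_cis mult_1)
        also have "\<dots> \<le> (- (x \<bullet> h))\<^sup>2 * norm (f x)"
          by (intro mult_right_mono cis_remainder) auto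
        also have "\<dots> \<le> (norm x * norm h)\<^sup>2 * norm (f x)"
          using Cauchy_Schwarz_ineq2[of x h] by (intro mult_right_mono) (auto simp: abs_le_square_iff[symmetric] abs_mult)
        also have "\<dots> = (norm h)\<^sup>2 * norm (of_real (norm x) * (of_real (norm x) * f x))"
          by (simp add: norm_mult power2_eq_square mult_ac)
        finally show ?thesis .
      qed
      have iR: "integrable lborel R"
        unfolding R_def by (intro Bochner_Integration.integrable_diff int f r1)
      have "norm (LINT x|lborel. R x) \<le> (LINT x|lborel. norm (R x))"
        by (rule integral_norm_bound)
      also have "\<dots> \<le> (LINT x|lborel. (norm h)\<^sup>2 * norm (of_real (norm x) * (of_real (norm x) * f x)))"
        by (rule integral_mono) (use R iR rapid_integrable[OF r2] in auto)
      finally have "norm (LINT x|lborel. R x) \<le> (norm h)\<^sup>2 * K"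
        by (simp only: K_def integral_mult_right_zero)
      then show ?thesis by (simp only: e)
    qed
    then have "norm (norm (fourier f (\<xi> + h) - fourier f \<xi> - D h) / norm h) \<le> norm h * K" for h
      by (cases "h = 0") (auto simp: divide_simps power2_eq_square mult_ac K)
    then show "\<forall>\<^sub>F h in at 0. norm (norm (fourier f (\<xi> + h) - fourier f \<xi> - D h) / norm h) \<le> norm h * K" by simp
    show "((\<lambda>h. norm h * K) \<longlongrightarrow> 0) (at 0)" by (auto intro!: tendsto_eq_intros)
  qed
  ultimately show ?thesis unfolding has_derivative_at D_def by blast
qed

lemma rapid_coord: "rapid f \<Longrightarrow> rapid (\<lambda>x. (- \<i> * of_real (x $ j)) * f x)"
  by (rule rapid_mult_linear[where K = 1])
    (auto simp: norm_mult intro!: order_trans[OF component_le_norm_cart])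

lemma partial_deriv_fourier:
  assumes "rapid f"
  shows "partial_deriv j (fourier f) = fourier (\<lambda>x. (- \<i> * of_real (x $ j)) * f x)"
  by (rule ext) (simp add: partial_deriv_eqI[OF fourier_has_derivative[OF assms]] inner_axis)

lemma smooth_fourier:
  assumes "rapid f"
  shows "smooth (fourier f)"
proof (rule smooth_coinduct[where S = "{fourier f | f. rapid f}"])
  fix g :: "real^'n \<Rightarrow> complex" and i x assume "g \<in> {fourier f | f. rapid f}"
  then obtain f where f: "g = fourier f" "rapid f" by blast
  then show "g differentiable (at x)" using fourier_has_derivative differentiableI by blast
  show "partial_deriv i g \<in> {fourier f | f. rapid f}"
    unfolding f(1) partial_deriv_fourier[OF f(2)] using rapid_coord[OF f(2)] by blast
qed (use assms in auto)

lemma fourier_translate: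
  assumes "integrable lborel f"
  shows "fourier (\<lambda>x. f (x + y)) \<xi> = cis (y \<bullet> \<xi>) * fourier f \<xi>"
proof -
  have [measurable]: "f \<in> borel_measurable borel" using assms by auto
  have "cis (y \<bullet> \<xi>) * fourier f \<xi> = (LINT x|lborel. cis (y \<bullet> \<xi>) * (cis (- (x \<bullet> \<xi>)) * f x))"
    by (simp add: fourier_def)
  also have "\<dots> = (LINT x|lborel. cis (y \<bullet> \<xi>) * (cis (- ((y + 1 *\<^sub>R x) \<bullet> \<xi>)) * f (y + 1 *\<^sub>R x)))"
    by (subst integral_lborel_affine[where c = 1 and t = y]) auto
  also have "\<dots> = fourier (\<lambda>x. f (x + y)) \<xi>"
    unfolding fourier_def by (intro Bochner_Integration.integral_cong) (auto simp: cis_mult inner_add_left add.commute simp flip: mult.assoc)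
  finally show ?thesis by simp
qed

lemma fourier_scale:
  assumes "integrable lborel f" "c \<noteq> 0"
  shows "fourier f \<xi> = of_real (\<bar>c\<bar> ^ CARD('n)) * fourier (\<lambda>x. f (c *\<^sub>R x)) (c *\<^sub>R \<xi> :: real^'n::finite)"
proof -
  have [measurable]: "f \<in> borel_measurable borel" using assms by auto
  show ?thesis unfolding fourier_def
    by (subst integral_lborel_affine[where c = c and t = 0]) (use assms in \<open>auto simp: mult_ac\<close>)
qed

lemma fourier_modulate: "fourier (\<lambda>x. cis (x \<bullet> a) * f x) \<xi> = fourier f (\<xi> - a)"
  unfolding fourier_def
  by (intro Bochner_Integration.integral_cong) (auto simp: cis_mult inner_diff_right simp flip: mult.assoc)

lemma inv_fourier_eq: "inv_fourier f x = fourier f (- x :: real^'n::finite) / of_real ((2 * pi) ^ CARD('n))"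
  by (simp add: inv_fourier_def fourier_def inner_commute)

lemma integrable_prod_mult:
  fixes f g :: "real^'n::finite \<Rightarrow> complex"
  assumes f: "integrable lborel f" and g: "integrable lborel g"
  shows "integrable (lborel \<Otimes>\<^sub>M lborel) (\<lambda>(x, y). f x * g y)"
proof (rule lborel_pair.Fubini_integrable)
  have [measurable]: "f \<in> borel_measurable borel" "g \<in> borel_measurable borel" using f g by auto
  show "(\<lambda>(x, y). f x * g y) \<in> borel_measurable (lborel \<Otimes>\<^sub>M lborel)" by measurable
  show "integrable lborel (\<lambda>x. LINT y|lborel. norm (case (x, y) of (x, y) \<Rightarrow> f x * g y))"
    using f by (simp add: norm_mult)
  show "AE x in lborel. integrable lborel (\<lambda>y. case (x, y) of (x, y) \<Rightarrow> f x * g y)"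
    using g by simp
qed

text \<open>The multiplication formula, which is Fubini's theorem for \<open>cis (- x \<bullet> \<xi>) f(x) g(\<xi>)\<close>.\<close>

lemma fourier_swap:
  assumes f: "integrable lborel f" and g: "integrable lborel g"
  shows "(LINT x|lborel. f x * fourier g x) = (LINT x|lborel. fourier f x * g x)"
proof -
  have [measurable]: "f \<in> borel_measurable borel" "g \<in> borel_measurable borel" using f g by auto
  have i: "integrable (lborel \<Otimes>\<^sub>M lborel) (\<lambda>(x, y). cis (- (x \<bullet> y)) * (f x * g y))"
    by (rule Bochner_Integration.integrable_bound[OF integrable_prod_mult[OF f g]]) (auto simp: norm_mult)
  have "(LINT x|lborel. f x * fourier g x) = (LINT x|lborel. LINT y|lborel. cis (- (x \<bullet> y)) * (f x * g y))"
    unfolding fourier_def integral_mult_right_zero[symmetric]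
    by (intro Bochner_Integration.integral_cong) (auto simp: inner_commute mult_ac)
  also have "\<dots> = (LINT y|lborel. LINT x|lborel. cis (- (x \<bullet> y)) * (f x * g y))"
    by (rule lborel_pair.Fubini_integral[symmetric, OF i])
  also have "\<dots> = (LINT y|lborel. fourier f y * g y)"
    unfolding fourier_def integral_mult_left_zero[symmetric]
    by (intro Bochner_Integration.integral_cong) (auto simp: mult_ac)
  finally show ?thesis .
qed

section \<open>The Fourier transform of Schwartz functions\<close>

lemma one_plus_norm_shift: "norm v \<le> 1 \<Longrightarrow> 1 + norm x \<le> 2 * (1 + norm (x + v))"
proof -
  assume v: "norm v \<le> 1"
  have "norm x \<le> norm (x + v) + norm v" using norm_triangle_ineq4[of "x + v" v] by simp
  then show ?thesis using v norm_ge_zero[of "x + v"] unfolding distrib_left by linarith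
qed

lemma difference_quotient_tendsto:
  fixes g :: "real \<Rightarrow> complex"
  assumes "(g has_vector_derivative d) (at 0)" "h \<longlonglongrightarrow> 0" "\<And>m. h m > 0"
  shows "(\<lambda>m. (g (h m) - g 0) / of_real (h m)) \<longlonglongrightarrow> d"
proof -
  have "((\<lambda>t. norm (g (0 + t) - g 0 - t *\<^sub>R d) / norm t) \<longlongrightarrow> 0) (at 0)"
    using assms(1) by (simp add: has_vector_derivative_def has_derivative_at)
  then have "(\<lambda>m. norm (g (0 + h m) - g 0 - h m *\<^sub>R d) / norm (h m)) \<longlonglongrightarrow> 0"
    by (rule filterlim_compose) (use assms(2,3) in \<open>auto simp: filterlim_at intro!: eventuallyI less_imp_neq[symmetric]\<close>)
  moreover have "norm (g (0 + h m) - g 0 - h m *\<^sub>R d) / norm (h m) = norm ((g (h m) - g 0) / of_real (h m) - d)" for m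
  proof -
    have "(g (h m) - g 0) / of_real (h m) - d = (g (0 + h m) - g 0 - h m *\<^sub>R d) / of_real (h m)"
      using assms(3)[of m] by (simp add: scaleR_conv_of_real field_simps)
    then show ?thesis by (simp add: norm_divide)
  qed
  ultimately have "(\<lambda>m. norm ((g (h m) - g 0) / of_real (h m) - d)) \<longlonglongrightarrow> 0" by simp
  from tendsto_add[OF tendsto_norm_zero_cancel[OF this] tendsto_const[of d]] show ?thesis by simp
qed

text \<open>Differentiation becomes multiplication: the difference quotient of \<open>f\<close> in direction \<open>j\<close> has
  the transform \<open>(cis (h \<xi>_j) - 1) / h\<close> times that of \<open>f\<close>, and both sides converge as \<open>h\<close> tends to
  zero.\<close>

lemma fourier_partial_deriv:
  fixes f :: "real^'n::finite \<Rightarrow> complex"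
  assumes f: "schwartz f"
  shows "fourier (partial_deriv j f) \<xi> = \<i> * of_real (\<xi> $ j) * fourier f \<xi>"
proof -
  let ?e = "axis j 1 :: real^'n"
  define h where "h m = 1 / real (Suc m)" for m
  have h: "0 < h m" "h m \<le> 1" for m by (auto simp: h_def)
  have h0: "h \<longlonglongrightarrow> 0" unfolding h_def using LIMSEQ_inverse_real_of_nat by (simp add: inverse_eq_divide)
  have fi: "integrable lborel f" using f by (rule schwartz_integrable)
  have [measurable]: "f \<in> borel_measurable borel" using f by auto
  have ps: "schwartz (partial_deriv j f)" using schwartz_partials[OF f, of "[j]"] by simp
  have [measurable]: "partial_deriv j f \<in> borel_measurable borel" using ps by auto
  define Q where "Q m x = (f (x + h m *\<^sub>R ?e) - f x) / of_real (h m)" for m x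
  have Qm [measurable]: "Q m \<in> borel_measurable borel" for m unfolding Q_def by measurable
  have vd: "((\<lambda>t. f (x + t *\<^sub>R ?e)) has_vector_derivative partial_deriv j f (x + t *\<^sub>R ?e)) (at t)" for x t
  proof -
    have "(f has_derivative frechet_derivative f (at (x + t *\<^sub>R ?e))) (at (x + t *\<^sub>R ?e))"
      using smooth_differentiable[OF schwartz_smooth[OF f]] frechet_derivative_works by blast
    then have "((\<lambda>t. f (x + t *\<^sub>R ?e)) has_derivative (\<lambda>s. frechet_derivative f (at (x + t *\<^sub>R ?e)) (s *\<^sub>R ?e))) (at t)"
      by (rule has_derivative_compose[rotated]) (auto intro!: derivative_eq_intros)
    moreover have "frechet_derivative f (at (x + t *\<^sub>R ?e)) (s *\<^sub>R ?e) = s *\<^sub>R partial_deriv j f (x + t *\<^sub>R ?e)" for s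
      unfolding partial_deriv_def
      by (rule linear_scale[OF linear_frechet_derivative[OF smooth_differentiable[OF schwartz_smooth[OF f]]]])
    ultimately show ?thesis by (simp add: has_vector_derivative_def)
  qed
  obtain C where C: "C \<ge> 0" "\<And>x. (1 + norm x) ^ (CARD('n) + 1) * norm (partial_deriv j f x) \<le> C"
    using schwartz_bound[OF f, of "CARD('n) + 1" "[j]"] by auto
  define C' where "C' = 2 ^ (CARD('n) + 1) * C"
  have Qb: "(1 + norm x) ^ (CARD('n) + 1) * norm (Q m x) \<le> C'" for m x
  proof -
    let ?p = "(1 + norm x) ^ (CARD('n) + 1)"
    have p: "?p > 0" by (simp add: add_pos_nonneg)
    have "norm (partial_deriv j f (x + t *\<^sub>R ?e)) \<le> C' / ?p" if "t \<in> {0..h m}" for t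
    proof -
      have "norm (t *\<^sub>R ?e) \<le> 1" using that h[of m] by simp
      then have "?p \<le> (2 * (1 + norm (x + t *\<^sub>R ?e))) ^ (CARD('n) + 1)"
        by (intro power_mono one_plus_norm_shift) auto
      also have "\<dots> = 2 ^ (CARD('n) + 1) * (1 + norm (x + t *\<^sub>R ?e)) ^ (CARD('n) + 1)" by (rule power_mult_distrib)
      finally have "?p * norm (partial_deriv j f (x + t *\<^sub>R ?e)) \<le>
         2 ^ (CARD('n) + 1) * (1 + norm (x + t *\<^sub>R ?e)) ^ (CARD('n) + 1) * norm (partial_deriv j f (x + t *\<^sub>R ?e))"
        by (rule mult_right_mono) auto
      also have "\<dots> \<le> C'" unfolding C'_def mult.assoc by (intro mult_left_mono C) auto
      finally show ?thesis using p by (simp only: pos_le_divide_eq mult.commute)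
    qed
    moreover define B where "B = C' / ?p"
    ultimately have B: "norm (partial_deriv j f (x + t *\<^sub>R ?e)) \<le> B" if "t \<in> {0..h m}" for t using that by blast
    have "norm (f (x + h m *\<^sub>R ?e) - f (x + 0 *\<^sub>R ?e)) \<le> B * norm (h m - 0)"
    proof (rule differentiable_bound[where S = "{0..h m}" and f' = "\<lambda>t s. s *\<^sub>R partial_deriv j f (x + t *\<^sub>R ?e)"])
      fix t assume t: "t \<in> {0..h m}"
      show "((\<lambda>t. f (x + t *\<^sub>R ?e)) has_derivative (\<lambda>s. s *\<^sub>R partial_deriv j f (x + t *\<^sub>R ?e))) (at t within {0..h m})"
        using vd[of x t] by (simp add: has_vector_derivative_def has_derivative_at_withinI)
      show "onorm (\<lambda>s. s *\<^sub>R partial_deriv j f (x + t *\<^sub>R ?e)) \<le> B"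
        by (rule onorm_le) (use B[OF t] in \<open>auto simp: mult.commute[of B] intro!: mult_left_mono\<close>)
    qed (use h[of m] in auto)
    then have "norm (f (x + h m *\<^sub>R ?e) - f x) \<le> B * h m" using h[of m] by simp
    then have "norm (Q m x) \<le> B"
      using h[of m] by (simp add: Q_def norm_divide pos_divide_le_eq)
    then show ?thesis using p unfolding B_def by (simp only: pos_le_divide_eq mult.commute)
  qed
  have Ql: "(\<lambda>m. Q m x) \<longlonglongrightarrow> partial_deriv j f x" for x
  proof -
    have "((\<lambda>t. f (x + t *\<^sub>R ?e)) has_vector_derivative partial_deriv j f x) (at 0)" using vd[of x 0] by simp
    from difference_quotient_tendsto[OF this h0 h(1)] show ?thesis by (simp add: Q_def)
  qed
  have qi: "integrable lborel (Q m)" for m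
    by (rule integrable_decay[OF Qm Qb])
  have FQ: "fourier (Q m) \<xi> = ((cis (h m * (\<xi> $ j)) - 1) / of_real (h m)) * fourier f \<xi>" for m
  proof -
    have "fourier (Q m) \<xi> = (LINT x|lborel. (cis (- (x \<bullet> \<xi>)) * f (x + h m *\<^sub>R ?e) - cis (- (x \<bullet> \<xi>)) * f x) / of_real (h m))"
      unfolding fourier_def Q_def by (intro Bochner_Integration.integral_cong) (auto simp: algebra_simps diff_divide_distrib)
    also have "\<dots> = (fourier (\<lambda>x. f (x + h m *\<^sub>R ?e)) \<xi> - fourier f \<xi>) / of_real (h m)"
    proof -
      have "integrable lborel (\<lambda>x. f (x + h m *\<^sub>R ?e))"
        using integrable_lborel_affine[OF fi, of 1 "h m *\<^sub>R ?e"] by (simp add: add.commute)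
      from Bochner_Integration.integral_diff[OF fourier_integrand[OF this] fourier_integrand[OF fi]]
      show ?thesis by (simp add: fourier_def)
    qed
    also have "\<dots> = ((cis (h m * (\<xi> $ j)) - 1) / of_real (h m)) * fourier f \<xi>"
      by (simp add: fourier_translate[OF fi] inner_axis' algebra_simps)
    finally show ?thesis .
  qed
  have wi: "integrable lborel (\<lambda>x::real^'n. C' * wt (- real (CARD('n) + 1)) x)"
    by (intro integrable_mult_right integrable_wt) auto
  have "(\<lambda>m. fourier (Q m) \<xi>) \<longlonglongrightarrow> fourier (partial_deriv j f) \<xi>"
    unfolding fourier_def
  proof (rule integral_dominated_convergence[where w = "\<lambda>x. C' * wt (- real (CARD('n) + 1)) x"])
    show "AE x in lborel. (\<lambda>m. cis (- (x \<bullet> \<xi>)) * Q m x) \<longlonglongrightarrow> cis (- (x \<bullet> \<xi>)) * partial_deriv j f x"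
      by (intro AE_I2 tendsto_intros Ql)
    show "AE x in lborel. norm (cis (- (x \<bullet> \<xi>)) * Q m x) \<le> C' * wt (- real (CARD('n) + 1)) x" for m
    proof (rule AE_I2)
      fix x :: "real^'n"
      let ?w = "wt (real (CARD('n) + 1)) x" and ?v = "wt (- real (CARD('n) + 1)) x"
      have "?w * norm (Q m x) \<le> C'"
        using mult_right_mono[OF wt_le_power[of "CARD('n) + 1" x] norm_ge_zero[of "Q m x"]] Qb[of x m] by linarith
      then have "?v * (?w * norm (Q m x)) \<le> ?v * C'" by (intro mult_left_mono) auto
      also have "?v * (?w * norm (Q m x)) = (?w * ?v) * norm (Q m x)" by (simp only: mult_ac)
      finally show "norm (cis (- (x \<bullet> \<xi>)) * Q m x) \<le> C' * ?v" by (simp only: wt_inverse mult_1 norm_mult norm_cis mult.commute)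
    qed
  qed (use wi in auto)
  moreover have "(\<lambda>m. fourier (Q m) \<xi>) \<longlonglongrightarrow> (\<i> * of_real (\<xi> $ j)) * fourier f \<xi>"
    unfolding FQ
  proof (intro tendsto_mult tendsto_const)
    have "((\<lambda>t. cis (t * (\<xi> $ j))) has_vector_derivative ((\<xi> $ j) *\<^sub>R (\<i> * cis (0 * (\<xi> $ j))))) (at 0)"
      by (auto intro!: derivative_eq_intros simp: has_vector_derivative_def fun_eq_iff scaleR_conv_of_real mult_ac)
    from difference_quotient_tendsto[OF this h0 h(1)]
    show "(\<lambda>m. (cis (h m * (\<xi> $ j)) - 1) / of_real (h m)) \<longlonglongrightarrow> \<i> * of_real (\<xi> $ j)"
      by (simp add: scaleR_conv_of_real mult.commute)
  qed
  ultimately show ?thesis using LIMSEQ_unique by blast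
qed

lemma norm_le_sum_components: "norm (x::real^'n::finite) \<le> (\<Sum>j\<in>UNIV. \<bar>x $ j\<bar>)"
  unfolding norm_vec_def by (metis (no_types, lifting) L2_set_le_sum_abs real_norm_def sum.cong L2_set_cong abs_ge_zero abs_abs)

text \<open>A factor \<open>|\<xi>|\<close> is at most \<open>\<Sum>|\<xi>_j|\<close>, and \<open>|\<xi>_j|\<close> times the transform is the transform of a partial
  derivative up to a unit.\<close>

lemma fourier_decay:
  fixes g :: "real^'n::finite \<Rightarrow> complex"
  assumes "schwartz g"
  shows "\<exists>C. \<forall>\<xi>. (1 + norm \<xi>) ^ k * norm (fourier g \<xi>) \<le> C"
  using assms
proof (induction k arbitrary: g)
  case 0
  then show ?case using fourier_bound[OF schwartz_integrable] by auto
next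
  case (Suc k)
  have "schwartz (partial_deriv j g)" for j using schwartz_partials[OF Suc.prems, of "[j]"] by simp
  then have "\<forall>j. \<exists>C. \<forall>\<xi>. (1 + norm \<xi>) ^ k * norm (fourier (partial_deriv j g) \<xi>) \<le> C"
    using Suc.IH by blast
  then obtain D where D: "\<And>j \<xi>. (1 + norm \<xi>) ^ k * norm (fourier (partial_deriv j g) \<xi>) \<le> D j" by metis
  obtain C where C: "\<And>\<xi>. (1 + norm \<xi>) ^ k * norm (fourier g \<xi>) \<le> C"
    using Suc by blast
  have "(1 + norm \<xi>) ^ Suc k * norm (fourier g \<xi>) \<le> C + (\<Sum>j\<in>UNIV. D j)" for \<xi>
  proof -
    have "(1 + norm \<xi>) ^ Suc k * norm (fourier g \<xi>) = (1 + norm \<xi>) ^ k * norm (fourier g \<xi>) + (1 + norm \<xi>) ^ k * (norm \<xi> * norm (fourier g \<xi>))"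
      by (simp add: algebra_simps)
    also have "norm \<xi> * norm (fourier g \<xi>) \<le> (\<Sum>j\<in>UNIV. \<bar>\<xi> $ j\<bar>) * norm (fourier g \<xi>)"
      by (intro mult_right_mono norm_le_sum_components) auto
    also have "\<dots> = (\<Sum>j\<in>UNIV. norm (fourier (partial_deriv j g) \<xi>))"
      by (simp add: fourier_partial_deriv[OF Suc.prems] norm_mult sum_distrib_right)
    also have "(1 + norm \<xi>) ^ k * norm (fourier g \<xi>) + (1 + norm \<xi>) ^ k * (\<Sum>j\<in>UNIV. norm (fourier (partial_deriv j g) \<xi>))
        \<le> C + (\<Sum>j\<in>UNIV. D j)"
      unfolding sum_distrib_left by (intro add_mono C sum_mono D)
    finally show ?thesis by (simp add: mult_left_mono)
  qed
  then show ?case by blast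
qed

lemma schwartz_fourier:
  fixes f :: "real^'n::finite \<Rightarrow> complex"
  assumes f: "schwartz f"
  shows "schwartz (fourier f)"
proof (rule schwartzI)
  show "smooth (fourier f)" by (rule smooth_fourier[OF schwartz_rapid[OF f]])
  fix k js
  have "partials js (fourier f) \<in> fourier ` {g. schwartz g}"
  proof (rule partials_in)
    fix g :: "real^'n \<Rightarrow> complex" and i assume "g \<in> fourier ` {g. schwartz g}"
    then obtain g' where g': "g = fourier g'" "schwartz g'" by blast
    have "schwartz (\<lambda>x. (- \<i>) * (of_real (x $ i) * g' x))"
      by (intro schwartz_mult temperate_const temperate_coord g')
    then show "partial_deriv i g \<in> fourier ` {g. schwartz g}"
      unfolding g'(1) partial_deriv_fourier[OF schwartz_rapid[OF g'(2)]] mult.assoc by blast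
  qed (use f in auto)
  then show "\<exists>C. \<forall>x. (1 + norm x) ^ k * norm (partials js (fourier f) x) \<le> C"
    using fourier_decay by auto
qed

lemma schwartz_inv_fourier:
  fixes f :: "real^'n::finite \<Rightarrow> complex"
  assumes f: "schwartz f"
  shows "schwartz (inv_fourier f)"
proof -
  have "schwartz (\<lambda>x::real^'n. (1 / of_real ((2 * pi) ^ CARD('n))) * fourier f (- x))"
    by (intro schwartz_mult temperate_const schwartz_uminus_arg schwartz_fourier f)
  then show ?thesis unfolding inv_fourier_eq[abs_def] by simp
qed

section \<open>Fourier inversion\<close>

lemma integral_prod_components:
  fixes g :: "'a::euclidean_space \<Rightarrow> real \<Rightarrow> complex"
  assumes g: "\<And>b. b \<in> Basis \<Longrightarrow> integrable lborel (g b)"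
  shows "(LINT x|lborel. (\<Prod>b\<in>Basis. g b (x \<bullet> b))) = (\<Prod>b\<in>Basis. LINT t|lborel. g b t)"
proof -
  interpret product_sigma_finite "\<lambda>_::'a. lborel :: real measure" ..
  have [measurable]: "b \<in> Basis \<Longrightarrow> g b \<in> borel_measurable borel" for b using g by fastforce
  have "(LINT x|lborel. (\<Prod>b\<in>Basis. g b (x \<bullet> b)))
      = (LINT x|distr (\<Pi>\<^sub>M b\<in>Basis. lborel) borel (\<lambda>f. \<Sum>b\<in>Basis. f b *\<^sub>R b). (\<Prod>b\<in>Basis. g b ((x::'a) \<bullet> b)))"
    by (rule arg_cong[OF lborel_eq, of "\<lambda>M. integral\<^sup>L M (\<lambda>x. \<Prod>b\<in>Basis. g b (x \<bullet> b))"])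
  also have "\<dots> = (LINT f|(\<Pi>\<^sub>M b\<in>Basis. lborel). (\<Prod>b\<in>Basis. g b ((\<Sum>c\<in>Basis. f c *\<^sub>R c) \<bullet> (b::'a))))"
    by (subst integral_distr) auto
  also have "\<dots> = (LINT f|(\<Pi>\<^sub>M b\<in>Basis. lborel). (\<Prod>b\<in>(Basis::'a set). g b (f b)))"
    by (intro Bochner_Integration.integral_cong prod.cong refl) (simp add: inner_sum_left inner_Basis if_distrib sum.delta cong: if_cong)
  also have "\<dots> = (\<Prod>b\<in>Basis. LINT t|lborel. g b t)"
    by (rule product_integral_prod) (auto intro: g)
  finally show ?thesis .
qed

lemma integrable_gaussian_real: "integrable lborel (\<lambda>t::real. complex_of_real (exp (- t\<^sup>2 / 2)))"
proof -
  have "integrable lborel (\<lambda>t::real. std_normal_density t * t ^ 0)" by (rule integrable_std_normal_moment)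
  then have "integrable lborel (\<lambda>t::real. sqrt (2 * pi) * std_normal_density t)" by simp
  then show ?thesis by (simp add: std_normal_density_def)
qed

lemma fourier_gaussian_real:
  "(LINT t|lborel. cis (- (t * a)) * complex_of_real (exp (- t\<^sup>2 / 2))) = of_real (sqrt (2 * pi) * exp (- a\<^sup>2 / 2))"
proof -
  have "char std_normal_distribution (- a) = (CLBINT t. std_normal_density t *\<^sub>R iexp (- a * t))"
    unfolding char_def by (subst integral_density) auto
  also have "\<dots> = (CLBINT t. of_real (1 / sqrt (2 * pi)) * (cis (- (t * a)) * complex_of_real (exp (- t\<^sup>2 / 2))))"
    by (intro Bochner_Integration.integral_cong)
      (auto simp: std_normal_density_def scaleR_conv_of_real cis_conv_exp mult_ac)
  also have "\<dots> = of_real (1 / sqrt (2 * pi)) * (CLBINT t. cis (- (t * a)) * complex_of_real (exp (- t\<^sup>2 / 2)))"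
    by (rule integral_mult_right_zero)
  finally have "of_real (1 / sqrt (2 * pi)) * (CLBINT t. cis (- (t * a)) * complex_of_real (exp (- t\<^sup>2 / 2))) = of_real (exp (- a\<^sup>2 / 2))"
    by (simp add: char_std_normal_distribution)
  then show ?thesis by (simp add: field_simps)
qed

definition gaussian :: "real^'n::finite \<Rightarrow> complex" where
  "gaussian x = of_real (exp (- (norm x)\<^sup>2 / 2))"

lemma gaussian_prod: "gaussian x = (\<Prod>b\<in>Basis. of_real (exp (- (x \<bullet> b)\<^sup>2 / 2)))"
  unfolding gaussian_def power2_norm_eq_inner euclidean_inner[of x x]
  by (simp add: exp_sum[symmetric] sum_negf sum_divide_distrib power2_eq_square flip: of_real_prod)

lemma fourier_gaussian:
  "fourier gaussian (\<xi> :: real^'n::finite) = of_real (sqrt (2 * pi) ^ CARD('n)) * gaussian \<xi>"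
proof -
  have "fourier gaussian \<xi> = (LINT x|lborel. (\<Prod>b\<in>Basis. cis (- ((x \<bullet> b) * (\<xi> \<bullet> b))) * of_real (exp (- (x \<bullet> b)\<^sup>2 / 2))))"
    unfolding fourier_def gaussian_prod prod.distrib
    by (intro Bochner_Integration.integral_cong refl arg_cong2[of _ _ _ _ "(*)"])
      (simp_all add: cis_conv_exp euclidean_inner[of _ \<xi>] sum_distrib_left sum_negf exp_sum[symmetric])
  also have "\<dots> = (\<Prod>b\<in>Basis. LINT t|lborel. cis (- (t * (\<xi> \<bullet> b))) * of_real (exp (- t\<^sup>2 / 2)))"
    by (rule integral_prod_components) (rule Bochner_Integration.integrable_bound[OF integrable_gaussian_real], auto simp: norm_mult)
  also have "\<dots> = (\<Prod>b\<in>(Basis::(real^'n) set). of_real (sqrt (2 * pi)) * of_real (exp (- (\<xi> \<bullet> b)\<^sup>2 / 2)))"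
    by (simp only: fourier_gaussian_real of_real_mult)
  also have "\<dots> = of_real (sqrt (2 * pi) ^ CARD('n)) * gaussian \<xi>"
    by (simp add: prod.distrib gaussian_prod)
  finally show ?thesis .
qed

lemma gaussian_measurable [measurable]: "gaussian \<in> borel_measurable borel"
  unfolding gaussian_def[abs_def] by measurable

lemma integrable_gaussian: "integrable lborel (gaussian :: real^'n::finite \<Rightarrow> complex)"
proof (rule ccontr)
  assume "\<not> ?thesis"
  then have "fourier (gaussian :: real^'n \<Rightarrow> complex) 0 = 0"
    unfolding fourier_def by (simp add: not_integrable_integral_eq)
  then show False using fourier_gaussian[of "0::real^'n"] by (simp add: gaussian_def)
qed

lemma integral_gaussian: "(LINT x|lborel. gaussian (x::real^'n::finite)) = of_real (sqrt (2 * pi) ^ CARD('n))"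
  using fourier_gaussian[of "0::real^'n"] by (simp add: fourier_def gaussian_def)

text \<open>Inversion by a Gaussian regulator: inserting \<open>gaussian (e \<xi>)\<close> into the inverse integral gives,
  by the multiplication formula, an average of \<open>f\<close> over a Gaussian of width \<open>e\<close> centred at \<open>x\<close>.\<close>

theorem fourier_inversion:
  fixes f :: "real^'n::finite \<Rightarrow> complex"
  assumes f: "integrable lborel f" and cont: "continuous_on UNIV f" and bd: "\<And>x. norm (f x) \<le> B"
    and Ff: "integrable lborel (fourier f)"
  shows "inv_fourier (fourier f) x = f x"
proof -
  have [measurable]: "f \<in> borel_measurable borel" using f by auto
  have [measurable]: "fourier f \<in> borel_measurable borel" using Ff by auto
  define e where "e m = 1 / real (Suc m)" for m
  have e: "0 < e m" for m by (auto simp: e_def)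
  have e0: "e \<longlonglongrightarrow> 0" unfolding e_def using LIMSEQ_inverse_real_of_nat by (simp add: inverse_eq_divide)
  let ?K = "of_real (sqrt (2 * pi) ^ CARD('n)) :: complex"
  have gs: "integrable lborel (\<lambda>\<xi>. gaussian (e m *\<^sub>R \<xi> :: real^'n))" for m
    using integrable_lborel_affine[OF integrable_gaussian, of "e m" 0] e[of m] by simp
  have Fgs: "of_real (\<bar>e m\<bar> ^ CARD('n)) * fourier (\<lambda>\<xi>. gaussian (e m *\<^sub>R \<xi>)) (e m *\<^sub>R z) = ?K * gaussian z" for m and z :: "real^'n"
    using fourier_scale[OF integrable_gaussian, of "e m" z] e[of m] by (simp add: fourier_gaussian)
  have id: "(LINT \<xi>|lborel. fourier f \<xi> * (cis (\<xi> \<bullet> x) * gaussian (e m *\<^sub>R \<xi>))) = (LINT z|lborel. f (x + e m *\<^sub>R z) * (?K * gaussian z))" for m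
  proof -
    have "integrable lborel (\<lambda>\<xi>. cis (\<xi> \<bullet> x) * gaussian (e m *\<^sub>R \<xi>))"
      by (rule Bochner_Integration.integrable_bound[OF gs[of m]]) (auto simp: norm_mult)
    from fourier_swap[OF f this]
    have "(LINT \<xi>|lborel. fourier f \<xi> * (cis (\<xi> \<bullet> x) * gaussian (e m *\<^sub>R \<xi>)))
       = (LINT y|lborel. f y * fourier (\<lambda>\<xi>. gaussian (e m *\<^sub>R \<xi>)) (y - x))"
      by (simp only: fourier_modulate)
    also have "\<dots> = of_real (\<bar>e m\<bar> ^ CARD('n)) * (LINT z|lborel. f (x + e m *\<^sub>R z) * fourier (\<lambda>\<xi>. gaussian (e m *\<^sub>R \<xi>)) ((x + e m *\<^sub>R z) - x))"
      using fourier_measurable[OF gs] e[of m] by (subst integral_lborel_affine[of _ "e m" x]) auto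
    also have "\<dots> = (LINT z|lborel. f (x + e m *\<^sub>R z) * (of_real (\<bar>e m\<bar> ^ CARD('n)) * fourier (\<lambda>\<xi>. gaussian (e m *\<^sub>R \<xi>)) (e m *\<^sub>R z)))"
      by (subst integral_mult_right_zero[symmetric]) (intro Bochner_Integration.integral_cong, auto simp: mult_ac)
    also have "\<dots> = (LINT z|lborel. f (x + e m *\<^sub>R z) * (?K * gaussian z))"
      by (simp only: Fgs)
    finally show ?thesis .
  qed
  have g1: "norm (gaussian y) \<le> 1" for y :: "real^'n" by (simp add: gaussian_def)
  have "(\<lambda>m. LINT \<xi>|lborel. fourier f \<xi> * (cis (\<xi> \<bullet> x) * gaussian (e m *\<^sub>R \<xi>)))
      \<longlonglongrightarrow> (LINT \<xi>|lborel. fourier f \<xi> * (cis (\<xi> \<bullet> x) * 1))"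
  proof (rule integral_dominated_convergence[where w = "\<lambda>\<xi>. norm (fourier f \<xi>)"])
    have "(\<lambda>m. gaussian (e m *\<^sub>R \<xi>)) \<longlonglongrightarrow> 1" for \<xi> :: "real^'n"
      unfolding gaussian_def using e0 by (auto intro!: tendsto_eq_intros)
    then show "AE \<xi> in lborel. (\<lambda>m. fourier f \<xi> * (cis (\<xi> \<bullet> x) * gaussian (e m *\<^sub>R \<xi>))) \<longlonglongrightarrow> fourier f \<xi> * (cis (\<xi> \<bullet> x) * 1)"
      by (intro AE_I2 tendsto_intros)
    show "AE \<xi> in lborel. norm (fourier f \<xi> * (cis (\<xi> \<bullet> x) * gaussian (e m *\<^sub>R \<xi>))) \<le> norm (fourier f \<xi>)" for m
      by (auto simp: norm_mult intro!: mult_left_le g1)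
  qed (use Ff in auto)
  moreover have "(\<lambda>m. LINT z|lborel. f (x + e m *\<^sub>R z) * (?K * gaussian z)) \<longlonglongrightarrow> (LINT z::real^'n|lborel. f x * (?K * gaussian z))"
  proof (rule integral_dominated_convergence[where w = "\<lambda>z::real^'n. B * norm (?K * gaussian z)"])
    have "isCont f x" using cont by (simp add: continuous_on_eq_continuous_at)
    moreover have "(\<lambda>m. x + e m *\<^sub>R z) \<longlonglongrightarrow> x" for z using e0 by (auto intro!: tendsto_eq_intros)
    ultimately have "(\<lambda>m. f (x + e m *\<^sub>R z)) \<longlonglongrightarrow> f x" for z by (rule isCont_tendsto_compose)
    then show "AE z in lborel. (\<lambda>m. f (x + e m *\<^sub>R z) * (?K * gaussian z)) \<longlonglongrightarrow> f x * (?K * gaussian z)"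
      by (intro AE_I2 tendsto_intros)
    show "AE z in lborel. norm (f (x + e m *\<^sub>R z) * (?K * gaussian z)) \<le> B * norm (?K * gaussian z)" for m
      unfolding norm_mult[of "f _"] by (intro AE_I2 mult_right_mono bd) auto
    show "integrable lborel (\<lambda>z::real^'n. B * norm (?K * gaussian z))"
      by (intro integrable_mult_right integrable_norm integrable_gaussian)
  qed auto
  ultimately have "(LINT \<xi>|lborel. fourier f \<xi> * (cis (\<xi> \<bullet> x) * 1)) = (LINT z::real^'n|lborel. f x * (?K * gaussian z))"
    unfolding id using LIMSEQ_unique by blast
  also have "\<dots> = f x * (?K * ?K)" by (simp add: integral_gaussian)
  also have "?K * ?K = of_real ((2 * pi) ^ CARD('n))"
  proof -
    have "sqrt (2 * pi) * sqrt (2 * pi) = 2 * pi" by simp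
    then show ?thesis by (simp only: of_real_mult[symmetric] power_mult_distrib[symmetric])
  qed
  finally show ?thesis
    by (simp add: inv_fourier_def inner_commute mult.commute)
qed

lemma inv_fourier_fourier:
  fixes f :: "real^'n::finite \<Rightarrow> complex"
  assumes f: "schwartz f"
  shows "inv_fourier (fourier f) = f"
proof
  fix x
  obtain B where "\<And>x. norm (f x) \<le> B" using schwartz_bounded[OF f] by blast
  then show "inv_fourier (fourier f) x = f x"
    by (intro fourier_inversion schwartz_integrable schwartz_fourier f smooth_continuous_on schwartz_smooth)
qed

lemma fourier_uminus_arg:
  assumes "integrable lborel f"
  shows "fourier (\<lambda>x. f (- x)) \<xi> = fourier f (- \<xi> :: real^'n::finite)"
  using fourier_scale[OF assms, of "-1" "- \<xi>"] by simp

lemma fourier_inv_fourier: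
  fixes f :: "real^'n::finite \<Rightarrow> complex"
  assumes f: "schwartz f"
  shows "fourier (inv_fourier f) = f"
proof
  fix x
  let ?c = "of_real ((2 * pi) ^ CARD('n)) :: complex"
  have "fourier (inv_fourier f) x = (LINT \<xi>|lborel. (1 / ?c) * (cis (- (\<xi> \<bullet> x)) * fourier f (- \<xi>)))"
    unfolding fourier_def[of "inv_fourier f"] inv_fourier_eq by (intro Bochner_Integration.integral_cong) auto
  also have "\<dots> = (1 / ?c) * fourier (\<lambda>\<xi>. fourier f (- \<xi>)) x"
    unfolding fourier_def[of "\<lambda>\<xi>. fourier f (- \<xi>)"] by (rule integral_mult_right_zero)
  also have "\<dots> = inv_fourier (fourier f) x"
    by (simp add: fourier_uminus_arg[OF schwartz_integrable[OF schwartz_fourier[OF f]]] inv_fourier_eq)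
  finally show "fourier (inv_fourier f) x = f x" by (simp add: inv_fourier_fourier[OF f])
qed

text \<open>Plancherel's identity is the multiplication formula for \<open>f\<close> and \<open>cnj (fourier f)\<close>.\<close>

lemma plancherel_schwartz:
  fixes f :: "real^'n::finite \<Rightarrow> complex"
  assumes f: "schwartz f"
  shows "(LINT \<xi>|lborel. (norm (fourier f \<xi>))\<^sup>2) = (2 * pi) ^ CARD('n) * (LINT x|lborel. (norm (f x))\<^sup>2)"
proof -
  let ?c = "(2 * pi) ^ CARD('n)"
  have F: "integrable lborel (fourier f)" using schwartz_integrable schwartz_fourier f by blast
  have cn: "fourier (\<lambda>\<xi>. cnj (fourier f \<xi>)) x = cnj (of_real ?c * f x)" for x
  proof -
    have "fourier (\<lambda>\<xi>. cnj (fourier f \<xi>)) x = cnj (LINT \<xi>|lborel. cis (x \<bullet> \<xi>) * fourier f \<xi>)"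
    proof -
      have "cnj (LINT \<xi>|lborel. cis (x \<bullet> \<xi>) * fourier f \<xi>) = (LINT \<xi>|lborel. cnj (cis (x \<bullet> \<xi>) * fourier f \<xi>))"
        by (rule Bochner_Integration.integral_cnj[symmetric])
      then show ?thesis
        unfolding fourier_def[of "\<lambda>\<xi>. cnj (fourier f \<xi>)"] by (simp add: cis_cnj inner_commute)
    qed
    also have "(LINT \<xi>|lborel. cis (x \<bullet> \<xi>) * fourier f \<xi>) = of_real ?c * inv_fourier (fourier f) x"
      by (simp add: inv_fourier_def)
    finally show ?thesis by (simp add: inv_fourier_fourier[OF f])
  qed
  have "(LINT \<xi>|lborel. fourier f \<xi> * cnj (fourier f \<xi>)) = (LINT x|lborel. f x * fourier (\<lambda>\<xi>. cnj (fourier f \<xi>)) x)"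
    by (rule fourier_swap[symmetric]) (use F f schwartz_integrable in auto)
  also have "\<dots> = of_real ?c * (LINT x|lborel. f x * cnj (f x))"
    unfolding cn by (subst integral_mult_right_zero[symmetric]) (intro Bochner_Integration.integral_cong, auto simp: mult_ac)
  finally have "complex_of_real (LINT \<xi>|lborel. (norm (fourier f \<xi>))\<^sup>2) = of_real (?c * (LINT x|lborel. (norm (f x))\<^sup>2))"
    by (simp only: complex_norm_square[symmetric] integral_complex_of_real of_real_mult)
  then show ?thesis using of_real_eq_iff by blast
qed

section \<open>Square integrable functions\<close>

lemma ennreal_lin:
  "0 \<le> a \<Longrightarrow> 0 \<le> b \<Longrightarrow> 0 \<le> u \<Longrightarrow> 0 \<le> v \<Longrightarrow> ennreal (a * u + b * v) = ennreal a * ennreal u + ennreal b * ennreal v"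
  by (simp add: ennreal_mult ennreal_plus)

text \<open>The bound \<open>M\<close> is kept strictly positive, which makes the triangle inequality a consequence of
  the convexity of the square.\<close>

definition L2_le :: "(real^'n::finite \<Rightarrow> complex) \<Rightarrow> real \<Rightarrow> bool" where
  "L2_le f M \<longleftrightarrow> f \<in> borel_measurable borel \<and> 0 < M \<and>
     (\<integral>\<^sup>+x. ennreal ((norm (f x))\<^sup>2) \<partial>lborel) \<le> ennreal (M\<^sup>2)"

lemma L2_leD:
  assumes "L2_le f M"
  shows "f \<in> borel_measurable borel" "0 < M" "(\<integral>\<^sup>+x. ennreal ((norm (f x))\<^sup>2) \<partial>lborel) \<le> ennreal (M\<^sup>2)"
  using assms by (auto simp: L2_le_def)

lemma L2_le_measurable [measurable_dest]: "L2_le f M \<Longrightarrow> f \<in> borel_measurable borel"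
  by (simp add: L2_le_def)

lemma L2_le_mono:
  assumes "L2_le f M" "g \<in> borel_measurable borel" "\<And>x. norm (g x) \<le> norm (f x)" "M \<le> N"
  shows "L2_le g N"
proof -
  have "(\<integral>\<^sup>+x. ennreal ((norm (g x))\<^sup>2) \<partial>lborel) \<le> (\<integral>\<^sup>+x. ennreal ((norm (f x))\<^sup>2) \<partial>lborel)"
    by (intro nn_integral_mono ennreal_leI power_mono assms) auto
  also have "\<dots> \<le> ennreal (M\<^sup>2)" using assms L2_leD by blast
  also have "\<dots> \<le> ennreal (N\<^sup>2)" using assms L2_leD(2)[OF assms(1)] by (intro ennreal_leI power_mono) auto
  finally show ?thesis using assms L2_leD(2)[OF assms(1)] by (simp add: L2_le_def)
qed

lemma L2_le_cmult:
  assumes "L2_le f M" "norm c \<le> k" "k > 0"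
  shows "L2_le (\<lambda>x. c * f x) (k * M)"
proof -
  have [measurable]: "f \<in> borel_measurable borel" and M: "M > 0" using assms L2_leD by auto
  have "(\<integral>\<^sup>+x. ennreal ((norm (c * f x))\<^sup>2) \<partial>lborel) \<le> (\<integral>\<^sup>+x. ennreal (k\<^sup>2) * ennreal ((norm (f x))\<^sup>2) \<partial>lborel)"
    using assms by (intro nn_integral_mono) (auto simp: norm_mult power_mult_distrib simp flip: ennreal_mult intro!: ennreal_leI mult_right_mono power_mono)
  also have "\<dots> = ennreal (k\<^sup>2) * (\<integral>\<^sup>+x. ennreal ((norm (f x))\<^sup>2) \<partial>lborel)" by (rule nn_integral_cmult) measurable
  also have "\<dots> \<le> ennreal (k\<^sup>2) * ennreal (M\<^sup>2)" by (intro mult_left_mono L2_leD assms) auto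
  finally show ?thesis using assms M by (auto simp: L2_le_def power_mult_distrib ennreal_mult)
qed

lemma L2_le_add:
  assumes "L2_le f A" "L2_le g B"
  shows "L2_le (\<lambda>x. f x + g x) (A + B)"
proof -
  have [measurable]: "f \<in> borel_measurable borel" "g \<in> borel_measurable borel" and A: "A > 0" and B: "B > 0"
    using assms L2_leD by auto
  have conv: "(a + b)\<^sup>2 \<le> (A + B) / A * a\<^sup>2 + (A + B) / B * b\<^sup>2" for a b :: real
  proof -
    have "(A + B) / A * a\<^sup>2 + (A + B) / B * b\<^sup>2 - (a + b)\<^sup>2 = (B * a - A * b)\<^sup>2 / (A * B)"
      using A B by (simp add: field_simps power2_eq_square)
    also have "\<dots> \<ge> 0" using A B by auto
    finally show ?thesis by simp
  qed
  have "(\<integral>\<^sup>+x. ennreal ((norm (f x + g x))\<^sup>2) \<partial>lborel) \<le>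
     (\<integral>\<^sup>+x. ennreal ((A + B) / A) * ennreal ((norm (f x))\<^sup>2) + ennreal ((A + B) / B) * ennreal ((norm (g x))\<^sup>2) \<partial>lborel)"
  proof (rule nn_integral_mono)
    fix x
    have "(norm (f x + g x))\<^sup>2 \<le> (norm (f x) + norm (g x))\<^sup>2" by (intro power_mono norm_triangle_ineq) auto
    also note conv
    finally have "ennreal ((norm (f x + g x))\<^sup>2) \<le> ennreal ((A + B) / A * (norm (f x))\<^sup>2 + (A + B) / B * (norm (g x))\<^sup>2)"
      by (rule ennreal_leI)
    also have "\<dots> = ennreal ((A + B) / A) * ennreal ((norm (f x))\<^sup>2) + ennreal ((A + B) / B) * ennreal ((norm (g x))\<^sup>2)"
      by (rule ennreal_lin) (use A B in auto)
    finally show "ennreal ((norm (f x + g x))\<^sup>2) \<le> \<dots>" .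
  qed
  also have "\<dots> = ennreal ((A + B) / A) * (\<integral>\<^sup>+x. ennreal ((norm (f x))\<^sup>2) \<partial>lborel) + ennreal ((A + B) / B) * (\<integral>\<^sup>+x. ennreal ((norm (g x))\<^sup>2) \<partial>lborel)"
    by (subst nn_integral_add) (auto simp: nn_integral_cmult)
  also have "\<dots> \<le> ennreal ((A + B) / A) * ennreal (A\<^sup>2) + ennreal ((A + B) / B) * ennreal (B\<^sup>2)"
    by (intro add_mono mult_left_mono L2_leD assms) auto
  also have "\<dots> = ennreal ((A + B) / A * A\<^sup>2 + (A + B) / B * B\<^sup>2)"
    by (rule ennreal_lin[symmetric]) (use A B in auto)
  also have "(A + B) / A * A\<^sup>2 + (A + B) / B * B\<^sup>2 = (A + B)\<^sup>2"
    using A B by (simp add: power2_eq_square) algebra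
  finally show ?thesis using A B by (simp add: L2_le_def)
qed

lemma L2_le_iff_square_integrable:
  assumes "square_integrable f" "L2_function_norm f \<le> M" "0 < M"
  shows "L2_le f M"
proof -
  have f: "f \<in> borel_measurable borel" "integrable lborel (\<lambda>x. (norm (f x))\<^sup>2)"
    using assms by (auto simp: square_integrable_def)
  have "(\<integral>\<^sup>+x. ennreal ((norm (f x))\<^sup>2) \<partial>lborel) = ennreal (LINT x|lborel. (norm (f x))\<^sup>2)"
    by (rule nn_integral_eq_integral[OF f(2)]) auto
  also have "(LINT x|lborel. (norm (f x))\<^sup>2) \<le> M\<^sup>2"
    using assms(2) unfolding L2_function_norm_def
    by (metis integral_nonneg_AE AE_I2 real_sqrt_le_iff real_sqrt_abs zero_le_power2 abs_of_pos assms(3))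
  finally show ?thesis using assms f by (simp add: L2_le_def ennreal_leI)
qed

lemma L2_le_square_integrable:
  assumes "L2_le f M"
  shows "square_integrable f" "L2_function_norm f \<le> M"
proof -
  have f [measurable]: "f \<in> borel_measurable borel" and M: "M > 0" using assms L2_leD by auto
  have "(\<integral>\<^sup>+x. ennreal (norm ((norm (f x))\<^sup>2)) \<partial>lborel) \<le> ennreal (M\<^sup>2)" using L2_leD(3)[OF assms] by simp
  also have "\<dots> < \<infinity>" by simp
  finally have i: "integrable lborel (\<lambda>x. (norm (f x))\<^sup>2)" by (simp add: integrable_iff_bounded)
  then show "square_integrable f" by (simp add: square_integrable_def)
  have "ennreal (LINT x|lborel. (norm (f x))\<^sup>2) \<le> ennreal (M\<^sup>2)"
    using nn_integral_eq_integral[OF i] L2_leD(3)[OF assms] by simp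
  then have "(LINT x|lborel. (norm (f x))\<^sup>2) \<le> M\<^sup>2" by simp
  then show "L2_function_norm f \<le> M" unfolding L2_function_norm_def
    using M by (metis abs_of_pos real_sqrt_abs real_sqrt_le_iff)
qed

text \<open>Cauchy--Schwarz, in the form \<open>2 |f g| \<le> |f|^2 / A^2 + |g|^2 / B^2\<close> for normalised functions.\<close>

lemma L2_le_product:
  assumes "L2_le f A" "L2_le g B"
  shows "(\<integral>\<^sup>+x. ennreal (norm (f x * g x)) \<partial>lborel) \<le> ennreal (A * B)"
    and "integrable lborel (\<lambda>x. f x * g x)"
    and "(LINT x|lborel. norm (f x * g x)) \<le> A * B"
    and "norm (LINT x|lborel. f x * g x) \<le> A * B"
proof -
  have [measurable]: "f \<in> borel_measurable borel" "g \<in> borel_measurable borel" and A: "A > 0" and B: "B > 0"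
    using assms L2_leD by auto
  have conv: "a * b \<le> B / (2 * A) * a\<^sup>2 + A / (2 * B) * b\<^sup>2" for a b :: real
  proof -
    have "B / (2 * A) * a\<^sup>2 + A / (2 * B) * b\<^sup>2 - a * b = (B * a - A * b)\<^sup>2 / (2 * A * B)"
      using A B by (simp add: field_simps power2_eq_square)
    also have "\<dots> \<ge> 0" using A B by auto
    finally show ?thesis by simp
  qed
  have "(\<integral>\<^sup>+x. ennreal (norm (f x * g x)) \<partial>lborel) \<le>
     (\<integral>\<^sup>+x. ennreal (B / (2 * A)) * ennreal ((norm (f x))\<^sup>2) + ennreal (A / (2 * B)) * ennreal ((norm (g x))\<^sup>2) \<partial>lborel)"
  proof (rule nn_integral_mono)
    fix x
    have "ennreal (norm (f x * g x)) \<le> ennreal (B / (2 * A) * (norm (f x))\<^sup>2 + A / (2 * B) * (norm (g x))\<^sup>2)"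
      unfolding norm_mult by (intro ennreal_leI conv)
    also have "\<dots> = ennreal (B / (2 * A)) * ennreal ((norm (f x))\<^sup>2) + ennreal (A / (2 * B)) * ennreal ((norm (g x))\<^sup>2)"
      by (rule ennreal_lin) (use A B in auto)
    finally show "ennreal (norm (f x * g x)) \<le> \<dots>" .
  qed
  also have "\<dots> = ennreal (B / (2 * A)) * (\<integral>\<^sup>+x. ennreal ((norm (f x))\<^sup>2) \<partial>lborel) + ennreal (A / (2 * B)) * (\<integral>\<^sup>+x. ennreal ((norm (g x))\<^sup>2) \<partial>lborel)"
    by (subst nn_integral_add) (auto simp: nn_integral_cmult)
  also have "\<dots> \<le> ennreal (B / (2 * A)) * ennreal (A\<^sup>2) + ennreal (A / (2 * B)) * ennreal (B\<^sup>2)"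
    by (intro add_mono mult_left_mono L2_leD assms) auto
  also have "\<dots> = ennreal (B / (2 * A) * A\<^sup>2 + A / (2 * B) * B\<^sup>2)"
    by (rule ennreal_lin[symmetric]) (use A B in auto)
  also have "B / (2 * A) * A\<^sup>2 + A / (2 * B) * B\<^sup>2 = A * B"
    using A B by (simp add: power2_eq_square)
  finally show 1: "(\<integral>\<^sup>+x. ennreal (norm (f x * g x)) \<partial>lborel) \<le> ennreal (A * B)" .
  then have "(\<integral>\<^sup>+x. ennreal (norm (f x * g x)) \<partial>lborel) < \<infinity>" by (rule le_less_trans) simp
  then show 2: "integrable lborel (\<lambda>x. f x * g x)" by (simp add: integrable_iff_bounded)
  have "ennreal (LINT x|lborel. norm (f x * g x)) \<le> ennreal (A * B)"
    using nn_integral_eq_integral[OF integrable_norm[OF 2]] 1 by simp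
  then show 3: "(LINT x|lborel. norm (f x * g x)) \<le> A * B" using A B by simp
  show "norm (LINT x|lborel. f x * g x) \<le> A * B"
    using integral_norm_bound[of lborel "\<lambda>x. f x * g x"] 3 by linarith
qed

lemma L2_le_fatou:
  assumes f: "\<And>k. L2_le (f k) M" and g: "g \<in> borel_measurable borel"
    and lim: "AE x in lborel. (\<lambda>k. f k x) \<longlonglongrightarrow> g x"
  shows "L2_le g M"
proof -
  have [measurable]: "f k \<in> borel_measurable borel" for k using f L2_leD by auto
  have "(\<integral>\<^sup>+x. ennreal ((norm (g x))\<^sup>2) \<partial>lborel) = (\<integral>\<^sup>+x. liminf (\<lambda>k. ennreal ((norm (f k x))\<^sup>2)) \<partial>lborel)"
  proof (rule nn_integral_cong_AE)
    show "AE x in lborel. ennreal ((norm (g x))\<^sup>2) = liminf (\<lambda>k. ennreal ((norm (f k x))\<^sup>2))"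
      using lim
    proof eventually_elim
      case (elim x)
      then have "(\<lambda>k. ennreal ((norm (f k x))\<^sup>2)) \<longlonglongrightarrow> ennreal ((norm (g x))\<^sup>2)"
        by (intro tendsto_ennrealI tendsto_power tendsto_norm)
      then show ?case by (rule lim_imp_Liminf[symmetric, rotated]) simp
    qed
  qed
  also have "\<dots> \<le> liminf (\<lambda>k. \<integral>\<^sup>+x. ennreal ((norm (f k x))\<^sup>2) \<partial>lborel)"
    by (rule nn_integral_liminf) measurable
  also have "\<dots> \<le> limsup (\<lambda>k. \<integral>\<^sup>+x. ennreal ((norm (f k x))\<^sup>2) \<partial>lborel)"
    by (rule Liminf_le_Limsup) simp
  also have "\<dots> \<le> ennreal (M\<^sup>2)"
    by (intro Limsup_bounded always_eventually allI L2_leD f)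
  finally show ?thesis using g L2_leD(2)[OF f] by (simp add: L2_le_def)
qed

text \<open>Completeness.  Where \<open>\<Sum> 2^j |G (Suc j) - G j|^2\<close> is finite, which is almost everywhere, the
  series of increments converges absolutely because \<open>d \<le> 2^(-j) + 2^j d^2\<close>.\<close>

lemma L2_complete:
  fixes G :: "nat \<Rightarrow> real^'n::finite \<Rightarrow> complex"
  assumes Gm: "\<And>j. G j \<in> borel_measurable borel"
    and d: "\<And>j k. j \<le> k \<Longrightarrow> L2_le (\<lambda>x. G k x - G j x) ((1 / 2) ^ j)"
  obtains g where "g \<in> borel_measurable borel" "\<And>j. L2_le (\<lambda>x. g x - G j x) ((1 / 2) ^ j)"
    "AE x in lborel. (\<lambda>k. G k x) \<longlonglongrightarrow> g x"
proof -
  have [measurable]: "G j \<in> borel_measurable borel" for j by (rule Gm)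
  have "(\<integral>\<^sup>+x. (\<Sum>j. ennreal (2 ^ j * (norm (G (Suc j) x - G j x))\<^sup>2)) \<partial>lborel)
      = (\<Sum>j. \<integral>\<^sup>+x. ennreal (2 ^ j * (norm (G (Suc j) x - G j x))\<^sup>2) \<partial>lborel)"
    by (rule nn_integral_suminf) measurable
  also have "\<dots> \<le> (\<Sum>j. ennreal ((1 / 2) ^ j))"
  proof (intro suminf_le summableI)
    fix j
    have "(\<integral>\<^sup>+x. ennreal (2 ^ j * (norm (G (Suc j) x - G j x))\<^sup>2) \<partial>lborel) = ennreal (2 ^ j) * (\<integral>\<^sup>+x. ennreal ((norm (G (Suc j) x - G j x))\<^sup>2) \<partial>lborel)"
      by (subst nn_integral_cmult[symmetric]) (auto simp: ennreal_mult)
    also have "\<dots> \<le> ennreal (2 ^ j) * ennreal (((1 / 2) ^ j)\<^sup>2)"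
      by (intro mult_left_mono L2_leD(3)[OF d]) auto
    also have "\<dots> = ennreal ((1 / 2) ^ j)"
      by (simp add: power2_eq_square power_divide flip: ennreal_mult)
    finally show "(\<integral>\<^sup>+x. ennreal (2 ^ j * (norm (G (Suc j) x - G j x))\<^sup>2) \<partial>lborel) \<le> ennreal ((1 / 2) ^ j)" .
  qed
  also have "\<dots> < \<infinity>"
    unfolding infinity_ennreal_def less_top[symmetric] by (intro ennreal_suminf_neq_top summable_geometric) auto
  finally have fin: "(\<integral>\<^sup>+x. (\<Sum>j. ennreal (2 ^ j * (norm (G (Suc j) x - G j x))\<^sup>2)) \<partial>lborel) \<noteq> \<infinity>"
    by simp
  have "AE x in lborel. (\<Sum>j. ennreal (2 ^ j * (norm (G (Suc j) x - G j x))\<^sup>2)) \<noteq> \<infinity>"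
    by (rule nn_integral_noteq_infinite[OF _ fin]) measurable
  then have conv: "AE x in lborel. convergent (\<lambda>k. G k x)"
  proof eventually_elim
    case (elim x)
    then have "summable (\<lambda>j. 2 ^ j * (norm (G (Suc j) x - G j x))\<^sup>2)"
      by (intro summable_suminf_not_top) auto
    moreover have "summable (\<lambda>j. (1 / 2 :: real) ^ j)" by (rule summable_geometric) simp
    ultimately have s: "summable (\<lambda>j. (1 / 2) ^ j + 2 ^ j * (norm (G (Suc j) x - G j x))\<^sup>2)"
      by (intro summable_add)
    have "summable (\<lambda>j. G (Suc j) x - G j x)"
    proof (rule summable_comparison_test'[OF s])
      fix j :: nat
      define a where "a = norm (G (Suc j) x - G j x)"
      have "0 \<le> (1 - 2 ^ j * a)\<^sup>2 + 1 + (2 ^ j * a)\<^sup>2" by simp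
      then have "2 ^ j * (2 * a) \<le> 2 * (1 + (2 ^ j * a)\<^sup>2)" by (simp add: power2_eq_square algebra_simps)
      then have "2 ^ j * a \<le> 2 ^ j * ((1 / 2) ^ j + 2 ^ j * a\<^sup>2)"
        by (simp add: power2_eq_square algebra_simps power_divide)
      then show "norm (G (Suc j) x - G j x) \<le> (1 / 2) ^ j + 2 ^ j * (norm (G (Suc j) x - G j x))\<^sup>2"
        unfolding a_def[symmetric] by simp
    qed
    then have "convergent (\<lambda>k. \<Sum>j<k. G (Suc j) x - G j x)" by (simp add: summable_iff_convergent)
    moreover have "(\<Sum>j<k. G (Suc j) x - G j x) = G k x - G 0 x" for k by (rule sum_lessThan_telescope)
    ultimately have "convergent (\<lambda>k. G k x - G 0 x)" by simp
    from convergent_add[OF this convergent_const[of "G 0 x"]] show ?case by simp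
  qed
  define g where "g x = lim (\<lambda>k. G k x)" for x
  have gm: "g \<in> borel_measurable borel" unfolding g_def[abs_def]
    by (rule borel_measurable_lim_metric) measurable
  have lim: "AE x in lborel. (\<lambda>k. G k x) \<longlonglongrightarrow> g x"
    using conv by eventually_elim (simp add: g_def convergent_LIMSEQ_iff)
  have "L2_le (\<lambda>x. g x - G j x) ((1 / 2) ^ j)" for j
  proof (rule L2_le_fatou[where f = "\<lambda>k x. G (k + j) x - G j x"])
    show "AE x in lborel. (\<lambda>k. G (k + j) x - G j x) \<longlonglongrightarrow> g x - G j x"
      using lim by eventually_elim (intro tendsto_intros LIMSEQ_ignore_initial_segment)
  qed (use d gm in auto)
  then show thesis using that gm lim by blast
qed

text \<open>Testing \<open>a\<close> against \<open>cnj a\<close> times a large cutoff recovers its norm.\<close>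

lemma L2_le_by_duality:
  fixes a :: "real^'n::finite \<Rightarrow> complex"
  assumes a: "smooth a" and M: "M > 0"
    and dual: "\<And>h N. test_function h \<Longrightarrow> L2_le h N \<Longrightarrow> norm (LINT x|lborel. a x * h x) \<le> M * N"
  shows "L2_le a M"
proof -
  have [measurable]: "a \<in> borel_measurable borel" by (rule smooth_measurable[OF a])
  define c where "c k x = plateau ((1 / real (Suc k)) *\<^sub>R x + 0)" for k and x :: "real^'n"
  have tc: "test_function (c k)" for k
    unfolding c_def by (rule test_function_affine[OF test_function_plateau]) simp
  have [measurable]: "c k \<in> borel_measurable borel" for k
    by (rule smooth_measurable[OF test_function_smooth[OF tc]])
  have c01: "0 \<le> Re (c k x)" "Re (c k x) \<le> 1" and cr: "c k x = of_real (Re (c k x))" for k x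
    unfolding c_def using plateau_range plateau_real by auto
  have nc: "norm (c k x) = Re (c k x)" for k x
    by (subst cr) (simp add: c01)
  have b: "L2_le (\<lambda>x. c k x * a x) M" for k
  proof -
    define h where "h x = c k x * cnj (a x)" for x
    have th: "test_function h" unfolding h_def by (intro test_function_mult_smooth tc smooth_cnj a)
    have [measurable]: "h \<in> borel_measurable borel" by (rule smooth_measurable[OF test_function_smooth[OF th]])
    have nh: "norm (h x) = norm (c k x * a x)" for x by (simp add: h_def norm_mult)
    define I where "I = (\<integral>\<^sup>+x. ennreal ((norm (h x))\<^sup>2) \<partial>lborel)"
    have "test_function (\<lambda>x. h x * cnj (h x))"
      by (intro test_function_mult_smooth th smooth_cnj test_function_smooth)
    then have "integrable lborel (\<lambda>x. h x * cnj (h x))" by (intro schwartz_integrable test_function_schwartz)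
    then have hi: "integrable lborel (\<lambda>x. (norm (h x))\<^sup>2)"
      using integrable_norm by (fastforce simp: norm_mult power2_eq_square)
    define N where "N = sqrt (LINT x|lborel. (norm (h x))\<^sup>2)"
    have N0: "N \<ge> 0" and N2: "N\<^sup>2 = (LINT x|lborel. (norm (h x))\<^sup>2)" by (auto simp: N_def)
    have I: "I = ennreal (N\<^sup>2)" unfolding I_def N2 by (rule nn_integral_eq_integral[OF hi]) auto
    have "N \<le> M"
    proof (cases "N = 0")
      case False
      then have N: "N > 0" using N0 by simp
      have "L2_le h N" using N I by (simp add: L2_le_def I_def)
      from dual[OF th this] have le: "norm (LINT x|lborel. a x * h x) \<le> M * N" .
      have ah: "a x * h x = of_real (Re (c k x) * (norm (a x))\<^sup>2)" for x
        by (simp only: of_real_mult cr[symmetric] complex_norm_square h_def mult_ac)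
      have ti: "integrable lborel (\<lambda>x. a x * h x)"
        by (intro schwartz_integrable test_function_schwartz) (simp add: mult.commute[of "a _"] test_function_mult_smooth[OF th a])
      then have ri: "integrable lborel (\<lambda>x. Re (c k x) * (norm (a x))\<^sup>2)"
        using integrable_Re unfolding ah by fastforce
      have "N\<^sup>2 \<le> (LINT x|lborel. Re (c k x) * (norm (a x))\<^sup>2)"
        unfolding N2
      proof (rule integral_mono[OF hi ri])
        fix x
        have "(Re (c k x))\<^sup>2 \<le> Re (c k x)"
          using c01[of k x] by (simp add: power2_eq_square mult_left_le)
        then show "(norm (h x))\<^sup>2 \<le> Re (c k x) * (norm (a x))\<^sup>2"
          unfolding nh norm_mult nc power_mult_distrib by (rule mult_right_mono) simp
      qed
      also have "\<dots> = Re (LINT x|lborel. a x * h x)" unfolding ah by (simp only: integral_complex_of_real Re_complex_of_real)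
      also have "\<dots> \<le> norm (LINT x|lborel. a x * h x)" by (rule complex_Re_le_cmod)
      also note le
      finally show ?thesis using N by (simp add: power2_eq_square)
    qed (use M in simp)
    then have "I \<le> ennreal (M\<^sup>2)" unfolding I using N0 by (intro ennreal_leI power_mono)
    then show ?thesis using M by (simp add: L2_le_def I_def nh)
  qed
  show ?thesis
  proof (rule L2_le_fatou[OF b])
    have "(\<lambda>k. c k x * a x) \<longlonglongrightarrow> a x" for x
    proof (rule tendsto_eventually)
      obtain k0 :: nat where "norm x \<le> real k0" using real_arch_simple by blast
      then have "c k x = 1" if "k \<ge> k0" for k
        unfolding c_def using that by (intro plateau_1) (auto simp: divide_simps)
      then show "\<forall>\<^sub>F k in sequentially. c k x * a x = a x"
        by (intro eventually_mono[OF eventually_ge_at_top[of k0]]) simp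
    qed
    then show "AE x in lborel. (\<lambda>k. c k x * a x) \<longlonglongrightarrow> a x" by simp
  qed measurable
qed

section \<open>The Fourier transform of a square integrable function\<close>

lemma L2_le_schwartz_fourier:
  fixes h :: "real^'n::finite \<Rightarrow> complex"
  assumes h: "schwartz h" "L2_le h N"
  shows "L2_le (fourier h) (sqrt ((2 * pi) ^ CARD('n)) * N)"
proof (rule L2_le_iff_square_integrable)
  have N: "N > 0" using h L2_leD by auto
  show "0 < sqrt ((2 * pi) ^ CARD('n)) * N" using N by simp
  obtain B where B: "B \<ge> 0" "\<And>x. norm (fourier h x) \<le> B" using schwartz_bounded[OF schwartz_fourier[OF h(1)]] by blast
  have Fi: "integrable lborel (fourier h)" by (intro schwartz_integrable schwartz_fourier h)
  then have [measurable]: "fourier h \<in> borel_measurable borel" by auto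
  have "integrable lborel (\<lambda>x. (norm (fourier h x))\<^sup>2)"
  proof (rule Bochner_Integration.integrable_bound[where f = "\<lambda>x. B * norm (fourier h x)"])
    show "AE x in lborel. norm ((norm (fourier h x))\<^sup>2) \<le> norm (B * norm (fourier h x))"
      using B by (auto simp: power2_eq_square intro!: mult_right_mono)
  qed (use Fi in auto)
  then show "square_integrable (fourier h)" by (simp add: square_integrable_def)
  have "(LINT x|lborel. (norm (h x))\<^sup>2) \<le> N\<^sup>2"
    using L2_le_square_integrable(2)[OF h(2)] N unfolding L2_function_norm_def
    by (metis abs_of_pos real_sqrt_abs real_sqrt_le_iff)
  then show "L2_function_norm (fourier h) \<le> sqrt ((2 * pi) ^ CARD('n)) * N"
    using N unfolding L2_function_norm_def plancherel_schwartz[OF h(1)] real_sqrt_mult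
    by (intro mult_left_mono real_le_lsqrt) auto
qed

lemma rapid_cutoff:
  fixes g :: "real^'n::finite \<Rightarrow> complex"
  assumes g: "L2_le g M"
  shows "rapid (\<lambda>x. indicator (ball 0 R) x * g x :: complex)"
  unfolding rapid_def
proof (intro conjI allI)
  have gm: "g \<in> borel_measurable borel" using g by auto
  show "(\<lambda>x. indicator (ball 0 R) x * g x) \<in> borel_measurable borel"
    by (intro borel_measurable_times borel_measurable_indicator gm) auto
  fix k
  let ?b = "\<lambda>x::real^'n. indicator (ball 0 R) x :: complex"
  have "(\<integral>\<^sup>+x. ennreal ((norm (?b x))\<^sup>2) \<partial>lborel) = (\<integral>\<^sup>+x. indicator (ball 0 R) x \<partial>(lborel :: (real^'n) measure))"
    by (intro nn_integral_cong) (auto simp: indicator_def)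
  also have "\<dots> = emeasure lborel (ball (0::real^'n) R)" by simp
  also have "\<dots> < \<infinity>" by (intro emeasure_lborel_ball_finite)
  finally obtain V where V: "V \<ge> 0" "(\<integral>\<^sup>+x. ennreal ((norm (?b x))\<^sup>2) \<partial>lborel) = ennreal V"
    by (cases "\<integral>\<^sup>+x. ennreal ((norm (?b x))\<^sup>2) \<partial>lborel") auto
  have "V \<le> (V + 1)\<^sup>2" using V by (simp add: power2_eq_square algebra_simps)
  moreover have "?b \<in> borel_measurable borel" by (intro borel_measurable_indicator) auto
  ultimately have "L2_le ?b (V + 1)" using V by (auto simp: L2_le_def ennreal_leI)
  then have i: "integrable lborel (\<lambda>x. ?b x * g x)" using L2_le_product(2) g by blast
  show "integrable lborel (\<lambda>x. (1 + norm x) ^ k *\<^sub>R (indicator (ball 0 R) x * g x :: complex))"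
  proof (rule Bochner_Integration.integrable_bound[where f = "\<lambda>x. (1 + \<bar>R\<bar>) ^ k *\<^sub>R (?b x * g x)"])
    show "AE x in lborel. norm ((1 + norm x) ^ k *\<^sub>R (?b x * g x)) \<le> norm ((1 + \<bar>R\<bar>) ^ k *\<^sub>R (?b x * g x))"
    proof (intro AE_I2)
      fix x :: "real^'n"
      show "norm ((1 + norm x) ^ k *\<^sub>R (?b x * g x)) \<le> norm ((1 + \<bar>R\<bar>) ^ k *\<^sub>R (?b x * g x))"
        by (cases "x \<in> ball 0 R") (auto intro!: mult_right_mono power_mono)
    qed
  qed (use i in auto)
qed

lemma schwartz_square_integrable:
  fixes f :: "real^'n::finite \<Rightarrow> complex"
  assumes sf: "schwartz f"
  shows "square_integrable f"
proof -
  have [measurable]: "f \<in> borel_measurable borel" using sf by auto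
  obtain B where B: "B \<ge> 0" "\<And>x. norm (f x) \<le> B" using schwartz_bounded[OF sf] by blast
  have "integrable lborel (\<lambda>x. (norm (f x))\<^sup>2)"
  proof (rule Bochner_Integration.integrable_bound[where f = "\<lambda>x. B * norm (f x)"])
    show "AE x in lborel. norm ((norm (f x))\<^sup>2) \<le> norm (B * norm (f x))"
      using B by (auto simp: power2_eq_square intro!: mult_right_mono)
  qed (use schwartz_integrable[OF sf] in auto)
  then show ?thesis by (simp add: square_integrable_def)
qed

text \<open>The \<open>L\<^sup>2\<close> transform is the limit of the transforms of the truncations of \<open>g\<close> to balls; these
  transforms are smooth, so that their distances can be estimated by duality.\<close>

theorem L2_fourier:
  fixes g :: "real^'n::finite \<Rightarrow> complex"
  assumes g: "L2_le g M"
  obtains G where "L2_le G (sqrt ((2 * pi) ^ CARD('n)) * M)"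
    "\<And>h. schwartz h \<Longrightarrow> (LINT x|lborel. g x * fourier h x) = (LINT x|lborel. G x * h x)"
proof -
  define c where "c = sqrt ((2 * pi) ^ CARD('n))"
  have c: "c > 0" by (simp add: c_def)
  have gm [measurable]: "g \<in> borel_measurable borel" and M: "M > 0" using g L2_leD by auto
  define t where "t k x = indicator (ball 0 (real k)) x * g x" for k x
  have tm [measurable]: "t k \<in> borel_measurable borel" for k
    unfolding t_def by (intro borel_measurable_times borel_measurable_indicator gm) auto
  have tr: "rapid (t k)" for k unfolding t_def by (rule rapid_cutoff[OF g])
  have tg: "(\<lambda>k. t k x) \<longlonglongrightarrow> g x" for x
  proof (rule tendsto_eventually)
    obtain k0 :: nat where "norm x < real k0" using reals_Archimedean2 by blast
    then have "t k x = g x" if "k \<ge> k0" for k using that by (auto simp: t_def)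
    then show "\<forall>\<^sub>F k in sequentially. t k x = g x"
      by (intro eventually_mono[OF eventually_ge_at_top[of k0]]) simp
  qed
  have gi: "integrable lborel (\<lambda>x. (norm (g x))\<^sup>2)" using L2_le_square_integrable(1)[OF g] by (simp add: square_integrable_def)
  have "(\<lambda>k. LINT x|lborel. (norm (g x - t k x))\<^sup>2) \<longlonglongrightarrow> (LINT x::real^'n|lborel. 0)"
  proof (rule integral_dominated_convergence[where w = "\<lambda>x. (norm (g x))\<^sup>2"])
    show "AE x in lborel. (\<lambda>k. (norm (g x - t k x))\<^sup>2) \<longlonglongrightarrow> 0"
      by (intro AE_I2) (use tg in \<open>auto intro!: tendsto_eq_intros\<close>)
    show "AE x in lborel. norm ((norm (g x - t k x))\<^sup>2) \<le> (norm (g x))\<^sup>2" for k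
      by (intro AE_I2) (auto simp: t_def indicator_def)
  qed (use gi in auto)
  then have lim0: "(\<lambda>k. LINT x|lborel. (norm (g x - t k x))\<^sup>2) \<longlonglongrightarrow> 0" by simp
  have "\<exists>k. \<forall>l\<ge>k. (LINT x|lborel. (norm (g x - t l x))\<^sup>2) < ((1 / 2) ^ j / (2 * c))\<^sup>2" for j
  proof -
    have "0 < ((1 / 2) ^ j / (2 * c))\<^sup>2" using c by simp
    from order_tendstoD(2)[OF lim0 this] show ?thesis by (simp only: eventually_sequentially)
  qed
  then have "\<forall>j. \<exists>k. \<forall>l\<ge>k. (LINT x|lborel. (norm (g x - t l x))\<^sup>2) < ((1 / 2) ^ j / (2 * c))\<^sup>2" by blast
  from choice[OF this] obtain K where K: "\<And>j l. l \<ge> K j \<Longrightarrow> (LINT x|lborel. (norm (g x - t l x))\<^sup>2) < ((1 / 2) ^ j / (2 * c))\<^sup>2"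
    by blast
  \<comment> \<open>A monotone choice of radii, so that each tail bound holds from its index on.\<close>
  define N where "N j = (\<Sum>i\<le>j. K i)" for j
  have NK: "N j \<ge> K j" for j unfolding N_def by (intro member_le_sum) auto
  have Nmono: "N j \<le> N k" if "j \<le> k" for j k unfolding N_def using that by (intro sum_mono2) auto
  have tail: "L2_le (\<lambda>x. g x - t (N k) x) ((1 / 2) ^ j / (2 * c))" if "j \<le> k" for j k
  proof (rule L2_le_iff_square_integrable)
    have "integrable lborel (\<lambda>x. (norm (g x - t (N k) x))\<^sup>2)"
      by (rule Bochner_Integration.integrable_bound[OF gi]) (auto simp: t_def indicator_def)
    then show "square_integrable (\<lambda>x. g x - t (N k) x)" by (simp add: square_integrable_def)
    have "N k \<ge> K j" using NK[of j] Nmono[OF that] by linarith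
    from K[OF this] show "L2_function_norm (\<lambda>x. g x - t (N k) x) \<le> (1 / 2) ^ j / (2 * c)"
      unfolding L2_function_norm_def using c by (intro real_le_lsqrt) auto
  qed (use c in auto)
  define G where "G j = fourier (t (N j))" for j
  have Gs: "smooth (G j)" for j unfolding G_def by (rule smooth_fourier[OF tr])
  have swap: "(LINT x|lborel. G j x * h x) = (LINT x|lborel. t (N j) x * fourier h x)" if "schwartz h" for j h
    unfolding G_def by (rule fourier_swap[symmetric]) (use that tr rapid_integrable schwartz_integrable in auto)
  have Gi: "integrable lborel (\<lambda>x. G j x * h x)" if "schwartz h" for j h
  proof -
    define B where "B = (LINT x|lborel. norm (t (N j) x))"
    have B: "norm (G j x) \<le> B" for x
      unfolding G_def B_def by (rule fourier_bound[OF rapid_integrable[OF tr]])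
    have [measurable]: "G j \<in> borel_measurable borel" "h \<in> borel_measurable borel"
      using that smooth_measurable[OF Gs] by auto
    have "norm (G j x * h x) \<le> norm (B *\<^sub>R h x)" for x
      unfolding norm_mult norm_scaleR by (rule mult_right_mono) (use B[of x] in auto)
    then show ?thesis
      by (intro Bochner_Integration.integrable_bound[OF integrable_scaleR_right[OF schwartz_integrable[OF that], of B]]) auto
  qed
  have diff: "L2_le (\<lambda>x. G k x - G j x) ((1 / 2) ^ j)" if "j \<le> k" for j k
  proof (rule L2_le_by_duality)
    show "smooth (\<lambda>x. G k x - G j x)" by (intro smooth_diff Gs)
    fix h :: "real^'n \<Rightarrow> complex" and Q assume h: "test_function h" and hQ: "L2_le h Q"
    have hs: "schwartz h" by (rule test_function_schwartz[OF h])
    have Q: "Q > 0" using hQ L2_leD by auto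
    have Fh: "L2_le (fourier h) (c * Q)" unfolding c_def by (rule L2_le_schwartz_fourier[OF hs hQ])
    have "L2_le (\<lambda>x. (g x - t (N j) x) + (-1) * (g x - t (N k) x)) ((1 / 2) ^ j / (2 * c) + 1 * ((1 / 2) ^ j / (2 * c)))"
      by (intro L2_le_add L2_le_cmult tail that order_refl) auto
    then have td: "L2_le (\<lambda>x. t (N k) x - t (N j) x) ((1 / 2) ^ j / c)"
      using c by (simp add: field_simps)
    have "(LINT x|lborel. (G k x - G j x) * h x) = (LINT x|lborel. G k x * h x) - (LINT x|lborel. G j x * h x)"
      unfolding left_diff_distrib by (rule Bochner_Integration.integral_diff[OF Gi Gi]) (rule hs)+
    also have "\<dots> = (LINT x|lborel. t (N k) x * fourier h x) - (LINT x|lborel. t (N j) x * fourier h x)"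
      by (simp only: swap[OF hs])
    also have "\<dots> = (LINT x|lborel. (t (N k) x - t (N j) x) * fourier h x)"
    proof -
      have "L2_le (t i) (1 * M)" for i
        by (rule L2_le_mono[OF g]) (auto simp: t_def indicator_def)
      then show ?thesis
        unfolding left_diff_distrib using L2_le_product(2)[OF _ Fh]
        by (intro Bochner_Integration.integral_diff[symmetric]) auto
    qed
    also have "norm \<dots> \<le> (1 / 2) ^ j / c * (c * Q)" by (rule L2_le_product(4)[OF td Fh])
    finally show "norm (LINT x|lborel. (G k x - G j x) * h x) \<le> (1 / 2) ^ j * Q" using c by simp
  qed simp
  obtain H where H: "H \<in> borel_measurable borel" "\<And>j. L2_le (\<lambda>x. H x - G j x) ((1 / 2) ^ j)"
      "AE x in lborel. (\<lambda>k. G k x) \<longlonglongrightarrow> H x"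
    using L2_complete[OF smooth_measurable[OF Gs] diff] by blast
  have GM: "L2_le (G j) (c * M)" for j
  proof (rule L2_le_by_duality[OF Gs])
    fix h :: "real^'n \<Rightarrow> complex" and Q assume h: "test_function h" and hQ: "L2_le h Q"
    have hs: "schwartz h" by (rule test_function_schwartz[OF h])
    have Fh: "L2_le (fourier h) (c * Q)" unfolding c_def by (rule L2_le_schwartz_fourier[OF hs hQ])
    have "L2_le (t (N j)) M"
      by (rule L2_le_mono[OF g]) (auto simp: t_def indicator_def)
    from L2_le_product(4)[OF this Fh] show "norm (LINT x|lborel. G j x * h x) \<le> c * M * Q"
      unfolding swap[OF hs] by (simp only: mult_ac)
  qed (use c M in auto)
  have HM: "L2_le H (c * M)" by (rule L2_le_fatou[OF GM H(1,3)])
  show thesis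
  proof (rule that[OF HM[unfolded c_def]])
    fix h :: "real^'n \<Rightarrow> complex" assume h: "schwartz h"
    have half: "(\<lambda>j. (1 / 2 :: real) ^ j) \<longlonglongrightarrow> 0" by (rule LIMSEQ_power_zero) simp
    define Q where "Q = L2_function_norm h + L2_function_norm (fourier h) + 1"
    have nn: "L2_function_norm f \<ge> 0" for f :: "real^'n \<Rightarrow> complex" by (simp add: L2_function_norm_def)
    have hQ: "L2_le h Q" and FQ: "L2_le (fourier h) Q"
      using nn[of h] nn[of "fourier h"]
      by (auto intro!: L2_le_iff_square_integrable schwartz_square_integrable h schwartz_fourier simp: Q_def)
    have "(\<lambda>j. (LINT x|lborel. G j x * h x) - (LINT x|lborel. H x * h x)) \<longlonglongrightarrow> 0"
    proof (rule Lim_null_comparison)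
      have "norm ((LINT x|lborel. G j x * h x) - (LINT x|lborel. H x * h x)) \<le> (1 / 2) ^ j * Q" for j
      proof -
        have "(LINT x|lborel. (H x - G j x) * h x) = (LINT x|lborel. H x * h x) - (LINT x|lborel. G j x * h x)"
          unfolding left_diff_distrib
          by (rule Bochner_Integration.integral_diff[OF L2_le_product(2)[OF HM hQ] Gi[OF h]])
        then show ?thesis using L2_le_product(4)[OF H(2) hQ, of j] by (simp add: norm_minus_commute)
      qed
      then show "\<forall>\<^sub>F j in sequentially. norm ((LINT x|lborel. G j x * h x) - (LINT x|lborel. H x * h x)) \<le> (1 / 2) ^ j * Q" by simp
      show "(\<lambda>j. (1 / 2) ^ j * Q) \<longlonglongrightarrow> 0" using tendsto_mult_left_zero[OF half] .
    qed
    then have "(\<lambda>j. LINT x|lborel. G j x * h x) \<longlonglongrightarrow> (LINT x|lborel. H x * h x)" by (rule LIM_zero_cancel)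
    moreover have "(\<lambda>j. (LINT x|lborel. G j x * h x) - (LINT x|lborel. g x * fourier h x)) \<longlonglongrightarrow> 0"
    proof (rule Lim_null_comparison)
      have "norm ((LINT x|lborel. G j x * h x) - (LINT x|lborel. g x * fourier h x)) \<le> (1 / 2) ^ j / (2 * c) * Q" for j
      proof -
        have "L2_le (t (N j)) M" by (rule L2_le_mono[OF g]) (auto simp: t_def indicator_def)
        then have "(LINT x|lborel. (g x - t (N j) x) * fourier h x) = (LINT x|lborel. g x * fourier h x) - (LINT x|lborel. t (N j) x * fourier h x)"
          unfolding left_diff_distrib
          by (intro Bochner_Integration.integral_diff L2_le_product(2)[OF g FQ] L2_le_product(2)[OF _ FQ])
        then show ?thesis using L2_le_product(4)[OF tail[OF order_refl] FQ, of j] by (simp add: norm_minus_commute swap[OF h])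
      qed
      then show "\<forall>\<^sub>F j in sequentially. norm ((LINT x|lborel. G j x * h x) - (LINT x|lborel. g x * fourier h x)) \<le> (1 / 2) ^ j / (2 * c) * Q" by simp
      show "(\<lambda>j. (1 / 2) ^ j / (2 * c) * Q) \<longlonglongrightarrow> 0"
        using tendsto_mult_left_zero[OF tendsto_divide_zero[OF half]] .
    qed
    then have "(\<lambda>j. LINT x|lborel. G j x * h x) \<longlonglongrightarrow> (LINT x|lborel. g x * fourier h x)" by (rule LIM_zero_cancel)
    ultimately show "(LINT x|lborel. g x * fourier h x) = (LINT x|lborel. H x * h x)" using LIMSEQ_unique by blast
  qed
qed

section \<open>Sobolev functions of bounded support\<close>

definition Cc :: "(real^'n::finite \<Rightarrow> complex) \<Rightarrow> bool" where
  "Cc f \<longleftrightarrow> continuous_on UNIV f \<and> (\<exists>R. \<forall>x. norm x > R \<longrightarrow> f x = 0)"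

lemma Cc_measurable [measurable_dest]: "Cc f \<Longrightarrow> f \<in> borel_measurable borel"
  by (simp add: Cc_def borel_measurable_continuous_onI)

lemma Cc_bounded:
  assumes "Cc f"
  obtains B where "B > 0" "\<And>x. norm (f x) \<le> B"
proof -
  obtain R where R: "\<And>x. norm x > R \<Longrightarrow> f x = 0" using assms by (auto simp: Cc_def)
  have "bounded (f ` cball 0 R)"
    using assms by (intro compact_imp_bounded compact_continuous_image) (auto simp: Cc_def intro: continuous_on_subset)
  then obtain B where B: "B > 0" "\<And>x. x \<in> cball 0 R \<Longrightarrow> norm (f x) \<le> B" unfolding bounded_pos by auto
  have "norm (f x) \<le> B" for x using B R[of x] by (cases "norm x > R") auto
  then show ?thesis using that B(1) by blast
qed

lemma Cc_rapid:
  fixes f :: "real^'n::finite \<Rightarrow> complex"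
  assumes f: "Cc f"
  shows "rapid f"
  unfolding rapid_def
proof (intro conjI allI)
  show [measurable]: "f \<in> borel_measurable borel" using f by auto
  fix k
  obtain R where R: "\<And>x. norm x > R \<Longrightarrow> f x = 0" using f by (auto simp: Cc_def)
  obtain B where B: "B > 0" "\<And>x. norm (f x) \<le> B" using Cc_bounded[OF f] by blast
  show "integrable lborel (\<lambda>x. (1 + norm x) ^ k *\<^sub>R f x)"
  proof (rule integrable_decay)
    fix x :: "real^'n"
    show "(1 + norm x) ^ (CARD('n) + 1) * norm ((1 + norm x) ^ k *\<^sub>R f x) \<le> (1 + \<bar>R\<bar>) ^ (CARD('n) + 1) * ((1 + \<bar>R\<bar>) ^ k * B)"
    proof (cases "norm x > R")
      case False
      then show ?thesis using B by (auto intro!: mult_mono power_mono simp del: power_Suc)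
    qed (use R B in \<open>auto simp del: power_Suc\<close>)
  qed measurable
qed

lemma Cc_integrable: "Cc f \<Longrightarrow> integrable lborel f"
  by (simp add: Cc_rapid rapid_integrable)

lemma Cc_mult:
  assumes "continuous_on UNIV g" "Cc f"
  shows "Cc (\<lambda>x. g x * f x)"
  using assms unfolding Cc_def by (auto intro!: continuous_intros)

lemma Cc_add:
  assumes "Cc f" "Cc g"
  shows "Cc (\<lambda>x. f x + g x)"
proof -
  obtain R S where "\<And>x. norm x > R \<Longrightarrow> f x = 0" "\<And>x. norm x > S \<Longrightarrow> g x = 0" using assms unfolding Cc_def by blast
  then have "\<forall>x. norm x > max R S \<longrightarrow> f x + g x = 0" by auto
  moreover have "continuous_on UNIV (\<lambda>x. f x + g x)" using assms unfolding Cc_def by (intro continuous_intros) auto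
  ultimately show ?thesis unfolding Cc_def by blast
qed

lemma Cc_affine:
  assumes f: "Cc f" and c: "c \<noteq> 0"
  shows "Cc (\<lambda>x. f (c *\<^sub>R x + b))"
proof -
  obtain R where R: "\<And>x. norm x > R \<Longrightarrow> f x = 0" using f unfolding Cc_def by blast
  have "f (c *\<^sub>R x + b) = 0" if "norm x > (R + norm b) / \<bar>c\<bar>" for x
  proof (rule R)
    have "\<bar>c\<bar> * norm x > R + norm b" using that c by (simp add: field_simps)
    then show "norm (c *\<^sub>R x + b) > R" using norm_triangle_ineq2[of "c *\<^sub>R x" "-b"] by simp
  qed
  moreover have "continuous_on UNIV (\<lambda>x. f (c *\<^sub>R x + b))"
    using f unfolding Cc_def by (auto intro!: continuous_intros continuous_on_compose2[of UNIV f])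
  ultimately show ?thesis unfolding Cc_def by blast
qed

lemma test_function_Cc: "test_function f \<Longrightarrow> Cc f"
  by (auto simp: Cc_def test_function_iff smooth_continuous_on)

text \<open>\<open>M\<close> bounds \<open>(2 \<pi>)^(n/2)\<close> times the Sobolev norm of order \<open>s\<close>.  Only localised functions occur, and
  bounded support makes the Fourier integral converge absolutely.\<close>

definition hs :: "real \<Rightarrow> (real^'n::finite \<Rightarrow> complex) \<Rightarrow> real \<Rightarrow> bool" where
  "hs s f M \<longleftrightarrow> Cc f \<and> L2_le (\<lambda>\<xi>. of_real (wt s \<xi>) * fourier f \<xi>) M"

lemma hsD:
  assumes "hs s f M"
  shows "Cc f" "M > 0" "L2_le (\<lambda>\<xi>. of_real (wt s \<xi>) * fourier f \<xi>) M"
  using assms L2_leD by (auto simp: hs_def)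

lemma fourier_Cc_measurable [measurable]: "Cc f \<Longrightarrow> fourier f \<in> borel_measurable borel"
  by (simp add: fourier_measurable Cc_integrable)

lemma hs_mono:
  assumes f: "hs s f M" and "t \<le> s" "M \<le> N"
  shows "hs t f N"
proof -
  have [measurable]: "fourier f \<in> borel_measurable borel" using hsD(1)[OF f] by measurable
  have "L2_le (\<lambda>\<xi>. of_real (wt t \<xi>) * fourier f \<xi>) N"
    by (rule L2_le_mono[OF hsD(3)[OF f]])
      (use assms in \<open>auto simp: norm_mult intro!: mult_right_mono wt_mono\<close>)
  then show ?thesis using hsD(1)[OF f] by (simp add: hs_def)
qed

lemma fourier_add:
  assumes "integrable lborel f" "integrable lborel g"
  shows "fourier (\<lambda>x. f x + g x) \<xi> = fourier f \<xi> + fourier g \<xi>"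
  unfolding fourier_def distrib_left
  by (rule Bochner_Integration.integral_add) (intro fourier_integrand assms)+

lemma fourier_cmult: "fourier (\<lambda>x. c * f x) \<xi> = c * fourier f \<xi>"
  unfolding fourier_def mult.left_commute[of _ c] by (rule integral_mult_right_zero)

lemma hs_add:
  assumes "hs s f A" "hs s g B"
  shows "hs s (\<lambda>x. f x + g x) (A + B)"
proof -
  have "L2_le (\<lambda>\<xi>. of_real (wt s \<xi>) * fourier f \<xi> + of_real (wt s \<xi>) * fourier g \<xi>) (A + B)"
    by (rule L2_le_add[OF hsD(3)[OF assms(1)] hsD(3)[OF assms(2)]])
  then show ?thesis
    using assms by (simp add: hs_def Cc_add fourier_add Cc_integrable distrib_left)
qed

lemma hs_cmult:
  assumes f: "hs s f A" and k: "norm c \<le> k" "k > 0"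
  shows "hs s (\<lambda>x. c * f x) (k * A)"
proof -
  have "L2_le (\<lambda>\<xi>. c * (of_real (wt s \<xi>) * fourier f \<xi>)) (k * A)"
    by (rule L2_le_cmult[OF hsD(3)[OF f] k])
  then show ?thesis
    using hsD(1)[OF f] by (auto simp: hs_def fourier_cmult Cc_mult mult_ac)
qed

lemma hs_diff:
  assumes "hs s f A" "hs s g B"
  shows "hs s (\<lambda>x. f x - g x) (A + B)"
  using hs_add[OF assms(1) hs_cmult[OF assms(2), of "-1" 1]] by simp

lemma hs_sum_atMost:
  fixes L :: nat
  assumes "\<And>l. hs s (f l) (M l)"
  shows "hs s (\<lambda>x. \<Sum>l\<le>L. f l x) (\<Sum>l\<le>L. M l)"
proof (induction L)
  case (Suc L)
  then show ?case using hs_add[OF Suc assms[of "Suc L"]] by simp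
qed (simp add: assms)

text \<open>The balls of the norm are closed under bounded pointwise convergence, by Fatou's lemma on the
  Fourier side.  All infinite sums and integrals of Sobolev functions below are controlled by it.\<close>

lemma hs_limit:
  fixes f :: "nat \<Rightarrow> real^'n::finite \<Rightarrow> complex"
  assumes f: "\<And>k. hs s (f k) M" and R: "\<And>k x. norm x > R \<Longrightarrow> f k x = 0"
    and B: "\<And>k x. norm (f k x) \<le> B" and lim: "\<And>x. (\<lambda>k. f k x) \<longlonglongrightarrow> g x"
    and g: "continuous_on UNIV g"
  shows "hs s g M"
proof -
  have gR: "g x = 0" if "norm x > R" for x
    using lim[of x] R[OF that] by (simp add: LIMSEQ_const_iff)
  have Cg: "Cc g" using g gR by (auto simp: Cc_def)
  have [measurable]: "f k \<in> borel_measurable borel" "g \<in> borel_measurable borel" for k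
    using hsD(1)[OF f] Cg by auto
  have [measurable]: "fourier g \<in> borel_measurable borel" using Cg by measurable
  have "(\<lambda>k. fourier (f k) \<xi>) \<longlonglongrightarrow> fourier g \<xi>" for \<xi>
    unfolding fourier_def
  proof (rule integral_dominated_convergence[where w = "\<lambda>x. B * indicator (cball 0 R) x"])
    show "integrable lborel (\<lambda>x::real^'n. B * indicator (cball 0 R) x)"
      by (intro integrable_mult_right integrable_real_indicator emeasure_lborel_cball_finite) auto
    show "AE x in lborel. (\<lambda>k. cis (- (x \<bullet> \<xi>)) * f k x) \<longlonglongrightarrow> cis (- (x \<bullet> \<xi>)) * g x"
      by (intro AE_I2 tendsto_intros lim)
    have "norm (f k x) \<le> B * indicator (cball 0 R) x" for k x
      using B[of k x] R[of x k] by (auto simp: indicator_def not_le)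
    then show "AE x in lborel. norm (cis (- (x \<bullet> \<xi>)) * f k x) \<le> B * indicator (cball 0 R) x" for k
      by (simp add: norm_mult)
  qed measurable
  then have "AE \<xi> in lborel. (\<lambda>k. of_real (wt s \<xi>) * fourier (f k) \<xi>) \<longlonglongrightarrow> of_real (wt s \<xi>) * fourier g \<xi>"
    by (intro AE_I2 tendsto_intros)
  then have "L2_le (\<lambda>\<xi>. of_real (wt s \<xi>) * fourier g \<xi>) M"
    by (intro L2_le_fatou[OF hsD(3)[OF f]]) measurable
  then show ?thesis using Cg by (simp add: hs_def)
qed

lemma ex_L2_le: "square_integrable f \<Longrightarrow> \<exists>M. L2_le f M"
  by (rule exI[of _ "L2_function_norm f + 1"])
    (auto intro!: L2_le_iff_square_integrable add_nonneg_pos simp: L2_function_norm_def)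

lemma ex_L2_le_wt:
  assumes "s > real CARD('n) / 2"
  shows "\<exists>W. L2_le (\<lambda>\<xi>::real^'n::finite. complex_of_real (wt (- s) \<xi>)) W"
proof (rule ex_L2_le)
  have "integrable lborel (wt (2 * - s) :: real^'n \<Rightarrow> real)" using assms by (intro integrable_wt) simp
  then show "square_integrable (\<lambda>\<xi>::real^'n. complex_of_real (wt (- s) \<xi>))"
    by (simp add: square_integrable_def wt_square)
qed

lemma test_function_hs:
  assumes "test_function f"
  shows "\<exists>M. hs s f M"
proof -
  have "schwartz (\<lambda>\<xi>. of_real (wt s \<xi>) * fourier f \<xi>)"
    by (intro schwartz_mult temperate_wt schwartz_fourier test_function_schwartz assms)
  then show ?thesis
    using ex_L2_le[OF schwartz_square_integrable] test_function_Cc[OF assms] by (simp add: hs_def)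
qed

lemma wt_cancel: "complex_of_real (wt (- s) \<xi>) * (of_real (wt s \<xi>) * z) = z"
  by (simp only: mult.assoc[symmetric] of_real_mult[symmetric] mult.commute[of "wt (- s) \<xi>"] wt_inverse of_real_1 mult_1)

lemma hs_fourier_L1:
  fixes f :: "real^'n::finite \<Rightarrow> complex"
  assumes W: "L2_le (\<lambda>\<xi>::real^'n. complex_of_real (wt (- s) \<xi>)) W" and f: "hs s f M"
  shows "integrable lborel (fourier f)" "(LINT \<xi>|lborel. norm (fourier f \<xi>)) \<le> W * M"
    "(\<integral>\<^sup>+\<xi>. ennreal (norm (fourier f \<xi>)) \<partial>lborel) \<le> ennreal (W * M)"
  using L2_le_product[OF W hsD(3)[OF f]] unfolding wt_cancel by simp_all

lemma hs_inversion:
  fixes f :: "real^'n::finite \<Rightarrow> complex"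
  assumes W: "L2_le (\<lambda>\<xi>::real^'n. complex_of_real (wt (- s) \<xi>)) W" and f: "hs s f M"
  shows "inv_fourier (fourier f) x = f x"
proof -
  obtain B where "\<And>x. norm (f x) \<le> B" using Cc_bounded[OF hsD(1)[OF f]] by blast
  then show ?thesis
    using hsD(1)[OF f] by (intro fourier_inversion Cc_integrable hs_fourier_L1(1)[OF W f]) (auto simp: Cc_def)
qed

lemma two_pi_power_ge_1: "1 \<le> (2 * pi) ^ n"
  using pi_gt3 by (intro one_le_power) simp

lemma norm_inv_fourier_le:
  fixes a :: "real^'n::finite \<Rightarrow> complex"
  assumes "norm (LINT \<xi>|lborel. cis (x \<bullet> \<xi>) * a \<xi>) \<le> B"
  shows "norm (inv_fourier a x) \<le> B"
proof -
  have "norm (inv_fourier a x) = norm (LINT \<xi>|lborel. cis (x \<bullet> \<xi>) * a \<xi>) / (2 * pi) ^ CARD('n)"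
    by (simp add: inv_fourier_def norm_divide del: of_real_power of_real_mult)
  also have "\<dots> \<le> norm (LINT \<xi>|lborel. cis (x \<bullet> \<xi>) * a \<xi>) / 1"
    by (intro divide_left_mono two_pi_power_ge_1) auto
  finally show ?thesis using assms by simp
qed

lemma hs_bound:
  fixes f :: "real^'n::finite \<Rightarrow> complex"
  assumes W: "L2_le (\<lambda>\<xi>::real^'n. complex_of_real (wt (- s) \<xi>)) W" and f: "hs s f M"
  shows "norm (f x) \<le> W * M"
proof -
  have "norm (LINT \<xi>|lborel. cis (x \<bullet> \<xi>) * fourier f \<xi>) \<le> (LINT \<xi>|lborel. norm (cis (x \<bullet> \<xi>) * fourier f \<xi>))"
    by (rule integral_norm_bound)
  also have "\<dots> \<le> W * M" using hs_fourier_L1(2)[OF W f] by (simp add: norm_mult)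
  finally have "norm (inv_fourier (fourier f) x) \<le> W * M" by (rule norm_inv_fourier_le)
  then show ?thesis by (simp only: hs_inversion[OF W f])
qed

text \<open>Point values are given by integration against \<open>cis (x \<bullet> \<xi>)\<close>, which tends to \<open>cis 0\<close> in the
  dual weighted space, so that the unit ball is equicontinuous.\<close>

lemma hs_equicontinuous:
  assumes s: "s > real CARD('n::finite) / 2" and \<omega>: "\<omega> > 0"
  obtains \<delta> where "\<delta> > 0"
    "\<And>(g :: real^'n \<Rightarrow> complex) A x. hs s g A \<Longrightarrow> norm x < \<delta> \<Longrightarrow> norm (g x - g 0) \<le> \<omega> * A"
proof -
  obtain W where W: "L2_le (\<lambda>\<xi>::real^'n. complex_of_real (wt (- s) \<xi>)) W" using ex_L2_le_wt[OF s] by blast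
  \<comment> \<open>The functional \<open>g \<mapsto> g x - g 0\<close> in the dual weighted space.\<close>
  define p where "p x \<xi> = of_real (wt (- s) \<xi>) * (cis (x \<bullet> \<xi>) - 1)" for x \<xi> :: "real^'n"
  have [measurable]: "p x \<in> borel_measurable borel" for x unfolding p_def[abs_def] by measurable
  have wi: "integrable lborel (\<lambda>\<xi>::real^'n. 4 * (wt (- s) \<xi>)\<^sup>2)"
    unfolding wt_square using s by (intro integrable_mult_right integrable_wt) simp
  have pb: "(norm (p x \<xi>))\<^sup>2 \<le> 4 * (wt (- s) \<xi>)\<^sup>2" for x \<xi>
  proof -
    have "norm (cis (x \<bullet> \<xi>) - 1) \<le> 2" using norm_triangle_ineq4[of "cis (x \<bullet> \<xi>)" 1] by simp
    then have "norm (p x \<xi>) \<le> wt (- s) \<xi> * 2" unfolding p_def norm_mult by (intro mult_mono) auto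
    then have "(norm (p x \<xi>))\<^sup>2 \<le> (wt (- s) \<xi> * 2)\<^sup>2" by (intro power_mono) auto
    then show ?thesis by (simp add: power_mult_distrib)
  qed
  have pi: "integrable lborel (\<lambda>\<xi>. (norm (p x \<xi>))\<^sup>2)" for x
    by (rule Bochner_Integration.integrable_bound[OF wi]) (use pb in auto)
  have "((\<lambda>x. LINT \<xi>|lborel. (norm (p x \<xi>))\<^sup>2) \<longlongrightarrow> 0) (at 0)"
    unfolding tendsto_at_iff_sequentially comp_def
  proof (intro allI impI)
    fix X :: "nat \<Rightarrow> real^'n" assume X: "X \<longlonglongrightarrow> 0"
    have "(\<lambda>m. LINT \<xi>|lborel. (norm (p (X m) \<xi>))\<^sup>2) \<longlonglongrightarrow> (LINT \<xi>::real^'n|lborel. 0)"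
    proof (rule integral_dominated_convergence[OF _ _ wi])
      have "(\<lambda>m. p (X m) \<xi>) \<longlonglongrightarrow> 0" for \<xi>
      proof -
        have "(\<lambda>m. p (X m) \<xi>) \<longlonglongrightarrow> of_real (wt (- s) \<xi>) * (cis (0 \<bullet> \<xi>) - 1)"
          unfolding p_def by (intro tendsto_intros X)
        then show ?thesis by simp
      qed
      then show "AE \<xi> in lborel. (\<lambda>m. (norm (p (X m) \<xi>))\<^sup>2) \<longlonglongrightarrow> 0"
        by (intro AE_I2) (auto intro!: tendsto_eq_intros)
    qed (use pb in auto)
    then show "(\<lambda>m. LINT \<xi>|lborel. (norm (p (X m) \<xi>))\<^sup>2) \<longlonglongrightarrow> 0" by simp
  qed
  then have "\<forall>\<^sub>F x in at 0. (LINT \<xi>|lborel. (norm (p x \<xi>))\<^sup>2) < \<omega>\<^sup>2"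
    by (rule order_tendstoD) (use \<omega> in simp)
  then obtain \<delta> where \<delta>: "\<delta> > 0" "\<And>x. x \<noteq> 0 \<Longrightarrow> norm x < \<delta> \<Longrightarrow> (LINT \<xi>|lborel. (norm (p x \<xi>))\<^sup>2) < \<omega>\<^sup>2"
    unfolding eventually_at by (auto simp: dist_norm)
  have "norm (g x - g 0) \<le> \<omega> * A" if g: "hs s g A" and x: "norm x < \<delta>" for g :: "real^'n \<Rightarrow> complex" and A x
  proof (cases "x = 0")
    case True
    then show ?thesis using \<omega> hsD(2)[OF g] by simp
  next
    case False
    have "L2_function_norm (p x) \<le> \<omega>"
      unfolding L2_function_norm_def using \<delta>(2)[OF False x] \<omega> by (intro real_le_lsqrt) auto
    then have L: "L2_le (p x) \<omega>"
      by (intro L2_le_iff_square_integrable \<omega>) (simp_all add: square_integrable_def pi)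
    have Fi: "integrable lborel (fourier g)" by (rule hs_fourier_L1(1)[OF W g])
    have ci: "integrable lborel (\<lambda>\<xi>. cis (y \<bullet> \<xi>) * fourier g \<xi>)" for y
      by (rule Bochner_Integration.integrable_bound[OF Fi]) (use Fi in \<open>auto simp: norm_mult\<close>)
    have cp: "cis (x \<bullet> \<xi>) * fourier g \<xi> - cis (0 \<bullet> \<xi>) * fourier g \<xi> = p x \<xi> * (of_real (wt s \<xi>) * fourier g \<xi>)" for \<xi>
    proof -
      have "p x \<xi> * (of_real (wt s \<xi>) * fourier g \<xi>) = of_real (wt s \<xi> * wt (- s) \<xi>) * ((cis (x \<bullet> \<xi>) - 1) * fourier g \<xi>)"
        by (simp add: p_def)
      then show ?thesis by (simp add: wt_inverse left_diff_distrib)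
    qed
    have "g x - g 0 = inv_fourier (fourier g) x - inv_fourier (fourier g) 0"
      by (simp only: hs_inversion[OF W g])
    also have "\<dots> = (LINT \<xi>|lborel. p x \<xi> * (of_real (wt s \<xi>) * fourier g \<xi>)) / of_real ((2 * pi) ^ CARD('n))"
      unfolding inv_fourier_def cp[symmetric] Bochner_Integration.integral_diff[OF ci ci] diff_divide_distrib ..
    finally have "norm (g x - g 0) = norm (LINT \<xi>|lborel. p x \<xi> * (of_real (wt s \<xi>) * fourier g \<xi>)) / (2 * pi) ^ CARD('n)"
      by (simp add: norm_divide del: of_real_power of_real_mult)
    also have "\<dots> \<le> norm (LINT \<xi>|lborel. p x \<xi> * (of_real (wt s \<xi>) * fourier g \<xi>)) / 1"
      by (intro divide_left_mono two_pi_power_ge_1) auto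
    also have "\<dots> \<le> \<omega> * A" using L2_le_product(4)[OF L hsD(3)[OF g]] by simp
    finally show ?thesis .
  qed
  then show thesis using that \<delta>(1) by blast
qed

section \<open>Translations, dilations and products\<close>

lemma hs_translate:
  assumes f: "hs s f M"
  shows "hs s (\<lambda>x. f (x + y)) M"
proof -
  have C: "Cc f" by (rule hsD(1)[OF f])
  have C': "Cc (\<lambda>x. f (x + y))" using Cc_affine[OF C, of 1 y] by simp
  have "L2_le (\<lambda>\<xi>. of_real (wt s \<xi>) * fourier (\<lambda>x. f (x + y)) \<xi>) M"
  proof (rule L2_le_mono[OF hsD(3)[OF f]])
    show "(\<lambda>\<xi>. of_real (wt s \<xi>) * fourier (\<lambda>x. f (x + y)) \<xi>) \<in> borel_measurable borel"
      using fourier_Cc_measurable[OF C'] by measurable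
  qed (simp_all add: fourier_translate[OF Cc_integrable[OF C]] norm_mult)
  then show ?thesis using C' by (simp add: hs_def)
qed

lemma wt_scale_le:
  assumes "s \<ge> 0" "c > 0"
  shows "wt s (c *\<^sub>R x) \<le> (1 + c) powr s * wt s x"
proof -
  have "1 + (norm (c *\<^sub>R x))\<^sup>2 \<le> (1 + c)\<^sup>2 * (1 + (norm x)\<^sup>2)"
    using assms(2) by (simp add: power_mult_distrib power2_eq_square algebra_simps)
  then have "wt s (c *\<^sub>R x) \<le> ((1 + c)\<^sup>2 * (1 + (norm x)\<^sup>2)) powr (s / 2)"
    unfolding wt_def using assms by (intro powr_mono2) auto
  also have "\<dots> = (1 + c) powr s * wt s x"
    using assms by (simp add: wt_def powr_mult powr_powr flip: powr_numeral)
  finally show ?thesis .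
qed

lemma hs_dilate:
  assumes s: "s \<ge> 0" and c: "c > 0"
  obtains D where "D > 0" "\<And>f M. hs s f M \<Longrightarrow> hs s (\<lambda>x::real^'n::finite. f (c *\<^sub>R x)) (D * M)"
proof -
  let ?n = "CARD('n)"
  define k where "k = (1 + c) powr s"
  define D where "D = k * (1 + 1 / c) ^ ?n"
  have k: "k > 0" using c by (simp add: k_def)
  have D: "D > 0" using c k by (auto simp: D_def intro!: mult_pos_pos zero_less_power add_pos_pos)
  have "hs s (\<lambda>x. f (c *\<^sub>R x)) (D * M)" if f: "hs s f M" for f :: "real^'n \<Rightarrow> complex" and M
  proof -
    have C: "Cc f" by (rule hsD(1)[OF f])
    have C': "Cc (\<lambda>x. f (c *\<^sub>R x))" using Cc_affine[OF C, of c 0] c by simp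
    let ?g = "fourier (\<lambda>x. f (c *\<^sub>R x))"
    have [measurable]: "?g \<in> borel_measurable borel" "fourier f \<in> borel_measurable borel"
      using C C' by measurable
    have Ff: "cmod (fourier f \<xi>) = c ^ ?n * cmod (?g (c *\<^sub>R \<xi>))" for \<xi>
      using fourier_scale[OF Cc_integrable[OF C], of c \<xi>] c by (simp add: norm_mult norm_power)
    have "(\<integral>\<^sup>+\<xi>. ennreal ((norm (of_real (wt s \<xi>) * ?g \<xi>))\<^sup>2) \<partial>lborel)
       = ennreal (c ^ ?n) * (\<integral>\<^sup>+\<xi>. ennreal ((norm (of_real (wt s (c *\<^sub>R \<xi>)) * ?g (c *\<^sub>R \<xi>)))\<^sup>2) \<partial>lborel)"
      using c by (subst nn_integral_lborel_affine[where c = c and t = 0]) auto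
    also have "\<dots> \<le> ennreal (c ^ ?n) * (\<integral>\<^sup>+\<xi>. ennreal ((k / c ^ ?n)\<^sup>2) * ennreal ((norm (of_real (wt s \<xi>) * fourier f \<xi>))\<^sup>2) \<partial>lborel)"
    proof (intro mult_left_mono nn_integral_mono)
      fix \<xi>
      have "norm (of_real (wt s (c *\<^sub>R \<xi>)) * ?g (c *\<^sub>R \<xi>)) \<le> (k * wt s \<xi>) * cmod (?g (c *\<^sub>R \<xi>))"
        unfolding norm_mult using wt_scale_le[OF s c, of \<xi>] by (intro mult_right_mono) (auto simp: k_def)
      also have "\<dots> = (k / c ^ ?n) * norm (of_real (wt s \<xi>) * fourier f \<xi>)"
        using c by (simp add: Ff norm_mult)
      finally have "(norm (of_real (wt s (c *\<^sub>R \<xi>)) * ?g (c *\<^sub>R \<xi>)))\<^sup>2 \<le> ((k / c ^ ?n) * norm (of_real (wt s \<xi>) * fourier f \<xi>))\<^sup>2"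
        by (intro power_mono) auto
      then show "ennreal ((norm (of_real (wt s (c *\<^sub>R \<xi>)) * ?g (c *\<^sub>R \<xi>)))\<^sup>2)
        \<le> ennreal ((k / c ^ ?n)\<^sup>2) * ennreal ((norm (of_real (wt s \<xi>) * fourier f \<xi>))\<^sup>2)"
        by (simp only: power_mult_distrib ennreal_mult[symmetric] zero_le_power2 ennreal_leI)
    qed simp
    also have "\<dots> = ennreal (c ^ ?n) * (ennreal ((k / c ^ ?n)\<^sup>2) * (\<integral>\<^sup>+\<xi>. ennreal ((norm (of_real (wt s \<xi>) * fourier f \<xi>))\<^sup>2) \<partial>lborel))"
      by (subst nn_integral_cmult) auto
    also have "\<dots> \<le> ennreal (c ^ ?n) * (ennreal ((k / c ^ ?n)\<^sup>2) * ennreal (M\<^sup>2))"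
      by (intro mult_left_mono L2_leD(3)[OF hsD(3)[OF f]]) auto
    also have "\<dots> = ennreal (c ^ ?n * ((k / c ^ ?n)\<^sup>2 * M\<^sup>2))"
      using c by (simp only: ennreal_mult[symmetric] zero_le_power2 zero_le_power less_imp_le mult_nonneg_nonneg)
    also have "c ^ ?n * ((k / c ^ ?n)\<^sup>2 * M\<^sup>2) = (1 / c) ^ ?n * (k * M)\<^sup>2"
      using c by (simp add: power2_eq_square field_simps)
    also have "\<dots> \<le> ((1 + 1 / c) ^ ?n)\<^sup>2 * (k * M)\<^sup>2"
    proof (rule mult_right_mono)
      have "(1 / c) ^ ?n \<le> (1 + 1 / c) ^ ?n" using c by (intro power_mono) auto
      also have "\<dots> \<le> ((1 + 1 / c) ^ ?n)\<^sup>2" using c by (intro self_le_power) auto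
      finally show "(1 / c) ^ ?n \<le> ((1 + 1 / c) ^ ?n)\<^sup>2" .
    qed simp
    also have "\<dots> = (D * M)\<^sup>2" by (simp only: D_def power_mult_distrib mult_ac)
    finally have "L2_le (\<lambda>\<xi>. of_real (wt s \<xi>) * ?g \<xi>) (D * M)"
      using D hsD(2)[OF f] by (simp add: L2_le_def ennreal_leI)
    then show ?thesis using C' by (simp add: hs_def)
  qed
  then show thesis using that D by blast
qed

lemma ennreal_arith_geo_mean: "2 * (a * b) \<le> a\<^sup>2 + (b::ennreal)\<^sup>2"
proof -
  have *: "2 * (a * b) \<le> a\<^sup>2 + b\<^sup>2" if "a \<le> b" for a b :: ennreal
  proof -
    obtain c where "b = a + c" using \<open>a \<le> b\<close> le_iff_add by blast
    then have "a\<^sup>2 + b\<^sup>2 = (a * b + a * b) + c * c"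
      by (simp only: power2_eq_square distrib_left distrib_right ac_simps)
    then show ?thesis by (simp add: mult_2)
  qed
  show ?thesis using *[of a b] *[of b a] by (cases "a \<le> b") (auto simp: mult_ac add_ac)
qed

lemma ennreal_square_sum_le: "(a + b)\<^sup>2 \<le> 2 * a\<^sup>2 + 2 * (b::ennreal)\<^sup>2"
proof -
  have "(a + b)\<^sup>2 = (a\<^sup>2 + b\<^sup>2) + (a * b + a * b)"
    by (simp only: power2_eq_square distrib_left distrib_right ac_simps)
  also have "\<dots> \<le> (a\<^sup>2 + b\<^sup>2) + (a\<^sup>2 + b\<^sup>2)" by (intro add_left_mono ennreal_arith_geo_mean[unfolded mult_2])
  also have "\<dots> = 2 * a\<^sup>2 + 2 * b\<^sup>2" by (simp only: mult_2 ac_simps)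
  finally show ?thesis .
qed

text \<open>The square of an integral is a double integral, to whose integrand the inequality between
  arithmetic and geometric mean applies.\<close>

lemma Cauchy_Schwarz_nn_integral_weighted:
  fixes p q :: "'a::euclidean_space \<Rightarrow> ennreal"
  assumes [measurable]: "p \<in> borel_measurable borel" "q \<in> borel_measurable borel"
  shows "(\<integral>\<^sup>+x. p x * q x \<partial>lborel)\<^sup>2 \<le> (\<integral>\<^sup>+x. p x \<partial>lborel) * (\<integral>\<^sup>+x. p x * (q x)\<^sup>2 \<partial>lborel)"
proof -
  let ?P = "\<integral>\<^sup>+x. p x \<partial>lborel" and ?Q = "\<integral>\<^sup>+x. p x * (q x)\<^sup>2 \<partial>lborel"
  let ?I = "\<integral>\<^sup>+x. p x * q x \<partial>lborel"
  have "2 * ?I\<^sup>2 = (\<integral>\<^sup>+x. 2 * (p x * q x) \<partial>lborel) * ?I"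
  proof -
    have "(\<integral>\<^sup>+x. 2 * (p x * q x) \<partial>lborel) = 2 * ?I" by (rule nn_integral_cmult) measurable
    then show ?thesis by (simp only: power2_eq_square mult.assoc)
  qed
  also have "\<dots> = (\<integral>\<^sup>+x. (2 * (p x * q x)) * ?I \<partial>lborel)"
    by (rule nn_integral_multc[symmetric]) measurable
  also have "\<dots> = (\<integral>\<^sup>+x. (\<integral>\<^sup>+y. 2 * ((p x * q x) * (p y * q y)) \<partial>lborel) \<partial>lborel)"
    by (intro nn_integral_cong, subst nn_integral_cmult[symmetric]) (auto simp: mult_ac)
  also have "\<dots> \<le> (\<integral>\<^sup>+x. (\<integral>\<^sup>+y. (p x * (q x)\<^sup>2) * p y + p x * (p y * (q y)\<^sup>2) \<partial>lborel) \<partial>lborel)"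
  proof (intro nn_integral_mono)
    fix x y
    have "2 * ((p x * q x) * (p y * q y)) = (p x * p y) * (2 * (q x * q y))" by (simp add: mult_ac)
    also have "\<dots> \<le> (p x * p y) * ((q x)\<^sup>2 + (q y)\<^sup>2)" by (intro mult_left_mono ennreal_arith_geo_mean) simp
    also have "\<dots> = (p x * (q x)\<^sup>2) * p y + p x * (p y * (q y)\<^sup>2)" by (simp add: algebra_simps)
    finally show "2 * ((p x * q x) * (p y * q y)) \<le> \<dots>" .
  qed
  also have "\<dots> = (\<integral>\<^sup>+x. (p x * (q x)\<^sup>2) * ?P + p x * ?Q \<partial>lborel)"
    by (intro nn_integral_cong, subst nn_integral_add) (auto simp: nn_integral_cmult)
  also have "\<dots> = (\<integral>\<^sup>+x. (p x * (q x)\<^sup>2) * ?P \<partial>lborel) + (\<integral>\<^sup>+x. p x * ?Q \<partial>lborel)"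
    by (rule nn_integral_add) measurable
  also have "(\<integral>\<^sup>+x. (p x * (q x)\<^sup>2) * ?P \<partial>lborel) = ?Q * ?P"
    by (rule nn_integral_multc) measurable
  also have "(\<integral>\<^sup>+x. p x * ?Q \<partial>lborel) = ?P * ?Q"
    by (rule nn_integral_multc) measurable
  also have "?Q * ?P + ?P * ?Q = 2 * (?P * ?Q)" by (simp only: mult_2 mult.commute)
  finally show ?thesis by (simp add: ennreal_mult_le_mult_iff)
qed

lemma wt_triangle:
  assumes "s \<ge> 0"
  shows "wt s (a + b) \<le> 2 powr s * (wt s a + norm b powr s)"
proof -
  let ?m = "max (1 + (norm a)\<^sup>2) ((norm b)\<^sup>2)"
  have "(norm (a + b))\<^sup>2 \<le> (norm a + norm b)\<^sup>2" by (intro power_mono norm_triangle_ineq) auto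
  also have "\<dots> \<le> 2 * (norm a)\<^sup>2 + 2 * (norm b)\<^sup>2"
    using zero_le_power2[of "norm a - norm b"] by (simp add: power2_eq_square algebra_simps)
  finally have "1 + (norm (a + b))\<^sup>2 \<le> 2 * (1 + (norm a)\<^sup>2) + 2 * (norm b)\<^sup>2" by simp
  also have "\<dots> \<le> 2 * ?m + 2 * ?m" by (intro add_mono mult_left_mono) auto
  finally have "1 + (norm (a + b))\<^sup>2 \<le> 2\<^sup>2 * ?m" by simp
  then have "wt s (a + b) \<le> (2\<^sup>2 * ?m) powr (s / 2)"
    unfolding wt_def using assms by (intro powr_mono2) auto
  also have "\<dots> = 2 powr s * ?m powr (s / 2)"
    by (simp add: powr_mult powr_powr flip: powr_numeral)
  also have "?m powr (s / 2) \<le> wt s a + norm b powr s"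
  proof -
    have "((norm b)\<^sup>2) powr (s / 2) = norm b powr s" by (cases "norm b = 0") (simp_all add: powr_powr flip: powr_numeral)
    then show ?thesis unfolding max_def wt_def by auto
  qed
  finally show ?thesis by (simp add: mult_left_mono)
qed

text \<open>Fubini's theorem after \<open>g\<close> has been replaced by its inversion integral.\<close>

lemma fourier_product_dilated:
  fixes f g :: "real^'n::finite \<Rightarrow> complex"
  assumes W: "L2_le (\<lambda>\<xi>::real^'n. complex_of_real (wt (- s) \<xi>)) W"
    and g: "hs s g A" and f: "Cc f"
  shows "fourier (\<lambda>x. g (r *\<^sub>R x) * f x) \<zeta> =
    (LINT \<xi>|lborel. fourier g \<xi> * fourier f (\<zeta> - r *\<^sub>R \<xi>)) / of_real ((2 * pi) ^ CARD('n))"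
proof -
  let ?c = "of_real ((2 * pi) ^ CARD('n)) :: complex"
  have Fg: "integrable lborel (fourier g)" by (rule hs_fourier_L1(1)[OF W g])
  have fi: "integrable lborel f" by (rule Cc_integrable[OF f])
  have [measurable]: "f \<in> borel_measurable borel" "fourier g \<in> borel_measurable borel" using fi Fg by auto
  have i: "integrable (lborel \<Otimes>\<^sub>M lborel) (\<lambda>(x, \<xi>). cis (- (x \<bullet> (\<zeta> - r *\<^sub>R \<xi>))) * (f x * fourier g \<xi>))"
    by (rule Bochner_Integration.integrable_bound[OF integrable_prod_mult[OF fi Fg]]) (auto simp: norm_mult)
  have "fourier (\<lambda>x. g (r *\<^sub>R x) * f x) \<zeta> = (LINT x|lborel. (LINT \<xi>|lborel. cis (- (x \<bullet> (\<zeta> - r *\<^sub>R \<xi>))) * (f x * fourier g \<xi>)) / ?c)"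
    unfolding fourier_def[of "\<lambda>x. g (r *\<^sub>R x) * f x"]
  proof (rule Bochner_Integration.integral_cong[OF refl])
    fix x
    have "cis (- (x \<bullet> \<zeta>)) * (g (r *\<^sub>R x) * f x) = (cis (- (x \<bullet> \<zeta>)) * f x) * (LINT \<xi>|lborel. cis ((r *\<^sub>R x) \<bullet> \<xi>) * fourier g \<xi>) / ?c"
      by (subst hs_inversion[OF W g, symmetric]) (simp add: inv_fourier_def)
    also have "(cis (- (x \<bullet> \<zeta>)) * f x) * (LINT \<xi>|lborel. cis ((r *\<^sub>R x) \<bullet> \<xi>) * fourier g \<xi>)
       = (LINT \<xi>|lborel. (cis (- (x \<bullet> \<zeta>)) * f x) * (cis ((r *\<^sub>R x) \<bullet> \<xi>) * fourier g \<xi>))"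
      by (rule integral_mult_right_zero[symmetric])
    also have "(\<lambda>\<xi>. (cis (- (x \<bullet> \<zeta>)) * f x) * (cis ((r *\<^sub>R x) \<bullet> \<xi>) * fourier g \<xi>)) = (\<lambda>\<xi>. cis (- (x \<bullet> (\<zeta> - r *\<^sub>R \<xi>))) * (f x * fourier g \<xi>))"
    proof
      fix \<xi>
      have "cis (- (x \<bullet> (\<zeta> - r *\<^sub>R \<xi>))) = cis (- (x \<bullet> \<zeta>)) * cis ((r *\<^sub>R x) \<bullet> \<xi>)"
        by (simp add: cis_mult inner_diff_right)
      then show "(cis (- (x \<bullet> \<zeta>)) * f x) * (cis ((r *\<^sub>R x) \<bullet> \<xi>) * fourier g \<xi>) = cis (- (x \<bullet> (\<zeta> - r *\<^sub>R \<xi>))) * (f x * fourier g \<xi>)"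
        by (simp only: mult_ac)
    qed
    finally show "cis (- (x \<bullet> \<zeta>)) * (g (r *\<^sub>R x) * f x) = (LINT \<xi>|lborel. cis (- (x \<bullet> (\<zeta> - r *\<^sub>R \<xi>))) * (f x * fourier g \<xi>)) / ?c" .
  qed
  also have "\<dots> = (LINT x|lborel. LINT \<xi>|lborel. cis (- (x \<bullet> (\<zeta> - r *\<^sub>R \<xi>))) * (f x * fourier g \<xi>)) / ?c"
    by (rule integral_divide_zero)
  also have "(LINT x|lborel. LINT \<xi>|lborel. cis (- (x \<bullet> (\<zeta> - r *\<^sub>R \<xi>))) * (f x * fourier g \<xi>))
     = (LINT \<xi>|lborel. LINT x|lborel. cis (- (x \<bullet> (\<zeta> - r *\<^sub>R \<xi>))) * (f x * fourier g \<xi>))"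
    by (rule lborel_pair.Fubini_integral[symmetric, OF i])
  also have "\<dots> = (LINT \<xi>|lborel. fourier g \<xi> * fourier f (\<zeta> - r *\<^sub>R \<xi>))"
    unfolding fourier_def[of f] integral_mult_right_zero[symmetric]
    by (intro Bochner_Integration.integral_cong) (auto simp: mult_ac)
  finally show ?thesis .
qed

text \<open>The central estimate.  For \<open>r = 1\<close> it says that the norm is submultiplicative up to a constant.
  For small \<open>r\<close> the point is that the constant does not depend on \<open>r\<close>: at high frequency the dilation
  of \<open>g\<close> gains \<open>r^(s - n/2) \<le> 1\<close>, and at low frequency only \<open>\<integral> |fourier g|\<close> enters, which is
  invariant under dilations.\<close>

theorem hs_mult_dilated:
  fixes f g :: "real^'n::finite \<Rightarrow> complex"
  assumes W: "L2_le (\<lambda>\<xi>::real^'n. complex_of_real (wt (- s) \<xi>)) W" and s: "2 * s \<ge> real CARD('n)"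
    and g: "hs s g A" and f: "hs s f B" and r: "0 < r" "r \<le> 1"
  shows "hs s (\<lambda>x. g (r *\<^sub>R x) * f x) (2 * 2 powr s * W * A * B)"
proof -
  let ?n = "CARD('n)"
  have s0: "s \<ge> 0" using s by simp
  have A: "A > 0" and B: "B > 0" and W0: "W > 0" using g f W hsD L2_leD by blast+
  have Cf: "Cc f" and Cg: "Cc g" using f g hsD by auto
  have "continuous_on UNIV (\<lambda>x. g (r *\<^sub>R x))"
    using Cc_affine[OF Cg, of r 0] r by (simp add: Cc_def)
  then have C: "Cc (\<lambda>x. g (r *\<^sub>R x) * f x)" by (rule Cc_mult[OF _ Cf])
  have [measurable]: "fourier f \<in> borel_measurable borel" "fourier g \<in> borel_measurable borel"
    using Cf Cg by measurable
  define a where "a \<xi> = ennreal (norm (fourier g \<xi>))" for \<xi>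
  define b where "b \<xi> = ennreal (norm (of_real (wt s \<xi>) * fourier g \<xi>))" for \<xi>
  define p where "p \<xi> = ennreal (norm (fourier f \<xi>))" for \<xi>
  define q where "q \<xi> = ennreal (norm (of_real (wt s \<xi>) * fourier f \<xi>))" for \<xi>
  have [measurable]: "a \<in> borel_measurable borel" "b \<in> borel_measurable borel"
    "p \<in> borel_measurable borel" "q \<in> borel_measurable borel"
    unfolding a_def[abs_def] b_def[abs_def] p_def[abs_def] q_def[abs_def] by measurable
  have a: "(\<integral>\<^sup>+\<xi>. a \<xi> \<partial>lborel) \<le> ennreal (W * A)" and p: "(\<integral>\<^sup>+\<xi>. p \<xi> \<partial>lborel) \<le> ennreal (W * B)"
    unfolding a_def p_def by (rule hs_fourier_L1(3)[OF W g] hs_fourier_L1(3)[OF W f])+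
  have b: "(\<integral>\<^sup>+\<xi>. (b \<xi>)\<^sup>2 \<partial>lborel) \<le> ennreal (A\<^sup>2)" and q: "(\<integral>\<^sup>+\<xi>. (q \<xi>)\<^sup>2 \<partial>lborel) \<le> ennreal (B\<^sup>2)"
    unfolding b_def q_def using L2_leD(3)[OF hsD(3)[OF g]] L2_leD(3)[OF hsD(3)[OF f]] by (simp_all add: ennreal_power)
  \<comment> \<open>By \<open>wt_triangle\<close> the weight falls on \<open>f\<close>, giving \<open>T1\<close>, or on the dilated \<open>g\<close>, giving \<open>r^s T2\<close>.\<close>
  define T1 where "T1 \<zeta> = (\<integral>\<^sup>+\<xi>. a \<xi> * q (\<zeta> - r *\<^sub>R \<xi>) \<partial>lborel)" for \<zeta>
  define T2 where "T2 \<zeta> = (\<integral>\<^sup>+\<xi>. p (\<zeta> - r *\<^sub>R \<xi>) * b \<xi> \<partial>lborel)" for \<zeta>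
  have [measurable]: "T1 \<in> borel_measurable borel" "T2 \<in> borel_measurable borel"
    unfolding T1_def[abs_def] T2_def[abs_def] by measurable
  have shift: "(\<integral>\<^sup>+\<zeta>. h (\<zeta> - r *\<^sub>R \<xi>) \<partial>lborel) = (\<integral>\<^sup>+\<zeta>. h \<zeta> \<partial>lborel)" if [measurable]: "h \<in> borel_measurable borel"
    for h :: "real^'n \<Rightarrow> ennreal" and \<xi>
    using nn_integral_lborel_affine[of h 1 "- (r *\<^sub>R \<xi>)"] by simp
  have t1: "(\<integral>\<^sup>+\<zeta>. (T1 \<zeta>)\<^sup>2 \<partial>lborel) \<le> ennreal ((W * A * B)\<^sup>2)"
  proof -
    have "(\<integral>\<^sup>+\<zeta>. (T1 \<zeta>)\<^sup>2 \<partial>lborel) \<le> (\<integral>\<^sup>+\<zeta>. ennreal (W * A) * (\<integral>\<^sup>+\<xi>. a \<xi> * (q (\<zeta> - r *\<^sub>R \<xi>))\<^sup>2 \<partial>lborel) \<partial>lborel)"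
      unfolding T1_def by (intro nn_integral_mono order_trans[OF Cauchy_Schwarz_nn_integral_weighted] mult_right_mono a) auto
    also have "\<dots> = ennreal (W * A) * (\<integral>\<^sup>+\<zeta>. (\<integral>\<^sup>+\<xi>. a \<xi> * (q (\<zeta> - r *\<^sub>R \<xi>))\<^sup>2 \<partial>lborel) \<partial>lborel)"
      by (rule nn_integral_cmult) measurable
    also have "(\<integral>\<^sup>+\<zeta>. (\<integral>\<^sup>+\<xi>. a \<xi> * (q (\<zeta> - r *\<^sub>R \<xi>))\<^sup>2 \<partial>lborel) \<partial>lborel) = (\<integral>\<^sup>+\<xi>. (\<integral>\<^sup>+\<zeta>. a \<xi> * (q (\<zeta> - r *\<^sub>R \<xi>))\<^sup>2 \<partial>lborel) \<partial>lborel)"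
      by (rule lborel_pair.Fubini') measurable
    also have "\<dots> = (\<integral>\<^sup>+\<xi>. a \<xi> * (\<integral>\<^sup>+\<zeta>. (q \<zeta>)\<^sup>2 \<partial>lborel) \<partial>lborel)"
      by (intro nn_integral_cong) (simp add: nn_integral_cmult shift[of "\<lambda>\<zeta>. (q \<zeta>)\<^sup>2"])
    also have "\<dots> = (\<integral>\<^sup>+\<xi>. a \<xi> \<partial>lborel) * (\<integral>\<^sup>+\<zeta>. (q \<zeta>)\<^sup>2 \<partial>lborel)" by (rule nn_integral_multc) measurable
    also have "ennreal (W * A) * \<dots> \<le> ennreal (W * A) * (ennreal (W * A) * ennreal (B\<^sup>2))"
      by (intro mult_left_mono mult_mono a q) auto
    also have "\<dots> = ennreal ((W * A * B)\<^sup>2)"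
      using W0 A B by (simp add: power2_eq_square ennreal_mult mult_ac)
    finally show ?thesis .
  qed
  \<comment> \<open>Here \<open>2 s \<ge> n\<close> enters: the loss \<open>r^(-n)\<close> of the dilated integral is compensated by \<open>r^(2 s)\<close>.\<close>
  have rscale: "ennreal (r powr (2 * s)) * (\<integral>\<^sup>+\<xi>. p (\<zeta> - r *\<^sub>R \<xi>) \<partial>lborel) \<le> ennreal (W * B)" for \<zeta>
  proof -
    have "r powr (2 * s) \<le> r powr real ?n" using r s by (intro powr_mono') auto
    also have "\<dots> = \<bar>- r\<bar> ^ ?n" using r by (simp add: powr_realpow)
    finally have "ennreal (r powr (2 * s)) * (\<integral>\<^sup>+\<xi>. p (\<zeta> - r *\<^sub>R \<xi>) \<partial>lborel) \<le> ennreal (\<bar>- r\<bar> ^ ?n) * (\<integral>\<^sup>+\<xi>. p (\<zeta> + (- r) *\<^sub>R \<xi>) \<partial>lborel)"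
      by (auto intro!: mult_right_mono ennreal_leI)
    also have "\<dots> = (\<integral>\<^sup>+\<xi>. p \<xi> \<partial>lborel)"
      using nn_integral_lborel_affine[of p "- r" \<zeta>] r by simp
    also note p
    finally show ?thesis .
  qed
  have t2: "(\<integral>\<^sup>+\<zeta>. (ennreal (r powr s) * T2 \<zeta>)\<^sup>2 \<partial>lborel) \<le> ennreal ((W * A * B)\<^sup>2)"
  proof -
    have "(\<integral>\<^sup>+\<zeta>. (ennreal (r powr s) * T2 \<zeta>)\<^sup>2 \<partial>lborel) \<le> (\<integral>\<^sup>+\<zeta>. ennreal (W * B) * (\<integral>\<^sup>+\<xi>. p (\<zeta> - r *\<^sub>R \<xi>) * (b \<xi>)\<^sup>2 \<partial>lborel) \<partial>lborel)"
    proof (rule nn_integral_mono)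
      fix \<zeta>
      let ?I = "\<integral>\<^sup>+\<xi>. p (\<zeta> - r *\<^sub>R \<xi>) * (b \<xi>)\<^sup>2 \<partial>lborel"
      have "(ennreal (r powr s) * T2 \<zeta>)\<^sup>2 = ennreal (r powr (2 * s)) * (T2 \<zeta>)\<^sup>2"
      proof -
        have "(r powr s)\<^sup>2 = r powr (2 * s)" by (simp only: power2_eq_square mult_2 powr_add)
        then show ?thesis by (simp add: power_mult_distrib ennreal_power)
      qed
      also have "\<dots> \<le> ennreal (r powr (2 * s)) * ((\<integral>\<^sup>+\<xi>. p (\<zeta> - r *\<^sub>R \<xi>) \<partial>lborel) * ?I)"
        unfolding T2_def by (intro mult_left_mono Cauchy_Schwarz_nn_integral_weighted) auto
      also have "\<dots> \<le> ennreal (W * B) * ?I"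
        unfolding mult.assoc[symmetric] by (intro mult_right_mono rscale) auto
      finally show "(ennreal (r powr s) * T2 \<zeta>)\<^sup>2 \<le> ennreal (W * B) * ?I" .
    qed
    also have "\<dots> = ennreal (W * B) * (\<integral>\<^sup>+\<zeta>. (\<integral>\<^sup>+\<xi>. p (\<zeta> - r *\<^sub>R \<xi>) * (b \<xi>)\<^sup>2 \<partial>lborel) \<partial>lborel)"
      by (rule nn_integral_cmult) measurable
    also have "(\<integral>\<^sup>+\<zeta>. (\<integral>\<^sup>+\<xi>. p (\<zeta> - r *\<^sub>R \<xi>) * (b \<xi>)\<^sup>2 \<partial>lborel) \<partial>lborel) = (\<integral>\<^sup>+\<xi>. (\<integral>\<^sup>+\<zeta>. p (\<zeta> - r *\<^sub>R \<xi>) * (b \<xi>)\<^sup>2 \<partial>lborel) \<partial>lborel)"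
      by (rule lborel_pair.Fubini') measurable
    also have "\<dots> = (\<integral>\<^sup>+\<xi>. (\<integral>\<^sup>+\<zeta>. p \<zeta> \<partial>lborel) * (b \<xi>)\<^sup>2 \<partial>lborel)"
      by (intro nn_integral_cong) (simp add: nn_integral_multc shift)
    also have "\<dots> = (\<integral>\<^sup>+\<zeta>. p \<zeta> \<partial>lborel) * (\<integral>\<^sup>+\<xi>. (b \<xi>)\<^sup>2 \<partial>lborel)" by (rule nn_integral_cmult) measurable
    also have "ennreal (W * B) * \<dots> \<le> ennreal (W * B) * (ennreal (W * B) * ennreal (A\<^sup>2))"
      by (intro mult_left_mono mult_mono b p) auto
    also have "\<dots> = ennreal ((W * A * B)\<^sup>2)"
      using W0 A B by (simp add: power2_eq_square ennreal_mult mult_ac)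
    finally show ?thesis .
  qed
  let ?F = "fourier (\<lambda>x. g (r *\<^sub>R x) * f x)"
  have pw: "ennreal (norm (of_real (wt s \<zeta>) * ?F \<zeta>)) \<le> ennreal (2 powr s) * (T1 \<zeta> + ennreal (r powr s) * T2 \<zeta>)" for \<zeta>
  proof -
    let ?I = "LINT \<xi>|lborel. fourier g \<xi> * fourier f (\<zeta> - r *\<^sub>R \<xi>)"
    have "norm (?F \<zeta>) = norm ?I / (2 * pi) ^ ?n"
      by (simp add: fourier_product_dilated[OF W g Cf] norm_divide del: of_real_power of_real_mult)
    also have "\<dots> \<le> norm ?I / 1" by (intro divide_left_mono two_pi_power_ge_1) auto
    finally have "ennreal (norm (?F \<zeta>)) \<le> ennreal (norm ?I)" by (simp add: ennreal_leI)
    also have "\<dots> \<le> (\<integral>\<^sup>+\<xi>. ennreal (norm (fourier g \<xi> * fourier f (\<zeta> - r *\<^sub>R \<xi>))) \<partial>lborel)"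
      by (cases "integrable lborel (\<lambda>\<xi>. fourier g \<xi> * fourier f (\<zeta> - r *\<^sub>R \<xi>))")
        (auto simp: integral_norm_bound_ennreal not_integrable_integral_eq)
    finally have "ennreal (norm (of_real (wt s \<zeta>) * ?F \<zeta>)) \<le> ennreal (wt s \<zeta>) * (\<integral>\<^sup>+\<xi>. ennreal (norm (fourier g \<xi> * fourier f (\<zeta> - r *\<^sub>R \<xi>))) \<partial>lborel)"
      by (simp add: norm_mult ennreal_mult mult_left_mono)
    also have "\<dots> = (\<integral>\<^sup>+\<xi>. ennreal (wt s \<zeta>) * ennreal (norm (fourier g \<xi> * fourier f (\<zeta> - r *\<^sub>R \<xi>))) \<partial>lborel)"
      by (rule nn_integral_cmult[symmetric]) measurable
    also have "\<dots> \<le> (\<integral>\<^sup>+\<xi>. ennreal (2 powr s) * (a \<xi> * q (\<zeta> - r *\<^sub>R \<xi>) + ennreal (r powr s) * (p (\<zeta> - r *\<^sub>R \<xi>) * b \<xi>)) \<partial>lborel)"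
    proof (rule nn_integral_mono)
      fix \<xi> :: "real^'n"
      define u v where "u = norm (fourier g \<xi>)" and "v = norm (fourier f (\<zeta> - r *\<^sub>R \<xi>))"
      have uv: "u \<ge> 0" "v \<ge> 0" by (auto simp: u_def v_def)
      have "norm (r *\<^sub>R \<xi>) powr s = r powr s * norm \<xi> powr s" using r by (simp add: powr_mult)
      also have "norm \<xi> powr s \<le> wt s \<xi>"
      proof -
        have "norm \<xi> powr s = ((norm \<xi>)\<^sup>2) powr (s / 2)" by (cases "norm \<xi> = 0") (simp_all add: powr_powr flip: powr_numeral)
        also have "\<dots> \<le> wt s \<xi>" unfolding wt_def using s0 by (intro powr_mono2) auto
        finally show ?thesis .
      qed
      finally have "norm (r *\<^sub>R \<xi>) powr s \<le> r powr s * wt s \<xi>" by (simp add: mult_left_mono)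
      moreover have "wt s \<zeta> \<le> 2 powr s * (wt s (\<zeta> - r *\<^sub>R \<xi>) + norm (r *\<^sub>R \<xi>) powr s)"
        using wt_triangle[OF s0, of "\<zeta> - r *\<^sub>R \<xi>" "r *\<^sub>R \<xi>"] by simp
      ultimately have "wt s \<zeta> \<le> 2 powr s * (wt s (\<zeta> - r *\<^sub>R \<xi>) + r powr s * wt s \<xi>)"
        by (smt (verit) mult_left_mono powr_ge_zero)
      then have "wt s \<zeta> * (u * v) \<le> 2 powr s * (wt s (\<zeta> - r *\<^sub>R \<xi>) + r powr s * wt s \<xi>) * (u * v)"
        using uv by (intro mult_right_mono) auto
      also have "\<dots> = 2 powr s * (u * (wt s (\<zeta> - r *\<^sub>R \<xi>) * v) + r powr s * (v * (wt s \<xi> * u)))"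
        by (simp add: algebra_simps)
      finally have "ennreal (wt s \<zeta> * (u * v)) \<le> ennreal (2 powr s * (u * (wt s (\<zeta> - r *\<^sub>R \<xi>) * v) + r powr s * (v * (wt s \<xi> * u))))"
        by (rule ennreal_leI)
      then show "ennreal (wt s \<zeta>) * ennreal (norm (fourier g \<xi> * fourier f (\<zeta> - r *\<^sub>R \<xi>)))
        \<le> ennreal (2 powr s) * (a \<xi> * q (\<zeta> - r *\<^sub>R \<xi>) + ennreal (r powr s) * (p (\<zeta> - r *\<^sub>R \<xi>) * b \<xi>))"
        using uv unfolding a_def b_def p_def q_def norm_mult u_def[symmetric] v_def[symmetric]
        by (simp add: ennreal_mult ennreal_plus)
    qed
    also have "\<dots> = ennreal (2 powr s) * (T1 \<zeta> + ennreal (r powr s) * T2 \<zeta>)"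
      unfolding T1_def T2_def by (simp add: nn_integral_cmult nn_integral_add)
    finally show ?thesis .
  qed
  have "(\<integral>\<^sup>+\<zeta>. ennreal ((norm (of_real (wt s \<zeta>) * ?F \<zeta>))\<^sup>2) \<partial>lborel)
     \<le> (\<integral>\<^sup>+\<zeta>. ennreal ((2 powr s)\<^sup>2) * (2 * (T1 \<zeta>)\<^sup>2 + 2 * (ennreal (r powr s) * T2 \<zeta>)\<^sup>2) \<partial>lborel)"
  proof (rule nn_integral_mono)
    fix \<zeta>
    have "ennreal ((norm (of_real (wt s \<zeta>) * ?F \<zeta>))\<^sup>2) = (ennreal (norm (of_real (wt s \<zeta>) * ?F \<zeta>)))\<^sup>2"
      by (simp add: ennreal_power)
    also have "\<dots> \<le> (ennreal (2 powr s) * (T1 \<zeta> + ennreal (r powr s) * T2 \<zeta>))\<^sup>2"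
      by (intro power_mono pw) auto
    also have "\<dots> = ennreal ((2 powr s)\<^sup>2) * (T1 \<zeta> + ennreal (r powr s) * T2 \<zeta>)\<^sup>2"
      by (simp add: power_mult_distrib ennreal_power)
    also have "\<dots> \<le> ennreal ((2 powr s)\<^sup>2) * (2 * (T1 \<zeta>)\<^sup>2 + 2 * (ennreal (r powr s) * T2 \<zeta>)\<^sup>2)"
      by (intro mult_left_mono ennreal_square_sum_le) auto
    finally show "ennreal ((norm (of_real (wt s \<zeta>) * ?F \<zeta>))\<^sup>2) \<le> \<dots>" .
  qed
  also have "\<dots> = ennreal ((2 powr s)\<^sup>2) * (2 * (\<integral>\<^sup>+\<zeta>. (T1 \<zeta>)\<^sup>2 \<partial>lborel) + 2 * (\<integral>\<^sup>+\<zeta>. (ennreal (r powr s) * T2 \<zeta>)\<^sup>2 \<partial>lborel))"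
    by (simp add: nn_integral_cmult nn_integral_add)
  also have "\<dots> \<le> ennreal ((2 powr s)\<^sup>2) * (2 * ennreal ((W * A * B)\<^sup>2) + 2 * ennreal ((W * A * B)\<^sup>2))"
    by (intro mult_left_mono add_mono t1 t2) auto
  also have "\<dots> = ennreal ((2 powr s)\<^sup>2 * (2 * (W * A * B)\<^sup>2 + 2 * (W * A * B)\<^sup>2))"
  proof -
    have "ennreal c * (2 * ennreal X + 2 * ennreal X) = ennreal (c * (2 * X + 2 * X))" if "c \<ge> 0" "X \<ge> 0" for c X
      by (simp only: mult_2 ennreal_mult ennreal_plus that add_nonneg_nonneg)
    then show ?thesis by simp
  qed
  also have "(2 powr s)\<^sup>2 * (2 * (W * A * B)\<^sup>2 + 2 * (W * A * B)\<^sup>2) = (2 * 2 powr s * W * A * B)\<^sup>2"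
    by (simp add: power2_eq_square)
  finally have "L2_le (\<lambda>\<zeta>. of_real (wt s \<zeta>) * ?F \<zeta>) (2 * 2 powr s * W * A * B)"
    using fourier_Cc_measurable[OF C] W0 A B by (simp add: L2_le_def)
  then show ?thesis using C by (simp add: hs_def)
qed

lemma hs_mult:
  fixes f g :: "real^'n::finite \<Rightarrow> complex"
  assumes W: "L2_le (\<lambda>\<xi>::real^'n. complex_of_real (wt (- s) \<xi>)) W" and s: "2 * s \<ge> real CARD('n)"
    and g: "hs s g A" and f: "hs s f B"
  shows "hs s (\<lambda>x. g x * f x) (2 * 2 powr s * W * A * B)"
  using hs_mult_dilated[OF assms, of 1] by simp

text \<open>Zooming in.  At frequencies above \<open>L\<close> the order \<open>s > t\<close> gains \<open>(1 + L^2)^((t - s)/2)\<close> over a bound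
  that is uniform in \<open>r\<close>; below \<open>L\<close> the transform is small because \<open>g (r z)\<close> is uniformly close to
  \<open>g 0\<close> on the support of \<open>\<kappa>\<close>.\<close>

theorem hs_zoom_small:
  fixes \<kappa> :: "real^'n::finite \<Rightarrow> complex"
  assumes t: "real CARD('n) / 2 < t" "t < s" and \<kappa>: "test_function \<kappa>" and A: "A > 0" and e: "e > 0"
  obtains r0 where "0 < r0" "r0 \<le> 1"
    "\<And>g r. hs s g A \<Longrightarrow> 0 < r \<Longrightarrow> r \<le> r0 \<Longrightarrow> hs t (\<lambda>z. (g (r *\<^sub>R z) - g 0) * \<kappa> z) e"
proof -
  let ?n = "CARD('n)"
  have s: "real ?n / 2 < s" using t by simp
  obtain W where W: "L2_le (\<lambda>\<xi>::real^'n. complex_of_real (wt (- s) \<xi>)) W" using ex_L2_le_wt[OF s] by blast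
  have W0: "W > 0" using W L2_leD by blast
  obtain B where B: "hs s \<kappa> B" using test_function_hs[OF \<kappa>] by blast
  have B0: "B > 0" using B hsD by blast
  have C\<kappa>: "Cc \<kappa>" using test_function_Cc[OF \<kappa>] .
  obtain R where R: "\<And>x. norm x > R \<Longrightarrow> \<kappa> x = 0" using C\<kappa> by (auto simp: Cc_def)
  \<comment> \<open>A bound of the stronger order \<open>s\<close> that does not depend on \<open>r\<close>.\<close>
  define Q where "Q = 2 * 2 powr s * W * A * B + W * A * B"
  have Q: "Q > 0" using W0 A B0 by (auto simp: Q_def intro!: add_pos_pos mult_pos_pos)
  have bound: "hs s (\<lambda>z. (g (r *\<^sub>R z) - g 0) * \<kappa> z) Q" if g: "hs s g A" and r: "0 < r" "r \<le> 1" for g r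
  proof -
    have "hs s (\<lambda>z. g (r *\<^sub>R z) * \<kappa> z) (2 * 2 powr s * W * A * B)"
      by (rule hs_mult_dilated[OF W _ g B r]) (use s in simp)
    moreover have "hs s (\<lambda>z. g 0 * \<kappa> z) (W * A * B)"
      by (rule hs_cmult[OF B hs_bound[OF W g]]) (use W0 A in simp)
    ultimately show ?thesis unfolding Q_def left_diff_distrib by (rule hs_diff)
  qed
  have "((\<lambda>y::real. y powr ((t - s) / 2)) \<longlongrightarrow> 0) at_top"
    using t by (intro tendsto_neg_powr filterlim_ident) simp
  then have "\<forall>\<^sub>F y in at_top. y powr ((t - s) / 2) < e / (2 * Q)"
    by (rule order_tendstoD) (use e Q in simp)
  from eventually_happens[OF eventually_conj[OF eventually_gt_at_top[of 1] this]]
  obtain y where y: "y > 1" "y powr ((t - s) / 2) < e / (2 * Q)" by auto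
  \<comment> \<open>Above the frequency \<open>L\<close> the gain leaves at most \<open>e / 2\<close> of the bound \<open>Q\<close>.\<close>
  define L where "L = sqrt (y - 1)"
  have L0: "L > 0" and L: "(1 + L\<^sup>2) powr ((t - s) / 2) < e / (2 * Q)"
    using y by (auto simp: L_def)
  obtain S where S: "L2_le (\<lambda>\<zeta>::real^'n. indicator (ball 0 L) \<zeta> * of_real (wt t \<zeta>) :: complex) S"
  proof -
    have int: "integrable lborel (\<lambda>\<zeta>::real^'n. ((1 + L\<^sup>2) powr (t / 2))\<^sup>2 * indicator (ball 0 L) \<zeta>)"
      by (intro integrable_mult_right integrable_real_indicator emeasure_lborel_ball_finite) auto
    have m: "(\<lambda>\<zeta>::real^'n. indicator (ball 0 L) \<zeta> * of_real (wt t \<zeta>) :: complex) \<in> borel_measurable lborel"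
      by (intro borel_measurable_times borel_measurable_indicator) auto
    have "integrable lborel (\<lambda>\<zeta>::real^'n. (norm (indicator (ball 0 L) \<zeta> * of_real (wt t \<zeta>) :: complex))\<^sup>2)"
    proof (rule Bochner_Integration.integrable_bound[OF int])
      have pw: "(norm (indicator (ball 0 L) \<zeta> * of_real (wt t \<zeta>) :: complex))\<^sup>2 \<le> ((1 + L\<^sup>2) powr (t / 2))\<^sup>2 * indicator (ball 0 L) \<zeta>" for \<zeta> :: "real^'n"
      proof (cases "norm \<zeta> < L")
        case True
        then have "wt t \<zeta> \<le> (1 + L\<^sup>2) powr (t / 2)"
          unfolding wt_def using t by (intro powr_mono2) (auto intro!: power_mono)
        then show ?thesis using True by (simp add: power_mono)
      qed auto
      show "AE \<zeta>::real^'n in lborel. norm ((norm (indicator (ball 0 L) \<zeta> * of_real (wt t \<zeta>) :: complex))\<^sup>2) \<le> norm (((1 + L\<^sup>2) powr (t / 2))\<^sup>2 * indicator (ball 0 L) \<zeta> :: real)"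
        by (intro AE_I2) (unfold real_norm_def abs_power2, rule order_trans[OF pw abs_ge_self])
      show "(\<lambda>\<zeta>::real^'n. (norm (indicator (ball 0 L) \<zeta> * of_real (wt t \<zeta>) :: complex))\<^sup>2) \<in> borel_measurable lborel"
        by (intro borel_measurable_power) (rule measurable_compose[OF m borel_measurable_norm])
    qed
    with m have "square_integrable (\<lambda>\<zeta>::real^'n. indicator (ball 0 L) \<zeta> * of_real (wt t \<zeta>) :: complex)"
      by (simp only: square_integrable_def)
    from ex_L2_le[OF this] that show thesis by blast
  qed
  have S0: "S > 0" using S L2_leD by blast
  define V where "V = (LINT z|lborel. norm (\<kappa> z)) + 1"
  have V0: "V > 0" by (auto simp: V_def intro!: add_nonneg_pos)
  \<comment> \<open>Below \<open>L\<close> the transform is at most \<open>\<omega> A V\<close>; multiplication with the norm \<open>S\<close> of the truncated weight gives \<open>e / 2\<close>.\<close>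
  define \<omega> where "\<omega> = e / (2 * S * V * A)"
  have \<omega>: "\<omega> > 0" using e S0 V0 A by (simp add: \<omega>_def)
  obtain \<delta> where \<delta>: "\<delta> > 0" "\<And>(g :: real^'n \<Rightarrow> complex) A x. hs s g A \<Longrightarrow> norm x < \<delta> \<Longrightarrow> norm (g x - g 0) \<le> \<omega> * A"
    using hs_equicontinuous[OF s \<omega>] by blast
  define r0 where "r0 = min 1 (\<delta> / (2 * (\<bar>R\<bar> + 1)))"
  have r0: "r0 > 0" "r0 \<le> 1" using \<delta> by (auto simp: r0_def)
  have "hs t (\<lambda>z. (g (r *\<^sub>R z) - g 0) * \<kappa> z) e" if g: "hs s g A" and r: "0 < r" "r \<le> r0" for g r
  proof -
    let ?G = "\<lambda>z. (g (r *\<^sub>R z) - g 0) * \<kappa> z"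
    have hG: "hs s ?G Q" using bound[OF g r(1)] r r0 by simp
    have CG: "Cc ?G" using hsD(1)[OF hG] .
    have [measurable]: "fourier ?G \<in> borel_measurable borel" by (rule fourier_Cc_measurable[OF CG])
    have low: "norm (fourier ?G \<zeta>) \<le> \<omega> * A * V" for \<zeta>
    proof -
      have "norm (fourier ?G \<zeta>) \<le> (LINT z|lborel. norm (?G z))" by (rule fourier_bound[OF Cc_integrable[OF CG]])
      also have "\<dots> \<le> (LINT z|lborel. \<omega> * A * norm (\<kappa> z))"
      proof (rule integral_mono)
        fix z
        show "norm (?G z) \<le> \<omega> * A * norm (\<kappa> z)"
        proof (cases "norm z > R")
          case False
          have "norm (r *\<^sub>R z) \<le> r0 * \<bar>R\<bar>" using False r by (auto intro!: mult_mono)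
          also have "\<dots> \<le> \<delta> / (2 * (\<bar>R\<bar> + 1)) * \<bar>R\<bar>" unfolding r0_def by (intro mult_right_mono) auto
          also have "\<dots> < \<delta>" using \<delta>(1) by (simp add: field_simps) (smt (verit) mult_nonneg_nonneg abs_ge_zero)
          finally show ?thesis unfolding norm_mult by (intro mult_right_mono \<delta>(2)[OF g]) auto
        qed (use R in auto)
      qed (use Cc_integrable[OF CG] Cc_integrable[OF C\<kappa>] in auto)
      also have "\<dots> \<le> \<omega> * A * V" using \<omega> A by (simp add: V_def)
      finally show ?thesis .
    qed
    have "L2_le (\<lambda>\<zeta>. of_real (of_bool (norm \<zeta> \<ge> L) * wt t \<zeta>) * fourier ?G \<zeta>) ((1 + L\<^sup>2) powr ((t - s) / 2) * Q)"
    proof (rule L2_le_mono[OF L2_le_cmult[OF hsD(3)[OF hG], of "of_real ((1 + L\<^sup>2) powr ((t - s) / 2))" "(1 + L\<^sup>2) powr ((t - s) / 2)"]])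
      fix \<zeta> :: "real^'n"
      have "of_bool (norm \<zeta> \<ge> L) * wt t \<zeta> \<le> (1 + L\<^sup>2) powr ((t - s) / 2) * wt s \<zeta>"
      proof (cases "norm \<zeta> \<ge> L")
        case True
        have "wt t \<zeta> = wt (t - s) \<zeta> * wt s \<zeta>" by (simp add: wt_mult)
        also have "\<dots> \<le> (1 + L\<^sup>2) powr ((t - s) / 2) * wt s \<zeta>"
        proof (intro mult_right_mono)
          show "wt (t - s) \<zeta> \<le> (1 + L\<^sup>2) powr ((t - s) / 2)"
            unfolding wt_def using t True L0 by (intro powr_mono2') (auto intro!: power_mono add_pos_nonneg)
        qed simp
        finally show ?thesis using True by simp
      qed simp
      then have "of_bool (norm \<zeta> \<ge> L) * wt t \<zeta> * norm (fourier ?G \<zeta>) \<le> (1 + L\<^sup>2) powr ((t - s) / 2) * wt s \<zeta> * norm (fourier ?G \<zeta>)"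
        by (rule mult_right_mono) simp
      then show "norm (of_real (of_bool (norm \<zeta> \<ge> L) * wt t \<zeta>) * fourier ?G \<zeta>)
         \<le> norm (of_real ((1 + L\<^sup>2) powr ((t - s) / 2)) * (of_real (wt s \<zeta>) * fourier ?G \<zeta>))"
        by (simp add: norm_mult)
    qed (use zero_le_power2[of L] in \<open>auto simp del: zero_le_power2 intro!: less_imp_neq[symmetric] add_pos_nonneg\<close>)
    moreover have "L2_le (\<lambda>\<zeta>. of_real (of_bool (norm \<zeta> < L) * wt t \<zeta>) * fourier ?G \<zeta>) ((\<omega> * A * V) * S)"
    proof (rule L2_le_mono[OF L2_le_cmult[OF S, of "of_real (\<omega> * A * V)" "\<omega> * A * V"]])
      fix \<zeta> :: "real^'n"
      show "norm (of_real (of_bool (norm \<zeta> < L) * wt t \<zeta>) * fourier ?G \<zeta>) \<le> norm (of_real (\<omega> * A * V) * (indicator (ball 0 L) \<zeta> * of_real (wt t \<zeta>) :: complex))"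
        using low[of \<zeta>] \<omega> A V0 by (auto simp: norm_mult indicator_def mult.commute[of "wt t \<zeta>"] intro!: mult_right_mono)
    qed (use \<omega> A V0 in \<open>auto simp: norm_mult\<close>)
    ultimately have "L2_le (\<lambda>\<zeta>. of_real (of_bool (norm \<zeta> \<ge> L) * wt t \<zeta>) * fourier ?G \<zeta> + of_real (of_bool (norm \<zeta> < L) * wt t \<zeta>) * fourier ?G \<zeta>)
       ((1 + L\<^sup>2) powr ((t - s) / 2) * Q + (\<omega> * A * V) * S)" by (rule L2_le_add)
    then have "L2_le (\<lambda>\<zeta>. of_real (wt t \<zeta>) * fourier ?G \<zeta>) e"
    proof (rule L2_le_mono)
      have "(1 + L\<^sup>2) powr ((t - s) / 2) * Q \<le> e / 2" using L Q by (simp add: field_simps)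
      moreover have "(\<omega> * A * V) * S = e / 2" using A V0 S0 by (simp add: \<omega>_def)
      ultimately show "(1 + L\<^sup>2) powr ((t - s) / 2) * Q + (\<omega> * A * V) * S \<le> e" by linarith
      show "norm (of_real (wt t \<zeta>) * fourier ?G \<zeta>) \<le> norm (of_real (of_bool (norm \<zeta> \<ge> L) * wt t \<zeta>) * fourier ?G \<zeta> + of_real (of_bool (norm \<zeta> < L) * wt t \<zeta>) * fourier ?G \<zeta>)" for \<zeta>
        by (cases "norm \<zeta> \<ge> L") auto
    qed measurable
    then show ?thesis using CG by (simp add: hs_def)
  qed
  then show thesis using that r0 by blast
qed

section \<open>Distributions in Sobolev spaces\<close>

text \<open>If \<open>f x \<noteq> 0\<close>, the integral of \<open>f\<close> against a nonnegative bump supported where \<open>|f - f x| \<le> |f x| / 2\<close>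
  differs from \<open>f x\<close> times the integral of the bump by at most half of it.\<close>

lemma continuous_zero_by_testing:
  fixes f :: "real^'n::finite \<Rightarrow> complex"
  assumes f: "continuous_on UNIV f" and U: "open U" "x \<in> U"
    and test: "\<And>\<psi>. test_function \<psi> \<Longrightarrow> (\<And>y. y \<notin> U \<Longrightarrow> \<psi> y = 0) \<Longrightarrow> regular_dist f \<psi> = 0"
  shows "f x = 0"
proof (rule ccontr)
  assume z: "f x \<noteq> 0"
  obtain d where d: "d > 0" "\<And>y. dist y x < d \<Longrightarrow> dist (f y) (f x) < norm (f x) / 2"
    using f z unfolding continuous_on_iff by (metis UNIV_I half_gt_zero zero_less_norm_iff)
  obtain e where e: "e > 0" "ball x e \<subseteq> U" using U open_contains_ball by blast
  define r where "r = min d e / 2"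
  have r: "r > 0" "2 * r \<le> d" "2 * r \<le> e" using d e by (auto simp: r_def)
  define p where "p y = plateau ((1 / r) *\<^sub>R y + (- (1 / r) *\<^sub>R x))" for y
  have p_eq: "p y = plateau ((1 / r) *\<^sub>R (y - x))" for y by (simp add: p_def algebra_simps)
  have tp: "test_function p"
    unfolding p_def using r by (intro test_function_affine test_function_plateau) simp
  have p0: "p y = 0" if "dist y x \<ge> 2 * r" for y
    unfolding p_eq using that r by (intro plateau_0) (simp add: dist_norm divide_simps)
  have p1: "p y = 1" if "dist y x \<le> r" for y
    unfolding p_eq using that r by (intro plateau_1) (simp add: dist_norm divide_simps)
  have ip: "integrable lborel p" by (intro schwartz_integrable test_function_schwartz tp)
  have [measurable]: "f \<in> borel_measurable borel" "p \<in> borel_measurable borel"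
    using f ip by (auto intro: borel_measurable_continuous_onI)
  have pr: "p y = of_real (norm (p y))" for y
    using plateau_range(1) plateau_real unfolding p_eq by (metis abs_of_nonneg norm_of_real)
  define I where "I = (LINT y|lborel. norm (p y))"
  have pI: "(LINT y|lborel. p y) = of_real I"
    unfolding I_def by (subst pr) (rule integral_complex_of_real)
  have diff: "norm ((f x - f y) * p y) \<le> norm (f x) / 2 * norm (p y)" for y
  proof (cases "dist y x < 2 * r")
    case True
    then have "norm (f x - f y) \<le> norm (f x) / 2"
      using d(2)[of y] r by (simp add: dist_norm norm_minus_commute)
    then show ?thesis unfolding norm_mult by (intro mult_right_mono) auto
  qed (use p0 in auto)
  have i1: "integrable lborel (\<lambda>y. (f x - f y) * p y)"
    by (rule Bochner_Integration.integrable_bound[where f = "\<lambda>y. norm (f x) / 2 * norm (p y)"])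
      (use ip diff in auto)
  have i2: "integrable lborel (\<lambda>y. f x * p y)" using ip by simp
  have "regular_dist f p = 0" by (rule test[OF tp]) (use p0 e r in \<open>force simp: dist_commute subset_iff not_less[symmetric]\<close>)
  moreover have "regular_dist f p = (LINT y|lborel. f x * p y) - (LINT y|lborel. (f x - f y) * p y)"
    unfolding regular_dist_def Bochner_Integration.integral_diff[OF i2 i1, symmetric]
    by (intro Bochner_Integration.integral_cong) (auto simp: algebra_simps)
  ultimately have "f x * of_real I = (LINT y|lborel. (f x - f y) * p y)" by (simp add: pI)
  then have "norm (f x * of_real I) \<le> (LINT y|lborel. norm ((f x - f y) * p y))"
    by (simp only: integral_norm_bound)
  also have "\<dots> \<le> (LINT y|lborel. norm (f x) / 2 * norm (p y))"
    by (rule integral_mono) (use i1 ip diff in auto)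
  also have "\<dots> = norm (f x) / 2 * I" unfolding I_def by (rule integral_mult_right_zero)
  finally have le: "norm (f x) * \<bar>I\<bar> \<le> norm (f x) / 2 * I" by (simp add: norm_mult)
  have "measure lborel (ball x r) = (LINT y|lborel. indicator (ball x r) y)" by simp
  also have "\<dots> \<le> I" unfolding I_def
  proof (rule integral_mono)
    show "integrable lborel (\<lambda>y. indicator (ball x r) y :: real)"
      by (intro integrable_real_indicator emeasure_lborel_ball_finite) auto
    show "indicator (ball x r) y \<le> norm (p y)" for y using p1[of y] by (auto simp: indicator_def dist_commute)
  qed (use ip in auto)
  finally have "I > 0" using content_ball_pos[OF r(1), of x] by linarith
  then show False using le z by (simp add: field_simps)
qed

lemma regular_dist_integrable:
  fixes f :: "real^'n::finite \<Rightarrow> complex"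
  assumes "continuous_on UNIV f" "test_function \<psi>"
  shows "integrable lborel (\<lambda>x. f x * \<psi> x)"
  using Cc_integrable[OF Cc_mult[OF assms(1) test_function_Cc[OF assms(2)]]] .

lemma continuous_eq_by_testing:
  fixes f g :: "real^'n::finite \<Rightarrow> complex"
  assumes f: "continuous_on UNIV f" and g: "continuous_on UNIV g"
    and eq: "\<And>\<psi>. test_function \<psi> \<Longrightarrow> regular_dist f \<psi> = regular_dist g \<psi>"
  shows "f = g"
proof
  fix x
  have "f x - g x = 0"
  proof (rule continuous_zero_by_testing[of "\<lambda>x. f x - g x" UNIV])
    show "continuous_on UNIV (\<lambda>x. f x - g x)" by (intro continuous_intros f g)
    fix \<psi> :: "real^'n \<Rightarrow> complex" assume t: "test_function \<psi>"
    show "regular_dist (\<lambda>x. f x - g x) \<psi> = 0"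
      using Bochner_Integration.integral_diff[OF regular_dist_integrable[OF f t] regular_dist_integrable[OF g t]] eq[OF t]
      by (simp add: regular_dist_def left_diff_distrib)
  qed auto
  then show "f x = g x" by simp
qed

lemma cont_rep_eqI:
  assumes "continuous_on UNIV f" "\<And>x. norm (f x) \<le> B" "\<And>\<psi>. test_function \<psi> \<Longrightarrow> u \<psi> = regular_dist f \<psi>"
  shows "cont_rep u = f"
  unfolding cont_rep_def
proof (rule the_equality)
  have "bounded (range f)" unfolding bounded_iff using assms(2) by blast
  then show "continuous_on UNIV f \<and> bounded (range f) \<and> (\<forall>\<phi>. test_function \<phi> \<longrightarrow> u \<phi> = regular_dist f \<phi>)"
    using assms by blast
  fix g assume "continuous_on UNIV g \<and> bounded (range g) \<and> (\<forall>\<phi>. test_function \<phi> \<longrightarrow> u \<phi> = regular_dist g \<phi>)"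
  then show "g = f" using assms by (intro continuous_eq_by_testing) auto
qed

lemma bessel_op_eq: "bessel_op s v \<phi> = v (fourier (\<lambda>\<xi>. of_real (wt s \<xi>) * inv_fourier \<phi> \<xi>))"
  by (simp add: bessel_op_def dist_inv_fourier_def dist_mult_def dist_fourier_def wt_def)

lemma inv_fourier_swap:
  fixes a \<psi> :: "real^'n::finite \<Rightarrow> complex"
  assumes a: "integrable lborel a" and \<psi>: "integrable lborel \<psi>"
  shows "(LINT x|lborel. a x * inv_fourier \<psi> x) = (LINT x|lborel. inv_fourier a x * \<psi> x)"
proof -
  let ?c = "of_real ((2 * pi) ^ CARD('n)) :: complex"
  have [measurable]: "a \<in> borel_measurable borel" "fourier \<psi> \<in> borel_measurable borel"
    using a fourier_measurable[OF \<psi>] by auto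
  have ra: "integrable lborel (\<lambda>x. a (- x))" using integrable_lborel_affine[OF a, of "-1" 0] by simp
  have "(LINT x|lborel. a x * inv_fourier \<psi> x) = (LINT x|lborel. a x * fourier \<psi> (- x) / ?c)"
    by (simp add: inv_fourier_eq)
  also have "\<dots> = (LINT x|lborel. a x * fourier \<psi> (- x)) / ?c" by (rule integral_divide_zero)
  also have "(LINT x|lborel. a x * fourier \<psi> (- x)) = (LINT x|lborel. a (- x) * fourier \<psi> x)"
    by (subst integral_lborel_affine[where c = "-1" and t = 0]) auto
  also have "\<dots> = (LINT x|lborel. fourier (\<lambda>x. a (- x)) x * \<psi> x)" by (rule fourier_swap[OF ra \<psi>])
  also have "\<dots> / ?c = (LINT x|lborel. fourier (\<lambda>x. a (- x)) x * \<psi> x / ?c)" by (rule integral_divide_zero[symmetric])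
  also have "\<dots> = (LINT x|lborel. inv_fourier a x * \<psi> x)"
    by (simp add: inv_fourier_eq fourier_uminus_arg[OF a])
  finally show ?thesis .
qed

lemma test_function_zero: "test_function (\<lambda>x. 0)"
  by (auto simp: test_function_iff smooth_const)

lemma distribution_linear:
  assumes "distribution u" "test_function \<phi>" "test_function \<psi>"
  shows "u (\<lambda>x. a * \<phi> x + b * \<psi> x) = a * u \<phi> + b * u \<psi>"
  using assms unfolding distribution_def linear_on_functions_def by blast

lemma distribution_zero:
  assumes "distribution u"
  shows "u (\<lambda>x. 0) = 0"
  using distribution_linear[OF assms test_function_zero test_function_zero, of 0 0] by simp

lemma test_function_sum:
  assumes "finite I" "\<And>i. i \<in> I \<Longrightarrow> test_function (f i)"
  shows "test_function (\<lambda>x. \<Sum>i\<in>I. f i x)"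
  using assms
proof (induction I rule: finite_induct)
  case (insert i I)
  then have "test_function (f i)" "test_function (\<lambda>x. \<Sum>i\<in>I. f i x)" by auto
  then obtain R S where "\<And>x. norm x > R \<Longrightarrow> f i x = 0" "\<And>x. norm x > S \<Longrightarrow> (\<Sum>i\<in>I. f i x) = 0"
    unfolding test_function_iff by blast
  then have "\<forall>x. norm x > max R S \<longrightarrow> f i x + (\<Sum>i\<in>I. f i x) = 0" by auto
  moreover have "smooth (\<lambda>x. f i x + (\<Sum>i\<in>I. f i x))"
    using insert by (intro smooth_add) (auto simp: test_function_iff)
  ultimately have "test_function (\<lambda>x. f i x + (\<Sum>i\<in>I. f i x))" unfolding test_function_iff by blast
  then show ?case using insert.hyps by simp
qed (simp add: test_function_zero)

lemma distribution_sum: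
  assumes "distribution u" "finite I" "\<And>i. i \<in> I \<Longrightarrow> test_function (f i)"
  shows "u (\<lambda>x. \<Sum>i\<in>I. f i x) = (\<Sum>i\<in>I. u (f i))"
  using assms(2,3)
proof (induction I rule: finite_induct)
  case (insert i I)
  then have "test_function (f i)" "test_function (\<lambda>x. \<Sum>i\<in>I. f i x)"
    by (auto intro!: test_function_sum)
  from distribution_linear[OF assms(1) this, of 1 1] show ?case using insert by simp
qed (simp add: distribution_zero[OF assms(1)])

text \<open>From the definition to functions.  The density \<open>g\<close> of \<open>(1 - \<Delta>)^(s/2) (\<eta> u)\<close> has an \<open>L\<^sup>2\<close> transform
  \<open>G\<close>, and \<open>wt (- s) * G\<close> is integrable because \<open>s > n/2\<close>; its inverse transform represents \<open>\<eta> u\<close>.\<close>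

theorem sobolev_norm_less_imp_hs:
  fixes u :: "'n::finite functional"
  assumes s: "s > real CARD('n) / 2" and u: "distribution u" and \<eta>: "test_function \<eta>"
    and K: "K > 0" and lt: "sobolev_norm s (dist_mult \<eta> u) < ennreal K"
  obtains f where "hs s f (sqrt ((2 * pi) ^ CARD('n)) * K)"
    "\<And>\<psi>. schwartz \<psi> \<Longrightarrow> u (\<lambda>x. \<eta> x * \<psi> x) = regular_dist f \<psi>"
proof -
  let ?v = "dist_mult \<eta> u"
  let ?c = "sqrt ((2 * pi) ^ CARD('n))"
  obtain W where W: "L2_le (\<lambda>\<xi>::real^'n. complex_of_real (wt (- s) \<xi>)) W" using ex_L2_le_wt[OF s] by blast
  have "?v \<in> sobolev s" using lt by (auto simp: sobolev_norm_def split: if_splits)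
  then obtain g where g: "square_integrable g" "\<And>\<phi>. schwartz \<phi> \<Longrightarrow> bessel_op s ?v \<phi> = regular_dist g \<phi>"
      "ennreal (L2_function_norm g) < ennreal K"
    using lt by (auto simp: sobolev_norm_def INF_less_iff)
  have gK: "L2_le g K"
    using g K by (intro L2_le_iff_square_integrable) (auto simp: ennreal_less_iff L2_function_norm_def)
  obtain G where G: "L2_le G (?c * K)" "\<And>h. schwartz h \<Longrightarrow> (LINT x|lborel. g x * fourier h x) = (LINT x|lborel. G x * h x)"
    using L2_fourier[OF gK] by blast
  define a where "a \<xi> = of_real (wt (- s) \<xi>) * G \<xi>" for \<xi>
  have ai: "integrable lborel a" unfolding a_def using L2_le_product(2)[OF W G(1)] .
  define f where "f = inv_fourier a"
  have rep: "u (\<lambda>x. \<eta> x * \<psi> x) = regular_dist f \<psi>" if \<psi>: "schwartz \<psi>" for \<psi>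
  proof -
    define h where "h \<xi> = of_real (wt (- s) \<xi>) * inv_fourier \<psi> \<xi>" for \<xi>
    have h: "schwartz h" unfolding h_def by (intro schwartz_mult temperate_wt schwartz_inv_fourier \<psi>)
    \<comment> \<open>\<open>fourier h\<close> is the test function for which the two weights cancel.\<close>
    have "(\<lambda>\<xi>. of_real (wt s \<xi>) * h \<xi>) = inv_fourier \<psi>"
      by (simp only: h_def wt_cancel[of "- s", unfolded minus_minus])
    then have "bessel_op s ?v (fourier h) = u (\<lambda>x. \<eta> x * \<psi> x)"
      by (simp add: bessel_op_eq inv_fourier_fourier[OF h] fourier_inv_fourier[OF \<psi>] dist_mult_def)
    then have "u (\<lambda>x. \<eta> x * \<psi> x) = (LINT x|lborel. g x * fourier h x)"
      using g(2)[OF schwartz_fourier[OF h]] by (simp add: regular_dist_def)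
    also have "\<dots> = (LINT x|lborel. G x * h x)" by (rule G(2)[OF h])
    also have "\<dots> = (LINT x|lborel. a x * inv_fourier \<psi> x)" by (simp add: a_def h_def mult_ac)
    also have "\<dots> = regular_dist f \<psi>"
      unfolding regular_dist_def f_def by (rule inv_fourier_swap[OF ai schwartz_integrable[OF \<psi>]])
    finally show ?thesis .
  qed
  obtain R where R: "\<And>x. norm x > R \<Longrightarrow> \<eta> x = 0" using \<eta> test_function_iff by blast
  have cf: "continuous_on UNIV f"
    unfolding f_def inv_fourier_eq[abs_def]
    by (intro continuous_intros continuous_on_compose2[OF fourier_continuous[OF ai, of UNIV]]) auto
  have "f x = 0" if "norm x > R" for x
  \<comment> \<open>\<open>f\<close> vanishes outside a ball that contains the support of \<open>\<eta>\<close>, because \<open>\<eta> u\<close> does.\<close>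
  proof (rule continuous_zero_by_testing[OF cf, of "{x. norm x > R}"])
    show "open {x::real^'n. norm x > R}" by (intro open_Collect_less continuous_intros)
    fix \<psi> :: "real^'n \<Rightarrow> complex" assume t: "test_function \<psi>" and z: "\<And>y. y \<notin> {x. norm x > R} \<Longrightarrow> \<psi> y = 0"
    have "(\<lambda>x. \<eta> x * \<psi> x) = (\<lambda>x. 0)" using R z by (auto simp: fun_eq_iff)
    then show "regular_dist f \<psi> = 0"
      using rep[OF test_function_schwartz[OF t]] distribution_zero[OF u] by simp
  qed (use that in simp)
  then have Cf: "Cc f" using cf by (auto simp: Cc_def)
  have "L2_le (\<lambda>\<xi>. of_real (wt s \<xi>) * fourier f \<xi>) (?c * K)"
  proof (rule L2_le_by_duality)
    show "smooth (\<lambda>\<xi>. of_real (wt s \<xi>) * fourier f \<xi>)"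
      using temperate_wt by (intro smooth_mult smooth_fourier Cc_rapid Cf) (auto simp: temperate_def)
    show "?c * K > 0" using K by simp
    fix h :: "real^'n \<Rightarrow> complex" and N assume h: "test_function h" "L2_le h N"
    have hs: "schwartz h" by (rule test_function_schwartz[OF h(1)])
    have ws: "schwartz (\<lambda>\<xi>. of_real (wt s \<xi>) * h \<xi>)" by (intro schwartz_mult temperate_wt hs)
    have "(LINT \<xi>|lborel. of_real (wt s \<xi>) * fourier f \<xi> * h \<xi>) = (LINT \<xi>|lborel. fourier f \<xi> * (of_real (wt s \<xi>) * h \<xi>))"
      by (simp add: mult_ac)
    also have "\<dots> = regular_dist f (fourier (\<lambda>\<xi>. of_real (wt s \<xi>) * h \<xi>))"
      unfolding regular_dist_def by (rule fourier_swap[symmetric, OF Cc_integrable[OF Cf] schwartz_integrable[OF ws]])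
    also have "\<dots> = bessel_op s ?v (fourier h)"
      by (simp add: rep[OF schwartz_fourier[OF ws], symmetric] bessel_op_eq inv_fourier_fourier[OF hs] dist_mult_def)
    also have "\<dots> = (LINT x|lborel. g x * fourier h x)"
      using g(2)[OF schwartz_fourier[OF hs]] by (simp add: regular_dist_def)
    finally show "norm (LINT \<xi>|lborel. of_real (wt s \<xi>) * fourier f \<xi> * h \<xi>) \<le> ?c * K * N"
      using L2_le_product(4)[OF gK L2_le_schwartz_fourier[OF hs h(2)]] by (simp add: mult_ac)
  qed
  then have "hs s f (?c * K)" using Cf by (simp add: hs_def)
  then show thesis using that rep by blast
qed

lemma Cc_tempered_distribution:
  fixes f :: "real^'n::finite \<Rightarrow> complex"
  assumes f: "Cc f" and v: "\<And>\<psi>. schwartz \<psi> \<Longrightarrow> v \<psi> = regular_dist f \<psi>"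
  shows "tempered_distribution v"
proof -
  have fi: "integrable lborel f" by (rule Cc_integrable[OF f])
  then have [measurable]: "f \<in> borel_measurable borel" by auto
  have bd: "norm (f x * \<psi> x) \<le> norm (f x) * (SUP x. norm (\<psi> x))" if "schwartz \<psi>" for \<psi> x
  proof -
    obtain B where "\<And>x. norm (\<psi> x) \<le> B" using schwartz_bounded[OF \<open>schwartz \<psi>\<close>] by blast
    then have "norm (\<psi> x) \<le> (SUP x. norm (\<psi> x))" by (intro cSUP_upper) (auto simp: bdd_above_def)
    then show ?thesis unfolding norm_mult by (intro mult_left_mono) auto
  qed
  have i: "integrable lborel (\<lambda>x. f x * \<psi> x)" if \<psi>: "schwartz \<psi>" for \<psi>
    using schwartz_measurable[OF \<psi>]
    by (intro Bochner_Integration.integrable_bound[OF integrable_mult_left[OF integrable_norm[OF fi], of "SUP x. norm (\<psi> x)"]])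
      (auto intro!: order_trans[OF bd[OF \<psi>] abs_ge_self])
  have lin: "linear_on_functions schwartz v"
    unfolding linear_on_functions_def
  proof (intro allI impI)
    fix \<phi> \<psi> :: "real^'n \<Rightarrow> complex" and a b assume p: "schwartz \<phi>" "schwartz \<psi>"
    have "schwartz (\<lambda>x. a * \<phi> x + b * \<psi> x)"
    proof (rule schwartzI)
      show "smooth (\<lambda>x. a * \<phi> x + b * \<psi> x)"
        by (intro smooth_add smooth_mult smooth_const schwartz_smooth p)
      fix k js
      let ?A = "\<lambda>x. a * \<phi> x" and ?B = "\<lambda>x. b * \<psi> x"
      have sA: "schwartz ?A" and sB: "schwartz ?B" by (intro schwartz_mult temperate_const p)+
      have "partials js (\<lambda>x. ?A x + ?B x) = (\<lambda>x. partials js ?A x + partials js ?B x)"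
      proof (induction js)
        case (Cons j js)
        have "partial_deriv j (\<lambda>x. partials js ?A x + partials js ?B x) = (\<lambda>x. partial_deriv j (partials js ?A) x + partial_deriv j (partials js ?B) x)"
          by (intro ext partial_deriv_add smooth_differentiable smooth_partials schwartz_smooth sA sB)
        then show ?case using Cons by simp
      qed simp
      moreover obtain C D where CD: "\<And>x. (1 + norm x) ^ k * norm (partials js ?A x) \<le> C" "\<And>x. (1 + norm x) ^ k * norm (partials js ?B x) \<le> D"
        using schwartz_bound[OF sA] schwartz_bound[OF sB] by metis
      moreover have le: "(1 + norm x) ^ k * norm (u + w) \<le> (1 + norm x) ^ k * norm u + (1 + norm x) ^ k * norm w" for x :: "real^'n" and u w :: complex
        unfolding distrib_left[symmetric] by (intro mult_left_mono norm_triangle_ineq) auto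
      ultimately show "\<exists>C. \<forall>x. (1 + norm x) ^ k * norm (partials js (\<lambda>x. ?A x + ?B x) x) \<le> C"
        by (auto intro!: exI[of _ "C + D"] order_trans[OF le add_mono[OF CD]])
    qed
    then have "v (\<lambda>x. a * \<phi> x + b * \<psi> x) = (LINT x|lborel. a * (f x * \<phi> x) + b * (f x * \<psi> x))"
      by (simp add: v regular_dist_def algebra_simps)
    also have "\<dots> = a * v \<phi> + b * v \<psi>"
      using i[OF p(1)] i[OF p(2)] by (simp add: v p regular_dist_def)
    finally show "v (\<lambda>x. a * \<phi> x + b * \<psi> x) = a * v \<phi> + b * v \<psi>" .
  qed
  have one: "{js :: 'n list. length js \<le> 0} = {[]}" by auto
  have "norm (v \<psi>) \<le> (LINT x|lborel. norm (f x)) * (\<Sum>js | length js \<le> 0. SUP x. (1 + norm x) ^ 0 * norm (partials js \<psi> x))"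
    if \<psi>: "schwartz \<psi>" for \<psi>
  proof -
    have "norm (v \<psi>) \<le> (LINT x|lborel. norm (f x * \<psi> x))"
      unfolding v[OF \<psi>] regular_dist_def by (rule integral_norm_bound)
    also have "\<dots> \<le> (LINT x|lborel. norm (f x) * (SUP x. norm (\<psi> x)))"
      by (rule integral_mono) (use i[OF \<psi>] fi bd[OF \<psi>] in auto)
    also have "\<dots> = (LINT x|lborel. norm (f x)) * (SUP x. norm (\<psi> x))" by (rule integral_mult_left_zero)
    finally show ?thesis unfolding one by simp
  qed
  then show ?thesis unfolding tempered_distribution_def using lin by blast
qed

text \<open>From functions back to the definition: the density is the inverse \<open>L\<^sup>2\<close> transform of
  \<open>wt t * fourier f\<close>.\<close>

theorem hs_imp_sobolev_norm_le:
  fixes f :: "real^'n::finite \<Rightarrow> complex"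
  assumes f: "hs s f M" and t: "t \<le> s" and v: "\<And>\<psi>. schwartz \<psi> \<Longrightarrow> v \<psi> = regular_dist f \<psi>"
  shows "sobolev_norm t v \<le> ennreal M"
proof -
  let ?C = "(2 * pi) ^ CARD('n)"
  have Cf: "Cc f" by (rule hsD(1)[OF f])
  have M: "M > 0" by (rule hsD(2)[OF f])
  have [measurable]: "fourier f \<in> borel_measurable borel" using Cf by measurable
  \<comment> \<open>The reflection turns the transform provided by \<open>L2_fourier\<close> into an inverse transform.\<close>
  define b where "b \<xi> = of_real (wt t (- \<xi>)) * fourier f (- \<xi>)" for \<xi>
  have "(\<integral>\<^sup>+\<xi>. ennreal ((norm (b \<xi>))\<^sup>2) \<partial>lborel) = (\<integral>\<^sup>+\<xi>. ennreal ((norm (of_real (wt t \<xi>) * fourier f \<xi>))\<^sup>2) \<partial>lborel)"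
    unfolding b_def using nn_integral_lborel_affine[of "\<lambda>\<xi>. ennreal ((norm (of_real (wt t \<xi>) * fourier f \<xi>))\<^sup>2)" "-1" 0] by simp
  also have "\<dots> \<le> ennreal (M\<^sup>2)" using L2_leD(3)[OF hsD(3)[OF hs_mono[OF f t order_refl]]] .
  finally have bM: "L2_le b M" using M unfolding L2_le_def b_def by simp
  obtain G0 where G0: "L2_le G0 (sqrt ?C * M)" "\<And>h. schwartz h \<Longrightarrow> (LINT x|lborel. b x * fourier h x) = (LINT x|lborel. G0 x * h x)"
    using L2_fourier[OF bM] by blast
  define G where "G x = of_real (1 / ?C) * G0 x" for x
  have C1: "?C \<ge> 1" by (rule two_pi_power_ge_1)
  have "L2_le G (1 / ?C * (sqrt ?C * M))"
    unfolding G_def by (rule L2_le_cmult[OF G0(1)]) (use C1 in \<open>auto simp: norm_divide norm_power norm_mult\<close>)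
  then have GM: "L2_le G M"
  proof (rule L2_le_mono)
    have "sqrt ?C \<le> ?C" using C1 by (intro real_le_lsqrt) (auto intro: self_le_power)
    then have "sqrt ?C * M \<le> ?C * M" using M by simp
    then show "1 / ?C * (sqrt ?C * M) \<le> M" using C1 by (simp add: field_simps)
    show "G \<in> borel_measurable borel" unfolding G_def using L2_leD(1)[OF G0(1)] by measurable
  qed simp
  have rep: "bessel_op t v \<phi> = regular_dist G \<phi>" if \<phi>: "schwartz \<phi>" for \<phi>
  proof -
    have ws: "schwartz (\<lambda>\<xi>. of_real (wt t \<xi>) * inv_fourier \<phi> \<xi>)" by (intro schwartz_mult temperate_wt schwartz_inv_fourier \<phi>)
    have [measurable]: "fourier \<phi> \<in> borel_measurable borel" using schwartz_measurable[OF schwartz_fourier[OF \<phi>]] .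
    have "bessel_op t v \<phi> = (LINT x|lborel. f x * fourier (\<lambda>\<xi>. of_real (wt t \<xi>) * inv_fourier \<phi> \<xi>) x)"
      by (simp add: bessel_op_eq v[OF schwartz_fourier[OF ws]] regular_dist_def)
    also have "\<dots> = (LINT \<xi>|lborel. fourier f \<xi> * (of_real (wt t \<xi>) * inv_fourier \<phi> \<xi>))"
      by (rule fourier_swap[OF Cc_integrable[OF Cf] schwartz_integrable[OF ws]])
    also have "\<dots> = (LINT \<xi>|lborel. of_real (1 / ?C) * (of_real (wt t \<xi>) * fourier f \<xi> * fourier \<phi> (- \<xi>)))"
      by (simp add: inv_fourier_eq mult_ac)
    also have "\<dots> = of_real (1 / ?C) * (LINT \<xi>|lborel. of_real (wt t \<xi>) * fourier f \<xi> * fourier \<phi> (- \<xi>))"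
      by (rule integral_mult_right_zero)
    also have "(LINT \<xi>|lborel. of_real (wt t \<xi>) * fourier f \<xi> * fourier \<phi> (- \<xi>)) = (LINT \<xi>|lborel. b \<xi> * fourier \<phi> \<xi>)"
      unfolding b_def by (subst integral_lborel_affine[where c = "-1" and t = 0]) auto
    also have "\<dots> = (LINT x|lborel. G0 x * \<phi> x)" by (rule G0(2)[OF \<phi>])
    also have "of_real (1 / ?C) * \<dots> = regular_dist G \<phi>"
      unfolding regular_dist_def G_def mult.assoc by (rule integral_mult_right_zero[symmetric])
    finally show ?thesis .
  qed
  have "v \<in> sobolev t"
    unfolding sobolev_def using Cc_tempered_distribution[OF Cf v] L2_le_square_integrable(1)[OF GM] rep by blast
  then have "sobolev_norm t v \<le> ennreal (L2_function_norm G)"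
    unfolding sobolev_norm_def using L2_le_square_integrable(1)[OF GM] rep by (auto intro!: INF_lower)
  also have "\<dots> \<le> ennreal M" by (intro ennreal_leI L2_le_square_integrable(2)[OF GM])
  finally show ?thesis .
qed

section \<open>The function that represents a distribution\<close>

text \<open>\<open>\<psi>\<close> is multiplied by the quotients of finitely many bumps, which are equal to 1 on balls covering the
  support of \<open>\<psi>\<close>, by their sum.\<close>

lemma test_function_partition:
  fixes \<psi> :: "real^'n::finite \<Rightarrow> complex"
  assumes \<psi>: "test_function \<psi>" and r: "r > 0"
  obtains P \<theta> where "finite P" "\<And>p. test_function (\<theta> p)" "\<And>p x. norm (x - p) \<ge> r \<Longrightarrow> \<theta> p x = 0"
    "\<psi> = (\<lambda>x. \<Sum>p\<in>P. \<theta> p x)"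
proof -
  obtain R where R: "\<And>x. norm x > R \<Longrightarrow> \<psi> x = 0" using \<psi> test_function_iff by blast
  define K where "K = cball (0 :: real^'n) R"
  define c where "c = 2 / r"
  have c: "c > 0" using r by (simp add: c_def)
  define \<rho> where "\<rho> p x = plateau (c *\<^sub>R x + (- c *\<^sub>R p))" for p x :: "real^'n"
  have \<rho>_eq: "\<rho> p x = plateau (c *\<^sub>R (x - p))" for p x by (simp add: \<rho>_def algebra_simps)
  have sm: "smooth (\<rho> p)" for p unfolding \<rho>_def[abs_def] by (intro smooth_affine smooth_plateau)
  have \<rho>0: "\<rho> p x = 0" if "norm (x - p) \<ge> r" for p x
    unfolding \<rho>_eq using that r by (intro plateau_0) (simp add: c_def divide_simps)
  have \<rho>1: "\<rho> p x = 1" if "norm (x - p) \<le> r / 2" for p x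
    unfolding \<rho>_eq using that r by (intro plateau_1) (simp add: c_def divide_simps)
  have "compact K" by (simp add: K_def)
  moreover have "K \<subseteq> (\<Union>p\<in>K. ball p (r / 2))" using r by auto
  ultimately obtain P where P: "finite P" "K \<subseteq> (\<Union>p\<in>P. ball p (r / 2))"
    using compactE_image[of K K "\<lambda>p. ball p (r / 2)"] by (metis open_ball)
  define \<sigma> where "\<sigma> x = (\<Sum>p\<in>P. \<rho> p x)" for x
  have \<sigma>s: "smooth \<sigma>" unfolding \<sigma>_def[abs_def] by (intro smooth_sum sm)
  have \<sigma>0: "\<sigma> x \<noteq> 0" if xK: "x \<in> K" for x
  proof -
    obtain p where p: "p \<in> P" "x \<in> ball p (r / 2)" using P xK by blast
    have "1 = Re (\<rho> p x)" using \<rho>1[of x p] p by (simp add: dist_norm norm_minus_commute)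
    also have "\<dots> \<le> (\<Sum>p\<in>P. Re (\<rho> p x))"
      using p P plateau_range by (intro member_le_sum) (auto simp: \<rho>_eq)
    also have "\<dots> = Re (\<sigma> x)" by (simp add: \<sigma>_def)
    finally show ?thesis by auto
  qed
  define \<theta> where "\<theta> p x = \<rho> p x * \<psi> x / \<sigma> x" for p x
  have "smooth (\<theta> p)" for p
    unfolding \<theta>_def[abs_def] using R
    by (intro smooth_divide[where K = K] smooth_mult sm \<sigma>s \<sigma>0 test_function_smooth[OF \<psi>]) (auto simp: K_def)
  moreover have "\<theta> p x = 0" if "norm x > R" for p x using R[OF that] by (simp add: \<theta>_def)
  ultimately have "test_function (\<theta> p)" for p by (auto simp: test_function_iff)
  moreover have eq: "\<psi> x = (\<Sum>p\<in>P. \<theta> p x)" for x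
  proof (cases "x \<in> K")
    case True
    have "(\<Sum>p\<in>P. \<theta> p x) = \<sigma> x * \<psi> x / \<sigma> x" unfolding \<theta>_def \<sigma>_def by (simp add: sum_distrib_right sum_divide_distrib)
    then show ?thesis using \<sigma>0[OF True] by simp
  qed (use R in \<open>auto simp: K_def \<theta>_def\<close>)
  moreover have "\<theta> p x = 0" if "norm (x - p) \<ge> r" for p x using \<rho>0[OF that] by (simp add: \<theta>_def)
  ultimately show thesis using that[OF P(1)] by blast
qed

lemma test_function_nonzero_cball:
  assumes \<eta>: "test_function \<eta>" and x0: "\<eta> x0 \<noteq> 0"
  obtains r where "r > 0" "\<And>x. norm (x - x0) \<le> r \<Longrightarrow> \<eta> x \<noteq> 0"
proof -
  have "open {z. \<eta> z \<noteq> 0}"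
    by (intro open_Collect_neq continuous_on_const smooth_continuous_on test_function_smooth \<eta>)
  then obtain e where "e > 0" "cball x0 e \<subseteq> {z. \<eta> z \<noteq> 0}" using x0 unfolding open_contains_cball by blast
  then show thesis using that[of e] by (auto simp: dist_norm norm_minus_commute subset_iff)
qed

text \<open>The local representatives \<open>f y\<close> of \<open>\<eta> (x - y) u\<close> fit together: \<open>f y / \<eta> (x - y)\<close> does not depend on
  \<open>y\<close>, and at \<open>x\<close> the translate with \<open>y = x - x0\<close> is used.\<close>

lemma local_representatives_glue:
  fixes u :: "'n::finite functional"
  assumes u: "distribution u" and \<eta>: "test_function \<eta>" and x0: "\<eta> x0 \<noteq> 0"
    and W: "L2_le (\<lambda>\<xi>::real^'n. complex_of_real (wt (- s) \<xi>)) W"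
    and f: "\<And>y. hs s (f y) M"
    and rep: "\<And>y \<psi>. schwartz \<psi> \<Longrightarrow> u (\<lambda>x. \<eta> (x - y) * \<psi> x) = regular_dist (f y) \<psi>"
  obtains F where "continuous_on UNIV F" "\<And>x. norm (F x) \<le> W * M / norm (\<eta> x0)"
    "\<And>\<psi>. test_function \<psi> \<Longrightarrow> u \<psi> = regular_dist F \<psi>" "\<And>x y. f y x = F x * \<eta> (x - y)"
proof -
  have sm: "smooth (\<lambda>x. \<eta> (x - y))" for y by (intro smooth_translate test_function_smooth \<eta>)
  have cf: "continuous_on UNIV (f y)" for y using hsD(1)[OF f] by (simp add: Cc_def)
  have c\<eta>: "continuous_on UNIV (\<lambda>x. \<eta> (x - y))" for y by (rule smooth_continuous_on[OF sm])
  have sym: "(\<lambda>x. f y x * \<eta> (x - y')) = (\<lambda>x. f y' x * \<eta> (x - y))" for y y'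
  proof (rule continuous_eq_by_testing)
    fix \<psi> :: "real^'n \<Rightarrow> complex" assume t: "test_function \<psi>"
    have s: "schwartz (\<lambda>x. \<psi> x * \<eta> (x - z))" for z by (intro test_function_schwartz test_function_mult_smooth t sm)
    have "regular_dist (\<lambda>x. f y x * \<eta> (x - y')) \<psi> = regular_dist (f y) (\<lambda>x. \<psi> x * \<eta> (x - y'))"
      by (simp add: regular_dist_def mult_ac)
    also have "\<dots> = u (\<lambda>x. \<eta> (x - y) * (\<psi> x * \<eta> (x - y')))" by (rule rep[OF s, symmetric])
    also have "\<dots> = u (\<lambda>x. \<eta> (x - y') * (\<psi> x * \<eta> (x - y)))" by (simp add: mult_ac)
    also have "\<dots> = regular_dist (f y') (\<lambda>x. \<psi> x * \<eta> (x - y))" by (rule rep[OF s])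
    also have "\<dots> = regular_dist (\<lambda>x. f y' x * \<eta> (x - y)) \<psi>" by (simp add: regular_dist_def mult_ac)
    finally show "regular_dist (\<lambda>x. f y x * \<eta> (x - y')) \<psi> = regular_dist (\<lambda>x. f y' x * \<eta> (x - y)) \<psi>" .
  qed (intro continuous_intros cf c\<eta>)+
  define F where "F x = f (x - x0) x / \<eta> x0" for x
  have fF: "f y x = F x * \<eta> (x - y)" for x y
    using fun_cong[OF sym[of y "x - x0"], of x] x0 by (simp add: F_def field_simps)
  have bd: "norm (F x) \<le> W * M / norm (\<eta> x0)" for x
    unfolding F_def norm_divide by (intro divide_right_mono hs_bound[OF W f]) auto
  have "isCont F x" for x
  proof -
    define y where "y = x - x0"
    have "continuous_on UNIV (\<lambda>z. \<eta> (z - y))" by (rule c\<eta>)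
    moreover have "\<eta> (x - y) \<noteq> 0" using x0 by (simp add: y_def)
    ultimately have "isCont (\<lambda>z. f y z / \<eta> (z - y)) x"
      using cf[of y] by (intro continuous_intros) (auto simp: continuous_on_eq_continuous_at)
    moreover have ev: "\<forall>\<^sub>F z in nhds x. F z = f y z / \<eta> (z - y)"
    proof -
      have "\<forall>\<^sub>F z in nhds x. \<eta> (z - y) \<noteq> 0"
      proof (rule eventually_nhds_in_open[THEN eventually_mono])
        show "open {z. \<eta> (z - y) \<noteq> 0}"
          by (intro open_Collect_neq continuous_on_const c\<eta>)
      qed (use \<open>\<eta> (x - y) \<noteq> 0\<close> in auto)
      then show ?thesis by eventually_elim (simp add: fF)
    qed
    ultimately show ?thesis using isCont_cong[OF ev] by simp
  qed
  then have cF: "continuous_on UNIV F" by (simp add: continuous_at_imp_continuous_on)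
  obtain r where r: "r > 0" "\<And>x. norm (x - x0) \<le> r \<Longrightarrow> \<eta> x \<noteq> 0"
    using test_function_nonzero_cball[OF \<eta> x0] by blast
  have "u \<psi> = regular_dist F \<psi>" if \<psi>: "test_function \<psi>" for \<psi>
  proof -
    obtain P \<theta> where P: "finite P" "\<And>p. test_function (\<theta> p)" "\<And>p x. norm (x - p) \<ge> r \<Longrightarrow> \<theta> p x = 0" "\<psi> = (\<lambda>x. \<Sum>p\<in>P. \<theta> p x)"
      using test_function_partition[OF \<psi> r(1)] by blast
    have pc: "u (\<theta> p) = regular_dist F (\<theta> p)" for p
    proof -
      define \<kappa> where "\<kappa> x = \<theta> p x / \<eta> (x - (p - x0))" for x
      have nz: "\<eta> (x - (p - x0)) \<noteq> 0" if "x \<in> cball p r" for x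
        using that by (intro r(2)) (simp add: dist_norm norm_minus_commute)
      have e\<kappa>: "\<eta> (x - (p - x0)) * \<kappa> x = \<theta> p x" for x
        using nz[of x] P(3)[of x p] by (cases "x \<in> cball p r") (auto simp: \<kappa>_def dist_norm norm_minus_commute)
      have "smooth \<kappa>" unfolding \<kappa>_def[abs_def]
        by (rule smooth_divide[OF test_function_smooth[OF P(2)] sm closed_cball _ nz])
          (use P(3) in \<open>auto simp: dist_norm norm_minus_commute\<close>)
      moreover obtain R where "\<And>x. norm x > R \<Longrightarrow> \<theta> p x = 0" using P(2) test_function_iff by blast
      ultimately have "test_function \<kappa>" unfolding test_function_iff \<kappa>_def by (auto intro!: exI[of _ R])
      from rep[OF test_function_schwartz[OF this], of "p - x0"]
      have "u (\<theta> p) = regular_dist (f (p - x0)) \<kappa>" by (simp add: e\<kappa>)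
      also have "\<dots> = regular_dist F (\<theta> p)" by (simp add: regular_dist_def fF mult.assoc e\<kappa>)
      finally show ?thesis .
    qed
    have "u \<psi> = (\<Sum>p\<in>P. u (\<theta> p))" unfolding P(4) by (rule distribution_sum[OF u P(1,2)])
    also have "\<dots> = regular_dist F \<psi>"
      unfolding pc regular_dist_def P(4) sum_distrib_left
      by (rule Bochner_Integration.integral_sum[symmetric]) (rule regular_dist_integrable[OF cF P(2)])
    finally show ?thesis .
  qed
  then show thesis using that cF bd fF by blast
qed

text \<open>Near a point where \<open>\<eta>\<close> does not vanish, every cutoff of small support is a multiple of \<open>\<eta>\<close>, so a
  bound for the norm with cutoff \<open>\<eta>\<close> controls all cutoffs of small support.\<close>

theorem ul_norm_controls_small_cutoffs:
  fixes \<eta> :: "real^'n::finite \<Rightarrow> complex"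
  assumes s: "s > real CARD('n) / 2" and \<eta>: "test_function \<eta>" "\<eta> \<noteq> (\<lambda>_. 0)"
  obtains r C0 where "r > 0" "C0 > 0"
    "\<And>u K. distribution u \<Longrightarrow> K > 0 \<Longrightarrow> ul_norm s \<eta> u < ennreal K \<Longrightarrow>
      continuous_on UNIV (cont_rep u) \<and> (\<forall>x. norm (cont_rep u x) \<le> C0 * K) \<and> (\<forall>\<psi>. test_function \<psi> \<longrightarrow> u \<psi> = regular_dist (cont_rep u) \<psi>)"
    "\<And>\<kappa>. test_function \<kappa> \<Longrightarrow> (\<And>x. norm x > r \<Longrightarrow> \<kappa> x = 0) \<Longrightarrow>
      \<exists>C>0. \<forall>u K y. distribution u \<longrightarrow> K > 0 \<longrightarrow> ul_norm s \<eta> u < ennreal K \<longrightarrow> hs s (\<lambda>x. cont_rep u (x + y) * \<kappa> x) (C * K)"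
proof -
  obtain W where W: "L2_le (\<lambda>\<xi>::real^'n. complex_of_real (wt (- s) \<xi>)) W" using ex_L2_le_wt[OF s] by blast
  have W0: "W > 0" using W L2_leD by blast
  obtain x0 where x0: "\<eta> x0 \<noteq> 0" using \<eta>(2) by auto
  let ?c = "sqrt ((2 * pi) ^ CARD('n))"
  have c: "?c > 0" by simp
  define C0 where "C0 = W * ?c / norm (\<eta> x0)"
  have C0: "C0 > 0" using W0 x0 by (simp add: C0_def)
  obtain r where r: "r > 0" "\<And>x. norm (x - x0) \<le> r \<Longrightarrow> \<eta> x \<noteq> 0"
    using test_function_nonzero_cball[OF \<eta>(1) x0] by blast
  have main: "continuous_on UNIV (cont_rep u) \<and> (\<forall>x. norm (cont_rep u x) \<le> C0 * K) \<and> (\<forall>\<psi>. test_function \<psi> \<longrightarrow> u \<psi> = regular_dist (cont_rep u) \<psi>)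
      \<and> (\<forall>y. hs s (\<lambda>x. cont_rep u x * \<eta> (x - y)) (?c * K))"
    if u: "distribution u" and K: "K > 0" and lt: "ul_norm s \<eta> u < ennreal K" for u K
  proof -
    have "\<exists>f. hs s f (?c * K) \<and> (\<forall>\<psi>. schwartz \<psi> \<longrightarrow> u (\<lambda>x. \<eta> (x - y) * \<psi> x) = regular_dist f \<psi>)" for y
    proof -
      have "sobolev_norm s (dist_mult (\<lambda>x. \<eta> (x - y)) u) \<le> ul_norm s \<eta> u"
        unfolding ul_norm_def by (rule SUP_upper) simp
      then have "sobolev_norm s (dist_mult (\<lambda>x. \<eta> (x - y)) u) < ennreal K" using lt by simp
      from sobolev_norm_less_imp_hs[OF s u test_function_translate[OF \<eta>(1)] K this] show ?thesis by blast
    qed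
    then obtain f where f: "\<And>y. hs s (f y) (?c * K)" "\<And>y \<psi>. schwartz \<psi> \<Longrightarrow> u (\<lambda>x. \<eta> (x - y) * \<psi> x) = regular_dist (f y) \<psi>"
      by metis
    obtain F where F: "continuous_on UNIV F" "\<And>x. norm (F x) \<le> W * (?c * K) / norm (\<eta> x0)"
        "\<And>\<psi>. test_function \<psi> \<Longrightarrow> u \<psi> = regular_dist F \<psi>" "\<And>x y. f y x = F x * \<eta> (x - y)"
      using local_representatives_glue[OF u \<eta>(1) x0 W f] by blast
    have cr: "cont_rep u = F" by (rule cont_rep_eqI[OF F(1-3)])
    have "hs s (\<lambda>x. F x * \<eta> (x - y)) (?c * K)" for y
    proof -
      have "(\<lambda>x. F x * \<eta> (x - y)) = f y" by (rule ext) (simp only: F(4))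
      then show ?thesis by (simp only: f(1))
    qed
    moreover have "norm (F x) \<le> C0 * K" for x
      using F(2)[of x] by (simp only: C0_def mult.assoc times_divide_eq_left)
    ultimately show ?thesis unfolding cr using F(1,3) by blast
  qed
  have "\<exists>C>0. \<forall>u K y. distribution u \<longrightarrow> K > 0 \<longrightarrow> ul_norm s \<eta> u < ennreal K \<longrightarrow> hs s (\<lambda>x. cont_rep u (x + y) * \<kappa> x) (C * K)"
    if \<kappa>: "test_function \<kappa>" "\<And>x. norm x > r \<Longrightarrow> \<kappa> x = 0" for \<kappa>
  proof -
    define \<theta> where "\<theta> x = \<kappa> x / \<eta> (x + x0)" for x
    have nz: "\<eta> (x + x0) \<noteq> 0" if "x \<in> cball 0 r" for x using that by (intro r(2)) simp
    have s\<eta>: "smooth (\<lambda>x. \<eta> (x + x0))" using smooth_affine[OF test_function_smooth[OF \<eta>(1)], of 1 x0] by simp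
    have "smooth \<theta>" unfolding \<theta>_def[abs_def]
      by (rule smooth_divide[OF test_function_smooth[OF \<kappa>(1)] s\<eta> closed_cball[of 0 r] _ nz]) (use \<kappa>(2) in auto)
    moreover have "\<forall>x. norm x > r \<longrightarrow> \<theta> x = 0" using \<kappa>(2) by (simp add: \<theta>_def)
    ultimately have t\<theta>: "test_function \<theta>" unfolding test_function_iff by blast
    then obtain N where N: "hs s \<theta> N" using test_function_hs by blast
    have N0: "N > 0" using hsD(2)[OF N] .
    define C where "C = 2 * 2 powr s * W * ?c * N"
    have C: "C > 0" using W0 N0 by (simp add: C_def)
    have "hs s (\<lambda>x. cont_rep u (x + y) * \<kappa> x) (C * K)" if u: "distribution u" "K > 0" "ul_norm s \<eta> u < ennreal K" for u K y
    proof -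
      have "hs s (\<lambda>x. cont_rep u (x + y) * \<eta> (x + y - (y - x0))) (?c * K)"
        using main[OF u] hs_translate[where y = y] by blast
      then have "hs s (\<lambda>x. (cont_rep u (x + y) * \<eta> (x + y - (y - x0))) * \<theta> x) (2 * 2 powr s * W * (?c * K) * N)"
        by (intro hs_mult[OF W] N) (use s in simp)
      moreover have "(\<lambda>x. (cont_rep u (x + y) * \<eta> (x + y - (y - x0))) * \<theta> x) = (\<lambda>x. cont_rep u (x + y) * \<kappa> x)"
      proof
        fix x
        show "(cont_rep u (x + y) * \<eta> (x + y - (y - x0))) * \<theta> x = cont_rep u (x + y) * \<kappa> x"
          using nz[of x] \<kappa>(2)[of x] by (cases "norm x > r") (auto simp: \<theta>_def add.commute)
      qed
      moreover have "2 * 2 powr s * W * (?c * K) * N = C * K" by (simp only: C_def mult_ac)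
      ultimately show ?thesis by (simp only:)
    qed
    then show ?thesis using C by blast
  qed
  then show thesis using that[of r C0] r(1) C0 main by blast
qed

lemma distribution_regular_dist:
  fixes f :: "real^'n::finite \<Rightarrow> complex"
  assumes f: "continuous_on UNIV f"
  shows "distribution (regular_dist f)"
  unfolding distribution_def
proof (intro conjI allI impI)
  show "linear_on_functions test_function (regular_dist f)"
    unfolding linear_on_functions_def
  proof (intro allI impI)
    fix \<phi> \<psi> :: "real^'n \<Rightarrow> complex" and a b assume p: "test_function \<phi>" "test_function \<psi>"
    have "regular_dist f (\<lambda>x. a * \<phi> x + b * \<psi> x) = (LINT x|lborel. a * (f x * \<phi> x) + b * (f x * \<psi> x))"
      by (simp add: regular_dist_def algebra_simps)
    also have "\<dots> = a * regular_dist f \<phi> + b * regular_dist f \<psi>"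
      using regular_dist_integrable[OF f p(1)] regular_dist_integrable[OF f p(2)] by (simp add: regular_dist_def)
    finally show "regular_dist f (\<lambda>x. a * \<phi> x + b * \<psi> x) = a * regular_dist f \<phi> + b * regular_dist f \<psi>" .
  qed
next
  fix K :: "(real^'n) set" assume K: "compact K"
  obtain R where R: "\<And>x. x \<in> K \<Longrightarrow> norm x \<le> R" using compact_imp_bounded[OF K] unfolding bounded_iff by blast
  define k where "k x = f x * plateau ((1 / (\<bar>R\<bar> + 1)) *\<^sub>R x + 0)" for x
  have "test_function (\<lambda>x::real^'n. plateau ((1 / (\<bar>R\<bar> + 1)) *\<^sub>R x + 0))"
    by (intro test_function_affine test_function_plateau) auto
  then have ki: "integrable lborel k" unfolding k_def by (rule regular_dist_integrable[OF f])
  have one: "{js :: 'n list. length js \<le> 0} = {[]}" by auto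
  have "norm (regular_dist f \<phi>) \<le> (LINT x|lborel. norm (k x)) * (\<Sum>js | length js \<le> 0. SUP x. norm (partials js \<phi> x))"
    if \<phi>: "test_function \<phi>" "{x. \<phi> x \<noteq> 0} \<subseteq> K" for \<phi>
  proof -
    have fk: "f x * \<phi> x = k x * \<phi> x" for x
    proof (cases "\<phi> x = 0")
      case False
      then have "norm x \<le> R" using \<phi>(2) R by blast
      then have "plateau ((1 / (\<bar>R\<bar> + 1)) *\<^sub>R x + 0) = 1" by (intro plateau_1) simp
      then show ?thesis by (simp add: k_def)
    qed simp
    obtain B where "\<And>x. norm (\<phi> x) \<le> B" using test_function_bounded[OF \<phi>(1)] unfolding bounded_iff by blast
    then have "norm (\<phi> x) \<le> (SUP x. norm (\<phi> x))" for x by (intro cSUP_upper) (auto simp: bdd_above_def)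
    then have bd: "norm (f x * \<phi> x) \<le> norm (k x) * (SUP x. norm (\<phi> x))" for x
      unfolding fk norm_mult by (intro mult_left_mono) auto
    have "norm (regular_dist f \<phi>) \<le> (LINT x|lborel. norm (f x * \<phi> x))"
      unfolding regular_dist_def by (rule integral_norm_bound)
    also have "\<dots> \<le> (LINT x|lborel. norm (k x) * (SUP x. norm (\<phi> x)))"
      by (rule integral_mono) (use regular_dist_integrable[OF f \<phi>(1)] ki bd in auto)
    also have "\<dots> = (LINT x|lborel. norm (k x)) * (SUP x. norm (\<phi> x))" by (rule integral_mult_left_zero)
    finally show ?thesis unfolding one by simp
  qed
  then show "\<exists>C N. \<forall>\<phi>. test_function \<phi> \<longrightarrow> {x. \<phi> x \<noteq> 0} \<subseteq> K \<longrightarrow> norm (regular_dist f \<phi>) \<le> C * (\<Sum>js | length js \<le> N. SUP x. norm (partials js \<phi> x))"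
    by blast
qed

lemma ul_norm_le:
  fixes f :: "real^'n::finite \<Rightarrow> complex"
  assumes f: "\<And>y. hs s (\<lambda>x. f x * \<eta> (x - y)) M" and t: "t \<le> s"
    and v: "\<And>\<psi>. test_function \<psi> \<Longrightarrow> v \<psi> = regular_dist f \<psi>" and \<eta>: "test_function \<eta>"
  shows "ul_norm t \<eta> v \<le> ennreal M"
  unfolding ul_norm_def
proof (rule SUP_least)
  fix y
  show "sobolev_norm t (dist_mult (\<lambda>x. \<eta> (x - y)) v) \<le> ennreal M"
  proof (rule hs_imp_sobolev_norm_le[OF f t])
    fix \<psi> :: "real^'n \<Rightarrow> complex" assume "schwartz \<psi>"
    then have "test_function (\<lambda>x. \<eta> (x - y) * \<psi> x)"
      by (intro test_function_mult_smooth test_function_translate \<eta> schwartz_smooth)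
    from v[OF this] show "dist_mult (\<lambda>x. \<eta> (x - y)) v \<psi> = regular_dist (\<lambda>x. f x * \<eta> (x - y)) \<psi>"
      by (simp add: dist_mult_def regular_dist_def mult_ac)
  qed
qed

lemma distribution_dist_diff:
  assumes u: "distribution u" and v: "distribution v"
  shows "distribution (dist_diff u v)"
  unfolding distribution_def
proof (intro conjI allI impI)
  show "linear_on_functions test_function (dist_diff u v)"
    using distribution_linear[OF u] distribution_linear[OF v]
    by (auto simp: linear_on_functions_def dist_diff_def algebra_simps)
next
  fix K :: "(real^'a) set" assume K: "compact K"
  obtain C N D M where u': "\<And>\<phi>. test_function \<phi> \<Longrightarrow> {x. \<phi> x \<noteq> 0} \<subseteq> K \<Longrightarrow> norm (u \<phi>) \<le> C * (\<Sum>js | length js \<le> N. SUP x. norm (partials js \<phi> x))"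
    and v': "\<And>\<phi>. test_function \<phi> \<Longrightarrow> {x. \<phi> x \<noteq> 0} \<subseteq> K \<Longrightarrow> norm (v \<phi>) \<le> D * (\<Sum>js | length js \<le> M. SUP x. norm (partials js \<phi> x))"
    using u v K unfolding distribution_def by metis
  have "norm (dist_diff u v \<phi>) \<le> (\<bar>C\<bar> + \<bar>D\<bar>) * (\<Sum>js | length js \<le> N + M. SUP x. norm (partials js \<phi> x))"
    if \<phi>: "test_function \<phi>" "{x. \<phi> x \<noteq> 0} \<subseteq> K" for \<phi>
  proof -
    let ?S = "\<lambda>N. \<Sum>js | length js \<le> N. SUP x. norm (partials js \<phi> x)"
    have nn: "0 \<le> (SUP x. norm (partials js \<phi> x))" for js
    proof -
      obtain B where "\<And>x. norm (partials js \<phi> x) \<le> B"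
        using test_function_bounded[OF test_function_partials[OF \<phi>(1)]] unfolding bounded_iff by blast
      then have "norm (partials js \<phi> 0) \<le> (SUP x. norm (partials js \<phi> x))" by (intro cSUP_upper) (auto simp: bdd_above_def)
      then show ?thesis by (rule order_trans[OF norm_ge_zero])
    qed
    have fin: "finite {js :: 'a list. length js \<le> k}" for k
      using finite_lists_length_le[of "UNIV :: 'a set" k] by simp
    have mono: "?S a \<le> ?S b" if "a \<le> b" for a b
      by (rule sum_mono2[OF fin]) (use that nn in auto)
    have S0: "0 \<le> ?S a" for a by (intro sum_nonneg nn)
    have "norm (u \<phi>) \<le> \<bar>C\<bar> * ?S (N + M)"
      by (rule order_trans[OF u'[OF \<phi>]], rule mult_mono[OF abs_ge_self mono]) (auto intro: S0)
    moreover have "norm (v \<phi>) \<le> \<bar>D\<bar> * ?S (N + M)"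
      by (rule order_trans[OF v'[OF \<phi>]], rule mult_mono[OF abs_ge_self mono]) (auto intro: S0)
    ultimately show ?thesis
      unfolding dist_diff_def distrib_right by (intro order_trans[OF norm_triangle_ineq4] add_mono)
  qed
  then show "\<exists>C N. \<forall>\<phi>. test_function \<phi> \<longrightarrow> {x. \<phi> x \<noteq> 0} \<subseteq> K \<longrightarrow> norm (dist_diff u v \<phi>) \<le> C * (\<Sum>js | length js \<le> N. SUP x. norm (partials js \<phi> x))"
    by blast
qed

section \<open>Composition with holomorphic functions\<close>

lemma riemann_sum_tendsto:
  fixes G :: "real \<Rightarrow> complex"
  assumes G: "continuous_on {0..1} G"
  shows "(\<lambda>m. of_real (1 / real (Suc m)) * (\<Sum>j\<le>m. G (real j / real (Suc m)))) \<longlonglongrightarrow> integral {0..1} G"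
proof (rule LIMSEQ_I)
  fix e :: real assume "e > 0"
  then have e: "e / 2 > 0" by simp
  have "uniformly_continuous_on {0..1} G" by (intro compact_uniformly_continuous G) auto
  then obtain d where d: "d > 0" "\<And>x y. x \<in> {0..1} \<Longrightarrow> y \<in> {0..1} \<Longrightarrow> dist y x < d \<Longrightarrow> dist (G y) (G x) < e / 2"
    using e unfolding uniformly_continuous_on_def by metis
  obtain m0 :: nat where m0: "1 / d < real m0" using reals_Archimedean2 by blast
  have "norm (of_real (1 / real (Suc m)) * (\<Sum>j\<le>m. G (real j / real (Suc m))) - integral {0..1} G) < e" if "m \<ge> m0" for m
  proof -
    let ?N = "real (Suc m)"
    have N: "?N > 0" "1 / ?N < d"
    proof -
      show "?N > 0" by simp
      have "1 / d < ?N" using m0 that by linarith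
      then have "1 < ?N * d" using d(1) by (simp only: pos_divide_less_eq)
      then show "1 / ?N < d" by (simp add: pos_divide_less_eq mult.commute)
    qed
    have step: "norm (integral {0..real k / ?N} G - of_real (1 / ?N) * (\<Sum>j<k. G (real j / ?N))) \<le> e / 2 * (real k / ?N)" if "k \<le> Suc m" for k
      using that
    proof (induction k)
      case (Suc k)
      let ?a = "real k / ?N" and ?b = "real (Suc k) / ?N"
      have ab: "0 \<le> ?a" "?a \<le> ?b" "?b \<le> 1" "?b - ?a = 1 / ?N"
        using N Suc.prems by (auto simp: field_simps)
      have sub: "continuous_on {x..y} G" if "0 \<le> x" "y \<le> 1" for x y
        by (rule continuous_on_subset[OF G]) (use that in auto)
      have "norm (integral {?a..?b} (\<lambda>x. G x - G ?a)) \<le> e / 2 * (?b - ?a)"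
      proof (rule integral_bound[OF ab(2)])
        show "continuous_on {?a..?b} (\<lambda>x. G x - G ?a)" using ab by (intro continuous_intros sub)
        fix x assume x: "x \<in> {?a..?b}"
        then have "dist x ?a < d" using ab N by (auto simp: dist_real_def)
        moreover have "?a \<in> {0..1}" "x \<in> {0..1}"
          using x ab(1-3) unfolding atLeastAtMost_iff by linarith+
        ultimately have "dist (G x) (G ?a) < e / 2" by (intro d(2))
        then show "norm (G x - G ?a) \<le> e / 2" by (simp only: dist_norm less_imp_le)
      qed
      moreover have "integral {?a..?b} (\<lambda>x. G x - G ?a) = integral {?a..?b} G - of_real (1 / ?N) * G ?a"
        using ab by (subst Henstock_Kurzweil_Integration.integral_diff) (auto intro!: integrable_continuous_interval sub simp: scaleR_conv_of_real)
      moreover have "integral {0..?a} G + integral {?a..?b} G = integral {0..?b} G"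
        using ab by (intro Henstock_Kurzweil_Integration.integral_combine integrable_continuous_interval sub) auto
      ultimately have "integral {0..?b} G - of_real (1 / ?N) * (\<Sum>j<Suc k. G (real j / ?N))
          = (integral {0..?a} G - of_real (1 / ?N) * (\<Sum>j<k. G (real j / ?N))) + integral {?a..?b} (\<lambda>x. G x - G ?a)"
        by (simp add: algebra_simps)
      also have "norm \<dots> \<le> e / 2 * ?a + e / 2 * (?b - ?a)"
        using Suc \<open>norm (integral {?a..?b} (\<lambda>x. G x - G ?a)) \<le> e / 2 * (?b - ?a)\<close> by (intro norm_triangle_mono) auto
      also have "\<dots> = e / 2 * ?b" by (simp add: algebra_simps)
      finally show ?case .
    qed simp
    have "norm (integral {0..1} G - of_real (1 / ?N) * (\<Sum>j<Suc m. G (real j / ?N))) \<le> e / 2"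
      using step[of "Suc m"] by simp
    then show ?thesis using \<open>e > 0\<close> by (simp add: norm_minus_commute lessThan_Suc_atMost)
  qed
  then show "\<exists>m0. \<forall>m\<ge>m0. norm (of_real (1 / real (Suc m)) * (\<Sum>j\<le>m. G (real j / real (Suc m))) - integral {0..1} G) < e"
    by blast
qed

text \<open>An integral over a parameter is a limit of Riemann means, and \<open>hs_limit\<close> applies to these.\<close>

lemma hs_mean:
  fixes F :: "real \<Rightarrow> real^'n::finite \<Rightarrow> complex"
  assumes F: "\<And>\<theta>. hs s (F \<theta>) M" and R: "\<And>\<theta> x. norm x > R \<Longrightarrow> F \<theta> x = 0" and B: "\<And>\<theta> x. norm (F \<theta> x) \<le> B"
    and c: "\<And>x. continuous_on {0..1} (\<lambda>\<theta>. F \<theta> x)" and f: "\<And>x. integral {0..1} (\<lambda>\<theta>. F \<theta> x) = f x"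
    and cf: "continuous_on UNIV f"
  shows "hs s f M"
proof (rule hs_limit[OF _ _ _ _ cf])
  let ?S = "\<lambda>m x. of_real (1 / real (Suc m)) * (\<Sum>j\<le>m. F (real j / real (Suc m)) x)"
  show "hs s (?S m) M" for m
  proof -
    have "hs s (\<lambda>x. \<Sum>j\<le>m. F (real j / real (Suc m)) x) (\<Sum>j\<le>m. M)"
      by (rule hs_sum_atMost) (rule F)
    moreover have "norm (complex_of_real (1 / real (Suc m))) \<le> 1 / real (Suc m)"
      unfolding norm_of_real by simp
    ultimately have "hs s (?S m) (1 / real (Suc m) * (\<Sum>j\<le>m. M))" by (rule hs_cmult) simp
    moreover have "1 / real (Suc m) * (\<Sum>j\<le>m. M) = M" by (simp del: of_nat_Suc)
    ultimately show ?thesis by (simp only:)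
  qed
  show "?S m x = 0" if "norm x > R" for m x using R[OF that] by simp
  show "norm (?S m x) \<le> B" for m x
  proof -
    have "norm (?S m x) = (1 / real (Suc m)) * norm (\<Sum>j\<le>m. F (real j / real (Suc m)) x)"
      unfolding norm_mult norm_of_real by simp
    also have "\<dots> \<le> (1 / real (Suc m)) * (\<Sum>j\<le>m. B)"
      by (intro mult_left_mono sum_norm_le B) auto
    also have "\<dots> = B" by (simp add: field_simps)
    finally show ?thesis .
  qed
  show "(\<lambda>m. ?S m x) \<longlonglongrightarrow> f x" for x
    using riemann_sum_tendsto[OF c, of x] by (simp add: f)
qed

definition unit_circle :: "real \<Rightarrow> complex" where
  "unit_circle \<theta> = exp (2 * of_real pi * \<i> * of_real \<theta>)"

lemma norm_unit_circle [simp]: "norm (unit_circle \<theta>) = 1"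
  by (simp add: unit_circle_def)

lemma unit_circle_continuous: "continuous_on A unit_circle"
  unfolding unit_circle_def[abs_def] by (intro continuous_intros)

lemma cauchy_circle_mean:
  assumes g: "g holomorphic_on cball 0 R" and R: "R > 0" and w: "norm w < R"
  shows "((\<lambda>\<theta>. g (of_real R * unit_circle \<theta>) * (of_real R * unit_circle \<theta> / (of_real R * unit_circle \<theta> - w))) has_integral g w) {0..1}"
proof -
  let ?u = "\<lambda>\<theta>. of_real R * unit_circle \<theta>"
  have "((\<lambda>u. g u / (u - w)) has_contour_integral 2 * of_real pi * \<i> * g w) (circlepath 0 R)"
    using Cauchy_integral_circlepath_simple[OF g, of w] w by simp
  then have "((\<lambda>\<theta>. g (circlepath 0 R \<theta>) / (circlepath 0 R \<theta> - w) * vector_derivative (circlepath 0 R) (at \<theta> within {0..1})) has_integral 2 * of_real pi * \<i> * g w) {0..1}"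
    unfolding has_contour_integral_def .
  then have I: "((\<lambda>\<theta>. (1 / (2 * of_real pi * \<i>)) * (g (circlepath 0 R \<theta>) / (circlepath 0 R \<theta> - w) * vector_derivative (circlepath 0 R) (at \<theta> within {0..1})))
      has_integral (1 / (2 * of_real pi * \<i>)) * (2 * of_real pi * \<i> * g w)) {0..1}"
    by (rule has_integral_mult_right)
  have eq: "(1 / (2 * of_real pi * \<i>)) * (g (circlepath 0 R \<theta>) / (circlepath 0 R \<theta> - w) * vector_derivative (circlepath 0 R) (at \<theta> within {0..1}))
      = g (?u \<theta>) * (?u \<theta> / (?u \<theta> - w))" if "\<theta> \<in> {0..1}" for \<theta>
  proof -
    have "vector_derivative (circlepath 0 R) (at \<theta> within {0..1}) = 2 * of_real pi * \<i> * ?u \<theta>"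
      using that by (subst vector_derivative_circlepath01) (auto simp: unit_circle_def mult_ac)
    moreover have "circlepath 0 R \<theta> = ?u \<theta>" by (simp add: circlepath unit_circle_def)
    moreover have *: "1 / c * (a / b * (c * v)) = a * (v / b)" if "c \<noteq> 0" for a b c v :: complex
      using that by simp
    moreover have **: "2 * complex_of_real pi * \<i> \<noteq> 0" by simp
    ultimately show ?thesis by (simp only: *[OF **])
  qed
  have "((\<lambda>\<theta>. g (?u \<theta>) * (?u \<theta> / (?u \<theta> - w))) has_integral (1 / (2 * of_real pi * \<i>)) * (2 * of_real pi * \<i> * g w)) {0..1}"
    by (rule has_integral_eq[OF eq I])
  then show ?thesis by simp
qed

text \<open>\<open>c / (c - h)\<close> is the geometric series in \<open>h / c\<close>, and by submultiplicativity each factor \<open>h / c\<close> at least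
  halves the bound.\<close>

lemma hs_divide_geometric:
  fixes q h :: "real^'n::finite \<Rightarrow> complex"
  assumes W: "L2_le (\<lambda>\<xi>::real^'n. complex_of_real (wt (- s) \<xi>)) W" and s: "2 * s \<ge> real CARD('n)"
    and q: "hs s q M" and h: "hs s h \<epsilon>" and \<rho>: "\<rho> > 0" "2 * 2 powr s * W * \<epsilon> \<le> \<rho> / 2" "W * \<epsilon> \<le> \<rho> / 2"
    and c: "norm c = \<rho>"
  shows "hs s (\<lambda>x. q x * (c / (c - h x))) (2 * M)"
proof -
  have M: "M > 0" and \<epsilon>: "\<epsilon> > 0" and W0: "W > 0" using hsD(2)[OF q] hsD(2)[OF h] L2_leD(2)[OF W] by auto
  have c0: "c \<noteq> 0" using c \<rho> by auto
  have hb: "norm (h x / c) \<le> 1 / 2" for x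
    using hs_bound[OF W h, of x] \<rho> c by (simp add: norm_divide field_simps)
  have ch: "c - h x \<noteq> 0" for x
  proof
    assume "c - h x = 0"
    then have "h x / c = 1" using c0 by simp
    then show False using hb[of x] by simp
  qed
  have t: "hs s (\<lambda>x. q x * (h x / c) ^ l) (M * (1 / 2) ^ l)" for l
  proof (induction l)
    case (Suc l)
    have "hs s (\<lambda>x. (1 / c) * ((q x * (h x / c) ^ l) * h x)) (1 / \<rho> * (2 * 2 powr s * W * (M * (1 / 2) ^ l) * \<epsilon>))"
      by (intro hs_cmult hs_mult[OF W s Suc h]) (use c \<rho> in \<open>auto simp: norm_divide\<close>)
    then have "hs s (\<lambda>x. q x * (h x / c) ^ Suc l) (1 / \<rho> * (2 * 2 powr s * W * (M * (1 / 2) ^ l) * \<epsilon>))"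
      by (simp add: mult_ac)
    moreover have "1 / \<rho> * (2 * 2 powr s * W * (M * (1 / 2) ^ l) * \<epsilon>) \<le> M * (1 / 2) ^ Suc l"
    proof -
      have "(2 * 2 powr s * W * \<epsilon>) * (M * (1 / 2) ^ l / \<rho>) \<le> \<rho> / 2 * (M * (1 / 2) ^ l / \<rho>)"
        using \<rho> M by (intro mult_right_mono) auto
      then show ?thesis using \<rho> by (simp add: field_simps)
    qed
    ultimately show ?case by (rule hs_mono[OF _ order_refl])
  qed (use q in simp)
  have geo: "(\<Sum>l\<le>L. M * (1 / 2) ^ l) \<le> 2 * M" for L :: nat
  proof -
    have "(\<Sum>l\<le>L. (1 / 2 :: real) ^ l) \<le> 2"
      using sum_gp0[of "1 / 2 :: real" L] by simp
    then show ?thesis using M by (simp add: sum_distrib_left[symmetric])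
  qed
  obtain R where R: "\<And>x. norm x > R \<Longrightarrow> q x = 0" using hsD(1)[OF q] by (auto simp: Cc_def)
  show ?thesis
  proof (rule hs_limit)
    show "hs s (\<lambda>x. \<Sum>l\<le>L. q x * (h x / c) ^ l) (2 * M)" for L
      by (rule hs_mono[OF hs_sum_atMost[OF t] order_refl geo])
    show "(\<Sum>l\<le>L. q x * (h x / c) ^ l) = 0" if "norm x > R" for L x using R[OF that] by simp
    show "norm (\<Sum>l\<le>L. q x * (h x / c) ^ l) \<le> W * (2 * M)" for L x
      by (rule hs_bound[OF W hs_mono[OF hs_sum_atMost[OF t] order_refl geo]])
    show "(\<lambda>L. \<Sum>l\<le>L. q x * (h x / c) ^ l) \<longlonglongrightarrow> q x * (c / (c - h x))" for x
    proof -
      have "norm (h x / c) < 1" using hb[of x] by linarith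
      then have "(\<lambda>l. (h x / c) ^ l) sums (1 / (1 - h x / c))" by (rule geometric_sums)
      then have "(\<lambda>L. q x * (\<Sum>l\<le>L. (h x / c) ^ l)) \<longlonglongrightarrow> q x * (1 / (1 - h x / c))"
        unfolding sums_def_le by (intro tendsto_intros)
      moreover have "1 / (1 - h x / c) = c / (c - h x)" using c0 ch[of x] by (simp add: field_simps)
      ultimately show ?thesis by (simp add: sum_distrib_left)
    qed
    show "continuous_on UNIV (\<lambda>x. q x * (c / (c - h x)))"
      using hsD(1)[OF q] hsD(1)[OF h] ch by (intro continuous_intros) (auto simp: Cc_def)
  qed
qed

lemma holomorphic_on_several_line:
  assumes \<Phi>: "holomorphic_on_several \<Phi> \<Omega>" and a: "\<And>\<tau>. \<tau> \<in> S \<Longrightarrow> a + \<tau> *s b \<in> \<Omega>"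
  shows "(\<lambda>\<tau>. \<Phi> (a + \<tau> *s b)) holomorphic_on S"
  unfolding holomorphic_on_def
proof
  fix \<tau> assume "\<tau> \<in> S"
  then obtain D where D: "(\<Phi> has_derivative D) (at (a + \<tau> *s b))" "\<And>c v. D (c *s v) = c * D v"
    using \<Phi> a unfolding holomorphic_on_several_def by blast
  have "((\<lambda>\<tau>. a + \<tau> *s b) has_derivative (\<lambda>c. c *s b)) (at \<tau> within S)"
  proof -
    have "bounded_linear (\<lambda>c. c *s b)"
      by (auto simp: linear_iff vec_eq_iff algebra_simps intro!: linear_conv_bounded_linear[THEN iffD1])
    from has_derivative_add[OF has_derivative_const bounded_linear_imp_has_derivative[OF this]]
    show ?thesis by simp
  qed
  from has_derivative_compose[OF this D(1)]
  have "((\<lambda>\<tau>. \<Phi> (a + \<tau> *s b)) has_derivative (\<lambda>c. c * D b)) (at \<tau> within S)"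
    by (simp add: D(2))
  then have "((\<lambda>\<tau>. \<Phi> (a + \<tau> *s b)) has_field_derivative D b) (at \<tau> within S)"
    unfolding has_field_derivative_def by (rule has_derivative_eq_rhs) (auto simp: mult.commute)
  then show "(\<lambda>\<tau>. \<Phi> (a + \<tau> *s b)) field_differentiable at \<tau> within S"
    by (auto simp: field_differentiable_def)
qed

lemma holomorphic_on_several_continuous:
  "holomorphic_on_several \<Phi> \<Omega> \<Longrightarrow> continuous_on \<Omega> \<Phi>"
  unfolding holomorphic_on_several_def
  by (meson continuous_at_imp_continuous_on has_derivative_continuous)

text \<open>One variable at a time.  By Cauchy's formula the value at \<open>h j x\<close> is a mean over the circle of
  radius \<open>\<rho>\<close> of values of \<open>\<Phi>\<close> with constant \<open>j\<close>-th argument, weighted with \<open>c / (c - h j x)\<close>, and each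
  such weight at most doubles the norm.\<close>

lemma hs_compose_polydisc:
  fixes \<Phi> :: "complex^'d::finite \<Rightarrow> complex" and h :: "'d \<Rightarrow> real^'n::finite \<Rightarrow> complex"
  assumes W: "L2_le (\<lambda>\<xi>::real^'n. complex_of_real (wt (- s) \<xi>)) W" and s: "2 * s \<ge> real CARD('n)"
    and \<Phi>: "holomorphic_on_several \<Phi> \<Omega>"
    and P: "\<And>z. (\<And>i. norm (z $ i - z0 $ i) \<le> \<rho>) \<Longrightarrow> z \<in> \<Omega> \<and> norm (\<Phi> z) \<le> B" and B: "B > 0"
    and \<rho>: "\<rho> > 0" "2 * 2 powr s * W * \<epsilon> \<le> \<rho> / 2" "W * \<epsilon> \<le> \<rho> / 2"
    and h: "\<And>i. hs s (h i) \<epsilon>" and \<eta>: "hs s \<eta> E" and I: "finite I"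
    and t: "\<And>i. norm (t i) \<le> \<rho>"
  shows "hs s (\<lambda>x. \<eta> x * \<Phi> (\<chi> i. z0 $ i + (if i \<in> I then h i x else t i))) (2 ^ card I * (E * B))"
  using I t
proof (induction I arbitrary: t rule: finite_induct)
  case empty
  have "norm (\<Phi> (\<chi> i. z0 $ i + t i)) \<le> B" using P[of "\<chi> i. z0 $ i + t i"] empty by simp
  then show ?case using hs_cmult[OF \<eta> _ B, of "\<Phi> (\<chi> i. z0 $ i + t i)"] by (simp add: mult.commute)
next
  case (insert j I)
  have hb: "norm (h i x) \<le> \<rho> / 2" for i x using hs_bound[OF W h, of i x] \<rho>(3) by linarith
  have ch: "continuous_on UNIV (h i)" for i using hsD(1)[OF h] by (simp add: Cc_def)
  have c\<eta>: "continuous_on UNIV \<eta>" using hsD(1)[OF \<eta>] by (simp add: Cc_def)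
  have c\<Phi>: "continuous_on \<Omega> \<Phi>" by (rule holomorphic_on_several_continuous[OF \<Phi>])
  let ?u = "\<lambda>\<theta>. of_real \<rho> * unit_circle \<theta>"
  have nu: "norm (?u \<theta>) = \<rho>" for \<theta> using \<rho> by (simp add: norm_mult)
  define V where "V x \<tau> = (\<chi> i. z0 $ i + (if i \<in> I then h i x else (t(j := \<tau>)) i))" for x \<tau>
  have VP: "V x \<tau> \<in> \<Omega> \<and> norm (\<Phi> (V x \<tau>)) \<le> B" if "norm \<tau> \<le> \<rho>" for x \<tau>
    by (rule P) (use that insert.prems hb \<rho>(1) in \<open>auto simp: V_def intro: order_trans[OF hb]\<close>)
  have Vins: "(\<chi> i. z0 $ i + (if i \<in> insert j I then h i x else t i)) = V x (h j x)" for x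
    using insert.hyps by (auto simp: V_def vec_eq_iff)
  have Vline: "V x \<tau> = V x 0 + \<tau> *s axis j 1" for x \<tau>
    using insert.hyps by (auto simp: V_def vec_eq_iff axis_def)
  define F where "F \<theta> x = (\<eta> x * \<Phi> (V x (?u \<theta>))) * (?u \<theta> / (?u \<theta> - h j x))" for \<theta> x
  have uh: "?u \<theta> - h j x \<noteq> 0" for \<theta> x using nu[of \<theta>] hb[of j x] \<rho>(1) by auto
  have cV: "continuous_on S (\<lambda>x. V (f x) (g x))" if "continuous_on S f" "continuous_on S g" for S :: "'z::topological_space set" and f g
    unfolding V_def
  proof (intro continuous_on_vec_lambda continuous_on_add continuous_on_const)
    fix i
    have "continuous_on S (\<lambda>x. h i (f x))" by (rule continuous_on_compose2[OF ch that(1)]) simp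
    then show "continuous_on S (\<lambda>x. if i \<in> I then h i (f x) else (t(j := g x)) i)"
      using that(2) by (cases "i \<in> I"; cases "i = j") (auto simp: continuous_on_const)
  qed
  have hF: "hs s (F \<theta>) (2 * (2 ^ card I * (E * B)))" for \<theta>
    unfolding F_def V_def
    by (rule hs_divide_geometric[OF W s insert.IH h \<rho> nu]) (use insert.prems nu in auto)
  obtain R where R: "\<And>x. norm x > R \<Longrightarrow> \<eta> x = 0" using hsD(1)[OF \<eta>] by (auto simp: Cc_def)
  have "hs s (\<lambda>x. \<eta> x * \<Phi> (V x (h j x))) (2 * (2 ^ card I * (E * B)))"
  proof (rule hs_mean[OF hF])
    show "F \<theta> x = 0" if "norm x > R" for \<theta> x using R[OF that] by (simp add: F_def)
    show "norm (F \<theta> x) \<le> W * (2 * (2 ^ card I * (E * B)))" for \<theta> x by (rule hs_bound[OF W hF])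
    show "continuous_on {0..1} (\<lambda>\<theta>. F \<theta> x)" for x
      unfolding F_def using VP nu uh
      by (intro continuous_intros unit_circle_continuous continuous_on_compose2[OF c\<Phi>] cV) auto
    show "integral {0..1} (\<lambda>\<theta>. F \<theta> x) = \<eta> x * \<Phi> (V x (h j x))" for x
    proof -
      have "(\<lambda>\<tau>. \<Phi> (V x \<tau>)) holomorphic_on cball 0 \<rho>"
      proof -
        have "(\<lambda>\<tau>. \<Phi> (V x 0 + \<tau> *s axis j 1)) holomorphic_on cball 0 \<rho>"
          by (rule holomorphic_on_several_line[OF \<Phi>], unfold Vline[symmetric]) (use VP in simp)
        then show ?thesis unfolding Vline[symmetric] .
      qed
      moreover have "norm (h j x) < \<rho>" using hb[of j x] \<rho>(1) by linarith
      ultimately have "((\<lambda>\<theta>. \<Phi> (V x (?u \<theta>)) * (?u \<theta> / (?u \<theta> - h j x))) has_integral \<Phi> (V x (h j x))) {0..1}"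
        by (intro cauchy_circle_mean \<rho>(1))
      from has_integral_mult_right[OF this, of "\<eta> x"] show ?thesis
        by (intro integral_unique) (simp add: F_def mult_ac)
    qed
    have "V x (h j x) \<in> \<Omega>" for x using VP[of "h j x" x] hb[of j x] \<rho>(1) by auto
    then show "continuous_on UNIV (\<lambda>x. \<eta> x * \<Phi> (V x (h j x)))"
      by (intro continuous_intros c\<eta> continuous_on_compose2[OF c\<Phi>] cV ch) auto
  qed
  then show ?case unfolding Vins using insert.hyps by (simp add: mult_ac)
qed

corollary hs_compose:
  fixes \<Phi> :: "complex^'d::finite \<Rightarrow> complex" and h :: "'d \<Rightarrow> real^'n::finite \<Rightarrow> complex"
  assumes W: "L2_le (\<lambda>\<xi>::real^'n. complex_of_real (wt (- s) \<xi>)) W" and s: "2 * s \<ge> real CARD('n)"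
    and \<Phi>: "holomorphic_on_several \<Phi> \<Omega>"
    and P: "\<And>z. (\<And>i. norm (z $ i - z0 $ i) \<le> \<rho>) \<Longrightarrow> z \<in> \<Omega> \<and> norm (\<Phi> z) \<le> B" and B: "B > 0"
    and \<rho>: "\<rho> > 0" "2 * 2 powr s * W * \<epsilon> \<le> \<rho> / 2" "W * \<epsilon> \<le> \<rho> / 2"
    and h: "\<And>i. hs s (h i) \<epsilon>" and \<eta>: "hs s \<eta> E"
  shows "hs s (\<lambda>x. \<eta> x * \<Phi> (\<chi> i. z0 $ i + h i x)) (2 ^ CARD('d) * (E * B))"
  using hs_compose_polydisc[OF assms finite[of UNIV], where t = "\<lambda>_. 0"] \<rho>(1) by simp

text \<open>The composition is Lipschitz because it is bounded and holomorphic: along the line \<open>h + \<tau> k\<close> the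
  bound of \<open>hs_compose\<close> holds for \<open>|\<tau>| \<le> \<epsilon> / (2 \<delta>)\<close>, and Cauchy's formula on that circle gives the
  increment from \<open>\<tau> = 0\<close> to \<open>\<tau> = 1\<close>, with a factor comparable to the inverse of the radius.\<close>

lemma hs_compose_Lipschitz:
  fixes \<Phi> :: "complex^'d::finite \<Rightarrow> complex" and h k :: "'d \<Rightarrow> real^'n::finite \<Rightarrow> complex"
  assumes W: "L2_le (\<lambda>\<xi>::real^'n. complex_of_real (wt (- s) \<xi>)) W" and s: "2 * s \<ge> real CARD('n)"
    and \<Phi>: "holomorphic_on_several \<Phi> \<Omega>"
    and P: "\<And>z. (\<And>i. norm (z $ i - z0 $ i) \<le> \<rho>) \<Longrightarrow> z \<in> \<Omega> \<and> norm (\<Phi> z) \<le> B" and B: "B > 0"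
    and \<rho>: "\<rho> > 0" "2 * 2 powr s * W * \<epsilon> \<le> \<rho> / 2" "W * \<epsilon> \<le> \<rho> / 2"
    and h: "\<And>i. hs s (h i) (\<epsilon> / 2)" and k: "\<And>i. hs s (k i) \<delta>" and \<delta>: "\<delta> \<le> \<epsilon> / 4" and \<eta>: "hs s \<eta> E"
  shows "hs s (\<lambda>x. \<eta> x * (\<Phi> (\<chi> i. z0 $ i + (h i x + k i x)) - \<Phi> (\<chi> i. z0 $ i + h i x))) (4 * \<delta> / \<epsilon> * (2 ^ CARD('d) * (E * B)))"
proof -
  have \<delta>0: "\<delta> > 0" using hsD(2)[OF k] .
  have \<epsilon>0: "\<epsilon> > 0" using \<delta>0 \<delta> by simp
  \<comment> \<open>The largest radius for which \<open>h + \<tau> k\<close> keeps the bound \<open>\<epsilon>\<close>.\<close>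
  define R where "R = \<epsilon> / (2 * \<delta>)"
  have R: "R \<ge> 2" using \<delta> \<delta>0 by (simp add: R_def field_simps)
  have R0: "R > 0" using R by simp
  have hk: "hs s (\<lambda>x. h i x + \<tau> * k i x) \<epsilon>" if "norm \<tau> \<le> R" for i \<tau>
  proof -
    have "hs s (\<lambda>x. h i x + \<tau> * k i x) (\<epsilon> / 2 + R * \<delta>)" by (intro hs_add h hs_cmult[OF k that] R0)
    then show ?thesis using \<delta>0 by (simp add: R_def)
  qed
  define V where "V x \<tau> = (\<chi> i. z0 $ i + (h i x + \<tau> * k i x))" for x \<tau>
  have VP: "V x \<tau> \<in> \<Omega> \<and> norm (\<Phi> (V x \<tau>)) \<le> B" if "norm \<tau> \<le> R" for x \<tau>
  proof (rule P)
    fix i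
    have "norm (h i x + \<tau> * k i x) \<le> W * \<epsilon>" by (rule hs_bound[OF W hk[OF that]])
    then show "norm (V x \<tau> $ i - z0 $ i) \<le> \<rho>" using \<rho>(1,3) by (simp add: V_def)
  qed
  have cV: "continuous_on UNIV (\<lambda>x. V x \<tau>)" for \<tau>
    unfolding V_def using hsD(1)[OF h] hsD(1)[OF k]
    by (intro continuous_on_vec_lambda continuous_intros) (auto simp: Cc_def)
  have cV2: "continuous_on UNIV (\<lambda>\<tau>. V x \<tau>)" for x
    unfolding V_def by (intro continuous_on_vec_lambda continuous_intros)
  have c\<Phi>: "continuous_on \<Omega> \<Phi>" by (rule holomorphic_on_several_continuous[OF \<Phi>])
  have c\<eta>: "continuous_on UNIV \<eta>" using hsD(1)[OF \<eta>] by (simp add: Cc_def)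
  let ?u = "\<lambda>\<theta>. of_real R * unit_circle \<theta>"
  have nu: "norm (?u \<theta>) = R" for \<theta> using R0 by (simp add: norm_mult)
  have u1: "?u \<theta> - 1 \<noteq> 0" and u0: "?u \<theta> \<noteq> 0" for \<theta> using nu[of \<theta>] R by auto
  have inv: "norm (1 / (?u \<theta> - 1)) \<le> 2 / R" for \<theta>
  proof -
    have "R / 2 \<le> norm (?u \<theta>) - norm (1 :: complex)" using nu[of \<theta>] R by simp
    also have "\<dots> \<le> norm (?u \<theta> - 1)" by (rule norm_triangle_ineq2)
    finally show ?thesis using R0 u1[of \<theta>] by (simp add: norm_divide field_simps)
  qed
  define F where "F \<theta> x = (1 / (?u \<theta> - 1)) * (\<eta> x * \<Phi> (V x (?u \<theta>)))" for \<theta> x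
  have hF: "hs s (F \<theta>) (2 / R * (2 ^ CARD('d) * (E * B)))" for \<theta>
    unfolding F_def V_def
    by (rule hs_cmult[OF hs_compose[OF W s \<Phi> P B \<rho> hk \<eta>] inv]) (use nu R0 in auto)
  obtain S where S: "\<And>x. norm x > S \<Longrightarrow> \<eta> x = 0" using hsD(1)[OF \<eta>] by (auto simp: Cc_def)
  have "hs s (\<lambda>x. \<eta> x * (\<Phi> (V x 1) - \<Phi> (V x 0))) (2 / R * (2 ^ CARD('d) * (E * B)))"
  proof (rule hs_mean[OF hF])
    show "F \<theta> x = 0" if "norm x > S" for \<theta> x using S[OF that] by (simp add: F_def)
    show "norm (F \<theta> x) \<le> W * (2 / R * (2 ^ CARD('d) * (E * B)))" for \<theta> x by (rule hs_bound[OF W hF])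
    show "continuous_on {0..1} (\<lambda>\<theta>. F \<theta> x)" for x
      unfolding F_def using VP nu u1
      by (intro continuous_intros unit_circle_continuous continuous_on_compose2[OF c\<Phi>] continuous_on_compose2[OF cV2]) auto
    show "integral {0..1} (\<lambda>\<theta>. F \<theta> x) = \<eta> x * (\<Phi> (V x 1) - \<Phi> (V x 0))" for x
    proof -
      have line: "V x \<tau> = V x 0 + \<tau> *s (\<chi> i. k i x)" for \<tau> by (simp add: V_def vec_eq_iff)
      have hol: "(\<lambda>\<tau>. \<Phi> (V x \<tau>)) holomorphic_on cball 0 R"
      proof -
        have "(\<lambda>\<tau>. \<Phi> (V x 0 + \<tau> *s (\<chi> i. k i x))) holomorphic_on cball 0 R"
          by (rule holomorphic_on_several_line[OF \<Phi>], unfold line[symmetric]) (use VP in simp)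
        then show ?thesis unfolding line[symmetric] .
      qed
      have "((\<lambda>\<theta>. \<Phi> (V x (?u \<theta>)) * (?u \<theta> / (?u \<theta> - 1)) - \<Phi> (V x (?u \<theta>)) * (?u \<theta> / (?u \<theta> - 0)))
          has_integral \<Phi> (V x 1) - \<Phi> (V x 0)) {0..1}"
        by (intro has_integral_diff cauchy_circle_mean hol R0) (use R in auto)
      from has_integral_mult_right[OF this, of "\<eta> x"]
      have "((\<lambda>\<theta>. \<eta> x * (\<Phi> (V x (?u \<theta>)) * (?u \<theta> / (?u \<theta> - 1)) - \<Phi> (V x (?u \<theta>)) * (?u \<theta> / (?u \<theta> - 0))))
          has_integral \<eta> x * (\<Phi> (V x 1) - \<Phi> (V x 0))) {0..1}" .
      moreover have "\<eta> x * (\<Phi> (V x (?u \<theta>)) * (?u \<theta> / (?u \<theta> - 1)) - \<Phi> (V x (?u \<theta>)) * (?u \<theta> / (?u \<theta> - 0))) = F \<theta> x" for \<theta>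
      proof -
        have "?u \<theta> / (?u \<theta> - 1) - ?u \<theta> / (?u \<theta> - 0) = 1 / (?u \<theta> - 1)"
          using u1[of \<theta>] u0[of \<theta>] by (simp add: divide_simps)
        then show ?thesis unfolding F_def right_diff_distrib[symmetric] by (simp add: mult_ac)
      qed
      ultimately show ?thesis by (intro integral_unique) simp
    qed
    show "continuous_on UNIV (\<lambda>x. \<eta> x * (\<Phi> (V x 1) - \<Phi> (V x 0)))"
      using VP R by (intro continuous_intros c\<eta> continuous_on_compose2[OF c\<Phi> cV]) auto
  qed
  then show ?thesis using \<delta>0 \<epsilon>0 by (simp add: V_def R_def)
qed

section \<open>Composition in uniformly local spaces\<close>

lemma compact_polydisc_neighbourhood:
  fixes K :: "(complex^'d::finite) set" and \<Phi> :: "complex^'d \<Rightarrow> complex"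
  assumes K: "compact K" "K \<subseteq> \<Omega>" and \<Omega>: "open \<Omega>" and \<Phi>: "continuous_on \<Omega> \<Phi>"
  obtains L \<rho> B where "compact L" "L \<subseteq> \<Omega>" "\<rho> > 0" "B > 0" "\<And>z. z \<in> L \<Longrightarrow> norm (\<Phi> z) \<le> B"
    "\<And>w z. w \<in> K \<Longrightarrow> (\<And>i. norm (z $ i - w $ i) \<le> \<rho>) \<Longrightarrow> z \<in> L"
proof -
  obtain e where e: "e > 0" "(\<Union>x\<in>K. cball x e) \<subseteq> \<Omega>"
    using compact_subset_open_imp_cball_epsilon_subset[OF K(1) \<Omega> K(2)] by blast
  define L where "L = (\<Union>x\<in>K. \<Union>y\<in>cball 0 e. {x + y})"
  have cL: "compact L" unfolding L_def by (intro compact_sums' K compact_cball)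
  have LO: "L \<subseteq> \<Omega>" using e(2) by (force simp: L_def dist_norm)
  have "bounded (\<Phi> ` L)" by (intro compact_imp_bounded compact_continuous_image cL continuous_on_subset[OF \<Phi> LO])
  then obtain B where B: "B > 0" "\<And>z. z \<in> L \<Longrightarrow> norm (\<Phi> z) \<le> B" unfolding bounded_pos by auto
  define \<rho> where "\<rho> = e / CARD('d)"
  have \<rho>: "\<rho> > 0" using e by (simp add: \<rho>_def)
  have "z \<in> L" if w: "w \<in> K" and z: "\<And>i. norm (z $ i - w $ i) \<le> \<rho>" for w z
  proof -
    have "norm (z - w) \<le> (\<Sum>i\<in>UNIV. norm ((z - w) $ i))"
      unfolding norm_vec_def by (rule L2_set_le_sum) simp
    also have "\<dots> \<le> (\<Sum>i\<in>(UNIV::'d set). \<rho>)" by (intro sum_mono) (simp add: z)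
    also have "\<dots> = e" by (simp add: \<rho>_def)
    finally have "z - w \<in> cball 0 e" by simp
    then show ?thesis unfolding L_def by (intro UN_I[OF w] UN_I[of "z - w"]) auto
  qed
  then show thesis using that[OF cL LO \<rho> B] by blast
qed

lemma cont_rep_vec_nth [simp]: "cont_rep_vec u x $ i = cont_rep (u $ i) x"
  by (simp add: cont_rep_vec_def)

lemma sobolev_ulD:
  assumes "u \<in> sobolev_ul s"
  obtains \<eta> K where "distribution u" "test_function \<eta>" "\<eta> \<noteq> (\<lambda>_. 0)" "K > 0" "ul_norm s \<eta> u < ennreal K"
proof -
  obtain \<eta> where \<eta>: "distribution u" "test_function \<eta>" "\<eta> \<noteq> (\<lambda>_. 0)" "ul_norm s \<eta> u < \<infinity>"
    using assms by (auto simp: sobolev_ul_def)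
  then obtain k where k: "k \<ge> 0" "ul_norm s \<eta> u = ennreal k" by (cases "ul_norm s \<eta> u") auto
  then have "ul_norm s \<eta> u < ennreal (k + 1)" by (simp add: ennreal_less_iff)
  then show thesis using that[of \<eta> "k + 1"] \<eta> k by simp
qed

lemma sobolev_ul_vec:
  fixes u :: "('n::finite functional)^'d::finite"
  assumes s: "s > real CARD('n) / 2" and u: "\<And>i. u $ i \<in> sobolev_ul s"
  obtains r where "r > 0" "continuous_on UNIV (cont_rep_vec u)" "bounded (range (cont_rep_vec u))"
    "\<And>i \<psi>. test_function \<psi> \<Longrightarrow> (u $ i) \<psi> = regular_dist (cont_rep (u $ i)) \<psi>"
    "\<And>\<kappa>. test_function \<kappa> \<Longrightarrow> (\<And>x. norm x > r \<Longrightarrow> \<kappa> x = 0) \<Longrightarrow>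
       \<exists>M>0. \<forall>i y. hs s (\<lambda>x. cont_rep (u $ i) (x + y) * \<kappa> x) M"
proof -
  define P where "P i r B \<longleftrightarrow> r > 0 \<and> continuous_on UNIV (cont_rep (u $ i)) \<and> (\<forall>x. norm (cont_rep (u $ i) x) \<le> B) \<and>
      (\<forall>\<psi>. test_function \<psi> \<longrightarrow> (u $ i) \<psi> = regular_dist (cont_rep (u $ i)) \<psi>) \<and>
      (\<forall>\<kappa>. test_function \<kappa> \<longrightarrow> (\<forall>x. norm x > r \<longrightarrow> \<kappa> x = 0) \<longrightarrow> (\<exists>M>0. \<forall>y. hs s (\<lambda>x. cont_rep (u $ i) (x + y) * \<kappa> x) M))"
    for i and r B :: real
  have "\<exists>r B. P i r B" for i
  proof -
    obtain \<eta> K where K: "distribution (u $ i)" "test_function \<eta>" "\<eta> \<noteq> (\<lambda>_. 0)" "K > 0" "ul_norm s \<eta> (u $ i) < ennreal K"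
      using sobolev_ulD[OF u] by blast
    obtain r C0 where r: "r > 0" and "C0 > 0"
      and rep: "\<And>u K. distribution u \<Longrightarrow> K > 0 \<Longrightarrow> ul_norm s \<eta> u < ennreal K \<Longrightarrow>
        continuous_on UNIV (cont_rep u) \<and> (\<forall>x. norm (cont_rep u x) \<le> C0 * K) \<and> (\<forall>\<psi>. test_function \<psi> \<longrightarrow> u \<psi> = regular_dist (cont_rep u) \<psi>)"
      and cut: "\<And>\<kappa>. test_function \<kappa> \<Longrightarrow> (\<And>x. norm x > r \<Longrightarrow> \<kappa> x = 0) \<Longrightarrow>
        \<exists>C>0. \<forall>u K y. distribution u \<longrightarrow> K > 0 \<longrightarrow> ul_norm s \<eta> u < ennreal K \<longrightarrow> hs s (\<lambda>x. cont_rep u (x + y) * \<kappa> x) (C * K)"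
      proof (rule ul_norm_controls_small_cutoffs[OF s K(2,3)], goal_cases)
        case (1 r C0)
        show ?case by (rule 1(1)[OF 1(2-5)])
      qed
    have "\<exists>M>0. \<forall>y. hs s (\<lambda>x. cont_rep (u $ i) (x + y) * \<kappa> x) M" if "test_function \<kappa>" "\<forall>x. norm x > r \<longrightarrow> \<kappa> x = 0" for \<kappa>
    proof -
      obtain C where C: "C > 0" "\<And>u K y. distribution u \<Longrightarrow> K > 0 \<Longrightarrow> ul_norm s \<eta> u < ennreal K \<Longrightarrow> hs s (\<lambda>x. cont_rep u (x + y) * \<kappa> x) (C * K)"
        using cut[of \<kappa>] \<open>test_function \<kappa>\<close> \<open>\<forall>x. norm x > r \<longrightarrow> \<kappa> x = 0\<close> by blast
      then show ?thesis using K C(2)[OF K(1,4,5)] by (intro exI[of _ "C * K"]) auto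
    qed
    then have "P i r (C0 * K)" using r rep[OF K(1,4,5)] unfolding P_def by blast
    then show ?thesis by blast
  qed
  then obtain r B where "\<And>i. P i (r i) (B i)" by metis
  then have r: "\<And>i. r i > 0" and c: "\<And>i. continuous_on UNIV (cont_rep (u $ i))"
    and B: "\<And>i x. norm (cont_rep (u $ i) x) \<le> B i"
    and rep: "\<And>i \<psi>. test_function \<psi> \<Longrightarrow> (u $ i) \<psi> = regular_dist (cont_rep (u $ i)) \<psi>"
    and cut: "\<And>i \<kappa>. test_function \<kappa> \<Longrightarrow> (\<And>x. norm x > r i \<Longrightarrow> \<kappa> x = 0) \<Longrightarrow> \<exists>M>0. \<forall>y. hs s (\<lambda>x. cont_rep (u $ i) (x + y) * \<kappa> x) M"
    unfolding P_def by blast+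
  define r' where "r' = Min (range r)"
  have r': "r' > 0" "\<And>i. r' \<le> r i" using r by (auto simp: r'_def)
  show thesis
  proof (rule that[OF r'(1)])
    show "continuous_on UNIV (cont_rep_vec u)"
      unfolding cont_rep_vec_def[abs_def] by (intro continuous_on_vec_lambda c)
    have "norm (cont_rep_vec u x) \<le> (\<Sum>i\<in>UNIV. B i)" for x
    proof -
      have "norm (cont_rep_vec u x) \<le> (\<Sum>i\<in>UNIV. norm (cont_rep_vec u x $ i))"
        unfolding norm_vec_def by (rule L2_set_le_sum) simp
      also have "\<dots> \<le> (\<Sum>i\<in>UNIV. B i)" by (intro sum_mono) (simp add: B)
      finally show ?thesis .
    qed
    then show "bounded (range (cont_rep_vec u))" unfolding bounded_iff by blast
    fix \<kappa> :: "real^'n \<Rightarrow> complex" assume \<kappa>: "test_function \<kappa>" "\<And>x. norm x > r' \<Longrightarrow> \<kappa> x = 0"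
    have "\<kappa> x = 0" if "norm x > r i" for i x using \<kappa>(2) r'(2)[of i] that by simp
    then have "\<forall>i. \<exists>M>0. \<forall>y. hs s (\<lambda>x. cont_rep (u $ i) (x + y) * \<kappa> x) M" using cut[OF \<kappa>(1)] by blast
    then obtain M where M: "\<And>i. M i > 0" "\<And>i y. hs s (\<lambda>x. cont_rep (u $ i) (x + y) * \<kappa> x) (M i)" by metis
    have "M i \<le> (\<Sum>i\<in>UNIV. M i)" for i using M(1) by (intro member_le_sum) (auto intro: less_imp_le)
    then have "hs s (\<lambda>x. cont_rep (u $ i) (x + y) * \<kappa> x) (\<Sum>i\<in>UNIV. M i)" for i y
      by (rule hs_mono[OF M(2) order_refl])
    moreover have "(\<Sum>i\<in>UNIV. M i) > 0" using M(1) by (intro sum_pos) auto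
    ultimately show "\<exists>M>0. \<forall>i y. hs s (\<lambda>x. cont_rep (u $ i) (x + y) * \<kappa> x) M" by blast
  qed (use rep in auto)
qed

text \<open>Everything happens in balls of one small radius \<open>\<mu>\<close>.  In the variable \<open>z = (x - y) / \<mu>\<close> the function
  \<open>cont_rep_vec u\<close> is a constant in the compact range plus a perturbation that is small in the norm of
  order \<open>t\<close>, uniformly in the centre \<open>y\<close>; there \<open>\<Phi>\<close> can be applied, also to a slightly perturbed \<open>u\<close>.\<close>

theorem ul_composition_estimates:
  fixes u :: "('n::finite functional)^'d::finite" and \<Phi> :: "complex^'d \<Rightarrow> complex"
  assumes \<Omega>: "open \<Omega>" and \<Phi>: "holomorphic_on_several \<Phi> \<Omega>"
    and t: "real CARD('n) / 2 < t" "t < s" and u: "\<And>i. u $ i \<in> sobolev_ul s"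
    and K: "closure (range (cont_rep_vec u)) \<subseteq> \<Omega>" and r1: "r1 > 0"
  obtains \<eta> \<kappa> L \<rho> M C \<delta>0 where "test_function \<eta>" "\<eta> \<noteq> (\<lambda>_. 0)" "test_function \<kappa>" "\<And>x. norm x > r1 \<Longrightarrow> \<kappa> x = 0"
    "compact L" "L \<subseteq> \<Omega>" "\<rho> > 0" "\<And>x z. (\<And>i. norm (z $ i - cont_rep (u $ i) x) \<le> \<rho>) \<Longrightarrow> z \<in> L"
    "\<And>y. hs t (\<lambda>x. \<Phi> (cont_rep_vec u x) * \<eta> (x - y)) M"
    "C > 0" "\<delta>0 > 0"
    "\<And>k \<delta> y. 0 < \<delta> \<Longrightarrow> \<delta> \<le> \<delta>0 \<Longrightarrow> (\<And>i y. hs t (\<lambda>x. k i (x + y) * \<kappa> x) \<delta>) \<Longrightarrow>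
       hs t (\<lambda>x. (\<Phi> (\<chi> i. cont_rep (u $ i) x + k i x) - \<Phi> (cont_rep_vec u x)) * \<eta> (x - y)) (C * \<delta>)"
proof -
  let ?n = "CARD('n)"
  have s: "s > real ?n / 2" using t by simp
  have t2: "2 * t \<ge> real ?n" and t0: "t \<ge> 0" using t by auto
  obtain r2 where r2: "r2 > 0" and cu: "continuous_on UNIV (cont_rep_vec u)" and bu: "bounded (range (cont_rep_vec u))"
    and cut: "\<And>\<kappa>. test_function \<kappa> \<Longrightarrow> (\<And>x. norm x > r2 \<Longrightarrow> \<kappa> x = 0) \<Longrightarrow>
       \<exists>M>0. \<forall>i y. hs s (\<lambda>x. cont_rep (u $ i) (x + y) * \<kappa> x) M"
    by (rule sobolev_ul_vec[OF s u]) (rule that; blast)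
  let ?f = "\<lambda>i. cont_rep (u $ i)"
  have "compact (closure (range (cont_rep_vec u)))" using bu by simp
  then obtain L \<rho> B where L: "compact L" "L \<subseteq> \<Omega>" "\<rho> > 0" "B > 0" "\<And>z. z \<in> L \<Longrightarrow> norm (\<Phi> z) \<le> B"
    "\<And>w z. w \<in> closure (range (cont_rep_vec u)) \<Longrightarrow> (\<And>i. norm (z $ i - w $ i) \<le> \<rho>) \<Longrightarrow> z \<in> L"
    using compact_polydisc_neighbourhood[OF _ K \<Omega> holomorphic_on_several_continuous[OF \<Phi>]] by blast
  have inL: "z \<in> L" if "\<And>i. norm (z $ i - ?f i x) \<le> \<rho>" for x z
    by (rule L(6)[OF subsetD[OF closure_subset rangeI[of _ x]]]) (use that in simp)
  obtain W where W: "L2_le (\<lambda>\<xi>::real^'n. complex_of_real (wt (- t) \<xi>)) W" using ex_L2_le_wt[OF t(1)] by blast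
  have W0: "W > 0" using W L2_leD by blast
  define A where "A = 2 * 2 powr t * W"
  have A0: "A > 0" using W0 by (simp add: A_def)
  define \<epsilon> where "\<epsilon> = min (\<rho> / (2 * A)) (\<rho> / (2 * W))"
  have \<epsilon>0: "\<epsilon> > 0" using L(3) A0 W0 by (simp add: \<epsilon>_def)
  have \<epsilon>A: "2 * 2 powr t * W * \<epsilon> \<le> \<rho> / 2"
  proof -
    have "A * \<epsilon> \<le> A * (\<rho> / (2 * A))" unfolding \<epsilon>_def using A0 by (intro mult_left_mono) auto
    also have "\<dots> = \<rho> / 2" using A0 by simp
    finally show ?thesis unfolding A_def .
  qed
  have \<epsilon>W: "W * \<epsilon> \<le> \<rho> / 2"
  proof -
    have "W * \<epsilon> \<le> W * (\<rho> / (2 * W))" unfolding \<epsilon>_def using W0 by (intro mult_left_mono) auto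
    then show ?thesis using W0 by simp
  qed
  define r where "r = min r1 r2"
  have r: "r > 0" "r \<le> r1" "r \<le> r2" using r1 r2 by (auto simp: r_def)
  define \<kappa> where "\<kappa> x = plateau ((2 / r) *\<^sub>R x + 0)" for x :: "real^'n"
  have t\<kappa>: "test_function \<kappa>" unfolding \<kappa>_def by (intro test_function_affine test_function_plateau) (use r in simp)
  have \<kappa>0: "\<kappa> x = 0" if "norm x > r" for x
    unfolding \<kappa>_def using that r by (intro plateau_0) (simp add: field_simps)
  have \<kappa>1: "\<kappa> x = 1" if "norm x \<le> r / 2" for x
    unfolding \<kappa>_def using that r by (intro plateau_1) (simp add: field_simps)
  obtain M1 where M1: "M1 > 0" "\<And>i y. hs s (\<lambda>x. ?f i (x + y) * \<kappa> x) M1"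
  proof -
    have "\<kappa> x = 0" if "norm x > r2" for x using \<kappa>0 that r(3) by auto
    then show thesis using cut[OF t\<kappa>] that by blast
  qed
  obtain r0 where r0: "0 < r0" "r0 \<le> 1"
    "\<And>g r. hs s g M1 \<Longrightarrow> 0 < r \<Longrightarrow> r \<le> r0 \<Longrightarrow> hs t (\<lambda>z::real^'n. (g (r *\<^sub>R z) - g 0) * plateau z) (\<epsilon> / 2)"
    by (rule hs_zoom_small[OF t test_function_plateau M1(1) half_gt_zero[OF \<epsilon>0]]) (rule that)
  \<comment> \<open>With \<open>\<mu> \<le> r / 4\<close> the rescaled \<open>\<kappa>\<close> is 1 on the support of \<open>plateau\<close>, the ball of radius 2.\<close>
  define \<mu> where "\<mu> = min r0 (r / 4)"
  have \<mu>: "\<mu> > 0" "\<mu> \<le> r0" "\<mu> \<le> r / 4" "\<mu> \<le> 1" using r0 r by (auto simp: \<mu>_def)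
  have \<kappa>\<mu>: "\<kappa> (\<mu> *\<^sub>R z) * plateau z = plateau z" for z
  proof (cases "norm z \<ge> 2")
    case False
    have "norm (\<mu> *\<^sub>R z) \<le> r / 4 * 2" using mult_mono[of \<mu> "r / 4" "norm z" 2] False \<mu> r by simp
    then show ?thesis using \<kappa>1[of "\<mu> *\<^sub>R z"] by simp
  qed (simp add: plateau_0)
  define h where "h y i z = (?f i (\<mu> *\<^sub>R z + y) - ?f i y) * plateau z" for y i z
  have hh: "hs t (h y i) (\<epsilon> / 2)" for y i
  proof -
    have "hs t (\<lambda>z. (?f i (\<mu> *\<^sub>R z + y) * \<kappa> (\<mu> *\<^sub>R z) - ?f i (0 + y) * \<kappa> 0) * plateau z) (\<epsilon> / 2)"
      by (rule r0(3)[OF M1(2) \<mu>(1,2)])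
    moreover have "(?f i (\<mu> *\<^sub>R z + y) * \<kappa> (\<mu> *\<^sub>R z) - ?f i (0 + y) * \<kappa> 0) * plateau z = h y i z" for z
    proof -
      have "(?f i (\<mu> *\<^sub>R z + y) * \<kappa> (\<mu> *\<^sub>R z) - ?f i (0 + y) * \<kappa> 0) * plateau z
          = ?f i (\<mu> *\<^sub>R z + y) * (\<kappa> (\<mu> *\<^sub>R z) * plateau z) - ?f i y * (\<kappa> 0 * plateau z)"
        by (simp add: left_diff_distrib mult.assoc)
      then show ?thesis using \<kappa>1[of 0] r by (simp only: \<kappa>\<mu>) (simp add: h_def left_diff_distrib)
    qed
    ultimately show ?thesis by simp
  qed
  \<comment> \<open>Supported where \<open>plateau = 1\<close>: there the perturbation \<open>h y\<close> is exactly \<open>u - u(y)\<close> in the new variable.\<close>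
  define \<eta>0 where "\<eta>0 z = plateau (2 *\<^sub>R z + 0)" for z :: "real^'n"
  have t\<eta>0: "test_function \<eta>0" unfolding \<eta>0_def by (intro test_function_affine test_function_plateau) simp
  obtain E where E: "hs t \<eta>0 E" using test_function_hs[OF t\<eta>0] by blast
  have E0: "E > 0" using hsD(2)[OF E] .
  have p1: "plateau z = 1" if "\<eta>0 z \<noteq> 0" for z :: "real^'n"
  proof (rule plateau_1)
    show "norm z \<le> 1" using that plateau_0[of "2 *\<^sub>R z"] by (force simp: \<eta>0_def)
  qed
  obtain N where N: "hs t (plateau :: real^'n \<Rightarrow> complex) N" using test_function_hs[OF test_function_plateau] by blast
  have N0: "N > 0" using hsD(2)[OF N] .
  obtain D where D: "D > 0" "\<And>f M. hs t f M \<Longrightarrow> hs t (\<lambda>x::real^'n. f ((1 / \<mu>) *\<^sub>R x)) (D * M)"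
    by (rule hs_dilate[OF t0, of "1 / \<mu>"]) (use \<mu>(1) in simp, rule that)
  define \<eta> where "\<eta> x = \<eta>0 ((1 / \<mu>) *\<^sub>R x + 0)" for x
  have t\<eta>: "test_function \<eta>" unfolding \<eta>_def by (intro test_function_affine t\<eta>0) (use \<mu> in simp)
  have "\<eta> 0 = 1" by (simp add: \<eta>_def \<eta>0_def plateau_1)
  then have \<eta>nz: "\<eta> \<noteq> (\<lambda>_. 0)" by auto
  have undilate: "hs t (\<lambda>x. G x * \<eta> (x - y)) (D * Q)" if "hs t (\<lambda>z. \<eta>0 z * G (\<mu> *\<^sub>R z + y)) Q" for G y Q
    using hs_translate[OF D(2)[OF that], of "- y"] \<mu>(1) by (simp add: \<eta>_def algebra_simps mult.commute)
  define M where "M = D * (2 ^ CARD('d) * (E * B))"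
  have P: "z \<in> \<Omega> \<and> norm (\<Phi> z) \<le> B" if "\<And>i. norm (z $ i - cont_rep_vec u y $ i) \<le> \<rho>" for y z
    using inL[of z y] that L(2,5) by auto
  have one: "hs t (\<lambda>x. \<Phi> (cont_rep_vec u x) * \<eta> (x - y)) M" for y
    unfolding M_def
  proof (rule undilate)
    have he: "hs t (h y i) \<epsilon>" for i using hs_mono[OF hh[of y i] order_refl, of \<epsilon>] \<epsilon>0 by simp
    have "hs t (\<lambda>z. \<eta>0 z * \<Phi> (\<chi> i. cont_rep_vec u y $ i + h y i z)) (2 ^ CARD('d) * (E * B))"
      by (rule hs_compose[OF W t2 \<Phi> P L(4) L(3) \<epsilon>A \<epsilon>W he E]) auto
    moreover have "\<eta>0 z * \<Phi> (\<chi> i. cont_rep_vec u y $ i + h y i z) = \<eta>0 z * \<Phi> (cont_rep_vec u (\<mu> *\<^sub>R z + y))" for z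
      using p1[of z] by (cases "\<eta>0 z = 0") (simp_all add: h_def cont_rep_vec_def)
    ultimately show "hs t (\<lambda>z. \<eta>0 z * \<Phi> (cont_rep_vec u (\<mu> *\<^sub>R z + y))) (2 ^ CARD('d) * (E * B))" by (simp only:)
  qed
  define C where "C = D * (4 * (A * N) / \<epsilon> * (2 ^ CARD('d) * (E * B)))"
  have C: "C > 0" using D(1) A0 N0 \<epsilon>0 E0 L(4) by (simp add: C_def)
  define \<delta>0 where "\<delta>0 = \<epsilon> / (4 * (A * N))"
  have \<delta>0: "\<delta>0 > 0" using \<epsilon>0 A0 N0 by (simp add: \<delta>0_def)
  have two: "hs t (\<lambda>x. (\<Phi> (\<chi> i. ?f i x + k i x) - \<Phi> (cont_rep_vec u x)) * \<eta> (x - y)) (C * \<delta>)"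
    if \<delta>: "0 < \<delta>" "\<delta> \<le> \<delta>0" and k: "\<And>i y. hs t (\<lambda>x. k i (x + y) * \<kappa> x) \<delta>" for k \<delta> y
  proof -
    define k' where "k' i z = k i (\<mu> *\<^sub>R z + y) * plateau z" for i z
    have hk: "hs t (k' i) (A * \<delta> * N)" for i
    proof -
      have "hs t (\<lambda>z. (k i (\<mu> *\<^sub>R z + y) * \<kappa> (\<mu> *\<^sub>R z)) * plateau z) (2 * 2 powr t * W * \<delta> * N)"
        by (rule hs_mult_dilated[OF W t2 k N \<mu>(1,4)])
      then show ?thesis by (simp add: mult.assoc \<kappa>\<mu> k'_def[abs_def] A_def)
    qed
    have small: "A * \<delta> * N \<le> \<epsilon> / 4"
    proof -
      have "(A * N) * \<delta> \<le> (A * N) * \<delta>0" using \<delta> A0 N0 by (intro mult_left_mono) auto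
      then show ?thesis using A0 N0 by (simp add: \<delta>0_def mult_ac)
    qed
    have "hs t (\<lambda>z. \<eta>0 z * (\<Phi> (\<chi> i. cont_rep_vec u y $ i + (h y i z + k' i z)) - \<Phi> (\<chi> i. cont_rep_vec u y $ i + h y i z)))
        (4 * (A * \<delta> * N) / \<epsilon> * (2 ^ CARD('d) * (E * B)))"
      by (rule hs_compose_Lipschitz[OF W t2 \<Phi> P L(4) L(3) \<epsilon>A \<epsilon>W hh hk small E]) auto
    moreover have "\<eta>0 z * (\<Phi> (\<chi> i. cont_rep_vec u y $ i + (h y i z + k' i z)) - \<Phi> (\<chi> i. cont_rep_vec u y $ i + h y i z))
        = \<eta>0 z * (\<Phi> (\<chi> i. ?f i (\<mu> *\<^sub>R z + y) + k i (\<mu> *\<^sub>R z + y)) - \<Phi> (cont_rep_vec u (\<mu> *\<^sub>R z + y)))" for z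
      using p1[of z] by (cases "\<eta>0 z = 0") (simp_all add: h_def k'_def cont_rep_vec_def)
    ultimately have "hs t (\<lambda>z. \<eta>0 z * (\<Phi> (\<chi> i. ?f i (\<mu> *\<^sub>R z + y) + k i (\<mu> *\<^sub>R z + y)) - \<Phi> (cont_rep_vec u (\<mu> *\<^sub>R z + y))))
        (4 * (A * \<delta> * N) / \<epsilon> * (2 ^ CARD('d) * (E * B)))" by (simp only:)
    from undilate[of "\<lambda>x. \<Phi> (\<chi> i. ?f i x + k i x) - \<Phi> (cont_rep_vec u x)", OF this]
    show ?thesis by (simp add: C_def mult_ac)
  qed
  have "\<kappa> x = 0" if "norm x > r1" for x using \<kappa>0 that r by auto
  then show thesis by (rule that[OF t\<eta> \<eta>nz t\<kappa> _ L(1-3) inL one C \<delta>0 two])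
qed

lemma continuous_on_comp_cont_rep_vec:
  assumes "holomorphic_on_several \<Phi> \<Omega>" "continuous_on UNIV f" "closure (range f) \<subseteq> \<Omega>"
  shows "continuous_on UNIV (\<Phi> \<circ> f)"
  using assms closure_subset[of "range f"]
  by (intro continuous_on_compose continuous_on_subset[OF holomorphic_on_several_continuous[OF assms(1)]]) auto

proposition composition_in_sobolev_ul:
  fixes u :: "('n::finite functional)^'d::finite"
  assumes "open \<Omega>" "holomorphic_on_several \<Phi> \<Omega>" and s: "s > real CARD('n) / 2"
    and u: "\<And>i. u $ i \<in> sobolev_ul s" and K: "closure (range (cont_rep_vec u)) \<subseteq> \<Omega>" and s': "s' < s"
  shows "regular_dist (\<Phi> \<circ> cont_rep_vec u) \<in> sobolev_ul s'"
proof -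
  \<comment> \<open>The order \<open>s'\<close> may be too small for the estimates, which an order in between repairs.\<close>
  obtain t where t: "max s' (real CARD('n) / 2) < t" "t < s" using dense[of "max s' (real CARD('n) / 2)" s] s s' by auto
  then have t1: "real CARD('n) / 2 < t" and st: "s' \<le> t" by auto
  obtain \<eta> M where \<eta>: "test_function \<eta>" "\<eta> \<noteq> (\<lambda>_. 0)" "\<And>y. hs t (\<lambda>x. \<Phi> (cont_rep_vec u x) * \<eta> (x - y)) M"
    by (rule ul_composition_estimates[OF assms(1,2) t1 t(2) u K zero_less_one]) (rule that)
  have "continuous_on UNIV (cont_rep_vec u)" using sobolev_ul_vec[OF s u] by metis
  then have "distribution (regular_dist (\<Phi> \<circ> cont_rep_vec u))"
    by (intro distribution_regular_dist continuous_on_comp_cont_rep_vec[OF assms(2) _ K])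
  moreover have "ul_norm s' \<eta> (regular_dist (\<Phi> \<circ> cont_rep_vec u)) \<le> ennreal M"
    by (rule ul_norm_le[where f = "\<Phi> \<circ> cont_rep_vec u", OF _ st _ \<eta>(1)]) (use \<eta>(3) in \<open>auto simp: comp_def\<close>)
  then have "ul_norm s' \<eta> (regular_dist (\<Phi> \<circ> cont_rep_vec u)) < \<infinity>" by (rule le_less_trans) simp
  ultimately show ?thesis using \<eta> by (auto simp: sobolev_ul_def)
qed

text \<open>In the topology of order \<open>t\<close> the difference \<open>k \<epsilon>\<close> of the representatives is eventually small uniformly,
  which keeps \<open>v \<epsilon>\<close> in the compact set \<open>L\<close>, and small in norm after any cutoff of small support, which is
  what the Lipschitz estimate asks for.\<close>

proposition composition_ul_tendsto:
  fixes u :: "('n::finite functional)^'d::finite" and v :: "real \<Rightarrow> ('n functional)^'d"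
  assumes \<Omega>: "open \<Omega>" and \<Phi>: "holomorphic_on_several \<Phi> \<Omega>" and t: "real CARD('n) / 2 < t" "t < s"
    and u: "\<And>i. u $ i \<in> sobolev_ul s" and v: "\<And>\<epsilon> i. 0 < \<epsilon> \<and> \<epsilon> \<le> 1 \<Longrightarrow> v \<epsilon> $ i \<in> sobolev_ul s"
    and K: "closure (range (cont_rep_vec u)) \<subseteq> \<Omega>"
    and lim: "\<And>i. ul_tendsto t (\<lambda>\<epsilon>. v \<epsilon> $ i) (u $ i) (at_right 0)"
  shows "(\<exists>\<epsilon>\<^sub>0. 0 < \<epsilon>\<^sub>0 \<and> \<epsilon>\<^sub>0 \<le> 1 \<and> (\<forall>\<epsilon>. 0 < \<epsilon> \<and> \<epsilon> \<le> \<epsilon>\<^sub>0 \<longrightarrow> closure (range (cont_rep_vec (v \<epsilon>))) \<subseteq> \<Omega>)) \<and>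
    ul_tendsto t (\<lambda>\<epsilon>. regular_dist (\<Phi> \<circ> cont_rep_vec (v \<epsilon>))) (regular_dist (\<Phi> \<circ> cont_rep_vec u)) (at_right 0)"
proof -
  have s: "s > real CARD('n) / 2" using t by simp
  have du: "distribution (u $ i)" for i using u by (simp add: sobolev_ul_def)
  have cu: "continuous_on UNIV (cont_rep_vec u)" and bu: "bounded (range (cont_rep_vec u))"
    and ru: "\<And>i \<psi>. test_function \<psi> \<Longrightarrow> (u $ i) \<psi> = regular_dist (cont_rep (u $ i)) \<psi>"
    using sobolev_ul_vec[OF s u] by metis+
  define k where "k \<epsilon> i = cont_rep (dist_diff (v \<epsilon> $ i) (u $ i))" for \<epsilon> i
  define P where "P i r C0 \<eta> \<longleftrightarrow> r > 0 \<and> C0 > 0 \<and> ((\<lambda>\<epsilon>. ul_norm t \<eta> (dist_diff (v \<epsilon> $ i) (u $ i))) \<longlongrightarrow> 0) (at_right 0) \<and>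
      (\<forall>u K. distribution u \<longrightarrow> K > 0 \<longrightarrow> ul_norm t \<eta> u < ennreal K \<longrightarrow>
        continuous_on UNIV (cont_rep u) \<and> (\<forall>x. norm (cont_rep u x) \<le> C0 * K) \<and> (\<forall>\<psi>. test_function \<psi> \<longrightarrow> u \<psi> = regular_dist (cont_rep u) \<psi>)) \<and>
      (\<forall>\<kappa>. test_function \<kappa> \<longrightarrow> (\<forall>x. norm x > r \<longrightarrow> \<kappa> x = 0) \<longrightarrow>
        (\<exists>C>0. \<forall>u K y. distribution u \<longrightarrow> K > 0 \<longrightarrow> ul_norm t \<eta> u < ennreal K \<longrightarrow> hs t (\<lambda>x. cont_rep u (x + y) * \<kappa> x) (C * K)))"
    for i and r C0 :: real and \<eta>
  have "\<exists>r C0 \<eta>. P i r C0 \<eta>" for i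
  proof -
    obtain \<eta> where \<eta>: "test_function \<eta>" "\<eta> \<noteq> (\<lambda>_. 0)" "((\<lambda>\<epsilon>. ul_norm t \<eta> (dist_diff (v \<epsilon> $ i) (u $ i))) \<longlongrightarrow> 0) (at_right 0)"
      using lim[of i] unfolding ul_tendsto_def by blast
    have "\<exists>r C0. P i r C0 \<eta>"
    proof (rule ul_norm_controls_small_cutoffs[OF t(1) \<eta>(1,2)], goal_cases)
      case (1 r C0)
      then have "P i r C0 \<eta>" using \<eta>(3) unfolding P_def by blast
      then show ?case by blast
    qed
    then show ?thesis by blast
  qed
  then obtain r C0 \<zeta> where "\<And>i. P i (r i) (C0 i) (\<zeta> i)" by metis
  then have r: "\<And>i. r i > 0" and C0: "\<And>i. C0 i > 0"
    and z: "\<And>i. ((\<lambda>\<epsilon>. ul_norm t (\<zeta> i) (dist_diff (v \<epsilon> $ i) (u $ i))) \<longlongrightarrow> 0) (at_right 0)"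
    and rep: "\<And>i u K. distribution u \<Longrightarrow> K > 0 \<Longrightarrow> ul_norm t (\<zeta> i) u < ennreal K \<Longrightarrow>
        continuous_on UNIV (cont_rep u) \<and> (\<forall>x. norm (cont_rep u x) \<le> C0 i * K) \<and> (\<forall>\<psi>. test_function \<psi> \<longrightarrow> u \<psi> = regular_dist (cont_rep u) \<psi>)"
    and cut: "\<And>i \<kappa>. test_function \<kappa> \<Longrightarrow> (\<And>x. norm x > r i \<Longrightarrow> \<kappa> x = 0) \<Longrightarrow>
        \<exists>C>0. \<forall>u K y. distribution u \<longrightarrow> K > 0 \<longrightarrow> ul_norm t (\<zeta> i) u < ennreal K \<longrightarrow> hs t (\<lambda>x. cont_rep u (x + y) * \<kappa> x) (C * K)"
    unfolding P_def by blast+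
  define r1 where "r1 = Min (range r)"
  have r1: "r1 > 0" "\<And>i. r1 \<le> r i" using r by (auto simp: r1_def)
  obtain \<eta> \<kappa> L \<rho> C \<delta>0 where \<eta>: "test_function \<eta>" "\<eta> \<noteq> (\<lambda>_. 0)" and \<kappa>: "test_function \<kappa>" "\<And>x. norm x > r1 \<Longrightarrow> \<kappa> x = 0"
    and L: "compact L" "L \<subseteq> \<Omega>" "\<rho> > 0" "\<And>x z. (\<And>i. norm (z $ i - cont_rep (u $ i) x) \<le> \<rho>) \<Longrightarrow> z \<in> L"
    and C: "C > 0" "\<delta>0 > 0"
    and est: "\<And>k \<delta> y. 0 < \<delta> \<Longrightarrow> \<delta> \<le> \<delta>0 \<Longrightarrow> (\<And>i y. hs t (\<lambda>x. k i (x + y) * \<kappa> x) \<delta>) \<Longrightarrow>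
       hs t (\<lambda>x. (\<Phi> (\<chi> i. cont_rep (u $ i) x + k i x) - \<Phi> (cont_rep_vec u x)) * \<eta> (x - y)) (C * \<delta>)"
    by (rule ul_composition_estimates[OF \<Omega> \<Phi> t u K r1(1)]) blast
  have "\<kappa> x = 0" if "norm x > r i" for i x using \<kappa>(2) r1(2)[of i] that by simp
  then have "\<forall>i. \<exists>C>0. \<forall>u K y. distribution u \<longrightarrow> K > 0 \<longrightarrow> ul_norm t (\<zeta> i) u < ennreal K \<longrightarrow> hs t (\<lambda>x. cont_rep u (x + y) * \<kappa> x) (C * K)"
    using cut[OF \<kappa>(1)] by blast
  then obtain C1 where C1: "\<And>i. C1 i > 0"
    "\<And>i u K y. distribution u \<Longrightarrow> K > 0 \<Longrightarrow> ul_norm t (\<zeta> i) u < ennreal K \<Longrightarrow> hs t (\<lambda>x. cont_rep u (x + y) * \<kappa> x) (C1 i * K)"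
    by metis
  have cL: "closed L" using L(1) by (rule compact_imp_closed)
  have key: "\<forall>\<^sub>F \<epsilon> in at_right 0. (0 < \<epsilon> \<and> \<epsilon> \<le> 1) \<and> range (cont_rep_vec (v \<epsilon>)) \<subseteq> L \<and>
      (\<forall>x. cont_rep_vec (v \<epsilon>) x = (\<chi> i. cont_rep (u $ i) x + k \<epsilon> i x)) \<and> (\<forall>i y. hs t (\<lambda>x. k \<epsilon> i (x + y) * \<kappa> x) \<delta>)"
    if \<delta>: "\<delta> > 0" for \<delta>
  proof -
    \<comment> \<open>The first bound keeps \<open>v \<epsilon>\<close> within \<open>\<rho>\<close> of \<open>u\<close>, the second bounds the cut-off difference by \<open>\<delta>\<close>.\<close>
    define Q where "Q i = min (\<rho> / C0 i) (\<delta> / C1 i)" for i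
    have Q: "Q i > 0" for i using L(3) C0 C1(1) \<delta> by (simp add: Q_def)
    have "\<forall>\<^sub>F \<epsilon> in at_right 0. ul_norm t (\<zeta> i) (dist_diff (v \<epsilon> $ i) (u $ i)) < ennreal (Q i)" for i
      by (rule order_tendstoD(2)[OF z]) (use Q in simp)
    then have all: "\<forall>\<^sub>F \<epsilon> in at_right 0. \<forall>i. ul_norm t (\<zeta> i) (dist_diff (v \<epsilon> $ i) (u $ i)) < ennreal (Q i)"
      by (intro eventually_all_finite) auto
    have pos: "\<forall>\<^sub>F \<epsilon> in at_right 0. 0 < \<epsilon> \<and> \<epsilon> \<le> (1::real)"
      unfolding eventually_at_right_field by (intro exI[of _ 1]) auto
    from all pos show ?thesis
    proof eventually_elim
      case (elim \<epsilon>)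
      then have vs: "v \<epsilon> $ i \<in> sobolev_ul s" for i using v by blast
      have dd: "distribution (dist_diff (v \<epsilon> $ i) (u $ i))" for i
        using vs[of i] du[of i] by (intro distribution_dist_diff) (simp_all add: sobolev_ul_def)
      have lt: "ul_norm t (\<zeta> i) (dist_diff (v \<epsilon> $ i) (u $ i)) < ennreal (Q i)" for i using elim by blast
      have ck: "continuous_on UNIV (k \<epsilon> i)" and rk: "test_function \<psi> \<Longrightarrow> dist_diff (v \<epsilon> $ i) (u $ i) \<psi> = regular_dist (k \<epsilon> i) \<psi>" for i \<psi>
        using rep[OF dd Q lt] unfolding k_def by blast+
      have kb: "norm (k \<epsilon> i x) \<le> \<rho>" for i x
      proof -
        have "norm (k \<epsilon> i x) \<le> C0 i * Q i" using rep[OF dd Q lt] unfolding k_def by blast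
        also have "\<dots> \<le> C0 i * (\<rho> / C0 i)" unfolding Q_def using C0[of i] by (intro mult_left_mono) auto
        finally show ?thesis using C0[of i] by simp
      qed
      have hk: "hs t (\<lambda>x. k \<epsilon> i (x + y) * \<kappa> x) \<delta>" for i y
      proof (rule hs_mono[OF _ order_refl])
        show "hs t (\<lambda>x. k \<epsilon> i (x + y) * \<kappa> x) (C1 i * Q i)" unfolding k_def by (rule C1(2)[OF dd Q lt])
        have "C1 i * Q i \<le> C1 i * (\<delta> / C1 i)" unfolding Q_def using C1(1)[of i] by (intro mult_left_mono) auto
        then show "C1 i * Q i \<le> \<delta>" using C1(1)[of i] by simp
      qed
      have cui: "continuous_on UNIV (cont_rep (u $ i))" for i
        using continuous_on_component[OF cu, of i] by simp
      obtain Bu where Bu: "\<And>x. norm (cont_rep_vec u x) \<le> Bu" using bu unfolding bounded_iff by blast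
      have "cont_rep (v \<epsilon> $ i) = (\<lambda>x. cont_rep (u $ i) x + k \<epsilon> i x)" for i
      proof (rule cont_rep_eqI)
        show "continuous_on UNIV (\<lambda>x. cont_rep (u $ i) x + k \<epsilon> i x)" by (intro continuous_intros cui ck)
        show "norm (cont_rep (u $ i) x + k \<epsilon> i x) \<le> Bu + \<rho>" for x
        proof (rule norm_triangle_mono[OF _ kb])
          show "norm (cont_rep (u $ i) x) \<le> Bu"
            using Finite_Cartesian_Product.norm_nth_le[of "cont_rep_vec u x" i] Bu[of x] by simp
        qed
        fix \<psi> :: "real^'n \<Rightarrow> complex" assume \<psi>: "test_function \<psi>"
        have "(v \<epsilon> $ i) \<psi> = (u $ i) \<psi> + dist_diff (v \<epsilon> $ i) (u $ i) \<psi>" by (simp add: dist_diff_def)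
        also have "\<dots> = regular_dist (cont_rep (u $ i)) \<psi> + regular_dist (k \<epsilon> i) \<psi>" by (simp add: ru[OF \<psi>] rk[OF \<psi>])
        also have "\<dots> = regular_dist (\<lambda>x. cont_rep (u $ i) x + k \<epsilon> i x) \<psi>"
          using Bochner_Integration.integral_add[OF regular_dist_integrable[OF cui \<psi>] regular_dist_integrable[OF ck \<psi>]]
          by (simp add: regular_dist_def distrib_right)
        finally show "(v \<epsilon> $ i) \<psi> = regular_dist (\<lambda>x. cont_rep (u $ i) x + k \<epsilon> i x) \<psi>" .
      qed
      then have cv: "cont_rep_vec (v \<epsilon>) x = (\<chi> i. cont_rep (u $ i) x + k \<epsilon> i x)" for x
        by (simp add: cont_rep_vec_def)
      have "cont_rep_vec (v \<epsilon>) x \<in> L" for x by (rule L(4)[of _ x]) (simp only: cv vec_lambda_beta add_diff_cancel_left' kb)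
      then show ?case using elim cv hk by blast
    qed
  qed
  have cl: "closure (range (cont_rep_vec (v \<epsilon>))) \<subseteq> \<Omega>" if "range (cont_rep_vec (v \<epsilon>)) \<subseteq> L" for \<epsilon>
    using closure_minimal[OF that cL] L(2) by blast
  have "\<forall>\<^sub>F \<epsilon> in at_right 0. closure (range (cont_rep_vec (v \<epsilon>))) \<subseteq> \<Omega>"
    using key[OF zero_less_one] by eventually_elim (use cl in blast)
  then obtain b where b: "b > 0" "\<And>\<epsilon>. 0 < \<epsilon> \<Longrightarrow> \<epsilon> < b \<Longrightarrow> closure (range (cont_rep_vec (v \<epsilon>))) \<subseteq> \<Omega>"
    unfolding eventually_at_right_field by blast
  have part1: "\<exists>\<epsilon>\<^sub>0. 0 < \<epsilon>\<^sub>0 \<and> \<epsilon>\<^sub>0 \<le> 1 \<and> (\<forall>\<epsilon>. 0 < \<epsilon> \<and> \<epsilon> \<le> \<epsilon>\<^sub>0 \<longrightarrow> closure (range (cont_rep_vec (v \<epsilon>))) \<subseteq> \<Omega>)"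
    by (rule exI[of _ "min 1 (b / 2)"]) (use b in auto)
  let ?w = "\<lambda>\<epsilon>. regular_dist (\<Phi> \<circ> cont_rep_vec (v \<epsilon>))" and ?W = "regular_dist (\<Phi> \<circ> cont_rep_vec u)"
  have m0: "?W \<in> sobolev_ul t" by (rule composition_in_sobolev_ul[OF \<Omega> \<Phi> s u K t(2)])
  have m1: "\<forall>\<^sub>F \<epsilon> in at_right 0. ?w \<epsilon> \<in> sobolev_ul t"
    using key[OF zero_less_one]
  proof eventually_elim
    case (elim \<epsilon>)
    then show ?case by (intro composition_in_sobolev_ul[OF \<Omega> \<Phi> s v cl t(2)]) auto
  qed
  have small': "\<forall>\<^sub>F \<epsilon> in at_right 0. ul_norm t \<eta> (dist_diff (?w \<epsilon>) ?W) \<le> ennreal (C * \<delta>)" if \<delta>: "0 < \<delta>" "\<delta> \<le> \<delta>0" for \<delta>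
    using key[OF \<delta>(1)]
  proof eventually_elim
    case (elim \<epsilon>)
    have vs: "v \<epsilon> $ i \<in> sobolev_ul s" for i using elim v by blast
    have cv: "continuous_on UNIV (cont_rep_vec (v \<epsilon>))" using sobolev_ul_vec[OF s vs] by metis
    have c1: "continuous_on UNIV (\<Phi> \<circ> cont_rep_vec (v \<epsilon>))"
      by (rule continuous_on_comp_cont_rep_vec[OF \<Phi> cv cl]) (use elim in blast)
    have c0: "continuous_on UNIV (\<Phi> \<circ> cont_rep_vec u)"
      by (rule continuous_on_comp_cont_rep_vec[OF \<Phi> cu K])
    show ?case
    proof (rule ul_norm_le[where f = "\<lambda>x. (\<Phi> \<circ> cont_rep_vec (v \<epsilon>)) x - (\<Phi> \<circ> cont_rep_vec u) x", OF _ order_refl _ \<eta>(1)])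
      fix y
      have "hs t (\<lambda>x. (\<Phi> (\<chi> i. cont_rep (u $ i) x + k \<epsilon> i x) - \<Phi> (cont_rep_vec u x)) * \<eta> (x - y)) (C * \<delta>)"
        by (rule est[OF \<delta>]) (use elim in blast)
      then show "hs t (\<lambda>x. ((\<Phi> \<circ> cont_rep_vec (v \<epsilon>)) x - (\<Phi> \<circ> cont_rep_vec u) x) * \<eta> (x - y)) (C * \<delta>)"
        using elim by simp
    next
      fix \<psi> :: "real^'n \<Rightarrow> complex" assume \<psi>: "test_function \<psi>"
      show "dist_diff (?w \<epsilon>) ?W \<psi> = regular_dist (\<lambda>x. (\<Phi> \<circ> cont_rep_vec (v \<epsilon>)) x - (\<Phi> \<circ> cont_rep_vec u) x) \<psi>"
        using Bochner_Integration.integral_diff[OF regular_dist_integrable[OF c1 \<psi>] regular_dist_integrable[OF c0 \<psi>]]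
        by (simp add: dist_diff_def regular_dist_def left_diff_distrib)
    qed
  qed
  have "((\<lambda>\<epsilon>. ul_norm t \<eta> (dist_diff (?w \<epsilon>) ?W)) \<longlongrightarrow> 0) (at_right 0)"
  proof (rule order_tendstoI)
    fix a :: ennreal assume a: "0 < a"
    obtain b where b: "b > 0" "ennreal b < a"
    proof (cases a)
      case (real r)
      then show thesis using that[of "r / 2"] a by (simp add: ennreal_less_iff)
    next
      case top
      then show thesis using that[of 1] by simp
    qed
    define \<delta> where "\<delta> = min \<delta>0 (b / C)"
    have \<delta>: "0 < \<delta>" "\<delta> \<le> \<delta>0" using b C by (auto simp: \<delta>_def)
    have "C * \<delta> \<le> C * (b / C)" unfolding \<delta>_def using C by (intro mult_left_mono) auto
    then have "ennreal (C * \<delta>) < a" using C b(2) by (intro le_less_trans[OF ennreal_leI b(2)]) simp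
    then show "\<forall>\<^sub>F \<epsilon> in at_right 0. ul_norm t \<eta> (dist_diff (?w \<epsilon>) ?W) < a"
      by (rule eventually_mono[OF small'[OF \<delta>], OF le_less_trans, rotated])
  qed simp
  then show ?thesis using part1 m0 m1 \<eta> unfolding ul_tendsto_def by blast
qed

theorem theorem4p6:
  fixes \<Omega> :: "(complex^'d::finite) set"
    and \<Phi> :: "complex^'d \<Rightarrow> complex"
    and s :: real
  assumes "open \<Omega>"
    and "holomorphic_on_several \<Phi> \<Omega>"
    and "s > real CARD('n::finite) / 2"
  shows "(\<forall>u :: ('n functional)^'d.
            (\<forall>i. u $ i \<in> sobolev_ul s) \<longrightarrow>
            closure (range (cont_rep_vec u)) \<subseteq> \<Omega> \<longrightarrow>
            (\<forall>s'<s. regular_dist (\<Phi> \<circ> cont_rep_vec u) \<in> sobolev_ul s'))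
       \<and>
         (\<forall>s' (u :: ('n functional)^'d) (u\<^sub>\<epsilon> :: real \<Rightarrow> ('n functional)^'d).
            real CARD('n) / 2 < s' \<longrightarrow> s' < s \<longrightarrow>
            (\<forall>i. u $ i \<in> sobolev_ul s) \<longrightarrow>
            (\<forall>\<epsilon>. 0 < \<epsilon> \<and> \<epsilon> \<le> 1 \<longrightarrow> (\<forall>i. u\<^sub>\<epsilon> \<epsilon> $ i \<in> sobolev_ul s)) \<longrightarrow>
            closure (range (cont_rep_vec u)) \<subseteq> \<Omega> \<longrightarrow>
            (\<forall>i. ul_tendsto s' (\<lambda>\<epsilon>. u\<^sub>\<epsilon> \<epsilon> $ i) (u $ i) (at_right 0)) \<longrightarrow>
            (\<exists>\<epsilon>\<^sub>0. 0 < \<epsilon>\<^sub>0 \<and> \<epsilon>\<^sub>0 \<le> 1 \<and>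
               (\<forall>\<epsilon>. 0 < \<epsilon> \<and> \<epsilon> \<le> \<epsilon>\<^sub>0 \<longrightarrow> closure (range (cont_rep_vec (u\<^sub>\<epsilon> \<epsilon>))) \<subseteq> \<Omega>)) \<and>
            ul_tendsto s' (\<lambda>\<epsilon>. regular_dist (\<Phi> \<circ> cont_rep_vec (u\<^sub>\<epsilon> \<epsilon>)))
              (regular_dist (\<Phi> \<circ> cont_rep_vec u)) (at_right 0))"
proof (intro conjI allI impI)
  fix u :: "('n functional)^'d" and s'
  assume "\<forall>i. u $ i \<in> sobolev_ul s" "closure (range (cont_rep_vec u)) \<subseteq> \<Omega>" "s' < s"
  then show "regular_dist (\<Phi> \<circ> cont_rep_vec u) \<in> sobolev_ul s'"
    by (intro composition_in_sobolev_ul[OF assms]) auto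
next
  fix s' and u :: "('n functional)^'d" and v :: "real \<Rightarrow> ('n functional)^'d"
  assume *: "real CARD('n) / 2 < s'" "s' < s" "\<forall>i. u $ i \<in> sobolev_ul s"
    "\<forall>\<epsilon>. 0 < \<epsilon> \<and> \<epsilon> \<le> 1 \<longrightarrow> (\<forall>i. v \<epsilon> $ i \<in> sobolev_ul s)" "closure (range (cont_rep_vec u)) \<subseteq> \<Omega>"
    "\<forall>i. ul_tendsto s' (\<lambda>\<epsilon>. v \<epsilon> $ i) (u $ i) (at_right 0)"
  have "(\<exists>\<epsilon>\<^sub>0. 0 < \<epsilon>\<^sub>0 \<and> \<epsilon>\<^sub>0 \<le> 1 \<and> (\<forall>\<epsilon>. 0 < \<epsilon> \<and> \<epsilon> \<le> \<epsilon>\<^sub>0 \<longrightarrow> closure (range (cont_rep_vec (v \<epsilon>))) \<subseteq> \<Omega>)) \<and>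
    ul_tendsto s' (\<lambda>\<epsilon>. regular_dist (\<Phi> \<circ> cont_rep_vec (v \<epsilon>))) (regular_dist (\<Phi> \<circ> cont_rep_vec u)) (at_right 0)"
    by (rule composition_ul_tendsto[OF assms(1,2) *(1,2)]) (use * in auto)
  then show "\<exists>\<epsilon>\<^sub>0. 0 < \<epsilon>\<^sub>0 \<and> \<epsilon>\<^sub>0 \<le> 1 \<and> (\<forall>\<epsilon>. 0 < \<epsilon> \<and> \<epsilon> \<le> \<epsilon>\<^sub>0 \<longrightarrow> closure (range (cont_rep_vec (v \<epsilon>))) \<subseteq> \<Omega>)"
    "ul_tendsto s' (\<lambda>\<epsilon>. regular_dist (\<Phi> \<circ> cont_rep_vec (v \<epsilon>))) (regular_dist (\<Phi> \<circ> cont_rep_vec u)) (at_right 0)"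
    by blast+
qed

end
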